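(* Let $\mathbf{A}$ be an additive track category with strict coproducts and coefficient bifunctor $D$. For every $n$ with $2\leq n\leq+\infty$, every object $X$ of $\mathbf{A}$ admits the structure $F_X$ of a weak $\mathsf{nil}_n$ cogroup. This statement also holds for $n=1$ under the extra assumption that $D$ has no 2-torsion.
   Context: **Track categories.** A track category $\mathbf{A}$ is a category enriched in groupoids (a 2-category in which all 2-morphisms are invertible). Its 2-morphisms $\eta:f\Rightarrow g$ are called tracks and form the set $\mathrm{Track}(f,g)$; vertical composition is $\varphi\,\square\,\eta$ ($\eta$ first); whiskering is $g_*\eta$ (postcomposition) and $h^*\eta$ (precomposition). $\mathrm{ho}(\mathbf{A})$ is obtained from the underlying category by identifying maps related by a track. A strict zero object is an object $*$ such that the hom-groupoids $[[X,*]]$ and $[[*,X]]$ have one object and one morphism for all $X$. Strict coproducts: for all $X,Y$ there are $X\vee Y$ and maps $X\to X\vee Y\leftarrow Y$ inducing an isomorphism of groupoids $[[X\vee Y,Z]]\to[[X,Z]]\times[[Y,Z]]$ for all $Z$. We write $(a,b)$ for the map or track out of $X\vee Y$ with components $a,b$. **Additive track category:** a track category $\mathbf{A}$ with a strict zero object such that $\mathrm{ho}(\mathbf{A})$ is additive, together with a biadditive bifunctor $D:\mathrm{ho}(\mathbf{A})^{op}\times\mathrm{ho}(\mathbf{A})\to\mathrm{Ab}$ and, for each $f:X\to Y$, a group isomorphism $\sigma_f:D(X,Y)\to\mathrm{Track}(f,f)$ with $\sigma_g(a)\,\square\,H=H\,\square\,\sigma_f(a)$ for $H:f\Rightarrow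 g$, and $h^*\sigma_f(a)=\sigma_{fh}(h^*a)$, $g_*\sigma_f(a)=\sigma_{gf}(g_*a)$. "$D$ has no 2-torsion" means no group $D(X,Y)$ has 2-torsion. **The theories $\mathsf{nil}_n$.** For a group $G$, $\Gamma_0G=G$, $\Gamma_{k+1}G=[G,\Gamma_kG]$. For $1\le n<\infty$, $\mathsf{nil}_n$ is the full subcategory of groups on $\mathbf{F}_p^{\mathsf{nil}_n}=\mathbf{F}_p/\Gamma_n\mathbf{F}_p$, $p\ge 0$, where $\mathbf{F}_p$ is free on $\{1,\dots,p\}$; $\mathsf{nil}_1=\mathsf{ab}$; and $\mathsf{nil}_{+\infty}=\mathsf{gr}$ is the full subcategory on the free groups $\mathbf{F}_p$. $\mathbf{F}_p^{\mathsf{nil}_n}$ is the $p$-fold coproduct of $\mathbb{Z}$ in $\mathsf{nil}_n$. $\mathsf{nil}_n$ is regarded as a track category with only identity tracks. **Weak cogroups.** A pseudofunctor $\varphi:\mathsf{nil}_n\rightsquigarrow\mathbf{A}$ assigns objects and maps, together with tracks $\varphi_{f,g}:\varphi(f)\varphi(g)\Rightarrow\varphi(fg)$ and $\varphi_X:\varphi(1_X)\Rightarrow 1_{\varphi(X)}$, such that $\varphi_{f,gh}\square\varphi(f)_*\varphi_{g,h}=\varphi_{fg,h}\square\varphi(h)^*\varphi_{f,g}$, $\varphi_{f,1_X}=\varphi(f)_*\varphi_X$, $\varphi_{1_Y,f}=\varphi(f)^*\varphi_Y$. It is coproduct preserving if: $\varphi(1_X)=1_{\varphi(X)}$ with $\varphi_X$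 the identity track; $\varphi( * )=*$, $\varphi$ sends zero maps to zero maps, and $\varphi_{f,*},\varphi_{*,f}$ are identity tracks of zero maps; the map $\iota_{X,Y}:\varphi(X)\vee\varphi(Y)\to\varphi(X\vee Y)$ with components $\varphi$ of the two inclusions is an isomorphism for all $X,Y$; $(\iota_{X,Y})^*\varphi_{g,(h,k)}=(\varphi_{g,h},\varphi_{g,k})$ for $h:X\to Z$, $k:Y\to Z$, $g:Z\to T$; and $\varphi_{X\vee X}$ corresponds to $(\varphi_X,\varphi_X)$ under $\iota$. A weak $\mathsf{nil}_n$ cogroup structure on an object $X$ of $\mathbf{A}$ is a coproduct preserving pseudofunctor $F_X:\mathsf{nil}_n\rightsquigarrow\mathbf{A}$ with $F_X(\mathbb{Z})=X$. *)

theory Defs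
  imports "HOL-Algebra.Generated_Groups" "HOL-Library.Extended_Nat"
begin

section \<open>Categories\<close>

text \<open>\<open>Comp C g f\<close> is the composite \<open>g f\<close> (first \<open>f\<close>); it is meaningful only for composable maps.\<close>

record ('o, 'm) cat =
  Obj :: "'o set"
  Arr :: "'m set"
  Src :: "'m \<Rightarrow> 'o"
  Tgt :: "'m \<Rightarrow> 'o"
  Comp :: "'m \<Rightarrow> 'm \<Rightarrow> 'm"
  Ident :: "'o \<Rightarrow> 'm"

definition maps :: "('o, 'm, 'z) cat_scheme \<Rightarrow> 'o \<Rightarrow> 'o \<Rightarrow> 'm set" where
  "maps C X Y = {f \<in> Arr C. Src C f = X \<and> Tgt C f = Y}"

locale category =
  fixes C :: "('o, 'm, 'z) cat_scheme"
  assumes Src_in: "f \<in> Arr C \<Longrightarrow> Src C f \<in> Obj C"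
    and Tgt_in: "f \<in> Arr C \<Longrightarrow> Tgt C f \<in> Obj C"
    and Ident_in: "X \<in> Obj C \<Longrightarrow> Ident C X \<in> maps C X X"
    and Comp_in: "\<lbrakk>f \<in> maps C X Y; g \<in> maps C Y Z\<rbrakk> \<Longrightarrow> Comp C g f \<in> maps C X Z"
    and Comp_assoc: "\<lbrakk>f \<in> maps C W X; g \<in> maps C X Y; h \<in> maps C Y Z\<rbrakk>
      \<Longrightarrow> Comp C h (Comp C g f) = Comp C (Comp C h g) f"
    and Comp_Ident: "f \<in> maps C X Y \<Longrightarrow> Comp C f (Ident C X) = f"
    and Ident_Comp: "f \<in> maps C X Y \<Longrightarrow> Comp C (Ident C Y) f = f"

definition isomorphism :: "('o, 'm, 'z) cat_scheme \<Rightarrow> 'm \<Rightarrow> bool" where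
  "isomorphism C f \<longleftrightarrow> f \<in> Arr C \<and>
    (\<exists>g \<in> maps C (Tgt C f) (Src C f).
      Comp C g f = Ident C (Src C f) \<and> Comp C f g = Ident C (Tgt C f))"

locale groupoid = category +
  assumes invertible: "f \<in> Arr C \<Longrightarrow> isomorphism C f"

definition prod_cat ::
  "('o, 'm, 'z) cat_scheme \<Rightarrow> ('p, 'n, 'y) cat_scheme \<Rightarrow> ('o \<times> 'p, 'm \<times> 'n) cat" where
  "prod_cat C D = \<lparr>
     Obj = Obj C \<times> Obj D,
     Arr = Arr C \<times> Arr D,
     Src = map_prod (Src C) (Src D),
     Tgt = map_prod (Tgt C) (Tgt D),
     Comp = (\<lambda>(g, g') (f, f'). (Comp C g f, Comp D g' f')),
     Ident = map_prod (Ident C) (Ident D)\<rparr>"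

definition is_functor ::
  "('o, 'm, 'z) cat_scheme \<Rightarrow> ('p, 'n, 'y) cat_scheme \<Rightarrow> ('o \<Rightarrow> 'p) \<Rightarrow> ('m \<Rightarrow> 'n) \<Rightarrow> bool" where
  "is_functor C D Fo Fm \<longleftrightarrow>
     category C \<and> category D \<and>
     (\<forall>X \<in> Obj C. Fo X \<in> Obj D) \<and>
     (\<forall>f \<in> Arr C. Fm f \<in> maps D (Fo (Src C f)) (Fo (Tgt C f))) \<and>
     (\<forall>X \<in> Obj C. Fm (Ident C X) = Ident D (Fo X)) \<and>
     (\<forall>f \<in> Arr C. \<forall>g \<in> Arr C. Tgt C f = Src C g \<longrightarrow>
        Fm (Comp C g f) = Comp D (Fm g) (Fm f))"

definition is_cat_iso ::
  "('o, 'm, 'z) cat_scheme \<Rightarrow> ('p, 'n, 'y) cat_scheme \<Rightarrow> ('o \<Rightarrow> 'p) \<Rightarrow> ('m \<Rightarrow> 'n) \<Rightarrow> bool" where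
  "is_cat_iso C D Fo Fm \<longleftrightarrow>
     is_functor C D Fo Fm \<and> bij_betw Fo (Obj C) (Obj D) \<and> bij_betw Fm (Arr C) (Arr D)"

text \<open>The zero map \<open>X \<rightarrow> z \<rightarrow> Y\<close> through a zero object \<open>z\<close>.\<close>

definition zero_map :: "('o, 'm, 'z) cat_scheme \<Rightarrow> 'o \<Rightarrow> 'o \<Rightarrow> 'o \<Rightarrow> 'm" where
  "zero_map C z X Y = Comp C (THE g. g \<in> maps C z Y) (THE f. f \<in> maps C X z)"

text \<open>A choice, for all pairs of objects, of a sum \<open>X \<or> Y\<close> and its two inclusions;
  the universal property is imposed separately.\<close>

record ('o, 'm) sum_choice =
  Wedge :: "'o \<Rightarrow> 'o \<Rightarrow> 'o"
  Inc1 :: "'o \<Rightarrow> 'o \<Rightarrow> 'm"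
  Inc2 :: "'o \<Rightarrow> 'o \<Rightarrow> 'm"

text \<open>The map \<open>(a, b) : X \<or> Y \<rightarrow> Z\<close> with components \<open>a : X \<rightarrow> Z\<close> and \<open>b : Y \<rightarrow> Z\<close>.\<close>

definition copair ::
  "('o, 'm, 'z) cat_scheme \<Rightarrow> ('o, 'm) sum_choice \<Rightarrow> 'm \<Rightarrow> 'm \<Rightarrow> 'm" where
  "copair C S a b = (let X = Src C a; Y = Src C b in
     THE m. m \<in> maps C (Wedge S X Y) (Tgt C a) \<and>
       Comp C m (Inc1 S X Y) = a \<and> Comp C m (Inc2 S X Y) = b)"


section \<open>Track categories\<close>

text \<open>\<open>VComp A \<phi> \<eta>\<close> is the vertical composite \<open>\<phi> \<box> \<eta>\<close> (first \<open>\<eta>\<close>), and \<open>HComp\<close> is the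
  action on tracks of the composition functors \<open>[[Y,Z]] \<times> [[X,Y]] \<rightarrow> [[X,Z]]\<close>.\<close>

record ('o, 'm, 't) track_cat = "('o, 'm) cat" +
  Trk :: "'t set"
  TSrc :: "'t \<Rightarrow> 'm"
  TTgt :: "'t \<Rightarrow> 'm"
  VComp :: "'t \<Rightarrow> 't \<Rightarrow> 't"
  TIdent :: "'m \<Rightarrow> 't"
  HComp :: "'t \<Rightarrow> 't \<Rightarrow> 't"

definition tracks :: "('o, 'm, 't, 'z) track_cat_scheme \<Rightarrow> 'm \<Rightarrow> 'm \<Rightarrow> 't set" where
  "tracks A f g = {\<eta> \<in> Trk A. TSrc A \<eta> = f \<and> TTgt A \<eta> = g}"

definition hom_groupoid ::
  "('o, 'm, 't, 'z) track_cat_scheme \<Rightarrow> 'o \<Rightarrow> 'o \<Rightarrow> ('m, 't) cat" where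
  "hom_groupoid A X Y = \<lparr>
     Obj = maps A X Y,
     Arr = {\<eta> \<in> Trk A. TSrc A \<eta> \<in> maps A X Y},
     Src = TSrc A,
     Tgt = TTgt A,
     Comp = VComp A,
     Ident = TIdent A\<rparr>"

locale track_category = category A for A :: "('o, 'm, 't, 'z) track_cat_scheme" +
  assumes TSrc_in: "\<eta> \<in> Trk A \<Longrightarrow> TSrc A \<eta> \<in> Arr A"
    and groupoid_hom: "\<lbrakk>X \<in> Obj A; Y \<in> Obj A\<rbrakk> \<Longrightarrow> groupoid (hom_groupoid A X Y)"
    and comp_functor: "\<lbrakk>X \<in> Obj A; Y \<in> Obj A; Z \<in> Obj A\<rbrakk> \<Longrightarrow>
      is_functor (prod_cat (hom_groupoid A Y Z) (hom_groupoid A X Y)) (hom_groupoid A X Z)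
        (\<lambda>(g, f). Comp A g f) (\<lambda>(\<beta>, \<alpha>). HComp A \<beta> \<alpha>)"
    and HComp_assoc:
      "\<lbrakk>W \<in> Obj A; X \<in> Obj A; Y \<in> Obj A; Z \<in> Obj A; \<alpha> \<in> Arr (hom_groupoid A W X);
        \<beta> \<in> Arr (hom_groupoid A X Y); \<gamma> \<in> Arr (hom_groupoid A Y Z)\<rbrakk>
       \<Longrightarrow> HComp A \<gamma> (HComp A \<beta> \<alpha>) = HComp A (HComp A \<gamma> \<beta>) \<alpha>"
    and HComp_Ident: "\<lbrakk>X \<in> Obj A; Y \<in> Obj A; \<alpha> \<in> Arr (hom_groupoid A X Y)\<rbrakk>
       \<Longrightarrow> HComp A \<alpha> (TIdent A (Ident A X)) = \<alpha>"
    and Ident_HComp: "\<lbrakk>X \<in> Obj A; Y \<in> Obj A; \<alpha> \<in> Arr (hom_groupoid A X Y)\<rbrakk>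
       \<Longrightarrow> HComp A (TIdent A (Ident A Y)) \<alpha> = \<alpha>"

text \<open>Whiskering: \<open>push A g \<eta>\<close> is \<open>g\<^sub>* \<eta>\<close> and \<open>pull A h \<eta>\<close> is \<open>h\<^sup>* \<eta>\<close>.\<close>

definition push :: "('o, 'm, 't, 'z) track_cat_scheme \<Rightarrow> 'm \<Rightarrow> 't \<Rightarrow> 't" where
  "push A g \<eta> = HComp A (TIdent A g) \<eta>"

definition pull :: "('o, 'm, 't, 'z) track_cat_scheme \<Rightarrow> 'm \<Rightarrow> 't \<Rightarrow> 't" where
  "pull A h \<eta> = HComp A \<eta> (TIdent A h)"

definition track_group :: "('o, 'm, 't, 'z) track_cat_scheme \<Rightarrow> 'm \<Rightarrow> 't monoid" where
  "track_group A f = \<lparr>carrier = tracks A f f, mult = VComp A, one = TIdent A f\<rparr>"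

text \<open>The homotopy category; its maps are the track classes of maps of \<open>A\<close>.\<close>

definition track_class :: "('o, 'm, 't, 'z) track_cat_scheme \<Rightarrow> 'm \<Rightarrow> 'm set" where
  "track_class A f = {g. tracks A f g \<noteq> {}}"

definition ho :: "('o, 'm, 't, 'z) track_cat_scheme \<Rightarrow> ('o, 'm set) cat" where
  "ho A = \<lparr>
     Obj = Obj A,
     Arr = track_class A ` Arr A,
     Src = (\<lambda>c. Src A (SOME f. f \<in> c)),
     Tgt = (\<lambda>c. Tgt A (SOME f. f \<in> c)),
     Comp = (\<lambda>d c. track_class A (Comp A (SOME g. g \<in> d) (SOME f. f \<in> c))),
     Ident = (\<lambda>X. track_class A (Ident A X))\<rparr>"

definition strict_zero :: "('o, 'm, 't, 'z) track_cat_scheme \<Rightarrow> 'o \<Rightarrow> bool" where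
  "strict_zero A z \<longleftrightarrow> z \<in> Obj A \<and> (\<forall>X \<in> Obj A.
     is_singleton (Obj (hom_groupoid A X z)) \<and> is_singleton (Arr (hom_groupoid A X z)) \<and>
     is_singleton (Obj (hom_groupoid A z X)) \<and> is_singleton (Arr (hom_groupoid A z X)))"

definition strict_coproducts ::
  "('o, 'm, 't, 'z) track_cat_scheme \<Rightarrow> ('o, 'm) sum_choice \<Rightarrow> bool" where
  "strict_coproducts A S \<longleftrightarrow> (\<forall>X \<in> Obj A. \<forall>Y \<in> Obj A.
     Wedge S X Y \<in> Obj A \<and>
     Inc1 S X Y \<in> maps A X (Wedge S X Y) \<and>
     Inc2 S X Y \<in> maps A Y (Wedge S X Y) \<and>
     (\<forall>Z \<in> Obj A.
       is_cat_iso (hom_groupoid A (Wedge S X Y) Z)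
         (prod_cat (hom_groupoid A X Z) (hom_groupoid A Y Z))
         (\<lambda>m. (Comp A m (Inc1 S X Y), Comp A m (Inc2 S X Y)))
         (\<lambda>\<eta>. (pull A (Inc1 S X Y) \<eta>, pull A (Inc2 S X Y) \<eta>))))"

text \<open>The track \<open>(\<alpha>, \<beta>)\<close> out of \<open>X \<or> Y\<close> with components \<open>\<alpha>\<close> in \<open>[[X,Z]]\<close> and \<open>\<beta>\<close> in \<open>[[Y,Z]]\<close>.\<close>

definition tcopair ::
  "('o, 'm, 't, 'z) track_cat_scheme \<Rightarrow> ('o, 'm) sum_choice \<Rightarrow> 't \<Rightarrow> 't \<Rightarrow> 't" where
  "tcopair A S \<alpha> \<beta> = (let X = Src A (TSrc A \<alpha>); Y = Src A (TSrc A \<beta>); Z = Tgt A (TSrc A \<alpha>) in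
     THE \<eta>. \<eta> \<in> Arr (hom_groupoid A (Wedge S X Y) Z) \<and>
       pull A (Inc1 S X Y) \<eta> = \<alpha> \<and> pull A (Inc2 S X Y) \<eta> = \<beta>)"


section \<open>Additive track categories\<close>

text \<open>The abelian groups \<open>P X Y\<close> on the hom-sets, which are determined by \<open>C\<close>, are written
  multiplicatively, as in the library.\<close>

locale additive_category = category C for C :: "('o, 'm, 'z) cat_scheme" +
  fixes P :: "'o \<Rightarrow> 'o \<Rightarrow> 'm monoid"
  assumes carrier_P: "\<lbrakk>X \<in> Obj C; Y \<in> Obj C\<rbrakk> \<Longrightarrow> carrier (P X Y) = maps C X Y"
    and comm_group_P: "\<lbrakk>X \<in> Obj C; Y \<in> Obj C\<rbrakk> \<Longrightarrow> comm_group (P X Y)"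
    and Comp_add_right: "\<lbrakk>f \<in> maps C X Y; f' \<in> maps C X Y; g \<in> maps C Y Z\<rbrakk> \<Longrightarrow>
      Comp C g (f \<otimes>\<^bsub>P X Y\<^esub> f') = Comp C g f \<otimes>\<^bsub>P X Z\<^esub> Comp C g f'"
    and Comp_add_left: "\<lbrakk>f \<in> maps C X Y; g \<in> maps C Y Z; g' \<in> maps C Y Z\<rbrakk> \<Longrightarrow>
      Comp C (g \<otimes>\<^bsub>P Y Z\<^esub> g') f = Comp C g f \<otimes>\<^bsub>P X Z\<^esub> Comp C g' f"
    and zero_object: "\<exists>Z \<in> Obj C. \<forall>X \<in> Obj C. is_singleton (maps C X Z) \<and> is_singleton (maps C Z X)"
    and biproducts: "\<lbrakk>X \<in> Obj C; Y \<in> Obj C\<rbrakk> \<Longrightarrow>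
      \<exists>B \<in> Obj C. \<exists>i \<in> maps C X B. \<exists>j \<in> maps C Y B. \<exists>p \<in> maps C B X. \<exists>q \<in> maps C B Y.
        Comp C p i = Ident C X \<and> Comp C q j = Ident C Y \<and>
        Comp C p j = \<one>\<^bsub>P Y X\<^esub> \<and> Comp C q i = \<one>\<^bsub>P X Y\<^esub> \<and>
        Comp C i p \<otimes>\<^bsub>P B B\<^esub> Comp C j q = Ident C B"

text \<open>A biadditive bifunctor from \<open>C\<^sup>o\<^sup>p \<times> C\<close> to abelian groups; for \<open>h : X' \<rightarrow> X\<close> and
  \<open>g : Y \<rightarrow> Y'\<close>, \<open>Dm h g\<close> is the induced homomorphism \<open>D X Y \<rightarrow> D X' Y'\<close>.\<close>

locale biadditive_bifunctor = additive_category C P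
  for C :: "('o, 'm, 'z) cat_scheme" and P +
  fixes D :: "'o \<Rightarrow> 'o \<Rightarrow> 'd monoid"
    and Dm :: "'m \<Rightarrow> 'm \<Rightarrow> 'd \<Rightarrow> 'd"
  assumes comm_group_D: "\<lbrakk>X \<in> Obj C; Y \<in> Obj C\<rbrakk> \<Longrightarrow> comm_group (D X Y)"
    and Dm_hom: "\<lbrakk>h \<in> maps C X' X; g \<in> maps C Y Y'\<rbrakk> \<Longrightarrow> Dm h g \<in> hom (D X Y) (D X' Y')"
    and Dm_Ident: "\<lbrakk>X \<in> Obj C; Y \<in> Obj C; a \<in> carrier (D X Y)\<rbrakk> \<Longrightarrow>
      Dm (Ident C X) (Ident C Y) a = a"
    and Dm_Comp:
      "\<lbrakk>h \<in> maps C X' X; h' \<in> maps C X'' X'; g \<in> maps C Y Y'; g' \<in> maps C Y' Y'';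
        a \<in> carrier (D X Y)\<rbrakk> \<Longrightarrow> Dm (Comp C h h') (Comp C g' g) a = Dm h' g' (Dm h g a)"
    and Dm_add_left:
      "\<lbrakk>h \<in> maps C X' X; h' \<in> maps C X' X; g \<in> maps C Y Y'; a \<in> carrier (D X Y)\<rbrakk> \<Longrightarrow>
        Dm (h \<otimes>\<^bsub>P X' X\<^esub> h') g a = Dm h g a \<otimes>\<^bsub>D X' Y'\<^esub> Dm h' g a"
    and Dm_add_right:
      "\<lbrakk>h \<in> maps C X' X; g \<in> maps C Y Y'; g' \<in> maps C Y Y'; a \<in> carrier (D X Y)\<rbrakk> \<Longrightarrow>
        Dm h (g \<otimes>\<^bsub>P Y Y'\<^esub> g') a = Dm h g a \<otimes>\<^bsub>D X' Y'\<^esub> Dm h g' a"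

locale additive_track_category =
  track_category A + coeff: biadditive_bifunctor "ho A" P D Dm
  for A :: "('o, 'm, 't, 'z) track_cat_scheme"
    and P :: "'o \<Rightarrow> 'o \<Rightarrow> 'm set monoid"
    and D :: "'o \<Rightarrow> 'o \<Rightarrow> 'd monoid"
    and Dm :: "'m set \<Rightarrow> 'm set \<Rightarrow> 'd \<Rightarrow> 'd" +
  fixes z :: 'o
    and \<sigma> :: "'m \<Rightarrow> 'd \<Rightarrow> 't"
  assumes zero: "strict_zero A z"
    and \<sigma>_iso: "f \<in> maps A X Y \<Longrightarrow> \<sigma> f \<in> iso (D X Y) (track_group A f)"
    and \<sigma>_natural: "\<lbrakk>f \<in> maps A X Y; g \<in> maps A X Y; H \<in> tracks A f g; a \<in> carrier (D X Y)\<rbrakk> \<Longrightarrow>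
      VComp A (\<sigma> g a) H = VComp A H (\<sigma> f a)"
    and \<sigma>_pull: "\<lbrakk>h \<in> maps A X' X; f \<in> maps A X Y; a \<in> carrier (D X Y)\<rbrakk> \<Longrightarrow>
      pull A h (\<sigma> f a) = \<sigma> (Comp A f h) (Dm (track_class A h) (Ident (ho A) Y) a)"
    and \<sigma>_push: "\<lbrakk>f \<in> maps A X Y; g \<in> maps A Y Y'; a \<in> carrier (D X Y)\<rbrakk> \<Longrightarrow>
      push A g (\<sigma> f a) = \<sigma> (Comp A g f) (Dm (Ident (ho A) X) (track_class A g) a)"

definition no_2_torsion :: "'o set \<Rightarrow> ('o \<Rightarrow> 'o \<Rightarrow> 'd monoid) \<Rightarrow> bool" where
  "no_2_torsion Ob D \<longleftrightarrow> (\<forall>X \<in> Ob. \<forall>Y \<in> Ob. \<forall>a \<in> carrier (D X Y).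
     a \<otimes>\<^bsub>D X Y\<^esub> a = \<one>\<^bsub>D X Y\<^esub> \<longrightarrow> a = \<one>\<^bsub>D X Y\<^esub>)"


section \<open>Free nilpotent groups and the theories \<open>nil\<^sub>n\<close>\<close>

text \<open>The free group on a set of letters, realised by reduced words; \<open>(i, True)\<close> is the generator
  \<open>i\<close> and \<open>(i, False)\<close> its inverse.\<close>

definition letter_inv :: "'a \<times> bool \<Rightarrow> 'a \<times> bool" where
  "letter_inv x = (fst x, \<not> snd x)"

definition reduced :: "('a \<times> bool) list \<Rightarrow> bool" where
  "reduced w \<longleftrightarrow> successively (\<lambda>x y. y \<noteq> letter_inv x) w"

fun push_letter :: "'a \<times> bool \<Rightarrow> ('a \<times> bool) list \<Rightarrow> ('a \<times> bool) list" where
  "push_letter x [] = [x]"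
| "push_letter x (y # w) = (if y = letter_inv x then w else x # y # w)"

definition free_group :: "'a set \<Rightarrow> ('a \<times> bool) list monoid" where
  "free_group S = \<lparr>
     carrier = {w. reduced w \<and> fst ` set w \<subseteq> S},
     mult = foldr push_letter,
     one = []\<rparr>"

definition commutator_subgroup :: "('g, 'z) monoid_scheme \<Rightarrow> 'g set \<Rightarrow> 'g set \<Rightarrow> 'g set" where
  "commutator_subgroup G H K =
     generate G {h \<otimes>\<^bsub>G\<^esub> k \<otimes>\<^bsub>G\<^esub> inv\<^bsub>G\<^esub> h \<otimes>\<^bsub>G\<^esub> inv\<^bsub>G\<^esub> k | h k. h \<in> H \<and> k \<in> K}"

primrec lower_central :: "('g, 'z) monoid_scheme \<Rightarrow> nat \<Rightarrow> 'g set" where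
  "lower_central G 0 = carrier G"
| "lower_central G (Suc k) = commutator_subgroup G (carrier G) (lower_central G k)"

text \<open>\<open>group_theory G\<close> is the full subcategory of groups on a sequence of groups \<open>G\<close>, with
  object \<open>p\<close> standing for \<open>G p\<close>. Homomorphisms are extensional functions, tagged with source
  and target.\<close>

definition group_theory :: "(nat \<Rightarrow> 'g monoid) \<Rightarrow> (nat, nat \<times> nat \<times> ('g \<Rightarrow> 'g)) cat" where
  "group_theory G = \<lparr>
     Obj = UNIV,
     Arr = {(p, q, f). f \<in> hom (G p) (G q) \<inter> extensional (carrier (G p))},
     Src = (\<lambda>(p, q, f). p),
     Tgt = (\<lambda>(p, q, f). q),
     Comp = (\<lambda>(q', r, g) (p, q, f). (p, r, compose (carrier (G p)) g f)),
     Ident = (\<lambda>p. (p, p, \<lambda>x \<in> carrier (G p). x))\<rparr>"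

text \<open>For groups \<open>G p\<close> that are (relatively) free on generators \<open>e p 1, \<dots>, e p p\<close>: the
  homomorphism \<open>G p \<rightarrow> G q\<close> sending the \<open>i\<close>-th generator to the \<open>s i\<close>-th one, and the standard sums
  \<open>G p \<or> G q = G (p + q)\<close>, with the generators of the second summand shifted by \<open>p\<close>. The
  inclusions must be fixed: the notion of a coproduct preserving pseudofunctor below is not invariant
  under changing them by automorphisms of \<open>G (p + q)\<close>.\<close>

definition generator_map ::
  "(nat \<Rightarrow> 'g monoid) \<Rightarrow> (nat \<Rightarrow> nat \<Rightarrow> 'g) \<Rightarrow> nat \<Rightarrow> nat \<Rightarrow> (nat \<Rightarrow> nat) \<Rightarrow> nat \<times> nat \<times> ('g \<Rightarrow> 'g)" where
  "generator_map G e p q s =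
     (THE m. m \<in> maps (group_theory G) p q \<and> (\<forall>i \<in> {1..p}. snd (snd m) (e p i) = e q (s i)))"

definition standard_sums ::
  "(nat \<Rightarrow> 'g monoid) \<Rightarrow> (nat \<Rightarrow> nat \<Rightarrow> 'g) \<Rightarrow> (nat, nat \<times> nat \<times> ('g \<Rightarrow> 'g)) sum_choice" where
  "standard_sums G e = \<lparr>
     Wedge = (+),
     Inc1 = (\<lambda>p q. generator_map G e p (p + q) (\<lambda>i. i)),
     Inc2 = (\<lambda>p q. generator_map G e q (p + q) (\<lambda>j. p + j))\<rparr>"

definition F_grp :: "nat \<Rightarrow> (nat \<times> bool) list monoid" where
  "F_grp p = free_group {1..p}"

definition F_gen :: "nat \<Rightarrow> nat \<Rightarrow> (nat \<times> bool) list" where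
  "F_gen p i = [(i, True)]"

definition F_nil :: "nat \<Rightarrow> nat \<Rightarrow> (nat \<times> bool) list set monoid" where
  "F_nil n p = F_grp p Mod lower_central (F_grp p) n"

definition F_nil_gen :: "nat \<Rightarrow> nat \<Rightarrow> nat \<Rightarrow> (nat \<times> bool) list set" where
  "F_nil_gen n p i = lower_central (F_grp p) n #>\<^bsub>F_grp p\<^esub> F_gen p i"


section \<open>Pseudofunctors and weak cogroups\<close>

text \<open>Pseudofunctors from a category \<open>N\<close>, regarded as a track category with only identity tracks:
  \<open>PComp \<phi> f g\<close> is \<open>\<phi>\<^bsub>f,g\<^esub> : \<phi>(f) \<phi>(g) \<Rightarrow> \<phi>(f g)\<close> and \<open>PUnit \<phi> X\<close> is \<open>\<phi>\<^bsub>X\<^esub> : \<phi>(1\<^bsub>X\<^esub>) \<Rightarrow> 1\<^bsub>\<phi>(X)\<^esub>\<close>.\<close>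

record ('p, 'n, 'o, 'm, 't) pseudo =
  PObj :: "'p \<Rightarrow> 'o"
  PMap :: "'n \<Rightarrow> 'm"
  PComp :: "'n \<Rightarrow> 'n \<Rightarrow> 't"
  PUnit :: "'p \<Rightarrow> 't"

locale pseudofunctor =
  fixes N :: "('p, 'n, 'y) cat_scheme"
    and A :: "('o, 'm, 't, 'z) track_cat_scheme"
    and \<phi> :: "('p, 'n, 'o, 'm, 't) pseudo"
  assumes PObj_in: "X \<in> Obj N \<Longrightarrow> PObj \<phi> X \<in> Obj A"
    and PMap_in: "f \<in> maps N X Y \<Longrightarrow> PMap \<phi> f \<in> maps A (PObj \<phi> X) (PObj \<phi> Y)"
    and PComp_in: "\<lbrakk>g \<in> maps N X Y; f \<in> maps N Y Z\<rbrakk> \<Longrightarrow>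
      PComp \<phi> f g \<in> tracks A (Comp A (PMap \<phi> f) (PMap \<phi> g)) (PMap \<phi> (Comp N f g))"
    and PUnit_in: "X \<in> Obj N \<Longrightarrow>
      PUnit \<phi> X \<in> tracks A (PMap \<phi> (Ident N X)) (Ident A (PObj \<phi> X))"
    and PComp_assoc: "\<lbrakk>h \<in> maps N W X; g \<in> maps N X Y; f \<in> maps N Y Z\<rbrakk> \<Longrightarrow>
      VComp A (PComp \<phi> f (Comp N g h)) (push A (PMap \<phi> f) (PComp \<phi> g h)) =
      VComp A (PComp \<phi> (Comp N f g) h) (pull A (PMap \<phi> h) (PComp \<phi> f g))"
    and PComp_Ident: "f \<in> maps N X Y \<Longrightarrow>
      PComp \<phi> f (Ident N X) = push A (PMap \<phi> f) (PUnit \<phi> X)"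
    and Ident_PComp: "f \<in> maps N X Y \<Longrightarrow>
      PComp \<phi> (Ident N Y) f = pull A (PMap \<phi> f) (PUnit \<phi> Y)"

definition sum_comparison ::
  "('p, 'n) sum_choice \<Rightarrow> ('o, 'm, 't, 'z) track_cat_scheme \<Rightarrow> ('o, 'm) sum_choice \<Rightarrow>
   ('p, 'n, 'o, 'm, 't) pseudo \<Rightarrow> 'p \<Rightarrow> 'p \<Rightarrow> 'm" where
  "sum_comparison S A T \<phi> X Y = copair A T (PMap \<phi> (Inc1 S X Y)) (PMap \<phi> (Inc2 S X Y))"

locale coproduct_preserving = pseudofunctor N A \<phi>
  for N :: "('p, 'n, 'y) cat_scheme"
    and A :: "('o, 'm, 't, 'z) track_cat_scheme"
    and \<phi> :: "('p, 'n, 'o, 'm, 't) pseudo" +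
  fixes zN :: 'p and S :: "('p, 'n) sum_choice" and zA :: 'o and T :: "('o, 'm) sum_choice"
  assumes PMap_Ident: "X \<in> Obj N \<Longrightarrow> PMap \<phi> (Ident N X) = Ident A (PObj \<phi> X)"
    and PUnit_Ident: "X \<in> Obj N \<Longrightarrow> PUnit \<phi> X = TIdent A (Ident A (PObj \<phi> X))"
    and PObj_zero: "PObj \<phi> zN = zA"
    and PMap_zero: "\<lbrakk>X \<in> Obj N; Y \<in> Obj N\<rbrakk> \<Longrightarrow>
      PMap \<phi> (zero_map N zN X Y) = zero_map A zA (PObj \<phi> X) (PObj \<phi> Y)"
    and PComp_zero_right: "\<lbrakk>W \<in> Obj N; f \<in> maps N X Y\<rbrakk> \<Longrightarrow>
      PComp \<phi> f (zero_map N zN W X) = TIdent A (zero_map A zA (PObj \<phi> W) (PObj \<phi> Y))"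
    and PComp_zero_left: "\<lbrakk>f \<in> maps N X Y; Z \<in> Obj N\<rbrakk> \<Longrightarrow>
      PComp \<phi> (zero_map N zN Y Z) f = TIdent A (zero_map A zA (PObj \<phi> X) (PObj \<phi> Z))"
    and sum_comparison_iso: "\<lbrakk>X \<in> Obj N; Y \<in> Obj N\<rbrakk> \<Longrightarrow> isomorphism A (sum_comparison S A T \<phi> X Y)"
    and PComp_copair: "\<lbrakk>h \<in> maps N X Z; k \<in> maps N Y Z; g \<in> maps N Z W\<rbrakk> \<Longrightarrow>
      pull A (sum_comparison S A T \<phi> X Y) (PComp \<phi> g (copair N S h k)) =
      tcopair A T (PComp \<phi> g h) (PComp \<phi> g k)"
    \<comment> \<open>\<open>(\<phi>\<^bsub>X\<^esub>, \<phi>\<^bsub>X\<^esub>)\<close> is the sum of \<open>\<phi>\<^bsub>X\<^esub>\<close> with itself, a track between self-maps of \<open>\<phi>(X) \<or> \<phi>(X)\<close>.\<close>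
    and PUnit_sum: "X \<in> Obj N \<Longrightarrow>
      pull A (sum_comparison S A T \<phi> X X) (PUnit \<phi> (Wedge S X X)) =
      push A (sum_comparison S A T \<phi> X X)
        (tcopair A T (push A (Inc1 T (PObj \<phi> X) (PObj \<phi> X)) (PUnit \<phi> X))
                     (push A (Inc2 T (PObj \<phi> X) (PObj \<phi> X)) (PUnit \<phi> X)))"

text \<open>A weak cogroup structure on \<open>X\<close> over the theory of the groups \<open>G p\<close> with generators \<open>e p i\<close>;
  object \<open>1\<close> of the theory is the infinite cyclic group and object \<open>0\<close> the trivial group.\<close>

definition weak_cogroup ::
  "(nat \<Rightarrow> 'g monoid) \<Rightarrow> (nat \<Rightarrow> nat \<Rightarrow> 'g) \<Rightarrow> ('o, 'm, 't, 'z) track_cat_scheme \<Rightarrow>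
   'o \<Rightarrow> ('o, 'm) sum_choice \<Rightarrow> 'o \<Rightarrow> (nat, nat \<times> nat \<times> ('g \<Rightarrow> 'g), 'o, 'm, 't) pseudo \<Rightarrow> bool" where
  "weak_cogroup G e A zA T X \<phi> \<longleftrightarrow>
     coproduct_preserving (group_theory G) A \<phi> 0 (standard_sums G e) zA T \<and> PObj \<phi> 1 = X"

definition admits_weak_nil_cogroup ::
  "enat \<Rightarrow> ('o, 'm, 't, 'z) track_cat_scheme \<Rightarrow> 'o \<Rightarrow> ('o, 'm) sum_choice \<Rightarrow> 'o \<Rightarrow> bool" where
  "admits_weak_nil_cogroup n A zA T X = (case n of
       enat k \<Rightarrow> \<exists>\<phi>. weak_cogroup (F_nil k) (F_nil_gen k) A zA T X \<phi>
     | \<infinity> \<Rightarrow> \<exists>\<phi>. weak_cogroup F_grp F_gen A zA T X \<phi>)"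

end

theory Submission
  imports Defs "HOL-Algebra.Ring"
begin

text \<open>
  Write \<open>X\<^sub>q\<close> for the \<open>q\<close>-fold copower of \<open>X\<close>. In the homotopy category the maps \<open>X\<^sub>q \<rightarrow> X\<^sub>r\<close> of integral
  class are matrices, so a choice of representatives \<open>\<phi>\<close> and of tracks \<open>\<phi>(f) \<phi>(x) \<Rightarrow> \<phi>(f x)\<close> has as its
  obstruction a normalised 3-cocycle \<open>c\<close> of the theory of free abelian groups with values in
  \<open>D X X\<close>. By naturality \<open>c\<close> can be evaluated on sums of two columns; after removing the
  associativity defect, which is a 3-cocycle of the group \<open>\<int>\<close> and hence a coboundary, this yields for each
  row \<open>a \<in> \<int>\<^sup>q\<close> a 2-cocycle \<open>u\<close> of the group \<open>\<int>\<^sup>q\<close>. The corresponding central extension of \<open>\<int>\<^sup>q\<close> is nilpotent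
  of class 2, so the generators of a free nilpotent group of class \<open>n \<ge> 2\<close>, or of a free group, lift
  to it by a homomorphism, which exhibits \<open>u\<close> as the coboundary of a function \<open>\<kappa>\<close> on that group. Changing
  the tracks by \<open>\<kappa>\<close> kills the obstruction, because the remaining error is a homomorphism that vanishes on
  the generators. For \<open>n = 1\<close> the extension must be abelian; its commutator form comes from a
  biadditive antisymmetric function on \<open>\<int>\<close>, hence from a 2-torsion element of \<open>D X X\<close>.
\<close>

text \<open>On maps the pseudofunctor sees of a homomorphism \<open>f\<close> only its matrix of
  exponent sums; the words \<open>f (e q i)\<close> themselves enter only through tracks. So a
  single obstruction \<open>c\<close>, computed for integer matrices, serves all the theories, which
  differ only in the functions \<kappa> on words that are available to kill it. The shape of the
  proof comes from an asymmetry: sums in \<open>A\<close> are strict, while products exist only up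
  to homotopy. Maps and tracks out of \<open>pw q\<close> can be prescribed on the summands, whereas
  a track into \<open>pw r\<close> must be recovered from its projections by the biadditivity of
  \<open>D\<close>. Hence matrices are families of columns, rows are tested one at a time, and the
  cochains take values in \<open>D X X\<close>. Strictness is demanded for identities, zero maps and
  inclusions, so every choice is normalised at zero and at unit rows and columns. The same
  normalisations make universal cases computable, because error terms with unit entries vanish. The
  function \<beta> exists because \<int> is free, so that its third cohomology vanishes.\<close>

declare One_nat_def [simp del]

section \<open>Integer matrices and the cohomology of the theory of free abelian groups\<close>

definition vec :: "nat \<Rightarrow> (nat \<Rightarrow> int) set" where
  "vec q = {x. \<forall>i. i \<notin> {1..q} \<longrightarrow> x i = 0}"

definition axis :: "nat \<Rightarrow> nat \<Rightarrow> int" where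
  "axis i = (\<lambda>j. if j = i then 1 else 0)"

lemma axis_apply: "axis i j = (if j = i then 1 else 0)"
  by (simp add: axis_def)

definition dot :: "nat \<Rightarrow> (nat \<Rightarrow> int) \<Rightarrow> (nat \<Rightarrow> int) \<Rightarrow> int" where
  "dot q a x = (\<Sum>i = 1..q. a i * x i)"

text \<open>A matrix is the family of its columns; only the columns \<open>1..q\<close> matter.\<close>

definition mats :: "nat \<Rightarrow> nat \<Rightarrow> (nat \<Rightarrow> nat \<Rightarrow> int) set" where
  "mats q r = {f. \<forall>i \<in> {1..q}. f i \<in> vec r}"

text \<open>Truncation outside \<open>{1..q}\<close> puts every row into \<open>vec q\<close>, so
  that rows can be compared as functions although a matrix is arbitrary outside its columns.\<close>

definition row :: "nat \<Rightarrow> (nat \<Rightarrow> nat \<Rightarrow> int) \<Rightarrow> nat \<Rightarrow> nat \<Rightarrow> int" where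
  "row q f k = (\<lambda>i. if i \<in> {1..q} then f i k else 0)"

definition app :: "nat \<Rightarrow> (nat \<Rightarrow> nat \<Rightarrow> int) \<Rightarrow> (nat \<Rightarrow> int) \<Rightarrow> nat \<Rightarrow> int" where
  "app q f x = (\<lambda>k. \<Sum>i = 1..q. f i k * x i)"

definition rowmul :: "nat \<Rightarrow> nat \<Rightarrow> (nat \<Rightarrow> int) \<Rightarrow> (nat \<Rightarrow> nat \<Rightarrow> int) \<Rightarrow> nat \<Rightarrow> int" where
  "rowmul q r a f = (\<lambda>i. if i \<in> {1..q} then dot r a (f i) else 0)"

lemma vec_zero [simp]: "(\<lambda>_. 0) \<in> vec q" by (simp add: vec_def)
lemma vec_axis [simp]: "i \<in> {1..q} \<Longrightarrow> axis i \<in> vec q" by (auto simp: vec_def axis_def)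
lemma vec_add [simp]: "x \<in> vec q \<Longrightarrow> y \<in> vec q \<Longrightarrow> (\<lambda>i. x i + y i) \<in> vec q" by (simp add: vec_def)
lemma vec_row [simp]: "row q f k \<in> vec q" by (auto simp: vec_def row_def)
lemma vec_rowmul [simp]: "rowmul q r a f \<in> vec q" by (auto simp: vec_def rowmul_def)
lemma vec_app [simp]: "f \<in> mats q r \<Longrightarrow> app q f x \<in> vec r"
  by (auto simp: mats_def vec_def app_def intro!: sum.neutral)

lemma dot_add_right: "dot q a (\<lambda>i. x i + y i) = dot q a x + dot q a y"
  by (simp add: dot_def sum.distrib algebra_simps)
lemma app_add: "app q f (\<lambda>i. x i + y i) = (\<lambda>k. app q f x k + app q f y k)"
  by (simp add: app_def sum.distrib algebra_simps)
lemma dot_zero_right [simp]: "dot q a (\<lambda>_. 0) = 0" by (simp add: dot_def)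
lemma dot_zero_left [simp]: "dot q (\<lambda>_. 0) x = 0" by (simp add: dot_def)
lemma dot_axis_left: "k \<in> {1..q} \<Longrightarrow> dot q (axis k) x = x k"
  by (simp add: dot_def axis_def if_distrib[of "\<lambda>u. u * _"] cong: if_cong)
lemma dot_axis_right: "k \<in> {1..q} \<Longrightarrow> dot q x (axis k) = x k"
  by (simp add: dot_def axis_def if_distrib[of "\<lambda>u. _ * u"] cong: if_cong)
lemma app_axis: "i \<in> {1..q} \<Longrightarrow> app q f (axis i) = f i"
  by (simp add: app_def axis_def if_distrib[of "\<lambda>u. _ * u"] cong: if_cong)
lemma rowmul_axis: "k \<in> {1..r} \<Longrightarrow> rowmul q r (axis k) f = row q f k"
  by (auto simp: rowmul_def row_def dot_axis_left)
lemma dot_rowmul: "dot q (rowmul q r a f) x = dot r a (app q f x)"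
proof -
  have "dot q (rowmul q r a f) x = (\<Sum>i=1..q. \<Sum>k=1..r. a k * f i k * x i)"
    by (simp add: dot_def rowmul_def sum_distrib_right)
  also have "\<dots> = (\<Sum>k=1..r. \<Sum>i=1..q. a k * f i k * x i)" by (rule sum.swap)
  also have "\<dots> = dot r a (app q f x)" by (simp add: dot_def app_def sum_distrib_left algebra_simps)
  finally show ?thesis .
qed
lemma dot_row: "dot q (row q f k) x = app q f x k"
  by (simp add: dot_def row_def app_def)

text \<open>Interchange of two finite sums. The family of the columns \<open>app q f (g i)\<close>
  is the matrix product, which is written out in this form wherever it occurs.\<close>

lemma app_app: "app q f (app s g x) = app s (\<lambda>i. app q f (g i)) x"
proof
  fix k
  have "app q f (app s g x) k = (\<Sum>i=1..q. \<Sum>j=1..s. f i k * (g j i * x j))"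
    by (simp add: app_def sum_distrib_left)
  also have "\<dots> = (\<Sum>j=1..s. \<Sum>i=1..q. f i k * (g j i * x j))" by (rule sum.swap)
  also have "\<dots> = app s (\<lambda>i. app q f (g i)) x k" by (simp add: app_def sum_distrib_right mult.assoc)
  finally show "app q f (app s g x) k = app s (\<lambda>i. app q f (g i)) x k" .
qed
lemma rowmul_rowmul: "rowmul s q (rowmul q r a f) g = rowmul s r a (\<lambda>i. app q f (g i))"
  by (simp add: rowmul_def[of s] dot_rowmul cong: if_cong)
text \<open>Test vectors for universal cases: columns \<open>x\<close>, \<open>y\<close> of \<int>^q
  are the images of the axes of \<int>^2 under \<open>cols2 x y\<close>, and a row \<open>a\<close>
  pulls back to \<open>vec2 (dot q a x) (dot q a y)\<close>. Four entries are needed for the cocycle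
  identity of the associativity defect.\<close>

definition vec2 :: "int \<Rightarrow> int \<Rightarrow> nat \<Rightarrow> int" where
  "vec2 l m = (\<lambda>i. if i = 1 then l else if i = 2 then m else 0)"
definition vec3 :: "int \<Rightarrow> int \<Rightarrow> int \<Rightarrow> nat \<Rightarrow> int" where
  "vec3 l m n = (\<lambda>i. if i = 1 then l else if i = 2 then m else if i = 3 then n else 0)"
definition vec4 :: "int \<Rightarrow> int \<Rightarrow> int \<Rightarrow> int \<Rightarrow> nat \<Rightarrow> int" where
  "vec4 k l m n = (\<lambda>i. if i = 1 then k else if i = 2 then l else if i = 3 then m else if i = 4 then n else 0)"
definition cols2 :: "(nat \<Rightarrow> int) \<Rightarrow> (nat \<Rightarrow> int) \<Rightarrow> nat \<Rightarrow> nat \<Rightarrow> int" where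
  "cols2 x y = (\<lambda>i. if i = 1 then x else y)"
definition cols3 :: "(nat \<Rightarrow> int) \<Rightarrow> (nat \<Rightarrow> int) \<Rightarrow> (nat \<Rightarrow> int) \<Rightarrow> nat \<Rightarrow> nat \<Rightarrow> int" where
  "cols3 x y z = (\<lambda>i. if i = 1 then x else if i = 2 then y else z)"

lemma atLeastAtMost_1_2: "{1..2::nat} = {1,2}" and atLeastAtMost_1_3: "{1..3::nat} = {1,2,3}"
  by auto

lemma vec2_in [simp]: "vec2 l m \<in> vec 2" and vec3_in [simp]: "vec3 k l m \<in> vec 3"
  and vec4_in [simp]: "vec4 k l m n \<in> vec 4"
  by (auto simp: vec_def vec2_def vec3_def vec4_def)
lemma cols2_in [simp]: "x \<in> vec q \<Longrightarrow> y \<in> vec q \<Longrightarrow> cols2 x y \<in> mats 2 q"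
  by (auto simp: mats_def cols2_def)
lemma cols3_in [simp]: "x \<in> vec q \<Longrightarrow> y \<in> vec q \<Longrightarrow> z \<in> vec q \<Longrightarrow> cols3 x y z \<in> mats 3 q"
  by (auto simp: mats_def cols3_def)

lemma app_cols2: "app 2 (cols2 x y) (vec2 l m) = (\<lambda>k. l * x k + m * y k)"
  by (auto simp: app_def cols2_def vec2_def atLeastAtMost_1_2[simplified] algebra_simps)
lemma app_cols3: "app 3 (cols3 x y z) (vec3 l m n) = (\<lambda>k. l * x k + m * y k + n * z k)"
  by (auto simp: app_def cols3_def vec3_def atLeastAtMost_1_3[simplified] algebra_simps)
lemma row_cols2: "row 2 (cols2 x y) k = vec2 (x k) (y k)"
  by (auto simp: row_def cols2_def vec2_def)
lemma row_cols3: "row 3 (cols3 x y z) k = vec3 (x k) (y k) (z k)"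
  by (force simp: row_def cols3_def vec3_def)
lemma rowmul_cols2: "rowmul 2 q a (cols2 x y) = vec2 (dot q a x) (dot q a y)"
  by (auto simp: rowmul_def cols2_def vec2_def)
lemma rowmul_cols3: "rowmul 3 q a (cols3 x y z) = vec3 (dot q a x) (dot q a y) (dot q a z)"
  by (force simp: rowmul_def cols3_def vec3_def)


section \<open>Integral linear combinations in abelian groups\<close>

definition lin :: "('d, 'b) ring_scheme \<Rightarrow> nat \<Rightarrow> (nat \<Rightarrow> int) \<Rightarrow> (nat \<Rightarrow> 'd) \<Rightarrow> 'd" where
  "lin R n a d = finsum R (\<lambda>k. add_pow R (a k) (d k)) {1..n}"

context abelian_group
begin

lemma neg_zero [simp]: "\<ominus> \<zero> = \<zero>"
  by (rule minus_equality) simp_all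

text \<open>With these rules the method \<open>algebra\<close> normalises terms of an abelian group.
  The longer cancellations below are stated over variables and left to it.\<close>

lemmas abelian_group_simprules [algebra abelian_group "zero G" "add G" "a_inv G" "a_minus G"] =
  a_closed zero_closed a_inv_closed minus_closed a_assoc l_zero l_neg a_comm minus_eq
  r_zero r_neg r_neg2 r_neg1 minus_add minus_minus neg_zero a_lcomm

lemma add_pow_0 [simp]: "[(0 :: int)] \<cdot> x = \<zero>"
  by (simp add: add_pow_def)

lemma lin_closed [simp]: "(\<And>k. d k \<in> carrier G) \<Longrightarrow> lin G n a d \<in> carrier G"
  by (auto simp: lin_def intro!: finsum_closed)

lemma lin_cong: "(\<And>k. k \<in> {1..n} \<Longrightarrow> a k = b k) \<Longrightarrow> (\<And>k. k \<in> {1..n} \<Longrightarrow> d k = e k) \<Longrightarrow>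
   (\<And>k. k \<in> {1..n} \<Longrightarrow> e k \<in> carrier G) \<Longrightarrow> lin G n a d = lin G n b e"
  unfolding lin_def by (rule finsum_cong') auto

lemma lin_0 [simp]: "lin G 0 a d = \<zero>" by (simp add: lin_def)

lemma lin_Suc: "(\<And>k. d k \<in> carrier G) \<Longrightarrow>
   lin G (Suc n) a d = lin G n a d \<oplus> [a (Suc n)] \<cdot> d (Suc n)"
  unfolding lin_def by (simp add: atLeastAtMostSuc_conv a_comm)

lemma lin_add: "(\<And>k. d k \<in> carrier G) \<Longrightarrow> (\<And>k. e k \<in> carrier G) \<Longrightarrow>
   lin G n a (\<lambda>k. d k \<oplus> e k) = lin G n a d \<oplus> lin G n a e"
  by (induction n) (simp_all add: lin_Suc add.int_pow_distrib a_ac)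

lemma lin_neg: "(\<And>k. d k \<in> carrier G) \<Longrightarrow>
   lin G n a (\<lambda>k. \<ominus> d k) = \<ominus> lin G n a d"
  by (induction n) (simp_all add: lin_Suc add.int_pow_inv minus_add)

lemma lin_minus: "(\<And>k. d k \<in> carrier G) \<Longrightarrow> (\<And>k. e k \<in> carrier G) \<Longrightarrow>
   lin G n a (\<lambda>k. d k \<ominus> e k) = lin G n a d \<ominus> lin G n a e"
  by (simp add: a_minus_def lin_add lin_neg)

lemma lin_zero [simp]: "lin G n a (\<lambda>k. \<zero>) = \<zero>"
  by (induction n) (simp_all add: lin_Suc)

lemma lin_vadd: "(\<And>k. d k \<in> carrier G) \<Longrightarrow>
   lin G n (\<lambda>k. a k + b k) d = lin G n a d \<oplus> lin G n b d"
  by (induction n) (simp_all add: lin_Suc add.int_pow_mult a_ac)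

lemma lin_vzero [simp]: "lin G n (\<lambda>k. 0) d = \<zero>"
  unfolding lin_def by (simp add: finsum_zero)

lemma lin_axis: "i \<in> {1..n} \<Longrightarrow> (\<And>k. d k \<in> carrier G) \<Longrightarrow> lin G n (axis i) d = d i"
proof (induction n)
  case (Suc n)
  have "lin G n (axis (Suc n)) d = lin G n (\<lambda>_. 0) d"
    unfolding lin_def by (rule finsum_cong') (auto simp: axis_def Suc.prems)
  then show ?case using Suc by (cases "i = Suc n") (auto simp: lin_Suc axis_def)
qed simp

lemma lin_smult: "(\<And>k. d k \<in> carrier G) \<Longrightarrow> lin G n (\<lambda>k. m * a k) d = [m] \<cdot> lin G n a d"
  by (induction n) (simp_all add: lin_Suc add.int_pow_distrib add.int_pow_pow mult.commute)

lemma lin_app: "(\<And>k. d k \<in> carrier G) \<Longrightarrow> lin G r (app q f x) d = lin G q x (\<lambda>i. lin G r (f i) d)"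
proof (induction q)
  case 0 then show ?case by (simp add: app_def)
next
  case (Suc q)
  have "app (Suc q) f x = (\<lambda>k. app q f x k + x (Suc q) * f (Suc q) k)"
    by (simp add: app_def mult.commute)
  then show ?case using Suc by (simp add: lin_vadd lin_smult lin_Suc)
qed

text \<open>The rows of \<open>f\<close> are the columns of its transpose, so this is
  \<open>lin_app\<close> for the transposed matrix with \<open>a\<close> as the vector of
  coefficients.\<close>

lemma lin_lin_row: "(\<And>k. d k \<in> carrier G) \<Longrightarrow>
   lin G r a (\<lambda>k. lin G q (row q f k) d) = lin G q (rowmul q r a f) d"
proof -
  assume d: "\<And>k. d k \<in> carrier G"
  have "lin G r a (\<lambda>k. lin G q (row q f k) d) = lin G q (app r (\<lambda>k. row q f k) a) d"
    using d by (simp add: lin_app)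
  also have "\<dots> = lin G q (rowmul q r a f) d"
    by (rule lin_cong) (auto simp: app_def row_def rowmul_def dot_def d mult.commute)
  finally show ?thesis .
qed

lemma lin_multiples: "d \<in> carrier G \<Longrightarrow> lin G n x (\<lambda>k. [a k] \<cdot> d) = [dot n a x] \<cdot> d"
  by (induction n) (simp_all add: lin_Suc dot_def add.int_pow_mult add.int_pow_pow mult.commute)

lemma lin_delta: "\<lbrakk>j \<in> {1..n}; \<And>k. d k \<in> carrier G\<rbrakk> \<Longrightarrow> lin G n (\<lambda>_. 1) (\<lambda>k. if k = j then d k else \<zero>) = d j"
proof (induction n)
  case (Suc n)
  show ?case
  proof (cases "j = Suc n")
    case True
    have "lin G n (\<lambda>_. 1) (\<lambda>k. if k = j then d k else \<zero>) = lin G n (\<lambda>_. 1) (\<lambda>k. \<zero>)"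
      by (rule lin_cong) (use True in auto)
    then show ?thesis using True Suc.prems by (simp add: lin_Suc)
  next
    case False
    then show ?thesis using Suc by (simp add: lin_Suc)
  qed
qed simp

lemma lin_vec2: "(\<And>k. d k \<in> carrier G) \<Longrightarrow> lin G 2 (vec2 l m) d = [l] \<cdot> d 1 \<oplus> [m] \<cdot> d 2"
  by (simp add: numeral_2_eq_2 lin_Suc vec2_def One_nat_def)

end


text \<open>A normalised 3-cocycle of the theory of free abelian groups with coefficients on
  which rows and columns act linearly: \<open>c r q a f x\<close> is its value on the composable maps
  \<open>\<int> \<rightarrow> \<int>\<^sup>q \<rightarrow> \<int>\<^sup>r \<rightarrow> \<int>\<close> given by a column \<open>x\<close>, a matrix \<open>f\<close> and a row \<open>a\<close>.\<close>

locale theory_cocycle = abelian_group R for R (structure) +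
  fixes c :: "nat \<Rightarrow> nat \<Rightarrow> (nat \<Rightarrow> int) \<Rightarrow> (nat \<Rightarrow> nat \<Rightarrow> int) \<Rightarrow> (nat \<Rightarrow> int) \<Rightarrow> 'a"
  assumes c_closed [simp]: "c r q a f x \<in> carrier R"
    and c_cong: "(\<And>i. i \<in> {1..q} \<Longrightarrow> f i = f' i) \<Longrightarrow> c r q a f x = c r q a f' x"
    and c_cocycle: "\<lbrakk>a \<in> vec r; f \<in> mats q r; g \<in> mats s q; x \<in> vec s\<rbrakk> \<Longrightarrow>
      lin R r a (\<lambda>k. c q s (row q f k) g x) \<oplus> c r s a (\<lambda>i. app q f (g i)) x \<oplus>
        lin R s x (\<lambda>i. c r q a f (g i)) =
      c q s (rowmul q r a f) g x \<oplus> c r q a f (app s g x)"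
    and c_axis_left: "\<lbrakk>k \<in> {1..r}; f \<in> mats q r; x \<in> vec q\<rbrakk> \<Longrightarrow> c r q (axis k) f x = \<zero>"
    and c_zero_left: "\<lbrakk>f \<in> mats q r; x \<in> vec q\<rbrakk> \<Longrightarrow> c r q (\<lambda>_. 0) f x = \<zero>"
    and c_axis_right: "\<lbrakk>i \<in> {1..q}; a \<in> vec r; f \<in> mats q r\<rbrakk> \<Longrightarrow> c r q a f (axis i) = \<zero>"
    and c_zero_right: "\<lbrakk>a \<in> vec r; f \<in> mats q r\<rbrakk> \<Longrightarrow> c r q a f (\<lambda>_. 0) = \<zero>"
begin

text \<open>\<open>v q a\<close> measures how far the tracks \<open>[a] \<phi>(x) \<Rightarrow> [a \<cdot> x]\<close> are from being additive in \<open>x\<close>.\<close>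

definition v :: "nat \<Rightarrow> (nat \<Rightarrow> int) \<Rightarrow> (nat \<Rightarrow> int) \<Rightarrow> (nat \<Rightarrow> int) \<Rightarrow> 'a" where
  "v q a x y = c q 2 a (cols2 x y) (vec2 1 1)"

lemma v_closed [simp]: "v q a x y \<in> carrier R" by (simp add: v_def)

lemma v_axis: "\<lbrakk>k \<in> {1..q}; x \<in> vec q; y \<in> vec q\<rbrakk> \<Longrightarrow> v q (axis k) x y = \<zero>"
  by (simp add: v_def c_axis_left)

lemma v_zero: "\<lbrakk>x \<in> vec q; y \<in> vec q\<rbrakk> \<Longrightarrow> v q (\<lambda>_. 0) x y = \<zero>"
  by (simp add: v_def c_zero_left)

text \<open>The cocycle identity for the column \<open>vec2 1 1\<close>, the matrix
  \<open>cols2 x y\<close>, then \<open>f\<close> and \<open>a\<close>: the column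
  \<open>vec2 1 1\<close> turns the sum of two columns into a composite. All later uses of the
  cocycle identity go through this instance.\<close>

lemma v_natural:
  assumes "a \<in> vec r" "f \<in> mats q r" "x \<in> vec q" "y \<in> vec q"
  shows "lin R r a (\<lambda>k. v q (row q f k) x y) \<oplus> v r a (app q f x) (app q f y) \<oplus>
      (c r q a f x \<oplus> c r q a f y) =
    v q (rowmul q r a f) x y \<oplus> c r q a f (\<lambda>i. x i + y i)"
proof -
  have "c r 2 a (\<lambda>i. app q f (cols2 x y i)) (vec2 1 1) = v r a (app q f x) (app q f y)"
    unfolding v_def by (rule c_cong) (auto simp: cols2_def)
  moreover have "lin R 2 (vec2 1 1) (\<lambda>i. c r q a f (cols2 x y i)) = c r q a f x \<oplus> c r q a f y"
    by (simp add: lin_vec2 cols2_def)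
  ultimately show ?thesis
    using c_cocycle[of a r f q "cols2 x y" 2 "vec2 1 1"] assms
    by (simp add: app_cols2 v_def)
qed

text \<open>The universal case of three columns: the difference between the two bracketings of the
  sum e1 + e2 + e3 of the axes of \<int>^3, at the row with entries \<open>l\<close>,
  \<open>m\<close>, \<open>n\<close>.\<close>

definition assoc_defect :: "int \<Rightarrow> int \<Rightarrow> int \<Rightarrow> 'a" where
  "assoc_defect l m n =
    (v 3 (vec3 l m n) (vec3 1 1 0) (vec3 0 0 1) \<oplus> v 3 (vec3 l m n) (vec3 1 0 0) (vec3 0 1 0)) \<ominus>
    (v 3 (vec3 l m n) (vec3 1 0 0) (vec3 0 1 1) \<oplus> v 3 (vec3 l m n) (vec3 0 1 0) (vec3 0 0 1))"

lemma assoc_defect_closed [simp]: "assoc_defect l m n \<in> carrier R" by (simp add: assoc_defect_def)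

lemma vec3_axis: "vec3 1 0 0 = axis 1" "vec3 0 1 0 = axis 2" "vec3 0 0 1 = axis 3" "vec3 0 0 0 = (\<lambda>_. 0)"
  and vec2_axis: "vec2 1 0 = axis 1" "vec2 0 1 = axis 2" "vec2 0 0 = (\<lambda>_. 0)"
  by (auto simp: vec3_def vec2_def axis_apply)

lemma assoc_defect_units:
  "assoc_defect 1 0 0 = \<zero>" "assoc_defect 0 1 0 = \<zero>" "assoc_defect 0 0 1 = \<zero>" "assoc_defect 0 0 0 = \<zero>"
  by (simp_all add: assoc_defect_def v_zero v_axis vec3_axis minus_eq)

text \<open>Naturality along \<open>cols3 x y z\<close> carries the four values of \<open>v\<close>
  over from \<int>^3. What remains is the universal defect, once at the products with
  \<open>a\<close> and once, combined linearly, at the coordinates.\<close>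

lemma v_assoc:
  assumes a: "a \<in> vec q" and x: "x \<in> vec q" and y: "y \<in> vec q" and z: "z \<in> vec q"
  shows "v q a x y \<oplus> v q a (\<lambda>i. x i + y i) z \<oplus> lin R q a (\<lambda>k. assoc_defect (x k) (y k) (z k)) =
    v q a y z \<oplus> v q a x (\<lambda>i. y i + z i) \<oplus> assoc_defect (dot q a x) (dot q a y) (dot q a z)"
proof -
  let ?f = "cols3 x y z"
  let ?b = "vec3 (dot q a x) (dot q a y) (dot q a z)" and ?b' = "\<lambda>k. vec3 (x k) (y k) (z k)"
  let ?e1 = "vec3 1 0 0" and ?e2 = "vec3 0 1 0" and ?e3 = "vec3 0 0 1"
  have f: "?f \<in> mats 3 q" using x y z by simp
  have ax: "c q 3 a ?f ?e1 = \<zero>" "c q 3 a ?f ?e2 = \<zero>" "c q 3 a ?f ?e3 = \<zero>"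
    using a f by (simp_all add: vec3_axis c_axis_right)
  have s: "(\<lambda>i. vec3 k l m i + vec3 k' l' m' i) = vec3 (k+k') (l+l') (m+m')" for k l m k' l' m'
    by (auto simp: vec3_def)
  note I = v_natural[OF a f, unfolded row_cols3 rowmul_cols3]
  have 1: "lin R q a (\<lambda>k. v 3 (?b' k) (vec3 1 1 0) ?e3) \<oplus> v q a (\<lambda>i. x i + y i) z \<oplus> c q 3 a ?f (vec3 1 1 0)
      = v 3 ?b (vec3 1 1 0) ?e3 \<oplus> c q 3 a ?f (vec3 1 1 1)"
    using I[of "vec3 1 1 0" ?e3] by (simp add: ax app_cols3 s)
  have 2: "lin R q a (\<lambda>k. v 3 (?b' k) ?e1 ?e2) \<oplus> v q a x y = v 3 ?b ?e1 ?e2 \<oplus> c q 3 a ?f (vec3 1 1 0)"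
    using I[of ?e1 ?e2] by (simp add: ax app_cols3 s)
  have 3: "lin R q a (\<lambda>k. v 3 (?b' k) ?e1 (vec3 0 1 1)) \<oplus> v q a x (\<lambda>i. y i + z i) \<oplus> c q 3 a ?f (vec3 0 1 1)
      = v 3 ?b ?e1 (vec3 0 1 1) \<oplus> c q 3 a ?f (vec3 1 1 1)"
    using I[of ?e1 "vec3 0 1 1"] by (simp add: ax app_cols3 s)
  have 4: "lin R q a (\<lambda>k. v 3 (?b' k) ?e2 ?e3) \<oplus> v q a y z = v 3 ?b ?e2 ?e3 \<oplus> c q 3 a ?f (vec3 0 1 1)"
    using I[of ?e2 ?e3] by (simp add: ax app_cols3 s)
  have L: "lin R q a (\<lambda>k. assoc_defect (x k) (y k) (z k)) =
     (lin R q a (\<lambda>k. v 3 (?b' k) (vec3 1 1 0) ?e3) \<oplus> lin R q a (\<lambda>k. v 3 (?b' k) ?e1 ?e2)) \<ominus>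
     (lin R q a (\<lambda>k. v 3 (?b' k) ?e1 (vec3 0 1 1)) \<oplus> lin R q a (\<lambda>k. v 3 (?b' k) ?e2 ?e3))"
    by (simp add: assoc_defect_def lin_minus lin_add)
  \<comment> \<open>Here \<open>d1\<close>, \<open>d2\<close>, \<open>d3\<close> stand for the
    values of \<open>c\<close> at e1 + e2, e1 + e2 + e3 and e2 + e3; each enters two of the four
    equations and drops out.\<close>
  have solve: "P \<oplus> Q \<oplus> ((l1 \<oplus> l2) \<ominus> (l3 \<oplus> l4)) = S \<oplus> T \<oplus> ((b1 \<oplus> b2) \<ominus> (b3 \<oplus> b4))"
    if e: "l1 \<oplus> Q \<oplus> d1 = b1 \<oplus> d2" "l2 \<oplus> P = b2 \<oplus> d1" "l3 \<oplus> T \<oplus> d3 = b3 \<oplus> d2" "l4 \<oplus> S = b4 \<oplus> d3"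
      and cl: "P \<in> carrier R" "Q \<in> carrier R" "S \<in> carrier R" "T \<in> carrier R"
        "l1 \<in> carrier R" "l2 \<in> carrier R" "l3 \<in> carrier R" "l4 \<in> carrier R"
        "b1 \<in> carrier R" "b2 \<in> carrier R" "b3 \<in> carrier R" "b4 \<in> carrier R"
        "d1 \<in> carrier R" "d2 \<in> carrier R" "d3 \<in> carrier R"
    for P Q S T l1 l2 l3 l4 b1 b2 b3 b4 d1 d2 d3
  proof -
    have "P \<oplus> Q \<oplus> ((l1 \<oplus> l2) \<ominus> (l3 \<oplus> l4)) =
        (l1 \<oplus> Q \<oplus> d1) \<oplus> (l2 \<oplus> P) \<ominus> (l3 \<oplus> T \<oplus> d3) \<ominus> (l4 \<oplus> S) \<oplus> (T \<oplus> S \<oplus> d3 \<ominus> d1)"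
      using cl by algebra
    also have "\<dots> = S \<oplus> T \<oplus> ((b1 \<oplus> b2) \<ominus> (b3 \<oplus> b4))"
      unfolding e using cl by algebra
    finally show ?thesis .
  qed
  show ?thesis unfolding L
    unfolding assoc_defect_def
    by (rule solve[OF 1 2 3 4]) simp_all
qed

text \<open>The pentagon for the sum of the four axes of \<int>^4 at the row
  \<open>vec4 k l m n\<close>: each of \<open>e1\<close> to \<open>e5\<close> is
  \<open>v_assoc\<close> for one edge, and in their alternating sum all values of \<open>v\<close>
  cancel.\<close>

lemma assoc_defect_cocycle:
  "assoc_defect l m n \<oplus> assoc_defect k (l + m) n \<oplus> assoc_defect k l m =
   assoc_defect (k + l) m n \<oplus> assoc_defect k l (m + n)"
proof -
  let ?a = "vec4 k l m n"
  let ?x = "axis 1" and ?y = "axis 2" and ?z = "axis 3" and ?w = "axis 4"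
  \<comment> \<open>In every coordinate at most one of the three vectors has the entry 1 and the
    others have 0, where \<open>assoc_defect_units\<close> applies; so the coordinate term of
    \<open>v_assoc\<close> disappears.\<close>
  have L: "lin R 4 ?a (\<lambda>j. assoc_defect (x j) (y j) (z j)) = \<zero>"
    if "\<And>j. j \<in> {1..4} \<Longrightarrow> (x j, y j, z j) \<in> {(0,0,0),(1,0,0),(0,1,0),(0,0,1)}" for x y z
  proof -
    have "lin R 4 ?a (\<lambda>j. assoc_defect (x j) (y j) (z j)) = lin R 4 ?a (\<lambda>j. \<zero>)"
    proof (rule lin_cong)
      fix j :: nat assume "j \<in> {1..4}"
      from that[OF this] show "assoc_defect (x j) (y j) (z j) = \<zero>"
        using assoc_defect_units by auto
    qed auto
    then show ?thesis by simp
  qed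
  have d: "dot 4 ?a ?x = k" "dot 4 ?a ?y = l" "dot 4 ?a ?z = m" "dot 4 ?a ?w = n"
    by (simp_all add: dot_axis_right vec4_def)
  have I: "v 4 ?a x y \<oplus> v 4 ?a (\<lambda>i. x i + y i) z =
      v 4 ?a y z \<oplus> v 4 ?a x (\<lambda>i. y i + z i) \<oplus> assoc_defect (dot 4 ?a x) (dot 4 ?a y) (dot 4 ?a z)"
    if "\<And>j. j \<in> {1..4} \<Longrightarrow> (x j, y j, z j) \<in> {(0,0,0),(1,0,0),(0,1,0),(0,0,1)}"
      "x \<in> vec 4" "y \<in> vec 4" "z \<in> vec 4" for x y z
    using v_assoc[of ?a 4 x y z] L[of x y z] that by simp
  let ?xy = "\<lambda>i. ?x i + ?y i" and ?yz = "\<lambda>i. ?y i + ?z i" and ?zw = "\<lambda>i. ?z i + ?w i"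
  have V: "?xy \<in> vec 4" "?yz \<in> vec 4" "?zw \<in> vec 4" by simp_all
  have p: "(axis 2 j, axis 3 j, axis 4 j) \<in> {(0,0,0),(1,0,0),(0,1,0),(0,0,1)}"
    "(axis 1 j + axis 2 j, axis 3 j, axis 4 j) \<in> {(0,0,0),(1,0,0),(0,1,0),(0,0,1)}"
    "(axis 1 j, axis 2 j + axis 3 j, axis 4 j) \<in> {(0,0,0),(1,0,0),(0,1,0),(0,0,1)}"
    "(axis 1 j, axis 2 j, axis 3 j + axis 4 j) \<in> {(0,0,0),(1,0,0),(0,1,0),(0,0,1)}"
    "(axis 1 j, axis 2 j, axis 3 j) \<in> {(0,0,0),(1,0,0),(0,1,0),(0,0,1)}" for j
    by (auto simp: axis_apply)
  have e1: "v 4 ?a ?y ?z \<oplus> v 4 ?a ?yz ?w = v 4 ?a ?z ?w \<oplus> v 4 ?a ?y ?zw \<oplus> assoc_defect l m n"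
    using I[OF p(1)] by (simp add: d)
  have e2: "v 4 ?a ?xy ?z \<oplus> v 4 ?a (\<lambda>i. ?x i + ?y i + ?z i) ?w = v 4 ?a ?z ?w \<oplus> v 4 ?a ?xy ?zw \<oplus> assoc_defect (k + l) m n"
    using I[OF p(2)] by (simp add: d dot_add_right)
  have e3: "v 4 ?a ?x ?yz \<oplus> v 4 ?a (\<lambda>i. ?x i + ?y i + ?z i) ?w =
      v 4 ?a ?yz ?w \<oplus> v 4 ?a ?x (\<lambda>i. ?y i + ?z i + ?w i) \<oplus> assoc_defect k (l + m) n"
    using I[OF p(3)] by (simp add: d dot_add_right add.assoc)
  have e4: "v 4 ?a ?x ?y \<oplus> v 4 ?a ?xy ?zw =
      v 4 ?a ?y ?zw \<oplus> v 4 ?a ?x (\<lambda>i. ?y i + ?z i + ?w i) \<oplus> assoc_defect k l (m + n)"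
    using I[OF p(4)] by (simp add: d dot_add_right add.assoc)
  have e5: "v 4 ?a ?x ?y \<oplus> v 4 ?a ?xy ?z = v 4 ?a ?y ?z \<oplus> v 4 ?a ?x ?yz \<oplus> assoc_defect k l m"
    using I[OF p(5)] by (simp add: d)
  have solve: "A1 \<oplus> A3 \<oplus> A5 = A2 \<oplus> A4"
    if e: "yz \<oplus> yz_w = zw \<oplus> y_zw \<oplus> A1" "xy_z \<oplus> xyz_w = zw \<oplus> xy_zw \<oplus> A2"
      "x_yz \<oplus> xyz_w = yz_w \<oplus> x_yzw \<oplus> A3" "xy \<oplus> xy_zw = y_zw \<oplus> x_yzw \<oplus> A4"
      "xy \<oplus> xy_z = yz \<oplus> x_yz \<oplus> A5"
      and cl: "yz \<in> carrier R" "yz_w \<in> carrier R" "zw \<in> carrier R" "y_zw \<in> carrier R" "xy_z \<in> carrier R"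
       "xyz_w \<in> carrier R" "xy_zw \<in> carrier R" "x_yz \<in> carrier R" "x_yzw \<in> carrier R" "xy \<in> carrier R"
       "A1 \<in> carrier R" "A2 \<in> carrier R" "A3 \<in> carrier R" "A4 \<in> carrier R" "A5 \<in> carrier R"
    for A1 A2 A3 A4 A5 yz yz_w zw y_zw xy_z xyz_w xy_zw x_yz x_yzw xy
  proof -
    have "A1 \<oplus> A3 \<oplus> A5 = (zw \<oplus> y_zw \<oplus> A1) \<oplus> (yz_w \<oplus> x_yzw \<oplus> A3) \<oplus> (yz \<oplus> x_yz \<oplus> A5)
        \<ominus> (zw \<oplus> y_zw \<oplus> yz_w \<oplus> x_yzw \<oplus> yz \<oplus> x_yz)"
      using cl by algebra
    also have "\<dots> = (xy_z \<oplus> xyz_w) \<oplus> (xy \<oplus> xy_zw) \<ominus> (zw \<oplus> y_zw \<oplus> x_yzw \<oplus> xy_zw)"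
      unfolding e[symmetric] using cl by algebra
    also have "\<dots> = A2 \<oplus> A4" unfolding e(2,4) using cl by algebra
    finally show ?thesis .
  qed
  show ?thesis by (rule solve[OF e1 e2 e3 e4 e5]) simp_all
qed

text \<open>The universal value of \<open>v\<close> at a zero column: adding zero need not be
  trivial for \<open>v\<close>. It becomes the initial value of \<beta>.\<close>

definition unit_defect :: "int \<Rightarrow> 'a" where
  "unit_defect m = v 1 (\<lambda>i. if i = 1 then m else 0) (axis 1) (\<lambda>_. 0)"

lemma unit_defect_closed [simp]: "unit_defect m \<in> carrier R" by (simp add: unit_defect_def)

lemma unit_defect_0 [simp]: "unit_defect 0 = \<zero>" by (simp add: unit_defect_def v_zero cong: if_cong)

lemma unit_defect_1 [simp]: "unit_defect 1 = \<zero>"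
  using v_axis[of 1 1 "axis 1" "\<lambda>_. 0"] by (simp add: unit_defect_def axis_def[symmetric])

text \<open>Naturality of \<open>v\<close> along the matrix with the single column \<open>x\<close>;
  all values of \<open>c\<close> that occur vanish by normalisation.\<close>

lemma v_zero_right:
  assumes "a \<in> vec q" "x \<in> vec q"
  shows "lin R q a (\<lambda>k. unit_defect (x k)) \<oplus> v q a x (\<lambda>_. 0) = unit_defect (dot q a x)"
proof -
  let ?f = "\<lambda>_ :: nat. x"
  have f: "?f \<in> mats 1 q" using assms by (simp add: mats_def)
  have "rowmul 1 q a ?f = (\<lambda>i. if i = 1 then dot q a x else 0)"
    "\<And>k. row 1 ?f k = (\<lambda>i. if i = 1 then x k else 0)"
    "app 1 ?f (axis 1) = x" "app 1 ?f (\<lambda>_. 0) = (\<lambda>_. 0)"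
    by (auto simp: rowmul_def row_def app_def axis_apply)
  then show ?thesis
    using v_natural[OF assms(1) f, of "axis 1" "\<lambda>_. 0"] c_axis_right[of 1 1 a q ?f]
      c_zero_right[of a q ?f 1] assms f
    by (simp add: unit_defect_def)
qed

text \<open>Associativity of e1 + e2 + 0 in \<int>^2, where both sides contain the same value of
  \<open>v\<close> at e1 and e2. This supplies the case \<open>n = 0\<close> of
  \<open>\<beta>_coboundary\<close>.\<close>

lemma assoc_defect_zero: "assoc_defect l m 0 = unit_defect (l + m) \<ominus> unit_defect m"
proof -
  let ?a = "vec2 l m"
  have L: "lin R 2 ?a (\<lambda>k. assoc_defect (axis 1 k) (axis 2 k) 0) = \<zero>"
    by (simp add: lin_vec2 axis_apply assoc_defect_units)
  have d: "dot 2 ?a (axis 1) = l" "dot 2 ?a (axis 2) = m"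
    by (simp_all add: dot_axis_right vec2_def)
  have 1: "v 2 ?a (axis 1) (axis 2) \<oplus> v 2 ?a (\<lambda>i. axis 1 i + axis 2 i) (\<lambda>_. 0) =
      v 2 ?a (axis 2) (\<lambda>_. 0) \<oplus> v 2 ?a (axis 1) (axis 2) \<oplus> assoc_defect l m 0"
    using v_assoc[of ?a 2 "axis 1" "axis 2" "\<lambda>_. 0"] by (simp add: L d)
  have 2: "v 2 ?a (axis 2) (\<lambda>_. 0) = unit_defect m"
    using v_zero_right[of ?a 2 "axis 2"] by (simp add: d lin_vec2 axis_apply)
  have 3: "v 2 ?a (\<lambda>i. axis 1 i + axis 2 i) (\<lambda>_. 0) = unit_defect (l + m)"
    using v_zero_right[of ?a 2 "\<lambda>i. axis 1 i + axis 2 i"] by (simp add: d lin_vec2 dot_add_right) (simp add: axis_apply)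
  have "assoc_defect l m 0 = (unit_defect m \<oplus> v 2 ?a (axis 1) (axis 2) \<oplus> assoc_defect l m 0)
      \<ominus> v 2 ?a (axis 1) (axis 2) \<ominus> unit_defect m"
    using unit_defect_closed[of m] assoc_defect_closed[of l m 0] v_closed[of 2 ?a "axis 1" "axis 2"] by algebra
  also have "\<dots> = (v 2 ?a (axis 1) (axis 2) \<oplus> unit_defect (l + m)) \<ominus> v 2 ?a (axis 1) (axis 2) \<ominus> unit_defect m"
    using 1 by (simp add: 2 3)
  also have "\<dots> = unit_defect (l + m) \<ominus> unit_defect m"
    using unit_defect_closed[of m] unit_defect_closed[of "l + m"] v_closed[of 2 ?a "axis 1" "axis 2"] by algebra
  finally show ?thesis .
qed

text \<open>On \<open>\<int>\<close> every 3-cocycle is a coboundary: solve for \<open>\<beta>\<close> by recursion on its second argument.\<close>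

definition \<beta> :: "int \<Rightarrow> int \<Rightarrow> 'a" where
  "\<beta> l m = (if m \<ge> 0
    then rec_nat (unit_defect l) (\<lambda>n b. b \<ominus> assoc_defect l (int n) 1) (nat m)
    else rec_nat (unit_defect l) (\<lambda>n b. b \<oplus> assoc_defect l (- int n - 1) 1) (nat (- m)))"

lemma \<beta>_closed [simp]: "\<beta> l m \<in> carrier R"
proof -
  have "rec_nat (unit_defect l) (\<lambda>n b. b \<ominus> assoc_defect l (int n) 1) k \<in> carrier R" for k
    by (induction k) simp_all
  moreover have "rec_nat (unit_defect l) (\<lambda>n b. b \<oplus> assoc_defect l (- int n - 1) 1) k \<in> carrier R" for k
    by (induction k) simp_all
  ultimately show ?thesis by (simp add: \<beta>_def)
qed

text \<open>Starting the recursion at \<open>unit_defect l\<close> instead of zero serves twice: it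
  gives the base case of \<open>\<beta>_coboundary\<close>, and it makes \<open>u\<close> vanish at
  a zero column.\<close>

lemma \<beta>_0 [simp]: "\<beta> l 0 = unit_defect l" by (simp add: \<beta>_def)

text \<open>One rule for both signs of \<open>m\<close>. For negative \<open>m\<close> the
  definition runs downwards, so the rule results from solving its equation for the other
  value.\<close>

lemma \<beta>_succ: "\<beta> l (m + 1) = \<beta> l m \<ominus> assoc_defect l m 1"
proof (cases "m \<ge> 0")
  case True
  then have "nat (m + 1) = Suc (nat m)" by simp
  with True show ?thesis by (simp add: \<beta>_def)
next
  case False
  define k where "k = nat (- m - 1)"
  have k: "m = - int k - 1" using False by (simp add: k_def)
  have "\<beta> l m = \<beta> l (m + 1) \<oplus> assoc_defect l m 1"
    by (cases "k = 0") (auto simp: k \<beta>_def nat_diff_distrib nat_add_distrib)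
  then have "\<beta> l m \<ominus> assoc_defect l m 1 = \<beta> l (m + 1) \<oplus> assoc_defect l m 1 \<ominus> assoc_defect l m 1" by simp
  also have "\<dots> = \<beta> l (m + 1)"
    using \<beta>_closed[of l "m + 1"] assoc_defect_closed[of l m 1] by algebra
  finally show ?thesis by simp
qed

text \<open>By \<open>\<beta>_succ\<close> and the cocycle identity for \<open>l\<close>,
  \<open>m\<close>, \<open>n\<close>, 1, the statements for \<open>n\<close> and
  \<open>n + 1\<close> are equivalent, so induction runs from 0 in both directions.\<close>

lemma \<beta>_coboundary: "\<beta> l m \<oplus> \<beta> (l + m) n = \<beta> m n \<oplus> \<beta> l (m + n) \<oplus> assoc_defect l m n"
proof -
  have solve: "(bl \<oplus> blm = bm \<oplus> bl' \<oplus> x) \<longleftrightarrow> (bl \<oplus> (blm \<ominus> a1) = (bm \<ominus> a2) \<oplus> (bl' \<ominus> a3) \<oplus> y)"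
    if e: "a2 \<oplus> a3 \<oplus> x = a1 \<oplus> y"
      and cl: "bl \<in> carrier R" "blm \<in> carrier R" "bm \<in> carrier R" "bl' \<in> carrier R" "x \<in> carrier R"
       "y \<in> carrier R" "a1 \<in> carrier R" "a2 \<in> carrier R" "a3 \<in> carrier R" for bl blm bm bl' x y a1 a2 a3
  proof -
    have "(bm \<ominus> a2) \<oplus> (bl' \<ominus> a3) \<oplus> y = bm \<oplus> bl' \<oplus> (a1 \<oplus> y) \<ominus> a2 \<ominus> a3 \<ominus> a1"
      using cl by algebra
    also have "\<dots> = (bm \<oplus> bl' \<oplus> x) \<ominus> a1" unfolding e[symmetric] using cl by algebra
    finally have 1: "(bm \<ominus> a2) \<oplus> (bl' \<ominus> a3) \<oplus> y = (bm \<oplus> bl' \<oplus> x) \<ominus> a1" .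
    have 2: "bl \<oplus> (blm \<ominus> a1) = (bl \<oplus> blm) \<ominus> a1" using cl by algebra
    show ?thesis unfolding 1 2 using cl by (simp add: minus_eq)
  qed
  let ?P = "\<lambda>n. \<beta> l m \<oplus> \<beta> (l + m) n = \<beta> m n \<oplus> \<beta> l (m + n) \<oplus> assoc_defect l m n"
  have step: "?P n \<longleftrightarrow> ?P (n + 1)" for n
    unfolding \<beta>_succ add.assoc[of m n 1, symmetric]
    by (rule solve) (use assoc_defect_cocycle[of m n 1 l] in \<open>simp_all\<close>)
  show ?thesis
  proof (induction n rule: int_induct[of _ 0])
    case base
    have "\<beta> l m \<oplus> unit_defect (l + m) = unit_defect m \<oplus> \<beta> l m \<oplus> (unit_defect (l + m) \<ominus> unit_defect m)"
      using \<beta>_closed[of l m] unit_defect_closed[of "l + m"] unit_defect_closed[of m] by algebra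
    then show ?case by (simp add: assoc_defect_zero)
  next
    case (step1 i) then show ?case using step[of i] by simp
  next
    case (step2 i) then show ?case using step[of "i - 1"] by simp
  qed
qed

text \<open>Correcting \<open>v\<close> by \<open>\<beta>\<close> removes the associativity defect, so that \<open>u q a\<close> is a 2-cocycle
  of the group \<open>\<int>\<^sup>q\<close>.\<close>

definition u :: "nat \<Rightarrow> (nat \<Rightarrow> int) \<Rightarrow> (nat \<Rightarrow> int) \<Rightarrow> (nat \<Rightarrow> int) \<Rightarrow> 'a" where
  "u q a x y = v q a x y \<ominus> \<beta> (dot q a x) (dot q a y) \<oplus> lin R q a (\<lambda>k. \<beta> (x k) (y k))"

lemma u_closed [simp]: "u q a x y \<in> carrier R" by (simp add: u_def)

text \<open>\<open>v_assoc\<close> has two error terms, the defect at the products with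
  \<open>a\<close> and the combination of the coordinatewise defects. By
  \<open>\<beta>_coboundary\<close> the two corrections in \<open>u\<close> absorb one each.\<close>

lemma u_cocycle:
  assumes "a \<in> vec q" "x \<in> vec q" "y \<in> vec q" "z \<in> vec q"
  shows "u q a x y \<oplus> u q a (\<lambda>i. x i + y i) z = u q a y z \<oplus> u q a x (\<lambda>i. y i + z i)"
proof -
  note e1 = v_assoc[OF assms]
  note e2 = \<beta>_coboundary[of "dot q a x" "dot q a y" "dot q a z"]
  have e3: "lin R q a (\<lambda>k. \<beta> (x k) (y k)) \<oplus> lin R q a (\<lambda>k. \<beta> (x k + y k) (z k)) =
     lin R q a (\<lambda>k. \<beta> (y k) (z k)) \<oplus> lin R q a (\<lambda>k. \<beta> (x k) (y k + z k)) \<oplus>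
     lin R q a (\<lambda>k. assoc_defect (x k) (y k) (z k))"
    by (simp add: lin_add[symmetric] \<beta>_coboundary)
  have solve: "(v1 \<ominus> b1 \<oplus> l1) \<oplus> (v2 \<ominus> b2 \<oplus> l2) = (v3 \<ominus> b3 \<oplus> l3) \<oplus> (v4 \<ominus> b4 \<oplus> l4)"
    if e: "v1 \<oplus> v2 \<oplus> L = v3 \<oplus> v4 \<oplus> B" "b1 \<oplus> b2 = b3 \<oplus> b4 \<oplus> B" "l1 \<oplus> l2 = l3 \<oplus> l4 \<oplus> L"
     and cl: "v1 \<in> carrier R" "v2 \<in> carrier R" "v3 \<in> carrier R" "v4 \<in> carrier R"
       "b1 \<in> carrier R" "b2 \<in> carrier R" "b3 \<in> carrier R" "b4 \<in> carrier R"
       "l1 \<in> carrier R" "l2 \<in> carrier R" "l3 \<in> carrier R" "l4 \<in> carrier R" "L \<in> carrier R" "B \<in> carrier R"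
    for v1 v2 v3 v4 b1 b2 b3 b4 l1 l2 l3 l4 L B
  proof -
    have "(v1 \<ominus> b1 \<oplus> l1) \<oplus> (v2 \<ominus> b2 \<oplus> l2) = (v1 \<oplus> v2 \<oplus> L) \<ominus> (b1 \<oplus> b2) \<oplus> (l1 \<oplus> l2) \<ominus> L"
      using cl by algebra
    also have "\<dots> = (v3 \<ominus> b3 \<oplus> l3) \<oplus> (v4 \<ominus> b4 \<oplus> l4)"
      unfolding e using cl by algebra
    finally show ?thesis .
  qed
  show ?thesis unfolding u_def dot_add_right
    by (rule solve[OF e1 e2 e3]) simp_all
qed

lemma u_zero_right:
  assumes "a \<in> vec q" "x \<in> vec q" shows "u q a x (\<lambda>_. 0) = \<zero>"
proof -
  have "d \<ominus> (e \<oplus> d) \<oplus> e = \<zero>" if "d \<in> carrier R" "e \<in> carrier R" for d e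
    using that by algebra
  then have "v q a x (\<lambda>_. 0) \<ominus> (lin R q a (\<lambda>k. unit_defect (x k)) \<oplus> v q a x (\<lambda>_. 0)) \<oplus>
      lin R q a (\<lambda>k. unit_defect (x k)) = \<zero>"
    by simp
  then show ?thesis by (simp add: u_def v_zero_right[OF assms])
qed

text \<open>The cocycle identity at the columns 0, 0, \<open>y\<close> reduces this to
  \<open>u_zero_right\<close>.\<close>

lemma u_zero_left:
  assumes "a \<in> vec q" "y \<in> vec q" shows "u q a (\<lambda>_. 0) y = \<zero>"
  using u_cocycle[of a q "\<lambda>_. 0" "\<lambda>_. 0" y] assms by (simp add: u_zero_right)

lemma u_axis: "\<lbrakk>k \<in> {1..q}; x \<in> vec q; y \<in> vec q\<rbrakk> \<Longrightarrow> u q (axis k) x y = \<zero>"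
  by (simp add: u_def v_axis lin_axis dot_axis_left minus_eq l_neg)

lemma u_zero: "\<lbrakk>x \<in> vec q; y \<in> vec q\<rbrakk> \<Longrightarrow> u q (\<lambda>_. 0) x y = \<zero>"
  by (simp add: u_def v_zero minus_eq)

text \<open>The corrections telescope: \<beta> at the coordinates of \<open>app q f x\<close> and
  \<open>app q f y\<close> enters once through the rows of \<open>f\<close> and once, with opposite
  sign, through the row \<open>a\<close>. Hence \<open>u\<close> inherits \<open>v_natural\<close>
  unchanged.\<close>

lemma u_natural:
  assumes "a \<in> vec r" "f \<in> mats q r" "x \<in> vec q" "y \<in> vec q"
  shows "lin R r a (\<lambda>k. u q (row q f k) x y) \<oplus> u r a (app q f x) (app q f y) \<oplus>
      (c r q a f x \<oplus> c r q a f y) =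
    u q (rowmul q r a f) x y \<oplus> c r q a f (\<lambda>i. x i + y i)"
proof -
  note e1 = v_natural[OF assms]
  let ?l = "lin R r a (\<lambda>k. \<beta> (app q f x k) (app q f y k))"
  let ?l' = "lin R q (rowmul q r a f) (\<lambda>k. \<beta> (x k) (y k))"
  have e2: "lin R r a (\<lambda>k. u q (row q f k) x y) = lin R r a (\<lambda>k. v q (row q f k) x y) \<ominus> ?l \<oplus> ?l'"
    by (simp add: u_def lin_add lin_minus dot_row lin_lin_row)
  have solve: "(V1 \<ominus> l \<oplus> l') \<oplus> (V2 \<ominus> b \<oplus> l) \<oplus> (c1 \<oplus> c2) = (V3 \<ominus> b \<oplus> l') \<oplus> c3"
    if e: "V1 \<oplus> V2 \<oplus> (c1 \<oplus> c2) = V3 \<oplus> c3" and cl: "V1 \<in> carrier R" "V2 \<in> carrier R" "V3 \<in> carrier R"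
     "l \<in> carrier R" "l' \<in> carrier R" "b \<in> carrier R" "c1 \<in> carrier R" "c2 \<in> carrier R" "c3 \<in> carrier R"
    for V1 V2 V3 l l' b c1 c2 c3
  proof -
    have "(V1 \<ominus> l \<oplus> l') \<oplus> (V2 \<ominus> b \<oplus> l) \<oplus> (c1 \<oplus> c2) = (V1 \<oplus> V2 \<oplus> (c1 \<oplus> c2)) \<ominus> b \<oplus> l'"
      using cl by algebra
    also have "\<dots> = (V3 \<ominus> b \<oplus> l') \<oplus> c3" unfolding e using cl by algebra
    finally show ?thesis .
  qed
  show ?thesis unfolding e2 unfolding u_def dot_rowmul
    by (rule solve[OF e1]) simp_all
qed

section \<open>The commutativity defect\<close>

definition \<tau> :: "int \<Rightarrow> int \<Rightarrow> 'a" where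
  "\<tau> l m = v 2 (vec2 l m) (axis 2) (axis 1) \<ominus> v 2 (vec2 l m) (axis 1) (axis 2)"

lemma \<tau>_closed [simp]: "\<tau> l m \<in> carrier R" by (simp add: \<tau>_def)

text \<open>Naturality along \<open>cols2 x y\<close> for both orders of the axes of \<int>^2. The
  common value of \<open>c\<close> at e1 + e2 cancels, which leaves \<tau> at the products with
  \<open>a\<close> and at the coordinates.\<close>

lemma v_commute:
  assumes "a \<in> vec q" "x \<in> vec q" "y \<in> vec q"
  shows "v q a x y \<oplus> \<tau> (dot q a x) (dot q a y) = v q a y x \<oplus> lin R q a (\<lambda>k. \<tau> (x k) (y k))"
proof -
  let ?f = "cols2 x y"
  have f: "?f \<in> mats 2 q" using assms by simp
  have ax: "c q 2 a ?f (axis 1) = \<zero>" "c q 2 a ?f (axis 2) = \<zero>"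
    using assms f by (simp_all add: c_axis_right)
  have cols: "app 2 ?f (axis 1) = x" "app 2 ?f (axis 2) = y"
    by (simp_all add: app_axis) (simp_all add: cols2_def)
  have 1: "lin R q a (\<lambda>k. v 2 (vec2 (x k) (y k)) (axis 1) (axis 2)) \<oplus> v q a x y =
    v 2 (vec2 (dot q a x) (dot q a y)) (axis 1) (axis 2) \<oplus> c q 2 a ?f (\<lambda>i. axis 1 i + axis 2 i)"
    using v_natural[OF assms(1) f, of "axis 1" "axis 2"] by (simp add: ax cols row_cols2 rowmul_cols2)
  have 2: "lin R q a (\<lambda>k. v 2 (vec2 (x k) (y k)) (axis 2) (axis 1)) \<oplus> v q a y x =
    v 2 (vec2 (dot q a x) (dot q a y)) (axis 2) (axis 1) \<oplus> c q 2 a ?f (\<lambda>i. axis 1 i + axis 2 i)"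
    using v_natural[OF assms(1) f, of "axis 2" "axis 1"] by (simp add: ax cols row_cols2 rowmul_cols2 add.commute)
  have solve: "V \<oplus> (b2 \<ominus> b1) = V' \<oplus> (l2 \<ominus> l1)"
    if e: "l1 \<oplus> V = b1 \<oplus> d" "l2 \<oplus> V' = b2 \<oplus> d" and cl: "l1 \<in> carrier R" "V \<in> carrier R" "b1 \<in> carrier R"
      "d \<in> carrier R" "l2 \<in> carrier R" "V' \<in> carrier R" "b2 \<in> carrier R" for V b2 b1 V' l2 l1 d
  proof -
    have "V \<oplus> (b2 \<ominus> b1) = (l1 \<oplus> V) \<oplus> (b2 \<oplus> d) \<ominus> l1 \<ominus> b1 \<ominus> d" using cl by algebra
    also have "\<dots> = V' \<oplus> (l2 \<ominus> l1)" unfolding e(1) e(2)[symmetric] using cl by algebra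
    finally show ?thesis .
  qed
  have L: "lin R q a (\<lambda>k. \<tau> (x k) (y k)) = lin R q a (\<lambda>k. v 2 (vec2 (x k) (y k)) (axis 2) (axis 1)) \<ominus>
    lin R q a (\<lambda>k. v 2 (vec2 (x k) (y k)) (axis 1) (axis 2))"
    by (simp add: \<tau>_def lin_minus)
  show ?thesis unfolding L unfolding \<tau>_def by (rule solve[OF 1 2]) simp_all
qed

text \<open>The universal commutator of the factor set \<open>u\<close>: it is \<tau> changed by the
  antisymmetrisation of \<beta>.\<close>

definition \<theta> :: "int \<Rightarrow> int \<Rightarrow> 'a" where
  "\<theta> l m = \<tau> l m \<oplus> \<beta> l m \<ominus> \<beta> m l"

lemma \<theta>_closed [simp]: "\<theta> l m \<in> carrier R" by (simp add: \<theta>_def)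

lemma u_commute:
  assumes "a \<in> vec q" "x \<in> vec q" "y \<in> vec q"
  shows "u q a x y \<oplus> \<theta> (dot q a x) (dot q a y) = u q a y x \<oplus> lin R q a (\<lambda>k. \<theta> (x k) (y k))"
proof -
  have L: "lin R q a (\<lambda>k. \<theta> (x k) (y k)) = lin R q a (\<lambda>k. \<tau> (x k) (y k)) \<oplus> lin R q a (\<lambda>k. \<beta> (x k) (y k)) \<ominus>
    lin R q a (\<lambda>k. \<beta> (y k) (x k))"
    by (simp add: \<theta>_def lin_minus lin_add)
  have solve: "(V \<ominus> b \<oplus> l) \<oplus> (t \<oplus> b \<ominus> b') = (V' \<ominus> b' \<oplus> l') \<oplus> (t' \<oplus> l \<ominus> l')"
    if e: "V \<oplus> t = V' \<oplus> t'" and cl: "V \<in> carrier R" "t \<in> carrier R" "V' \<in> carrier R" "t' \<in> carrier R"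
     "b \<in> carrier R" "b' \<in> carrier R" "l \<in> carrier R" "l' \<in> carrier R" for V b l t b' V' l' t'
  proof -
    have "(V \<ominus> b \<oplus> l) \<oplus> (t \<oplus> b \<ominus> b') = (V \<oplus> t) \<oplus> l \<ominus> b'" using cl by algebra
    also have "\<dots> = (V' \<ominus> b' \<oplus> l') \<oplus> (t' \<oplus> l \<ominus> l')" unfolding e using cl by algebra
    finally show ?thesis .
  qed
  show ?thesis unfolding L unfolding u_def \<theta>_def by (rule solve[OF v_commute[OF assms]]) simp_all
qed

lemma \<theta>_units: "\<theta> 1 0 = \<zero>" "\<theta> 0 1 = \<zero>" "\<theta> 0 0 = \<zero>"
proof -
  have t: "\<tau> 1 0 = \<zero>" "\<tau> 0 1 = \<zero>" "\<tau> 0 0 = \<zero>"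
    by (simp_all add: \<tau>_def vec2_axis v_axis v_zero minus_eq)
  have b: "\<beta> 0 1 = \<zero>"
    using \<beta>_succ[of 0 0] by (simp add: assoc_defect_units minus_eq)
  show "\<theta> 1 0 = \<zero>" "\<theta> 0 1 = \<zero>" "\<theta> 0 0 = \<zero>"
    using b by (simp_all add: \<theta>_def t minus_eq)
qed

text \<open>With unit entries the coordinate terms vanish by \<open>\<theta>_units\<close>, so
  \<theta> can be read off as a genuine commutator of \<open>u\<close>. Its laws then follow as for
  the commutator form of any central extension of an abelian group.\<close>

lemma u_commute_axis:
  assumes "a \<in> vec q" "x \<in> vec q" "y \<in> vec q"
    and "\<And>k. k \<in> {1..q} \<Longrightarrow> (x k, y k) \<in> {(0, 0), (1, 0), (0, 1)}"
  shows "u q a x y \<oplus> \<theta> (dot q a x) (dot q a y) = u q a y x"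
proof -
  have "lin R q a (\<lambda>k. \<theta> (x k) (y k)) = lin R q a (\<lambda>k. \<zero>)"
  proof (rule lin_cong)
    fix k assume "k \<in> {1..q}"
    from assms(4)[OF this] show "\<theta> (x k) (y k) = \<zero>" using \<theta>_units by auto
  qed auto
  with u_commute[OF assms(1-3)] show ?thesis by simp
qed

text \<open>Exchanging the two axes of \<int>^2 twice returns to the original order.\<close>

lemma \<theta>_antisym: "\<theta> l m \<oplus> \<theta> m l = \<zero>"
proof -
  let ?a = "vec2 l m"
  have d: "dot 2 ?a (axis 1) = l" "dot 2 ?a (axis 2) = m"
    by (simp_all add: dot_axis_right vec2_def)
  have 1: "u 2 ?a (axis 1) (axis 2) \<oplus> \<theta> l m = u 2 ?a (axis 2) (axis 1)"
    using u_commute_axis[of ?a 2 "axis 1" "axis 2"] by (simp add: d axis_apply)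
  have 2: "u 2 ?a (axis 2) (axis 1) \<oplus> \<theta> m l = u 2 ?a (axis 1) (axis 2)"
    using u_commute_axis[of ?a 2 "axis 2" "axis 1"] by (simp add: d axis_apply)
  from 2 have "u 2 ?a (axis 1) (axis 2) \<oplus> (\<theta> l m \<oplus> \<theta> m l) = u 2 ?a (axis 1) (axis 2)"
    unfolding 1[symmetric] by (simp add: a_assoc)
  then show ?thesis by simp
qed

text \<open>The third axis of \<int>^3 is moved past the sum of the first two, either at once or
  past one after the other; three instances of the cocycle identity compare the results.\<close>

lemma \<theta>_add: "\<theta> (k + l) m = \<theta> k m \<oplus> \<theta> l m"
proof -
  let ?a = "vec3 k l m" and ?x = "axis 1" and ?y = "axis 2" and ?z = "axis 3"
  let ?xy = "\<lambda>i. ?x i + ?y i"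
  have d: "dot 3 ?a ?x = k" "dot 3 ?a ?y = l" "dot 3 ?a ?z = m"
    by (simp_all add: dot_axis_right vec3_def)
  have 1: "u 3 ?a ?xy ?z \<oplus> \<theta> (k + l) m = u 3 ?a ?z ?xy"
    using u_commute_axis[of ?a 3 ?xy ?z] by (simp add: d dot_add_right) (simp add: axis_apply)
  have 2: "u 3 ?a ?x ?z \<oplus> \<theta> k m = u 3 ?a ?z ?x" "u 3 ?a ?y ?z \<oplus> \<theta> l m = u 3 ?a ?z ?y"
    using u_commute_axis[of ?a 3 ?x ?z] u_commute_axis[of ?a 3 ?y ?z] by (simp_all add: d axis_apply)
  have 3: "u 3 ?a ?x ?y \<oplus> u 3 ?a ?xy ?z = u 3 ?a ?y ?z \<oplus> u 3 ?a ?x (\<lambda>i. ?y i + ?z i)"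
    by (rule u_cocycle) simp_all
  have 4: "u 3 ?a ?x ?z \<oplus> u 3 ?a (\<lambda>i. ?x i + ?z i) ?y = u 3 ?a ?z ?y \<oplus> u 3 ?a ?x (\<lambda>i. ?y i + ?z i)"
    using u_cocycle[of ?a 3 ?x ?z ?y] by (simp add: add.commute)
  have 5: "u 3 ?a ?z ?x \<oplus> u 3 ?a (\<lambda>i. ?x i + ?z i) ?y = u 3 ?a ?x ?y \<oplus> u 3 ?a ?z ?xy"
    using u_cocycle[of ?a 3 ?z ?x ?y] by (simp add: add.commute)
  have solve: "t = tk \<oplus> tl" if e: "uxyz \<oplus> t = uzxy" "uxz \<oplus> tk = uzx" "uyz \<oplus> tl = uzy"
     "uxy \<oplus> uxyz = uyz \<oplus> uxyz'" "uxz \<oplus> w = uzy \<oplus> uxyz'" "uzx \<oplus> w = uxy \<oplus> uzxy"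
    and cl: "t \<in> carrier R" "tk \<in> carrier R" "tl \<in> carrier R" "uxyz \<in> carrier R" "uzxy \<in> carrier R"
     "uxz \<in> carrier R" "uzx \<in> carrier R" "uyz \<in> carrier R" "uzy \<in> carrier R" "uxy \<in> carrier R"
     "uxyz' \<in> carrier R" "w \<in> carrier R" for t tk tl uxyz uzxy uxz uzx uyz uzy uxy uxyz' w
  proof -
    have "t = (uxyz \<oplus> t) \<ominus> uxyz" using cl by algebra
    also have "\<dots> = (uxy \<oplus> uzxy) \<ominus> (uxy \<oplus> uxyz)" unfolding e(1) using cl by algebra
    also have "\<dots> = (uzx \<oplus> w) \<ominus> (uyz \<oplus> uxyz')" unfolding e(4,6) ..
    also have "\<dots> = (uxz \<oplus> w) \<oplus> tk \<ominus> (uyz \<oplus> uxyz')" unfolding e(2)[symmetric] using cl by algebra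
    also have "\<dots> = tk \<oplus> tl" unfolding e(5) e(3)[symmetric] using cl by algebra
    finally show ?thesis .
  qed
  show ?thesis by (rule solve[OF 1 2 3 4 5]) simp_all
qed

text \<open>\<open>\<theta>\<close> is biadditive and antisymmetric, hence determined by the 2-torsion element \<open>\<theta> 1 1\<close>, the
  only obstruction to the symmetry of \<open>u\<close>.\<close>

lemma u_symmetric:
  assumes tors: "\<And>d. d \<in> carrier R \<Longrightarrow> d \<oplus> d = \<zero> \<Longrightarrow> d = \<zero>"
    and "a \<in> vec q" "x \<in> vec q" "y \<in> vec q"
  shows "u q a x y = u q a y x"
proof -
  have add0: "h m = \<zero>" if "\<And>k l. h (k + l) = h k \<oplus> h l" "h 1 = \<zero>" "\<And>k. h k \<in> carrier R"
    for h :: "int \<Rightarrow> 'a" and m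
  proof (induction m rule: int_induct[of _ 1])
    case base then show ?case using that(2) by simp
  next
    case (step1 i) then show ?case using that by simp
  next
    case (step2 i)
    have "h i = h (i - 1) \<oplus> h 1" using that(1)[of "i - 1" 1] by simp
    then show ?case using step2 that by simp
  qed
  have 11: "\<theta> 1 1 = \<zero>" by (rule tors[OF _ \<theta>_antisym]) simp
  have m1: "\<theta> m 1 = \<zero>" for m by (rule add0[of "\<lambda>m. \<theta> m 1"]) (simp_all add: \<theta>_add 11)
  have 1: "\<theta> 1 m = \<zero>" for m using \<theta>_antisym[of 1 m] by (simp add: m1)
  have "\<theta> l m = \<zero>" for l m by (rule add0[of "\<lambda>l. \<theta> l m"]) (simp_all add: \<theta>_add 1)
  then show ?thesis using u_commute[OF assms(2-4)] by simp
qed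

end

section \<open>Free groups and free nilpotent groups\<close>

lemma letter_inv_inv [simp]: "letter_inv (letter_inv x) = x"
  by (simp add: letter_inv_def)

lemma fst_letter_inv [simp]: "fst (letter_inv x) = fst x"
  by (simp add: letter_inv_def)

lemma reduced_Cons: "reduced (x # w) \<longleftrightarrow> reduced w \<and> (w = [] \<or> hd w \<noteq> letter_inv x)"
  by (cases w) (auto simp: reduced_def)

lemma reduced_push_letter: "reduced w \<Longrightarrow> reduced (push_letter x w)"
  by (cases w) (auto simp: reduced_Cons reduced_def[of "[]"])

lemma reduced_Nil [simp]: "reduced []" by (simp add: reduced_def)

lemma set_push_letter: "fst ` set (push_letter x w) \<subseteq> insert (fst x) (fst ` set w)"
  by (cases w) auto

text \<open>If pushing \<open>x\<close> cancels the head of \<open>w\<close>, then by reducedness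
  the remaining word does not begin with \<open>x\<close>, and pushing the inverse letter restores
  the head. Letters thus act on reduced words by permutations, which is van der Waerden's route to
  associativity.\<close>

lemma push_letter_inv: "reduced w \<Longrightarrow> push_letter (letter_inv x) (push_letter x w) = w"
proof (cases w)
  case (Cons y w')
  assume "reduced w"
  then show ?thesis by (cases w') (auto simp: Cons reduced_Cons)
qed simp

lemma push_letter_inv': "reduced w \<Longrightarrow> push_letter x (push_letter (letter_inv x) w) = w"
  using push_letter_inv[of w "letter_inv x"] by simp

lemma reduced_foldr: "reduced v \<Longrightarrow> reduced (foldr push_letter u v)"
  by (induction u) (auto intro: reduced_push_letter)

lemma set_foldr: "fst ` set (foldr push_letter u v) \<subseteq> fst ` set u \<union> fst ` set v"
proof (induction u)
  case (Cons x u)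
  have "fst ` set (foldr push_letter (x # u) v) \<subseteq> insert (fst x) (fst ` set (foldr push_letter u v))"
    using set_push_letter by simp
  also have "\<dots> \<subseteq> fst ` set (x # u) \<union> fst ` set v" using Cons.IH by auto
  finally show ?case .
qed simp

text \<open>A cancellation in \<open>push_letter x u\<close> does no harm because a letter and its
  inverse act on reduced words as mutually inverse permutations. Associativity follows by induction
  in \<open>foldr_foldr\<close>.\<close>

lemma foldr_push_letter:
  "reduced v \<Longrightarrow> foldr push_letter (push_letter x u) v = push_letter x (foldr push_letter u v)"
  by (cases u) (auto simp: push_letter_inv' reduced_foldr)

lemma foldr_foldr: "reduced v \<Longrightarrow>
  foldr push_letter (foldr push_letter u w) v = foldr push_letter u (foldr push_letter w v)"
  by (induction u) (auto simp: foldr_push_letter)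

lemma foldr_Nil: "reduced w \<Longrightarrow> foldr push_letter w [] = w"
proof (induction w)
  case (Cons x w)
  then show ?case by (cases w) (auto simp: reduced_Cons)
qed simp

lemma foldr_inverse: "reduced v \<Longrightarrow>
  foldr push_letter (rev (map letter_inv w)) (foldr push_letter w v) = v"
  by (induction w) (auto simp: push_letter_inv reduced_foldr)

lemma free_group_group: "group (free_group S)"
proof (rule groupI)
  fix x assume x: "x \<in> carrier (free_group S)"
  show "\<exists>y\<in>carrier (free_group S). y \<otimes>\<^bsub>free_group S\<^esub> x = \<one>\<^bsub>free_group S\<^esub>"
  proof
    let ?y = "foldr push_letter (rev (map letter_inv x)) []"
    show "?y \<otimes>\<^bsub>free_group S\<^esub> x = \<one>\<^bsub>free_group S\<^esub>"
      using x foldr_inverse[of "[]" x] by (simp add: free_group_def foldr_foldr foldr_Nil)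
    show "?y \<in> carrier (free_group S)"
      using x order_trans[OF set_foldr[of "rev (map letter_inv x)" "[]"], of S]
      by (simp add: free_group_def reduced_foldr image_image)
  qed
next
  fix x y assume "x \<in> carrier (free_group S)" "y \<in> carrier (free_group S)"
  then show "x \<otimes>\<^bsub>free_group S\<^esub> y \<in> carrier (free_group S)"
    using order_trans[OF set_foldr[of x y], of S] by (simp add: free_group_def reduced_foldr)
qed (auto simp: free_group_def foldr_foldr)

lemma free_group_gen: "i \<in> S \<Longrightarrow> [(i, True)] \<in> carrier (free_group S)"
  by (simp add: free_group_def reduced_def)

lemma free_group_generate:
  "carrier (free_group S) = generate (free_group S) ((\<lambda>i. [(i, True)]) ` S)" (is "_ = generate ?F ?B")
proof
  interpret group ?F by (rule free_group_group)
  have B: "?B \<subseteq> carrier ?F" by (auto simp: free_group_gen)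
  show "generate ?F ?B \<subseteq> carrier ?F" by (rule generate_incl[OF B])
  show "carrier ?F \<subseteq> generate ?F ?B"
  proof
    fix w assume "w \<in> carrier ?F"
    then show "w \<in> generate ?F ?B"
    proof (induction w)
      case Nil
      then show ?case using generate.one[of ?F ?B] by (simp add: free_group_def)
    next
      case (Cons x w)
      obtain i b where x: "x = (i, b)" by force
      have w: "w \<in> carrier ?F" and i: "i \<in> S"
        using Cons.prems x by (auto simp: free_group_def reduced_Cons)
      have "[x] \<in> generate ?F ?B"
      proof (cases b)
        case True then show ?thesis using i x by (auto intro: generate.incl)
      next
        case False
        have "inv\<^bsub>?F\<^esub> [(i, True)] = [(i, False)]"
          by (rule inv_equality) (use i in \<open>auto simp: free_group_def reduced_def letter_inv_def\<close>)
        then show ?thesis using generate.inv[of "[(i, True)]" ?B ?F] False i x by simp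
      qed
      then have "[x] \<otimes>\<^bsub>?F\<^esub> w \<in> generate ?F ?B" using Cons.IH[OF w] by (rule generate.eng)
      moreover have "[x] \<otimes>\<^bsub>?F\<^esub> w = x # w"
        using Cons.prems by (cases w) (auto simp: free_group_def reduced_Cons)
      ultimately show ?case by simp
    qed
  qed
qed

text \<open>Words are evaluated letter by letter, with inverse letters sent to inverses. Evaluation
  respects \<open>push_letter\<close> since a cancelled pair of letters evaluates to the
  unit.\<close>

lemma free_group_hom:
  assumes "group H" and h: "\<And>i. i \<in> S \<Longrightarrow> h i \<in> carrier H"
  shows "\<exists>f \<in> hom (free_group S) H. \<forall>i \<in> S. f [(i, True)] = h i"
proof -
  interpret H: group H by fact
  define val where "val x = (if snd x then h (fst x) else inv\<^bsub>H\<^esub> h (fst x))" for x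
  define ev where "ev w = foldr (\<lambda>x acc. val x \<otimes>\<^bsub>H\<^esub> acc) w \<one>\<^bsub>H\<^esub>" for w
  have val: "val x \<in> carrier H" if "fst x \<in> S" for x using that h by (simp add: val_def)
  have val_inv: "val x \<otimes>\<^bsub>H\<^esub> val (letter_inv x) = \<one>\<^bsub>H\<^esub>" if "fst x \<in> S" for x
    using that h by (simp add: val_def letter_inv_def)
  have ev: "ev w \<in> carrier H" if "fst ` set w \<subseteq> S" for w
    using that by (induction w) (auto simp: ev_def val)
  have push: "ev (push_letter x w) = val x \<otimes>\<^bsub>H\<^esub> ev w" if "fst x \<in> S" "fst ` set w \<subseteq> S" for x w
  proof (cases w)
    case Nil then show ?thesis using that by (simp add: ev_def)
  next
    case (Cons y w')
    have "ev w' = val x \<otimes>\<^bsub>H\<^esub> (val (letter_inv x) \<otimes>\<^bsub>H\<^esub> ev w')"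
      using that Cons ev[of w'] by (simp add: H.m_assoc[symmetric] val val_inv)
    then show ?thesis using Cons by (simp add: ev_def)
  qed
  have mult: "ev (foldr push_letter u w) = ev u \<otimes>\<^bsub>H\<^esub> ev w"
    if "fst ` set u \<subseteq> S" "fst ` set w \<subseteq> S" for u w
    using that
  proof (induction u)
    case Nil then show ?case using ev[of w] by (simp add: ev_def[of "[]"])
  next
    case (Cons x u)
    have "fst ` set (foldr push_letter u w) \<subseteq> S"
      using Cons.prems by (intro order_trans[OF set_foldr]) auto
    then have "ev (foldr push_letter (x # u) w) = val x \<otimes>\<^bsub>H\<^esub> (ev u \<otimes>\<^bsub>H\<^esub> ev w)"
      using push Cons by simp
    also have "\<dots> = (val x \<otimes>\<^bsub>H\<^esub> ev u) \<otimes>\<^bsub>H\<^esub> ev w"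
      using Cons.prems by (intro H.m_assoc[symmetric] val ev) auto
    finally show ?case by (simp add: ev_def)
  qed
  show ?thesis
  proof
    show "ev \<in> hom (free_group S) H" by (rule homI) (auto simp: free_group_def ev mult)
    show "\<forall>i \<in> S. ev [(i, True)] = h i" using h by (simp add: ev_def val_def)
  qed
qed

lemma hom_eq_on_generate:
  assumes "group G" "group H" "f \<in> hom G H" "g \<in> hom G H" "B \<subseteq> carrier G"
    and "\<And>x. x \<in> B \<Longrightarrow> f x = g x" and "x \<in> generate G B"
  shows "f x = g x"
proof -
  interpret G: group G by fact
  interpret f: group_hom G H f using assms by (simp add: group_hom_def group_hom_axioms_def)
  interpret g: group_hom G H g using assms by (simp add: group_hom_def group_hom_axioms_def)
  show ?thesis using assms(7)
  proof induction
    case (eng h1 h2)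
    then show ?case using G.generate_in_carrier[OF assms(5)] by simp
  qed (use assms(5,6) in auto)
qed

section \<open>Lower central series and free nilpotent groups\<close>

lemma (in group) commutator_subgroup_normal:
  assumes "normal K G"
  shows "normal (commutator_subgroup G (carrier G) K) G"
proof -
  interpret K: normal K G by fact
  show ?thesis unfolding commutator_subgroup_def
  proof (rule normal_generateI)
    fix c g assume c: "c \<in> {h \<otimes> k \<otimes> inv h \<otimes> inv k | h k. h \<in> carrier G \<and> k \<in> K}" and g: "g \<in> carrier G"
    then obtain h k where hk: "c = h \<otimes> k \<otimes> inv h \<otimes> inv k" "h \<in> carrier G" "k \<in> K" by auto
    let ?h = "g \<otimes> h \<otimes> inv g" and ?k = "g \<otimes> k \<otimes> inv g"
    have kc: "k \<in> carrier G" using hk by auto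
    have cancel: "inv g \<otimes> (g \<otimes> y) = y" if "y \<in> carrier G" for y
      using g that by (simp add: m_assoc[symmetric])
    \<comment> \<open>A conjugate of a commutator is the commutator of the conjugates.\<close>
    have "g \<otimes> c \<otimes> inv g = ?h \<otimes> ?k \<otimes> inv ?h \<otimes> inv ?k"
      using hk g kc by (simp add: inv_mult_group m_assoc cancel)
    moreover have "?h \<in> carrier G" "?k \<in> K" using hk g by (auto intro: K.inv_op_closed2)
    ultimately show "g \<otimes> c \<otimes> inv g \<in> {h \<otimes> k \<otimes> inv h \<otimes> inv k | h k. h \<in> carrier G \<and> k \<in> K}"
      by blast
  qed (use K.subset in auto)
qed

lemma (in group) lower_central_normal: "normal (lower_central G k) G"
proof (induction k)
  case 0
  show ?case by (rule normal_invI) (simp_all add: subgroup_self)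
qed (simp add: commutator_subgroup_normal)

lemma hom_lower_central:
  assumes "group_hom G H f"
  shows "f ` lower_central G k \<subseteq> lower_central H k"
proof -
  interpret group_hom G H f by fact
  show ?thesis
  proof (induction k)
    case (Suc k)
    interpret K: normal "lower_central G k" G by (rule G.lower_central_normal)
    have "f ` lower_central G (Suc k) =
        generate H (f ` {h \<otimes>\<^bsub>G\<^esub> k' \<otimes>\<^bsub>G\<^esub> inv\<^bsub>G\<^esub> h \<otimes>\<^bsub>G\<^esub> inv\<^bsub>G\<^esub> k' | h k'. h \<in> carrier G \<and> k' \<in> lower_central G k})"
      unfolding lower_central.simps commutator_subgroup_def
      by (rule generate_img[symmetric]) (use K.subset in auto)
    also have "\<dots> \<subseteq> lower_central H (Suc k)"
      unfolding lower_central.simps commutator_subgroup_def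
    proof (rule H.mono_generate, clarify)
      fix h k' assume "h \<in> carrier G" "k' \<in> lower_central G k"
      moreover from this have "k' \<in> carrier G" using K.subset by auto
      ultimately show "\<exists>h' k''. f (h \<otimes>\<^bsub>G\<^esub> k' \<otimes>\<^bsub>G\<^esub> inv\<^bsub>G\<^esub> h \<otimes>\<^bsub>G\<^esub> inv\<^bsub>G\<^esub> k') =
          h' \<otimes>\<^bsub>H\<^esub> k'' \<otimes>\<^bsub>H\<^esub> inv\<^bsub>H\<^esub> h' \<otimes>\<^bsub>H\<^esub> inv\<^bsub>H\<^esub> k'' \<and> h' \<in> carrier H \<and> k'' \<in> lower_central H k"
        using Suc.IH by (intro exI[of _ "f h"] exI[of _ "f k'"] conjI) (simp_all add: image_subset_iff)
    qed
    finally show ?case .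
  qed auto
qed

text \<open>Both entries of a commutator have preimages, by surjectivity and by induction, and the
  commutator of these maps to the given one. For the projection of the free group it leads to the
  nilpotency of \<open>F_nil n p\<close>.\<close>

lemma surj_lower_central:
  assumes "group_hom G H f" and "f ` carrier G = carrier H"
  shows "lower_central H k \<subseteq> f ` lower_central G k"
proof -
  interpret group_hom G H f by fact
  show ?thesis
  proof (induction k)
    case (Suc k)
    interpret K: normal "lower_central G k" G by (rule G.lower_central_normal)
    have "lower_central H (Suc k) \<subseteq>
        generate H (f ` {h \<otimes>\<^bsub>G\<^esub> k' \<otimes>\<^bsub>G\<^esub> inv\<^bsub>G\<^esub> h \<otimes>\<^bsub>G\<^esub> inv\<^bsub>G\<^esub> k' | h k'. h \<in> carrier G \<and> k' \<in> lower_central G k})"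
      unfolding lower_central.simps commutator_subgroup_def
    proof (rule H.mono_generate, clarify)
      fix h' k'' assume "h' \<in> carrier H" "k'' \<in> lower_central H k"
      then have "h' \<in> f ` carrier G" "k'' \<in> f ` lower_central G k"
        using Suc.IH assms(2) by auto
      then obtain h k' where hk: "h \<in> carrier G" "h' = f h" "k' \<in> lower_central G k" "k'' = f k'"
        by blast
      then have "k' \<in> carrier G" using K.subset by auto
      then have "h' \<otimes>\<^bsub>H\<^esub> k'' \<otimes>\<^bsub>H\<^esub> inv\<^bsub>H\<^esub> h' \<otimes>\<^bsub>H\<^esub> inv\<^bsub>H\<^esub> k'' = f (h \<otimes>\<^bsub>G\<^esub> k' \<otimes>\<^bsub>G\<^esub> inv\<^bsub>G\<^esub> h \<otimes>\<^bsub>G\<^esub> inv\<^bsub>G\<^esub> k')"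
        using hk by simp
      then show "h' \<otimes>\<^bsub>H\<^esub> k'' \<otimes>\<^bsub>H\<^esub> inv\<^bsub>H\<^esub> h' \<otimes>\<^bsub>H\<^esub> inv\<^bsub>H\<^esub> k'' \<in> f ` {h \<otimes>\<^bsub>G\<^esub> k' \<otimes>\<^bsub>G\<^esub> inv\<^bsub>G\<^esub> h \<otimes>\<^bsub>G\<^esub> inv\<^bsub>G\<^esub> k' | h k'. h \<in> carrier G \<and> k' \<in> lower_central G k}"
        using hk by blast
    qed
    also have "\<dots> = f ` lower_central G (Suc k)"
      unfolding lower_central.simps commutator_subgroup_def
      by (rule generate_img) (use K.subset in auto)
    finally show ?case .
  qed (use assms in auto)
qed

lemma F_grp_group: "group (F_grp p)"
  by (simp add: F_grp_def free_group_group)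

lemma F_nil_normal: "normal (lower_central (F_grp p) n) (F_grp p)"
  by (rule group.lower_central_normal[OF F_grp_group])

lemma F_nil_group: "group (F_nil n p)"
  unfolding F_nil_def by (rule normal.factorgroup_is_group[OF F_nil_normal])

lemma F_nil_proj:
  "group_hom (F_grp p) (F_nil n p) (\<lambda>w. lower_central (F_grp p) n #>\<^bsub>F_grp p\<^esub> w)" (is "group_hom _ _ ?\<pi>")
  "(\<lambda>w. lower_central (F_grp p) n #>\<^bsub>F_grp p\<^esub> w) ` carrier (F_grp p) = carrier (F_nil n p)"
proof -
  have "?\<pi> \<in> hom (F_grp p) (F_nil n p)"
    unfolding F_nil_def by (rule normal.r_coset_hom_Mod[OF F_nil_normal])
  then show "group_hom (F_grp p) (F_nil n p) ?\<pi>"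
    by (simp add: group_hom_def group_hom_axioms_def F_grp_group F_nil_group)
  show "?\<pi> ` carrier (F_grp p) = carrier (F_nil n p)"
    by (simp add: F_nil_def carrier_FactGroup)
qed

text \<open>Elements of \<Gamma>_n of the quotient lift to \<Gamma>_n of the free group, which is
  the kernel of the projection.\<close>

lemma lower_central_F_nil: "lower_central (F_nil n p) n \<subseteq> {\<one>\<^bsub>F_nil n p\<^esub>}"
proof
  fix y assume "y \<in> lower_central (F_nil n p) n"
  then obtain x where x: "x \<in> lower_central (F_grp p) n" "y = lower_central (F_grp p) n #>\<^bsub>F_grp p\<^esub> x"
    using surj_lower_central[OF F_nil_proj(1)[of p n] F_nil_proj(2)[of p n], of n] by auto
  interpret F: group "F_grp p" by (rule F_grp_group)
  interpret N: normal "lower_central (F_grp p) n" "F_grp p" by (rule F_nil_normal)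
  have "y = lower_central (F_grp p) n" using x by (simp add: F.coset_join2 N.subgroup_axioms)
  then show "y \<in> {\<one>\<^bsub>F_nil n p\<^esub>}" by (simp add: F_nil_def)
qed

lemma F_grp_gen: "i \<in> {1..p} \<Longrightarrow> F_gen p i \<in> carrier (F_grp p)"
  by (simp add: F_grp_def F_gen_def free_group_gen)

lemma F_grp_generate: "carrier (F_grp p) = generate (F_grp p) (F_gen p ` {1..p})"
  using free_group_generate[of "{1..p}"] by (simp add: F_grp_def F_gen_def image_def)

lemma F_nil_gen: "i \<in> {1..p} \<Longrightarrow> F_nil_gen n p i \<in> carrier (F_nil n p)"
  using F_grp_gen[of i p] by (auto simp: F_nil_gen_def F_nil_proj(2)[symmetric])

lemma F_nil_generate: "carrier (F_nil n p) = generate (F_nil n p) (F_nil_gen n p ` {1..p})"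
proof -
  let ?\<pi> = "\<lambda>w. lower_central (F_grp p) n #>\<^bsub>F_grp p\<^esub> w"
  interpret group_hom "F_grp p" "F_nil n p" ?\<pi> by (rule F_nil_proj)
  have "?\<pi> ` generate (F_grp p) (F_gen p ` {1..p}) = generate (F_nil n p) (?\<pi> ` F_gen p ` {1..p})"
    by (rule generate_img[symmetric]) (use F_grp_gen in auto)
  moreover have "?\<pi> ` F_gen p ` {1..p} = F_nil_gen n p ` {1..p}"
    by (simp add: image_image F_nil_gen_def)
  ultimately show ?thesis
    by (simp only: F_grp_generate[symmetric] F_nil_proj(2))
qed

lemma F_grp_hom:
  assumes "group H" and "\<And>i. i \<in> {1..p} \<Longrightarrow> h i \<in> carrier H"
  shows "\<exists>f \<in> hom (F_grp p) H. \<forall>i \<in> {1..p}. f (F_gen p i) = h i"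
  using free_group_hom[of H "{1..p}" h] assms by (simp add: F_grp_def F_gen_def)

text \<open>A homomorphism on the free group maps \<Gamma>_n into \<Gamma>_n of \<open>H\<close>,
  hence kills it and factors through the quotient. This serves both for maps within the theory and
  for lifts to the central extensions.\<close>

lemma F_nil_hom:
  assumes H: "group H" and low: "lower_central H n \<subseteq> {\<one>\<^bsub>H\<^esub>}"
    and h: "\<And>i. i \<in> {1..p} \<Longrightarrow> h i \<in> carrier H"
  shows "\<exists>f \<in> hom (F_nil n p) H. \<forall>i \<in> {1..p}. f (F_nil_gen n p i) = h i"
proof -
  let ?N = "lower_central (F_grp p) n"
  obtain f where f: "f \<in> hom (F_grp p) H" "\<forall>i \<in> {1..p}. f (F_gen p i) = h i"
    using F_grp_hom[of H p h] H h by blast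
  interpret f: group_hom "F_grp p" H f
    using f H by (simp add: group_hom_def group_hom_axioms_def F_grp_group)
  interpret N: normal ?N "F_grp p" by (rule F_nil_normal)
  have ker: "f x = \<one>\<^bsub>H\<^esub>" if "x \<in> ?N" for x
    using hom_lower_central[OF f.group_hom_axioms, of n] low that by auto
  have eq: "f x = f y" if "x \<in> carrier (F_grp p)" "y \<in> carrier (F_grp p)"
     "?N #>\<^bsub>F_grp p\<^esub> x = ?N #>\<^bsub>F_grp p\<^esub> y" for x y
  proof -
    have "x \<in> ?N #>\<^bsub>F_grp p\<^esub> y"
      using that f.G.rcos_self[OF that(1) N.subgroup_axioms] by simp
    then obtain k where "k \<in> ?N" "x = k \<otimes>\<^bsub>F_grp p\<^esub> y" by (auto simp: r_coset_def)
    moreover from this have "k \<in> carrier (F_grp p)" using N.subset by auto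
    ultimately show ?thesis using that ker by simp
  qed
  obtain g where g: "g \<in> hom (F_grp p Mod ?N) H"
    "\<And>x. x \<in> carrier (F_grp p) \<Longrightarrow> g (?N #>\<^bsub>F_grp p\<^esub> x) = f x"
    using FactGroup_universal[OF f(1) F_nil_normal eq] by blast
  show ?thesis
  proof
    show "g \<in> hom (F_nil n p) H" using g by (simp add: F_nil_def)
    show "\<forall>i \<in> {1..p}. g (F_nil_gen n p i) = h i"
      using f(2) g(2) F_grp_gen by (simp add: F_nil_gen_def)
  qed
qed

section \<open>Track categories\<close>

lemma maps_Arr: "f \<in> maps C X Y \<Longrightarrow> f \<in> Arr C"
  and maps_Src: "f \<in> maps C X Y \<Longrightarrow> Src C f = X"
  and maps_Tgt: "f \<in> maps C X Y \<Longrightarrow> Tgt C f = Y"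
  by (simp_all add: maps_def)

lemma (in category) maps_Obj: "f \<in> maps C X Y \<Longrightarrow> X \<in> Obj C" "f \<in> maps C X Y \<Longrightarrow> Y \<in> Obj C"
  using Src_in Tgt_in by (auto simp: maps_def)

context track_category
begin

abbreviation cmp (infixr \<open>\<bullet>\<close> 75) where "g \<bullet> f \<equiv> Comp A g f"
abbreviation vcmp (infixr \<open>\<box>\<close> 65) where "\<theta> \<box> \<eta> \<equiv> VComp A \<theta> \<eta>"
abbreviation wpush (infixr \<open>\<triangleright>\<close> 70) where "g \<triangleright> \<eta> \<equiv> push A g \<eta>"
abbreviation wpull (infixl \<open>\<triangleleft>\<close> 71) where "\<eta> \<triangleleft> h \<equiv> pull A h \<eta>"
abbreviation tid where "tid f \<equiv> TIdent A f"

section \<open>Vertical composition in the hom-groupoids\<close>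

lemma hom_groupoid_simps [simp]:
  "Obj (hom_groupoid A X Y) = maps A X Y"
  "Arr (hom_groupoid A X Y) = {\<eta> \<in> Trk A. TSrc A \<eta> \<in> maps A X Y}"
  "Src (hom_groupoid A X Y) = TSrc A" "Tgt (hom_groupoid A X Y) = TTgt A"
  "Comp (hom_groupoid A X Y) = VComp A" "Ident (hom_groupoid A X Y) = TIdent A"
  by (simp_all add: hom_groupoid_def)

lemma tracks_maps: "\<lbrakk>\<eta> \<in> tracks A f g; f \<in> maps A X Y\<rbrakk> \<Longrightarrow> g \<in> maps A X Y"
proof -
  assume a: "\<eta> \<in> tracks A f g" "f \<in> maps A X Y"
  then interpret groupoid "hom_groupoid A X Y" using groupoid_hom maps_Obj by blast
  show ?thesis using Tgt_in[of \<eta>] a by (auto simp: tracks_def)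
qed

lemma tracks_maps_iff: "\<eta> \<in> tracks A f g \<Longrightarrow> f \<in> maps A X Y \<longleftrightarrow> g \<in> maps A X Y"
proof -
  assume \<eta>: "\<eta> \<in> tracks A f g"
  then have f: "f \<in> maps A (Src A f) (Tgt A f)" using TSrc_in by (auto simp: tracks_def maps_def)
  have "g \<in> maps A (Src A f) (Tgt A f)" by (rule tracks_maps[OF \<eta> f])
  with f show ?thesis by (auto simp: maps_def)
qed

lemma tracks_ex_maps: "\<eta> \<in> tracks A f g \<Longrightarrow> \<exists>X Y. f \<in> maps A X Y"
  using TSrc_in by (auto simp: tracks_def maps_def)

lemma hom_maps: "maps (hom_groupoid A X Y) f g = {\<eta> \<in> tracks A f g. f \<in> maps A X Y}"
  by (auto simp: maps_def[of "hom_groupoid A X Y"] tracks_def)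

lemma hom_groupoid': "f \<in> maps A X Y \<Longrightarrow> groupoid (hom_groupoid A X Y)"
  using groupoid_hom maps_Obj by blast

lemma vcomp_in: "\<lbrakk>\<eta> \<in> tracks A f g; \<theta> \<in> tracks A g h\<rbrakk> \<Longrightarrow> \<theta> \<box> \<eta> \<in> tracks A f h"
proof -
  assume a: "\<eta> \<in> tracks A f g" "\<theta> \<in> tracks A g h"
  then obtain X Y where f: "f \<in> maps A X Y" using tracks_ex_maps by blast
  interpret groupoid "hom_groupoid A X Y" by (rule hom_groupoid'[OF f])
  show ?thesis using Comp_in[of \<eta> f g \<theta> h] a f tracks_maps_iff by (auto simp: hom_maps)
qed

lemma vcomp_assoc: "\<lbrakk>\<eta> \<in> tracks A f g; \<theta> \<in> tracks A g h; \<zeta> \<in> tracks A h k\<rbrakk> \<Longrightarrow>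
  (\<zeta> \<box> \<theta>) \<box> \<eta> = \<zeta> \<box> \<theta> \<box> \<eta>"
proof -
  assume a: "\<eta> \<in> tracks A f g" "\<theta> \<in> tracks A g h" "\<zeta> \<in> tracks A h k"
  then obtain X Y where f: "f \<in> maps A X Y" using tracks_ex_maps by blast
  interpret groupoid "hom_groupoid A X Y" by (rule hom_groupoid'[OF f])
  show ?thesis using Comp_assoc[of \<eta> f g \<theta> h \<zeta> k] a f tracks_maps_iff by (auto simp: hom_maps)
qed

lemma tid_in: "f \<in> maps A X Y \<Longrightarrow> tid f \<in> tracks A f f"
proof -
  assume f: "f \<in> maps A X Y"
  interpret groupoid "hom_groupoid A X Y" by (rule hom_groupoid'[OF f])
  show ?thesis using Ident_in[of f] f by (auto simp: hom_maps)
qed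

lemma vcomp_tid: "\<eta> \<in> tracks A f g \<Longrightarrow> \<eta> \<box> tid f = \<eta>"
proof -
  assume a: "\<eta> \<in> tracks A f g"
  then obtain X Y where f: "f \<in> maps A X Y" using tracks_ex_maps by blast
  interpret groupoid "hom_groupoid A X Y" by (rule hom_groupoid'[OF f])
  show ?thesis using Comp_Ident[of \<eta> f g] a f by (auto simp: hom_maps)
qed

lemma tid_vcomp: "\<eta> \<in> tracks A f g \<Longrightarrow> tid g \<box> \<eta> = \<eta>"
proof -
  assume a: "\<eta> \<in> tracks A f g"
  then obtain X Y where f: "f \<in> maps A X Y" using tracks_ex_maps by blast
  interpret groupoid "hom_groupoid A X Y" by (rule hom_groupoid'[OF f])
  show ?thesis using Ident_Comp[of \<eta> f g] a f by (auto simp: hom_maps)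
qed

lemma vinv_ex: "\<eta> \<in> tracks A f g \<Longrightarrow> \<exists>\<theta> \<in> tracks A g f. \<theta> \<box> \<eta> = tid f \<and> \<eta> \<box> \<theta> = tid g"
proof -
  assume a: "\<eta> \<in> tracks A f g"
  then obtain X Y where f: "f \<in> maps A X Y" using tracks_ex_maps by blast
  interpret groupoid "hom_groupoid A X Y" by (rule hom_groupoid'[OF f])
  have "\<eta> \<in> Trk A" "TSrc A \<eta> = f" "TTgt A \<eta> = g" using a by (auto simp: tracks_def)
  with invertible[of \<eta>] f show ?thesis by (auto simp: isomorphism_def hom_maps)
qed

lemma vcomp_cancel_right: "\<lbrakk>\<eta> \<in> tracks A f g; \<theta> \<in> tracks A g h; \<theta>' \<in> tracks A g h; \<theta> \<box> \<eta> = \<theta>' \<box> \<eta>\<rbrakk> \<Longrightarrow> \<theta> = \<theta>'"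
proof -
  assume a: "\<eta> \<in> tracks A f g" "\<theta> \<in> tracks A g h" "\<theta>' \<in> tracks A g h" "\<theta> \<box> \<eta> = \<theta>' \<box> \<eta>"
  obtain \<zeta> where \<zeta>: "\<zeta> \<in> tracks A g f" "\<eta> \<box> \<zeta> = tid g" using vinv_ex[OF a(1)] by blast
  have "\<theta> = (\<theta> \<box> \<eta>) \<box> \<zeta>" using vcomp_assoc[OF \<zeta>(1) a(1,2)] vcomp_tid[OF a(2)] \<zeta>(2) by simp
  also have "\<dots> = \<theta>'" using vcomp_assoc[OF \<zeta>(1) a(1,3)] vcomp_tid[OF a(3)] \<zeta>(2) a(4) by simp
  finally show ?thesis .
qed

section \<open>Horizontal composition and whiskering\<close>

lemma comp_functor': "\<lbrakk>f \<in> maps A X Y; g \<in> maps A Y Z\<rbrakk> \<Longrightarrow>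
      is_functor (prod_cat (hom_groupoid A Y Z) (hom_groupoid A X Y)) (hom_groupoid A X Z)
        (\<lambda>(g, f). Comp A g f) (\<lambda>(\<beta>, \<alpha>). HComp A \<beta> \<alpha>)"
  by (rule comp_functor) (auto dest: maps_Obj)

lemma prod_cat_simps [simp]:
  "Obj (prod_cat C D) = Obj C \<times> Obj D" "Arr (prod_cat C D) = Arr C \<times> Arr D"
  "Src (prod_cat C D) (a, b) = (Src C a, Src D b)" "Tgt (prod_cat C D) (a, b) = (Tgt C a, Tgt D b)"
  "Comp (prod_cat C D) (a, b) (a', b') = (Comp C a a', Comp D b b')"
  "Ident (prod_cat C D) (X, Y) = (Ident C X, Ident D Y)"
  by (simp_all add: prod_cat_def)

lemma hcomp_in: "\<lbrakk>\<alpha> \<in> tracks A f f'; f \<in> maps A X Y; \<beta> \<in> tracks A g g'; g \<in> maps A Y Z\<rbrakk> \<Longrightarrow>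
  HComp A \<beta> \<alpha> \<in> tracks A (g \<bullet> f) (g' \<bullet> f')"
  using comp_functor'[of f X Y g Z] unfolding is_functor_def
  by (auto simp: tracks_def maps_def[of "hom_groupoid A X Z"])

lemma interchange: "\<lbrakk>\<alpha> \<in> tracks A f f'; \<alpha>' \<in> tracks A f' f''; f \<in> maps A X Y;
   \<beta> \<in> tracks A g g'; \<beta>' \<in> tracks A g' g''; g \<in> maps A Y Z\<rbrakk> \<Longrightarrow>
  HComp A (\<beta>' \<box> \<beta>) (\<alpha>' \<box> \<alpha>) = HComp A \<beta>' \<alpha>' \<box> HComp A \<beta> \<alpha>"
proof -
  assume a: "\<alpha> \<in> tracks A f f'" "\<alpha>' \<in> tracks A f' f''" "f \<in> maps A X Y"
   "\<beta> \<in> tracks A g g'" "\<beta>' \<in> tracks A g' g''" "g \<in> maps A Y Z"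
  then have "f' \<in> maps A X Y" "g' \<in> maps A Y Z" using tracks_maps by blast+
  moreover have "\<forall>p \<in> Arr (prod_cat (hom_groupoid A Y Z) (hom_groupoid A X Y)).
      \<forall>p' \<in> Arr (prod_cat (hom_groupoid A Y Z) (hom_groupoid A X Y)).
      Tgt (prod_cat (hom_groupoid A Y Z) (hom_groupoid A X Y)) p = Src (prod_cat (hom_groupoid A Y Z) (hom_groupoid A X Y)) p' \<longrightarrow>
     (\<lambda>(\<beta>, \<alpha>). HComp A \<beta> \<alpha>) (Comp (prod_cat (hom_groupoid A Y Z) (hom_groupoid A X Y)) p' p) =
       Comp (hom_groupoid A X Z) ((\<lambda>(\<beta>, \<alpha>). HComp A \<beta> \<alpha>) p') ((\<lambda>(\<beta>, \<alpha>). HComp A \<beta> \<alpha>) p)"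
    using comp_functor'[of f X Y g Z] a unfolding is_functor_def by blast
  from this[rule_format, of "(\<beta>, \<alpha>)" "(\<beta>', \<alpha>')"] show ?thesis
    using a calculation by (auto simp: tracks_def)
qed

lemma hcomp_tid: "\<lbrakk>f \<in> maps A X Y; g \<in> maps A Y Z\<rbrakk> \<Longrightarrow> HComp A (tid g) (tid f) = tid (g \<bullet> f)"
proof -
  assume a: "f \<in> maps A X Y" "g \<in> maps A Y Z"
  have "\<forall>p \<in> Obj (prod_cat (hom_groupoid A Y Z) (hom_groupoid A X Y)).
    (\<lambda>(\<beta>, \<alpha>). HComp A \<beta> \<alpha>) (Ident (prod_cat (hom_groupoid A Y Z) (hom_groupoid A X Y)) p) =
     Ident (hom_groupoid A X Z) ((\<lambda>(g, f). Comp A g f) p)"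
    using comp_functor'[OF a] unfolding is_functor_def by blast
  from this[rule_format, of "(g, f)"] show ?thesis using a by simp
qed

lemma hcomp_assoc: "\<lbrakk>\<alpha> \<in> tracks A f f'; f \<in> maps A W X; \<beta> \<in> tracks A g g'; g \<in> maps A X Y;
   \<gamma> \<in> tracks A h h'; h \<in> maps A Y Z\<rbrakk> \<Longrightarrow> HComp A \<gamma> (HComp A \<beta> \<alpha>) = HComp A (HComp A \<gamma> \<beta>) \<alpha>"
  by (rule HComp_assoc[of W X Y Z]) (auto simp: tracks_def dest: maps_Obj)

lemma push_in: "\<lbrakk>\<eta> \<in> tracks A f f'; f \<in> maps A X Y; g \<in> maps A Y Z\<rbrakk> \<Longrightarrow> g \<triangleright> \<eta> \<in> tracks A (g \<bullet> f) (g \<bullet> f')"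
  unfolding push_def by (rule hcomp_in) (auto intro: tid_in)

lemma pull_in: "\<lbrakk>\<eta> \<in> tracks A g g'; g \<in> maps A Y Z; h \<in> maps A X Y\<rbrakk> \<Longrightarrow> \<eta> \<triangleleft> h \<in> tracks A (g \<bullet> h) (g' \<bullet> h)"
  unfolding pull_def by (rule hcomp_in) (auto intro: tid_in)

lemma push_vcomp: "\<lbrakk>\<eta> \<in> tracks A f f'; \<theta> \<in> tracks A f' f''; f \<in> maps A X Y; g \<in> maps A Y Z\<rbrakk> \<Longrightarrow>
  g \<triangleright> (\<theta> \<box> \<eta>) = (g \<triangleright> \<theta>) \<box> (g \<triangleright> \<eta>)"
  unfolding push_def using interchange[of \<eta> f f' \<theta> f'' X Y "tid g" g g "tid g" g Z]
  by (simp add: tid_in vcomp_tid[OF tid_in])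

lemma pull_vcomp: "\<lbrakk>\<eta> \<in> tracks A g g'; \<theta> \<in> tracks A g' g''; g \<in> maps A Y Z; h \<in> maps A X Y\<rbrakk> \<Longrightarrow>
  (\<theta> \<box> \<eta>) \<triangleleft> h = (\<theta> \<triangleleft> h) \<box> (\<eta> \<triangleleft> h)"
  unfolding pull_def using interchange[of "tid h" h h "tid h" h X Y \<eta> g g' \<theta> g'' Z]
  by (simp add: tid_in vcomp_tid[OF tid_in])

lemma push_tid: "\<lbrakk>f \<in> maps A X Y; g \<in> maps A Y Z\<rbrakk> \<Longrightarrow> g \<triangleright> tid f = tid (g \<bullet> f)"
  by (simp add: push_def hcomp_tid)

lemma pull_tid: "\<lbrakk>f \<in> maps A X Y; g \<in> maps A Y Z\<rbrakk> \<Longrightarrow> tid g \<triangleleft> f = tid (g \<bullet> f)"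
  by (simp add: pull_def hcomp_tid)

lemma pull_Ident: "\<lbrakk>\<eta> \<in> tracks A f f'; f \<in> maps A X Y\<rbrakk> \<Longrightarrow> \<eta> \<triangleleft> Ident A X = \<eta>"
  unfolding pull_def by (rule HComp_Ident[of X Y]) (auto simp: tracks_def dest: maps_Obj)

lemma push_push: "\<lbrakk>\<eta> \<in> tracks A f f'; f \<in> maps A W X; g \<in> maps A X Y; h \<in> maps A Y Z\<rbrakk> \<Longrightarrow>
  h \<triangleright> g \<triangleright> \<eta> = (h \<bullet> g) \<triangleright> \<eta>"
  using hcomp_assoc[of \<eta> f f' W X "tid g" g g Y "tid h" h h Z] by (simp add: push_def tid_in hcomp_tid)

lemma pull_pull: "\<lbrakk>\<eta> \<in> tracks A h h'; h \<in> maps A Y Z; g \<in> maps A X Y; f \<in> maps A W X\<rbrakk> \<Longrightarrow>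
  \<eta> \<triangleleft> g \<triangleleft> f = \<eta> \<triangleleft> (g \<bullet> f)"
  using hcomp_assoc[of "tid f" f f W X "tid g" g g Y \<eta> h h' Z] by (simp add: pull_def tid_in hcomp_tid)

lemma push_pull: "\<lbrakk>\<eta> \<in> tracks A g g'; f \<in> maps A W X; g \<in> maps A X Y; h \<in> maps A Y Z\<rbrakk> \<Longrightarrow>
  h \<triangleright> (\<eta> \<triangleleft> f) = (h \<triangleright> \<eta>) \<triangleleft> f"
  using hcomp_assoc[of "tid f" f f W X \<eta> g g' Y "tid h" h h Z] by (simp add: push_def pull_def tid_in)

text \<open>Both composites equal \<open>HComp A \<beta> \<alpha>\<close>, by interchange with
  identity tracks inserted in either order.\<close>

lemma exchange: "\<lbrakk>\<alpha> \<in> tracks A f f'; f \<in> maps A X Y; \<beta> \<in> tracks A g g'; g \<in> maps A Y Z\<rbrakk> \<Longrightarrow>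
  (g' \<triangleright> \<alpha>) \<box> (\<beta> \<triangleleft> f) = (\<beta> \<triangleleft> f') \<box> (g \<triangleright> \<alpha>)"
proof -
  assume a: "\<alpha> \<in> tracks A f f'" "f \<in> maps A X Y" "\<beta> \<in> tracks A g g'" "g \<in> maps A Y Z"
  have g': "g' \<in> maps A Y Z" and f': "f' \<in> maps A X Y" using a tracks_maps by blast+
  have "(g' \<triangleright> \<alpha>) \<box> (\<beta> \<triangleleft> f) = HComp A \<beta> \<alpha>"
    unfolding push_def pull_def
    using interchange[of "tid f" f f \<alpha> f' X Y \<beta> g g' "tid g'" g' Z] a g'
    by (simp add: tid_in vcomp_tid tid_vcomp)
  also have "\<dots> = (\<beta> \<triangleleft> f') \<box> (g \<triangleright> \<alpha>)"
    unfolding push_def pull_def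
    using interchange[of \<alpha> f f' "tid f'" f' X Y "tid g" g g \<beta> g' Z] a f'
    by (simp add: tid_in vcomp_tid tid_vcomp)
  finally show ?thesis .
qed

section \<open>The homotopy category\<close>

lemma track_class_refl: "f \<in> maps A X Y \<Longrightarrow> f \<in> track_class A f"
  using tid_in by (auto simp: track_class_def)

lemma track_class_eq_iff: "\<lbrakk>f \<in> maps A X Y; g \<in> maps A X Y\<rbrakk> \<Longrightarrow>
  track_class A f = track_class A g \<longleftrightarrow> tracks A f g \<noteq> {}"
proof
  assume a: "f \<in> maps A X Y" "g \<in> maps A X Y"
  { assume "track_class A f = track_class A g"
    then show "tracks A f g \<noteq> {}" using track_class_refl[OF a(2)] by (auto simp: track_class_def) }
  assume "tracks A f g \<noteq> {}"
  then obtain \<eta> \<theta> where "\<eta> \<in> tracks A f g" "\<theta> \<in> tracks A g f" using vinv_ex by blast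
  then show "track_class A f = track_class A g"
    using vcomp_in by (fastforce simp: track_class_def)
qed

lemma track_class_maps: "\<lbrakk>f \<in> maps A X Y; g \<in> track_class A f\<rbrakk> \<Longrightarrow> g \<in> maps A X Y \<and> track_class A g = track_class A f"
proof -
  assume a: "f \<in> maps A X Y" "g \<in> track_class A f"
  then obtain \<eta> where "\<eta> \<in> tracks A f g" by (auto simp: track_class_def)
  with tracks_maps[OF this a(1)] track_class_eq_iff[OF a(1), of g] show ?thesis by auto
qed

lemma some_track_class: "f \<in> maps A X Y \<Longrightarrow>
  (SOME g. g \<in> track_class A f) \<in> maps A X Y \<and> track_class A (SOME g. g \<in> track_class A f) = track_class A f"
  using track_class_maps someI[of "\<lambda>g. g \<in> track_class A f", OF track_class_refl] by blast

lemma ho_Obj [simp]: "Obj (ho A) = Obj A" by (simp add: ho_def)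

lemma ho_Ident: "Ident (ho A) X = track_class A (Ident A X)" by (simp add: ho_def)

text \<open>Maps in one track class are parallel, so the source and target of a class do not depend
  on the representative picked in \<open>ho\<close>.\<close>

lemma ho_maps: "maps (ho A) X Y = track_class A ` maps A X Y"
proof -
  have "Src (ho A) (track_class A f) = X' \<and> Tgt (ho A) (track_class A f) = Y'" if "f \<in> maps A X' Y'" for f X' Y'
    using some_track_class[OF that] by (auto simp: ho_def maps_def)
  then have "maps (ho A) X Y = {c \<in> track_class A ` Arr A. Src (ho A) c = X \<and> Tgt (ho A) c = Y}"
    by (simp add: maps_def ho_def)
  also have "\<dots> = track_class A ` maps A X Y"
  proof -
    have "Src (ho A) (track_class A f) = Src A f \<and> Tgt (ho A) (track_class A f) = Tgt A f" if "f \<in> Arr A" for f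
      using some_track_class[of f "Src A f" "Tgt A f"] that by (auto simp: ho_def maps_def)
    then show ?thesis by (auto simp: maps_def)
  qed
  finally show ?thesis .
qed

text \<open>Composites of different representatives are related by the horizontal composite of the
  connecting tracks, so the choices in \<open>ho\<close> do not matter.\<close>

lemma ho_Comp: "\<lbrakk>f \<in> maps A X Y; g \<in> maps A Y Z\<rbrakk> \<Longrightarrow>
  Comp (ho A) (track_class A g) (track_class A f) = track_class A (g \<bullet> f)"
proof -
  assume a: "f \<in> maps A X Y" "g \<in> maps A Y Z"
  let ?f = "SOME h. h \<in> track_class A f" and ?g = "SOME h. h \<in> track_class A g"
  have f: "?f \<in> maps A X Y" "track_class A ?f = track_class A f" using some_track_class[OF a(1)] by auto
  have g: "?g \<in> maps A Y Z" "track_class A ?g = track_class A g" using some_track_class[OF a(2)] by auto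
  obtain \<alpha> where "\<alpha> \<in> tracks A ?f f" using track_class_eq_iff[OF f(1) a(1)] f by auto
  moreover obtain \<beta> where "\<beta> \<in> tracks A ?g g" using track_class_eq_iff[OF g(1) a(2)] g by auto
  ultimately have "HComp A \<beta> \<alpha> \<in> tracks A (?g \<bullet> ?f) (g \<bullet> f)" using hcomp_in f g by blast
  then have "track_class A (?g \<bullet> ?f) = track_class A (g \<bullet> f)"
    using track_class_eq_iff[OF Comp_in[OF f(1) g(1)] Comp_in[OF a]] by auto
  then show ?thesis by (simp add: ho_def)
qed

end

section \<open>Tracks in additive track categories\<close>

text \<open>The library writes the abelian groups of the statement multiplicatively; \<open>ring_of\<close> gives access
  to its additive notation and leaves the ring multiplication unspecified.\<close>

definition ring_of :: "'a monoid \<Rightarrow> 'a ring" where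
  "ring_of G = \<lparr>carrier = carrier G, mult = undefined, one = undefined,
     zero = \<one>\<^bsub>G\<^esub>, add = monoid.mult G\<rparr>"

lemma ring_of_simps [simp]: "carrier (ring_of G) = carrier G" "\<zero>\<^bsub>ring_of G\<^esub> = \<one>\<^bsub>G\<^esub>"
  "a \<oplus>\<^bsub>ring_of G\<^esub> b = a \<otimes>\<^bsub>G\<^esub> b"
  by (simp_all add: ring_of_def)

lemma abelian_group_ring_of: "comm_group G \<Longrightarrow> abelian_group (ring_of G)"
proof (rule comm_group_abelian_groupI)
  have "add_monoid (ring_of G) = G" by (simp add: ring_of_def)
  then show "comm_group G \<Longrightarrow> comm_group (add_monoid (ring_of G))" by simp
qed

text \<open>Additive functions preserve multiples and finite sums. It is applied to composition in
  \<open>ho A\<close> on either side and to \<open>D\<close> in either variable, which is how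
  biadditivity enters.\<close>

lemma hom_lin:
  assumes "abelian_group R" "abelian_group S"
    and h: "\<And>x. x \<in> carrier R \<Longrightarrow> h x \<in> carrier S"
    and add: "\<And>x y. \<lbrakk>x \<in> carrier R; y \<in> carrier R\<rbrakk> \<Longrightarrow> h (x \<oplus>\<^bsub>R\<^esub> y) = h x \<oplus>\<^bsub>S\<^esub> h y"
    and d: "\<And>k. d k \<in> carrier R"
  shows "h (lin R n a d) = lin S n a (\<lambda>k. h (d k))"
proof -
  interpret R: abelian_group R by fact
  interpret S: abelian_group S by fact
  interpret h: group_hom "add_monoid R" "add_monoid S" h
    using h add by (auto simp: group_hom_def group_hom_axioms_def hom_def R.a_group S.a_group)
  have pow: "h (add_pow R k x) = add_pow S k (h x)" if "x \<in> carrier R" for x and k :: int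
    using h.hom_int_pow[of x k] that by (simp add: add_pow_def)
  have zero: "h \<zero>\<^bsub>R\<^esub> = \<zero>\<^bsub>S\<^esub>" using h.hom_one by simp
  show ?thesis
    by (induction n) (simp_all add: zero R.lin_Suc S.lin_Suc d h add pow)
qed

context additive_track_category
begin

abbreviation DR :: "'o \<Rightarrow> 'o \<Rightarrow> 'd ring" where "DR X Y \<equiv> ring_of (D X Y)"
abbreviation PR :: "'o \<Rightarrow> 'o \<Rightarrow> 'm set ring" where "PR X Y \<equiv> ring_of (P X Y)"
abbreviation cls where "cls f \<equiv> track_class A f"

lemma DR_abelian_group: "\<lbrakk>X \<in> Obj A; Y \<in> Obj A\<rbrakk> \<Longrightarrow> abelian_group (DR X Y)"
  by (rule abelian_group_ring_of, rule coeff.comm_group_D) simp_all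

lemma PR_abelian_group: "\<lbrakk>X \<in> Obj A; Y \<in> Obj A\<rbrakk> \<Longrightarrow> abelian_group (PR X Y)"
  by (rule abelian_group_ring_of, rule coeff.comm_group_P) simp_all

lemma PR_carrier: "\<lbrakk>X \<in> Obj A; Y \<in> Obj A\<rbrakk> \<Longrightarrow> carrier (P X Y) = cls ` maps A X Y"
  by (simp add: coeff.carrier_P ho_maps)

lemma cls_in: "f \<in> maps A X Y \<Longrightarrow> cls f \<in> maps (ho A) X Y"
  by (simp add: ho_maps)

lemma cls_in_P: "f \<in> maps A X Y \<Longrightarrow> cls f \<in> carrier (P X Y)"
  by (subst PR_carrier) (auto dest: maps_Obj)

lemma ho_Ident_in: "X \<in> Obj A \<Longrightarrow> Ident (ho A) X \<in> maps (ho A) X X"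
  by (simp add: ho_Ident cls_in Ident_in)

section \<open>The action of the coefficients on tracks\<close>

definition dpush :: "'o \<Rightarrow> 'm \<Rightarrow> 'd \<Rightarrow> 'd" where
  "dpush X g a = Dm (Ident (ho A) X) (cls g) a"

definition dpull :: "'m \<Rightarrow> 'o \<Rightarrow> 'd \<Rightarrow> 'd" where
  "dpull h Y a = Dm (cls h) (Ident (ho A) Y) a"

lemma dpush_hom: "\<lbrakk>g \<in> maps A Y Y'; X \<in> Obj A\<rbrakk> \<Longrightarrow> dpush X g \<in> hom (D X Y) (D X Y')"
  using coeff.Dm_hom[OF ho_Ident_in cls_in] by (simp add: dpush_def[abs_def])

lemma dpull_hom: "\<lbrakk>h \<in> maps A X' X; Y \<in> Obj A\<rbrakk> \<Longrightarrow> dpull h Y \<in> hom (D X Y) (D X' Y)"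
  using coeff.Dm_hom[OF cls_in ho_Ident_in] by (simp add: dpull_def[abs_def])

lemma dpush_in: "\<lbrakk>g \<in> maps A Y Y'; X \<in> Obj A; a \<in> carrier (D X Y)\<rbrakk> \<Longrightarrow> dpush X g a \<in> carrier (D X Y')"
  using hom_in_carrier[OF dpush_hom] .

lemma dpull_in: "\<lbrakk>h \<in> maps A X' X; Y \<in> Obj A; a \<in> carrier (D X Y)\<rbrakk> \<Longrightarrow> dpull h Y a \<in> carrier (D X' Y)"
  using hom_in_carrier[OF dpull_hom] .

lemma dpush_add: "\<lbrakk>g \<in> maps A Y Y'; X \<in> Obj A; a \<in> carrier (D X Y); b \<in> carrier (D X Y)\<rbrakk> \<Longrightarrow>
   dpush X g (a \<otimes>\<^bsub>D X Y\<^esub> b) = dpush X g a \<otimes>\<^bsub>D X Y'\<^esub> dpush X g b"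
  using dpush_hom by (auto simp: hom_def)

lemma dpush_dpush: "\<lbrakk>g \<in> maps A Y Y'; g' \<in> maps A Y' Y''; X \<in> Obj A; a \<in> carrier (D X Y)\<rbrakk> \<Longrightarrow>
   dpush X g' (dpush X g a) = dpush X (g' \<bullet> g) a"
  using coeff.Dm_Comp[OF ho_Ident_in[of X] ho_Ident_in[of X] cls_in[of g] cls_in[of g'], of Y Y' Y'' a]
    coeff.Comp_Ident[OF ho_Ident_in[of X]]
  by (simp add: dpush_def ho_Comp)

lemma dpush_Ident: "\<lbrakk>X \<in> Obj A; Y \<in> Obj A; a \<in> carrier (D X Y)\<rbrakk> \<Longrightarrow> dpush X (Ident A Y) a = a"
  using coeff.Dm_Ident[of X Y a] by (simp add: dpush_def ho_Ident)

text \<open>Translation of tracks by coefficients. The tracks between two maps \<open>X\<close>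
  \<rightarrow> \<open>Y\<close> of one class form a torsor under \<open>D X Y\<close>, transitive
  by \<open>act_ex\<close> and free by \<open>act_inj\<close>; so two such tracks deviate by a
  unique coefficient.\<close>

definition act :: "'d \<Rightarrow> 't \<Rightarrow> 't" where
  "act a \<eta> = \<sigma> (TTgt A \<eta>) a \<box> \<eta>"

lemma TTgt_tracks: "\<eta> \<in> tracks A f g \<Longrightarrow> TTgt A \<eta> = g" by (simp add: tracks_def)

lemma \<sigma>_in: "\<lbrakk>f \<in> maps A X Y; a \<in> carrier (D X Y)\<rbrakk> \<Longrightarrow> \<sigma> f a \<in> tracks A f f"
  using \<sigma>_iso[of f X Y] by (auto simp: iso_def hom_def track_group_def)

lemma \<sigma>_mult: "\<lbrakk>f \<in> maps A X Y; a \<in> carrier (D X Y); b \<in> carrier (D X Y)\<rbrakk> \<Longrightarrow>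
   \<sigma> f (a \<otimes>\<^bsub>D X Y\<^esub> b) = \<sigma> f a \<box> \<sigma> f b"
  using \<sigma>_iso[of f X Y] by (auto simp: iso_def hom_def track_group_def)

lemma \<sigma>_bij: "f \<in> maps A X Y \<Longrightarrow> bij_betw (\<sigma> f) (carrier (D X Y)) (tracks A f f)"
  using \<sigma>_iso[of f X Y] by (auto simp: iso_def track_group_def)

lemma D_group: "f \<in> maps A X Y \<Longrightarrow> comm_group (D X Y)"
  using coeff.comm_group_D[of X Y] maps_Obj by simp

lemma \<sigma>_one: "f \<in> maps A X Y \<Longrightarrow> \<sigma> f \<one>\<^bsub>D X Y\<^esub> = tid f"
proof -
  assume f: "f \<in> maps A X Y"
  interpret comm_group "D X Y" by (rule D_group[OF f])
  have s: "\<sigma> f \<one>\<^bsub>D X Y\<^esub> \<in> tracks A f f" by (rule \<sigma>_in[OF f]) simp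
  have "\<sigma> f \<one>\<^bsub>D X Y\<^esub> \<box> \<sigma> f \<one>\<^bsub>D X Y\<^esub> = tid f \<box> \<sigma> f \<one>\<^bsub>D X Y\<^esub>"
    using \<sigma>_mult[OF f, of "\<one>\<^bsub>D X Y\<^esub>" "\<one>\<^bsub>D X Y\<^esub>"] tid_vcomp[OF s] by simp
  then show ?thesis by (rule vcomp_cancel_right[OF s s tid_in[OF f]])
qed

lemma act_in: "\<lbrakk>\<eta> \<in> tracks A f g; f \<in> maps A X Y; a \<in> carrier (D X Y)\<rbrakk> \<Longrightarrow> act a \<eta> \<in> tracks A f g"
  unfolding act_def using TTgt_tracks[of \<eta> f g] \<sigma>_in[of g X Y a] tracks_maps[of \<eta> f g] vcomp_in by auto

lemma act_act: "\<lbrakk>\<eta> \<in> tracks A f g; f \<in> maps A X Y; a \<in> carrier (D X Y); b \<in> carrier (D X Y)\<rbrakk> \<Longrightarrow>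
  act a (act b \<eta>) = act (a \<otimes>\<^bsub>D X Y\<^esub> b) \<eta>"
proof -
  assume a: "\<eta> \<in> tracks A f g" "f \<in> maps A X Y" "a \<in> carrier (D X Y)" "b \<in> carrier (D X Y)"
  have g: "g \<in> maps A X Y" using a tracks_maps by blast
  show ?thesis
    using TTgt_tracks[OF a(1)] TTgt_tracks[OF act_in[OF a(1,2,4)]]
      vcomp_assoc[OF a(1) \<sigma>_in[OF g a(4)] \<sigma>_in[OF g a(3)]]
    by (simp add: act_def \<sigma>_mult[OF g a(3,4)])
qed

lemma act_one: "\<lbrakk>\<eta> \<in> tracks A f g; f \<in> maps A X Y\<rbrakk> \<Longrightarrow> act \<one>\<^bsub>D X Y\<^esub> \<eta> = \<eta>"
  using tracks_maps[of \<eta> f g X Y] by (simp add: act_def TTgt_tracks \<sigma>_one tid_vcomp)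

lemma act_vcomp: "\<lbrakk>\<eta> \<in> tracks A f g; \<theta> \<in> tracks A g h; f \<in> maps A X Y; a \<in> carrier (D X Y)\<rbrakk> \<Longrightarrow>
  act a \<theta> \<box> \<eta> = act a (\<theta> \<box> \<eta>)"
proof -
  assume a: "\<eta> \<in> tracks A f g" "\<theta> \<in> tracks A g h" "f \<in> maps A X Y" "a \<in> carrier (D X Y)"
  have h: "h \<in> maps A X Y" using a tracks_maps by blast
  show ?thesis unfolding act_def TTgt_tracks[OF a(2)] TTgt_tracks[OF vcomp_in[OF a(1,2)]]
    by (rule vcomp_assoc[OF a(1,2) \<sigma>_in[OF h a(4)]])
qed

text \<open>Sliding the translation past \<theta> is \<open>\<sigma>_natural\<close>. Together with
  \<open>act_vcomp\<close> it allows translations to be collected in front of a vertical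
  composite.\<close>

lemma vcomp_act: "\<lbrakk>\<eta> \<in> tracks A f g; \<theta> \<in> tracks A g h; f \<in> maps A X Y; a \<in> carrier (D X Y)\<rbrakk> \<Longrightarrow>
  \<theta> \<box> act a \<eta> = act a (\<theta> \<box> \<eta>)"
proof -
  assume a: "\<eta> \<in> tracks A f g" "\<theta> \<in> tracks A g h" "f \<in> maps A X Y" "a \<in> carrier (D X Y)"
  have g: "g \<in> maps A X Y" using a tracks_maps by blast
  have h: "h \<in> maps A X Y" using a(2) g tracks_maps by blast
  have "\<theta> \<box> act a \<eta> = (\<theta> \<box> \<sigma> g a) \<box> \<eta>"
    unfolding act_def TTgt_tracks[OF a(1)] by (rule vcomp_assoc[symmetric, OF a(1) \<sigma>_in[OF g a(4)] a(2)])
  also have "\<dots> = act a \<theta> \<box> \<eta>"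
    unfolding act_def TTgt_tracks[OF a(2)] using \<sigma>_natural[OF g h a(2,4)] by simp
  finally show ?thesis using act_vcomp[OF a] by simp
qed

text \<open>The composite of \<eta>' with an inverse of \<eta> is a track from \<open>g\<close> to
  itself, hence in the image of \<open>\<sigma> g\<close>.\<close>

lemma act_ex: "\<lbrakk>\<eta> \<in> tracks A f g; \<eta>' \<in> tracks A f g; f \<in> maps A X Y\<rbrakk> \<Longrightarrow>
  \<exists>a \<in> carrier (D X Y). \<eta>' = act a \<eta>"
proof -
  assume a: "\<eta> \<in> tracks A f g" "\<eta>' \<in> tracks A f g" "f \<in> maps A X Y"
  have g: "g \<in> maps A X Y" using a tracks_maps by blast
  obtain \<theta> where \<theta>: "\<theta> \<in> tracks A g f" "\<theta> \<box> \<eta> = tid f" using vinv_ex[OF a(1)] by blast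
  obtain d where d: "d \<in> carrier (D X Y)" "\<sigma> g d = \<eta>' \<box> \<theta>"
    using \<sigma>_bij[OF g] vcomp_in[OF \<theta>(1) a(2)] by (metis bij_betw_imp_surj_on imageE)
  have "act d \<eta> = \<eta>'"
    using vcomp_assoc[OF a(1) \<theta>(1) a(2)] vcomp_tid[OF a(2)]
    by (simp add: act_def TTgt_tracks[OF a(1)] d \<theta>)
  then show ?thesis using d by blast
qed

lemma act_inj: "\<lbrakk>\<eta> \<in> tracks A f g; f \<in> maps A X Y; a \<in> carrier (D X Y); b \<in> carrier (D X Y); act a \<eta> = act b \<eta>\<rbrakk> \<Longrightarrow> a = b"
proof -
  assume a: "\<eta> \<in> tracks A f g" "f \<in> maps A X Y" "a \<in> carrier (D X Y)" "b \<in> carrier (D X Y)" "act a \<eta> = act b \<eta>"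
  have g: "g \<in> maps A X Y" using a tracks_maps by blast
  have "\<sigma> g a = \<sigma> g b"
    using vcomp_cancel_right[OF a(1) \<sigma>_in[OF g a(3)] \<sigma>_in[OF g a(4)]] a(5)
    by (simp add: act_def TTgt_tracks[OF a(1)])
  then show ?thesis using \<sigma>_bij[OF g] a(3,4) by (auto simp: bij_betw_def dest: inj_onD)
qed

lemma push_act: "\<lbrakk>\<eta> \<in> tracks A f f'; f \<in> maps A X Y; g \<in> maps A Y Z; a \<in> carrier (D X Y)\<rbrakk> \<Longrightarrow>
  g \<triangleright> act a \<eta> = act (dpush X g a) (g \<triangleright> \<eta>)"
proof -
  assume a: "\<eta> \<in> tracks A f f'" "f \<in> maps A X Y" "g \<in> maps A Y Z" "a \<in> carrier (D X Y)"
  have f': "f' \<in> maps A X Y" using a tracks_maps by blast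
  show ?thesis unfolding act_def TTgt_tracks[OF a(1)] TTgt_tracks[OF push_in[OF a(1-3)]]
    using push_vcomp[OF a(1) \<sigma>_in[OF f' a(4)] a(2,3)] \<sigma>_push[OF f' a(3,4)] by (simp add: dpush_def)
qed

lemma pull_act: "\<lbrakk>\<eta> \<in> tracks A g g'; g \<in> maps A Y Z; h \<in> maps A X Y; a \<in> carrier (D Y Z)\<rbrakk> \<Longrightarrow>
  act a \<eta> \<triangleleft> h = act (dpull h Z a) (\<eta> \<triangleleft> h)"
proof -
  assume a: "\<eta> \<in> tracks A g g'" "g \<in> maps A Y Z" "h \<in> maps A X Y" "a \<in> carrier (D Y Z)"
  have g': "g' \<in> maps A Y Z" using a tracks_maps by blast
  show ?thesis unfolding act_def TTgt_tracks[OF a(1)] TTgt_tracks[OF pull_in[OF a(1-3)]]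
    using pull_vcomp[OF a(1) \<sigma>_in[OF g' a(4)] a(2,3)] \<sigma>_pull[OF a(3) g' a(4)] by (simp add: dpull_def)
qed

text \<open>Both ways around the diagram from \<open>a f g x\<close> to its reduction are compared with one reference
  track; the deviations \<open>c\<^sub>i, d, e\<close> of the faces then satisfy the cocycle relation.\<close>

lemma track_cocycle:
  assumes x: "x \<in> maps A W S" and g: "g \<in> maps A S Q" and f: "f \<in> maps A Q R" and a: "a \<in> maps A R V"
    and Pgx: "Pgx \<in> tracks A (g \<bullet> x) gx" and Pf_gx: "Pf_gx \<in> tracks A (f \<bullet> gx) fgx"
    and Pfg: "Pfg \<in> tracks A (f \<bullet> g) fg" and Pfg_x: "Pfg_x \<in> tracks A (fg \<bullet> x) fgx"
    and t_afgx: "t_afgx \<in> tracks A (a \<bullet> fgx) afgx" and t_af: "t_af \<in> tracks A (a \<bullet> f) af"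
    and t_af_gx: "t_af_gx \<in> tracks A (af \<bullet> gx) afgx" and t_afg: "t_afg \<in> tracks A (af \<bullet> g) afg"
    and t_afg_x: "t_afg_x \<in> tracks A (afg \<bullet> x) afgx" and t_a_fg: "t_a_fg \<in> tracks A (a \<bullet> fg) afg"
    and c: "c1 \<in> carrier (D W V)" "c2 \<in> carrier (D W V)" "c3 \<in> carrier (D W V)"
    and d: "d \<in> carrier (D S V)" and e: "e \<in> carrier (D W R)"
    and 1: "t_afgx \<box> (a \<triangleright> Pf_gx) = act c1 (t_af_gx \<box> (t_af \<triangleleft> gx))"
    and 2: "t_af_gx \<box> (af \<triangleright> Pgx) = act c2 (t_afg_x \<box> (t_afg \<triangleleft> x))"
    and 3: "t_afgx \<box> (a \<triangleright> Pfg_x) = act c3 (t_afg_x \<box> (t_a_fg \<triangleleft> x))"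
    and 4: "t_a_fg \<box> (a \<triangleright> Pfg) = act d (t_afg \<box> (t_af \<triangleleft> g))"
    and 5: "Pf_gx \<box> (f \<triangleright> Pgx) = act e (Pfg_x \<box> (Pfg \<triangleleft> x))"
  shows "dpush W a e \<otimes>\<^bsub>D W V\<^esub> c3 \<otimes>\<^bsub>D W V\<^esub> dpull x V d = c1 \<otimes>\<^bsub>D W V\<^esub> c2"
proof -
  note C = Comp_in
  have gx_m: "gx \<in> maps A W Q" using tracks_maps[OF Pgx] C[OF x g] by blast
  have fg_m: "fg \<in> maps A S R" using tracks_maps[OF Pfg] C[OF g f] by blast
  have fgx_m: "fgx \<in> maps A W R" using tracks_maps[OF Pf_gx] C[OF gx_m f] by blast
  have af_m: "af \<in> maps A Q V" using tracks_maps[OF t_af] C[OF f a] by blast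
  have afg_m: "afg \<in> maps A S V" using tracks_maps[OF t_afg] C[OF g af_m] by blast
  have ObW: "W \<in> Obj A" and ObV: "V \<in> Obj A" using x a maps_Obj by blast+
  interpret DWV: comm_group "D W V" using coeff.comm_group_D ObW ObV by simp
  note as = Comp_assoc
  have a1: "a \<bullet> f \<bullet> g \<bullet> x = (a \<bullet> f) \<bullet> g \<bullet> x" by (rule as[OF C[OF x g] f a])
  have a2: "(a \<bullet> f) \<bullet> g \<bullet> x = ((a \<bullet> f) \<bullet> g) \<bullet> x" by (rule as[OF x g C[OF f a]])
  have a3: "a \<bullet> f \<bullet> g = (a \<bullet> f) \<bullet> g" by (rule as[OF g f a])
  have a4: "f \<bullet> g \<bullet> x = (f \<bullet> g) \<bullet> x" by (rule as[OF x g f])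
  let ?Z = "t_afg_x \<box> ((t_afg \<triangleleft> x) \<box> (t_af \<triangleleft> (g \<bullet> x)))"
  have T1: "t_af \<triangleleft> (g \<bullet> x) \<in> tracks A ((a \<bullet> f) \<bullet> g \<bullet> x) (af \<bullet> g \<bullet> x)" by (rule pull_in[OF t_af C[OF f a] C[OF x g]])
  have T2: "t_afg \<triangleleft> x \<in> tracks A (af \<bullet> g \<bullet> x) (afg \<bullet> x)"
    using pull_in[OF t_afg C[OF g af_m] x] as[OF x g af_m] by simp
  have Z: "?Z \<in> tracks A ((a \<bullet> f) \<bullet> g \<bullet> x) afgx" by (intro vcomp_in[OF vcomp_in[OF T1 T2] t_afg_x])
  have m: "(a \<bullet> f) \<bullet> g \<bullet> x \<in> maps A W V" by (rule C[OF C[OF x g] C[OF f a]])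
  have fPgx: "f \<triangleright> Pgx \<in> tracks A (f \<bullet> g \<bullet> x) (f \<bullet> gx)" by (rule push_in[OF Pgx C[OF x g] f])
  have afPgx: "(a \<bullet> f) \<triangleright> Pgx \<in> tracks A ((a \<bullet> f) \<bullet> g \<bullet> x) ((a \<bullet> f) \<bullet> gx)" by (rule push_in[OF Pgx C[OF x g] C[OF f a]])
  have aPf_gx: "a \<triangleright> Pf_gx \<in> tracks A ((a \<bullet> f) \<bullet> gx) (a \<bullet> fgx)"
    using push_in[OF Pf_gx C[OF gx_m f] a] as[OF gx_m f a] by simp
  have t_af_gx': "t_af \<triangleleft> gx \<in> tracks A ((a \<bullet> f) \<bullet> gx) (af \<bullet> gx)" by (rule pull_in[OF t_af C[OF f a] gx_m])
  have af'Pgx: "af \<triangleright> Pgx \<in> tracks A (af \<bullet> g \<bullet> x) (af \<bullet> gx)" by (rule push_in[OF Pgx C[OF x g] af_m])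
  have "t_afgx \<box> (a \<triangleright> (Pf_gx \<box> (f \<triangleright> Pgx))) = t_afgx \<box> ((a \<triangleright> Pf_gx) \<box> ((a \<bullet> f) \<triangleright> Pgx))"
    using push_vcomp[OF fPgx Pf_gx C[OF C[OF x g] f] a] push_push[OF Pgx C[OF x g] f a] by simp
  also have "\<dots> = act c1 (t_af_gx \<box> (t_af \<triangleleft> gx)) \<box> ((a \<bullet> f) \<triangleright> Pgx)"
    using vcomp_assoc[OF afPgx aPf_gx t_afgx] 1 by simp
  also have "\<dots> = act c1 (t_af_gx \<box> ((t_af \<triangleleft> gx) \<box> ((a \<bullet> f) \<triangleright> Pgx)))"
    using act_vcomp[OF afPgx vcomp_in[OF t_af_gx' t_af_gx] m c(1)] vcomp_assoc[OF afPgx t_af_gx' t_af_gx] by simp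
  \<comment> \<open>The reductions of \<open>a f\<close> and of \<open>g x\<close> take place in
    disjoint parts of the composite, so their order may be exchanged.\<close>
  also have "\<dots> = act c1 (t_af_gx \<box> ((af \<triangleright> Pgx) \<box> (t_af \<triangleleft> (g \<bullet> x))))"
    using exchange[OF Pgx C[OF x g] t_af C[OF f a]] by simp
  also have "\<dots> = act c1 (act c2 (t_afg_x \<box> (t_afg \<triangleleft> x)) \<box> (t_af \<triangleleft> (g \<bullet> x)))"
    using vcomp_assoc[OF T1 af'Pgx t_af_gx] 2 by simp
  also have "\<dots> = act c1 (act c2 ?Z)"
    using act_vcomp[OF T1 vcomp_in[OF T2 t_afg_x] m c(2)] vcomp_assoc[OF T1 T2 t_afg_x] by simp
  finally have L: "t_afgx \<box> (a \<triangleright> (Pf_gx \<box> (f \<triangleright> Pgx))) = act (c1 \<otimes>\<^bsub>D W V\<^esub> c2) ?Z"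
    using act_act[OF Z m c(1,2)] by simp
  have Pfgx': "Pfg \<triangleleft> x \<in> tracks A (f \<bullet> g \<bullet> x) (fg \<bullet> x)" using pull_in[OF Pfg C[OF g f] x] a4 by simp
  have aPfg: "a \<triangleright> Pfg \<in> tracks A ((a \<bullet> f) \<bullet> g) (a \<bullet> fg)" using push_in[OF Pfg C[OF g f] a] a3 by simp
  have aPfgx: "(a \<triangleright> Pfg) \<triangleleft> x \<in> tracks A ((a \<bullet> f) \<bullet> g \<bullet> x) ((a \<bullet> fg) \<bullet> x)"
    using pull_in[OF aPfg C[OF g C[OF f a]] x] a2 by simp
  have aPfg_x: "a \<triangleright> Pfg_x \<in> tracks A ((a \<bullet> fg) \<bullet> x) (a \<bullet> fgx)"
    using push_in[OF Pfg_x C[OF x fg_m] a] as[OF x fg_m a] by simp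
  have Q: "Pfg_x \<box> (Pfg \<triangleleft> x) \<in> tracks A (f \<bullet> g \<bullet> x) fgx" by (rule vcomp_in[OF Pfgx' Pfg_x])
  have aQ: "a \<triangleright> (Pfg_x \<box> (Pfg \<triangleleft> x)) \<in> tracks A ((a \<bullet> f) \<bullet> g \<bullet> x) (a \<bullet> fgx)"
    using push_in[OF Q C[OF C[OF x g] f] a] a1 by simp
  have t_a_fg_x: "t_a_fg \<triangleleft> x \<in> tracks A ((a \<bullet> fg) \<bullet> x) (afg \<bullet> x)" by (rule pull_in[OF t_a_fg C[OF fg_m a] x])
  have t_af_g: "t_af \<triangleleft> g \<in> tracks A ((a \<bullet> f) \<bullet> g) (af \<bullet> g)" by (rule pull_in[OF t_af C[OF f a] g])
  have ae: "dpush W a e \<in> carrier (D W V)" by (rule dpush_in[OF a ObW e])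
  have xd: "dpull x V d \<in> carrier (D W V)" by (rule dpull_in[OF x ObV d])
  have "t_afgx \<box> (a \<triangleright> act e (Pfg_x \<box> (Pfg \<triangleleft> x))) = act (dpush W a e) (t_afgx \<box> (a \<triangleright> (Pfg_x \<box> (Pfg \<triangleleft> x))))"
    using push_act[OF Q C[OF C[OF x g] f] a e] vcomp_act[OF aQ t_afgx m ae] by simp
  also have "a \<triangleright> (Pfg_x \<box> (Pfg \<triangleleft> x)) = (a \<triangleright> Pfg_x) \<box> ((a \<triangleright> Pfg) \<triangleleft> x)"
    using push_vcomp[OF Pfgx' Pfg_x C[OF C[OF x g] f] a] push_pull[OF Pfg x C[OF g f] a] by simp
  also have "t_afgx \<box> \<dots> = act c3 (t_afg_x \<box> (t_a_fg \<triangleleft> x)) \<box> ((a \<triangleright> Pfg) \<triangleleft> x)"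
    using vcomp_assoc[OF aPfgx aPfg_x t_afgx] 3 by simp
  also have "\<dots> = act c3 (t_afg_x \<box> ((t_a_fg \<triangleleft> x) \<box> ((a \<triangleright> Pfg) \<triangleleft> x)))"
    using act_vcomp[OF aPfgx vcomp_in[OF t_a_fg_x t_afg_x] m c(3)] vcomp_assoc[OF aPfgx t_a_fg_x t_afg_x] by simp
  also have "(t_a_fg \<triangleleft> x) \<box> ((a \<triangleright> Pfg) \<triangleleft> x) = act d (t_afg \<box> (t_af \<triangleleft> g)) \<triangleleft> x"
    using pull_vcomp[OF aPfg t_a_fg C[OF g C[OF f a]] x] 4 by simp
  also have "\<dots> = act (dpull x V d) ((t_afg \<triangleleft> x) \<box> (t_af \<triangleleft> (g \<bullet> x)))"
    using pull_act[OF vcomp_in[OF t_af_g t_afg] C[OF g C[OF f a]] x d]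
      pull_vcomp[OF t_af_g t_afg C[OF g C[OF f a]] x] pull_pull[OF t_af C[OF f a] g x] by simp
  also have "t_afg_x \<box> \<dots> = act (dpull x V d) ?Z"
    by (rule vcomp_act[OF vcomp_in[OF T1 T2] t_afg_x m xd])
  finally have R: "t_afgx \<box> (a \<triangleright> act e (Pfg_x \<box> (Pfg \<triangleleft> x))) =
      act (dpush W a e \<otimes>\<^bsub>D W V\<^esub> c3 \<otimes>\<^bsub>D W V\<^esub> dpull x V d) ?Z"
    using act_act[OF Z m c(3) xd] act_act[OF Z m ae, of "c3 \<otimes>\<^bsub>D W V\<^esub> dpull x V d"] c xd ae
    by (simp add: DWV.m_assoc)
  show ?thesis
    by (rule act_inj[OF Z m]) (use L R 5 ae xd c in auto)
qed

end

section \<open>Copowers of an object\<close>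

context additive_track_category
begin

section \<open>Zero maps and their tracks\<close>

lemma zero_in: "z \<in> Obj A" using zero by (simp add: strict_zero_def)

lemma to_zero_unique: assumes "f \<in> maps A X z" "g \<in> maps A X z" shows "f = g"
proof -
  have "is_singleton (maps A X z)" using zero maps_Obj(1)[OF assms(1)] by (auto simp: strict_zero_def)
  then show ?thesis using assms by (auto elim!: is_singletonE)
qed

lemma from_zero_unique: assumes "f \<in> maps A z X" "g \<in> maps A z X" shows "f = g"
proof -
  have "is_singleton (maps A z X)" using zero maps_Obj(2)[OF assms(1)] by (auto simp: strict_zero_def)
  then show ?thesis using assms by (auto elim!: is_singletonE)
qed

lemma to_zero_ex: "X \<in> Obj A \<Longrightarrow> \<exists>f. f \<in> maps A X z"
  using zero by (auto simp: strict_zero_def is_singleton_def)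

lemma from_zero_ex: "X \<in> Obj A \<Longrightarrow> \<exists>f. f \<in> maps A z X"
  using zero by (auto simp: strict_zero_def is_singleton_def)

lemma track_to_zero: assumes "\<eta> \<in> tracks A f g" "f \<in> maps A X z" shows "\<eta> = tid f"
proof -
  have "is_singleton (Arr (hom_groupoid A X z))"
    using zero maps_Obj(1)[OF assms(2)] by (auto simp: strict_zero_def)
  moreover have "\<eta> \<in> Arr (hom_groupoid A X z)" "tid f \<in> Arr (hom_groupoid A X z)"
    using assms tid_in[OF assms(2)] by (auto simp: tracks_def)
  ultimately show ?thesis by (auto simp only: is_singleton_def singleton_iff)
qed

lemma track_from_zero: assumes "\<eta> \<in> tracks A f g" "f \<in> maps A z X" shows "\<eta> = tid f"
proof -
  have "is_singleton (Arr (hom_groupoid A z X))"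
    using zero maps_Obj(2)[OF assms(2)] by (auto simp: strict_zero_def)
  moreover have "\<eta> \<in> Arr (hom_groupoid A z X)" "tid f \<in> Arr (hom_groupoid A z X)"
    using assms tid_in[OF assms(2)] by (auto simp: tracks_def)
  ultimately show ?thesis by (auto simp only: is_singleton_def singleton_iff)
qed

abbreviation zm where "zm X Y \<equiv> zero_map A z X Y"

lemma zm_eq: "\<lbrakk>f \<in> maps A X z; g \<in> maps A z Y\<rbrakk> \<Longrightarrow> zm X Y = g \<bullet> f"
proof -
  assume a: "f \<in> maps A X z" "g \<in> maps A z Y"
  have "(THE g. g \<in> maps A z Y) = g" using a from_zero_unique by blast
  moreover have "(THE f. f \<in> maps A X z) = f" using a to_zero_unique by blast
  ultimately show ?thesis by (simp add: zero_map_def)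
qed

lemma zm_factor: "\<lbrakk>X \<in> Obj A; Y \<in> Obj A\<rbrakk> \<Longrightarrow> \<exists>f g. f \<in> maps A X z \<and> g \<in> maps A z Y \<and> zm X Y = g \<bullet> f"
  using to_zero_ex[of X] from_zero_ex[of Y] zm_eq by blast

lemma zm_in: "\<lbrakk>X \<in> Obj A; Y \<in> Obj A\<rbrakk> \<Longrightarrow> zm X Y \<in> maps A X Y"
  using zm_factor[of X Y] Comp_in by metis

lemma comp_zm: "\<lbrakk>g \<in> maps A Y Z; X \<in> Obj A\<rbrakk> \<Longrightarrow> g \<bullet> zm X Y = zm X Z"
proof -
  assume a: "g \<in> maps A Y Z" "X \<in> Obj A"
  obtain f h where fh: "f \<in> maps A X z" "h \<in> maps A z Y" "zm X Y = h \<bullet> f"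
    using zm_factor a maps_Obj by blast
  show ?thesis using zm_eq[OF fh(1) Comp_in[OF fh(2) a(1)]] Comp_assoc[OF fh(1,2) a(1)] fh by simp
qed

lemma zm_comp: "\<lbrakk>f \<in> maps A X Y; Z \<in> Obj A\<rbrakk> \<Longrightarrow> zm Y Z \<bullet> f = zm X Z"
proof -
  assume a: "f \<in> maps A X Y" "Z \<in> Obj A"
  obtain g h where gh: "g \<in> maps A Y z" "h \<in> maps A z Z" "zm Y Z = h \<bullet> g"
    using zm_factor a maps_Obj by blast
  show ?thesis using zm_eq[OF Comp_in[OF a(1) gh(1)] gh(2)] Comp_assoc[OF a(1) gh(1,2)] gh by simp
qed

text \<open>Whiskering with a zero map passes through the hom-groupoid into \<open>z\<close>, where
  every track is an identity. This normalises \<open>c\<close> at the zero row, and the dual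
  \<open>zm_pull\<close> normalises it at the zero column.\<close>

lemma zm_push: "\<lbrakk>\<eta> \<in> tracks A f f'; f \<in> maps A X Y; Z \<in> Obj A\<rbrakk> \<Longrightarrow> zm Y Z \<triangleright> \<eta> = tid (zm X Z)"
proof -
  assume a: "\<eta> \<in> tracks A f f'" "f \<in> maps A X Y" "Z \<in> Obj A"
  obtain g h where gh: "g \<in> maps A Y z" "h \<in> maps A z Z" "zm Y Z = h \<bullet> g"
    using zm_factor a maps_Obj by blast
  have "zm Y Z \<triangleright> \<eta> = h \<triangleright> g \<triangleright> \<eta>" using push_push[OF a(1,2) gh(1,2)] gh by simp
  also have "g \<triangleright> \<eta> = tid (g \<bullet> f)" using track_to_zero[OF push_in[OF a(1,2) gh(1)]] Comp_in[OF a(2) gh(1)] by simp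
  finally show ?thesis
    using push_tid[OF Comp_in[OF a(2) gh(1)] gh(2)] zm_eq[OF Comp_in[OF a(2) gh(1)] gh(2)] by simp
qed

lemma zm_pull: "\<lbrakk>\<eta> \<in> tracks A g g'; g \<in> maps A Y Z; W \<in> Obj A\<rbrakk> \<Longrightarrow> \<eta> \<triangleleft> zm W Y = tid (zm W Z)"
proof -
  assume a: "\<eta> \<in> tracks A g g'" "g \<in> maps A Y Z" "W \<in> Obj A"
  obtain f h where fh: "f \<in> maps A W z" "h \<in> maps A z Y" "zm W Y = h \<bullet> f"
    using zm_factor a maps_Obj by blast
  have "\<eta> \<triangleleft> zm W Y = \<eta> \<triangleleft> h \<triangleleft> f" using pull_pull[OF a(1,2) fh(2,1)] fh by simp
  also have "\<eta> \<triangleleft> h = tid (g \<bullet> h)" using track_from_zero[OF pull_in[OF a(1,2) fh(2)]] Comp_in[OF fh(2) a(2)] by simp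
  finally show ?thesis
    using pull_tid[OF fh(1) Comp_in[OF fh(2) a(2)]] zm_eq[OF fh(1) Comp_in[OF fh(2) a(2)]] by simp
qed

section \<open>Linearity of composition and of the coefficients\<close>

lemma P_comm_group: "\<lbrakk>U \<in> Obj A; V \<in> Obj A\<rbrakk> \<Longrightarrow> comm_group (P U V)"
  using coeff.comm_group_P by simp

abbreviation hc where "hc \<equiv> Comp (ho A)"

lemma hc_lin_right:
  assumes g: "g \<in> maps A V W" and U: "U \<in> Obj A" and F: "\<And>i. F i \<in> carrier (P U V)"
  shows "hc (cls g) (lin (PR U V) n a F) = lin (PR U W) n a (\<lambda>i. hc (cls g) (F i))"
proof (rule hom_lin)
  show "abelian_group (PR U V)" "abelian_group (PR U W)" using PR_abelian_group U maps_Obj[OF g] by auto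
  have c: "carrier (PR U V) = maps (ho A) U V" "carrier (PR U W) = maps (ho A) U W"
    using U maps_Obj[OF g] by (simp_all add: coeff.carrier_P)
  show "hc (cls g) x \<in> carrier (PR U W)" if "x \<in> carrier (PR U V)" for x
    using coeff.Comp_in[OF _ cls_in[OF g]] that unfolding c by blast
  show "hc (cls g) (x \<oplus>\<^bsub>PR U V\<^esub> y) = hc (cls g) x \<oplus>\<^bsub>PR U W\<^esub> hc (cls g) y"
    if "x \<in> carrier (PR U V)" "y \<in> carrier (PR U V)" for x y
    using coeff.Comp_add_right[OF _ _ cls_in[OF g]] that unfolding c by simp
qed (use F in simp)

lemma hc_lin_left:
  assumes f: "f \<in> maps A U V" and W: "W \<in> Obj A" and G: "\<And>i. G i \<in> carrier (P V W)"
  shows "hc (lin (PR V W) n a G) (cls f) = lin (PR U W) n a (\<lambda>i. hc (G i) (cls f))"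
proof (rule hom_lin[of _ _ "\<lambda>c. hc c (cls f)"])
  show "abelian_group (PR V W)" "abelian_group (PR U W)" using PR_abelian_group W maps_Obj[OF f] by auto
  have c: "carrier (PR V W) = maps (ho A) V W" "carrier (PR U W) = maps (ho A) U W"
    using W maps_Obj[OF f] by (simp_all add: coeff.carrier_P)
  show "hc x (cls f) \<in> carrier (PR U W)" if "x \<in> carrier (PR V W)" for x
    using coeff.Comp_in[OF cls_in[OF f]] that unfolding c by blast
  show "hc (x \<oplus>\<^bsub>PR V W\<^esub> y) (cls f) = hc x (cls f) \<oplus>\<^bsub>PR U W\<^esub> hc y (cls f)"
    if "x \<in> carrier (PR V W)" "y \<in> carrier (PR V W)" for x y
    using coeff.Comp_add_left[OF cls_in[OF f]] that unfolding c by simp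
qed (use G in simp)

lemma Dm_lin_left:
  assumes V: "V \<in> Obj A" and U: "U \<in> Obj A" and Y: "Y \<in> Obj A" and F: "\<And>i. F i \<in> carrier (P U V)"
    and d: "d \<in> carrier (D V Y)"
  shows "Dm (lin (PR U V) n a F) (Ident (ho A) Y) d = lin (DR U Y) n a (\<lambda>i. Dm (F i) (Ident (ho A) Y) d)"
proof (rule hom_lin[of _ _ "\<lambda>c. Dm c (Ident (ho A) Y) d"])
  show "abelian_group (PR U V)" "abelian_group (DR U Y)" using PR_abelian_group DR_abelian_group U V Y by auto
  have c: "carrier (PR U V) = maps (ho A) U V" using U V by (simp add: coeff.carrier_P)
  show "Dm x (Ident (ho A) Y) d \<in> carrier (DR U Y)" if "x \<in> carrier (PR U V)" for x
    using hom_in_carrier[OF coeff.Dm_hom[OF _ ho_Ident_in[OF Y]] d] that unfolding c by simp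
  show "Dm (x \<oplus>\<^bsub>PR U V\<^esub> y) (Ident (ho A) Y) d = Dm x (Ident (ho A) Y) d \<oplus>\<^bsub>DR U Y\<^esub> Dm y (Ident (ho A) Y) d"
    if "x \<in> carrier (PR U V)" "y \<in> carrier (PR U V)" for x y
    using coeff.Dm_add_left[OF _ _ ho_Ident_in[OF Y] d] that unfolding c by simp
qed (use F in simp)

lemma Dm_lin_right:
  assumes V: "V \<in> Obj A" and U: "U \<in> Obj A" and Y: "Y \<in> Obj A" and F: "\<And>i. F i \<in> carrier (P U V)"
    and d: "d \<in> carrier (D Y U)"
  shows "Dm (Ident (ho A) Y) (lin (PR U V) n a F) d = lin (DR Y V) n a (\<lambda>i. Dm (Ident (ho A) Y) (F i) d)"
proof (rule hom_lin[of _ _ "\<lambda>c. Dm (Ident (ho A) Y) c d"])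
  show "abelian_group (PR U V)" "abelian_group (DR Y V)" using PR_abelian_group DR_abelian_group U V Y by auto
  have c: "carrier (PR U V) = maps (ho A) U V" using U V by (simp add: coeff.carrier_P)
  show "Dm (Ident (ho A) Y) x d \<in> carrier (DR Y V)" if "x \<in> carrier (PR U V)" for x
    using hom_in_carrier[OF coeff.Dm_hom[OF ho_Ident_in[OF Y]] d] that unfolding c by simp
  show "Dm (Ident (ho A) Y) (x \<oplus>\<^bsub>PR U V\<^esub> y) d = Dm (Ident (ho A) Y) x d \<oplus>\<^bsub>DR Y V\<^esub> Dm (Ident (ho A) Y) y d"
    if "x \<in> carrier (PR U V)" "y \<in> carrier (PR U V)" for x y
    using coeff.Dm_add_right[OF ho_Ident_in[OF Y] _ _ d] that unfolding c by simp
qed (use F in simp)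

text \<open>The group of maps into the zero object is trivial, and composition with \<open>g\<close>
  is additive, so it carries neutral element to neutral element.\<close>

lemma cls_zm: "\<lbrakk>U \<in> Obj A; V \<in> Obj A\<rbrakk> \<Longrightarrow> cls (zm U V) = \<one>\<^bsub>P U V\<^esub>"
proof -
  assume UV: "U \<in> Obj A" "V \<in> Obj A"
  obtain f g where fg: "f \<in> maps A U z" "g \<in> maps A z V" "zm U V = g \<bullet> f" using zm_factor UV by blast
  interpret P1: comm_group "P U z" by (rule P_comm_group[OF UV(1) zero_in])
  interpret P2: abelian_group "PR U V" by (rule PR_abelian_group[OF UV])
  have "carrier (P U z) = {cls f}"
    unfolding PR_carrier[OF UV(1) zero_in] using fg(1) to_zero_unique by blast
  then have "cls f = \<one>\<^bsub>P U z\<^esub>" using P1.one_closed by blast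
  \<comment> \<open>The neutral element is written as a combination over no indices, so that
    \<open>hc_lin_right\<close> applies to it.\<close>
  then have "cls (zm U V) = hc (cls g) (lin (PR U z) 0 (\<lambda>_. 0) (\<lambda>_. \<one>\<^bsub>P U z\<^esub>))"
    using fg ho_Comp[OF fg(1,2)] abelian_group.lin_0[OF PR_abelian_group[OF UV(1) zero_in]] by simp
  also have "\<dots> = \<one>\<^bsub>P U V\<^esub>"
    by (subst hc_lin_right[OF fg(2) UV(1)]) (simp_all add: P2.lin_0)
  finally show ?thesis .
qed

end

locale copowers = additive_track_category A P D Dm z \<sigma>
  for A :: "('o, 'm, 't, 'z) track_cat_scheme"
    and P :: "'o \<Rightarrow> 'o \<Rightarrow> 'm set monoid"
    and D :: "'o \<Rightarrow> 'o \<Rightarrow> 'd monoid"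
    and Dm :: "'m set \<Rightarrow> 'm set \<Rightarrow> 'd \<Rightarrow> 'd"
    and z :: 'o
    and \<sigma> :: "'m \<Rightarrow> 'd \<Rightarrow> 't" +
  fixes T :: "('o, 'm) sum_choice" and X :: 'o
  assumes coproducts: "strict_coproducts A T" and X_in: "X \<in> Obj A"
begin

section \<open>Wedges and iterated copowers\<close>

lemma Wedge_in: "\<lbrakk>U \<in> Obj A; V \<in> Obj A\<rbrakk> \<Longrightarrow> Wedge T U V \<in> Obj A"
  and Inc1_in: "\<lbrakk>U \<in> Obj A; V \<in> Obj A\<rbrakk> \<Longrightarrow> Inc1 T U V \<in> maps A U (Wedge T U V)"
  and Inc2_in: "\<lbrakk>U \<in> Obj A; V \<in> Obj A\<rbrakk> \<Longrightarrow> Inc2 T U V \<in> maps A V (Wedge T U V)"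
  using coproducts by (auto simp: strict_coproducts_def)

lemma wedge_iso: "\<lbrakk>U \<in> Obj A; V \<in> Obj A; Z \<in> Obj A\<rbrakk> \<Longrightarrow>
  is_cat_iso (hom_groupoid A (Wedge T U V) Z) (prod_cat (hom_groupoid A U Z) (hom_groupoid A V Z))
         (\<lambda>m. (Comp A m (Inc1 T U V), Comp A m (Inc2 T U V)))
         (\<lambda>\<eta>. (pull A (Inc1 T U V) \<eta>, pull A (Inc2 T U V) \<eta>))"
  using coproducts by (auto simp: strict_coproducts_def)

lemma wedge_map_ex:
  assumes "a \<in> maps A U Z" "b \<in> maps A V Z"
  shows "\<exists>m \<in> maps A (Wedge T U V) Z. m \<bullet> Inc1 T U V = a \<and> m \<bullet> Inc2 T U V = b"
proof -
  have "bij_betw (\<lambda>m. (m \<bullet> Inc1 T U V, m \<bullet> Inc2 T U V)) (maps A (Wedge T U V) Z) (maps A U Z \<times> maps A V Z)"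
    using wedge_iso[of U V Z] assms maps_Obj by (auto simp: is_cat_iso_def)
  then have "(a, b) \<in> (\<lambda>m. (m \<bullet> Inc1 T U V, m \<bullet> Inc2 T U V)) ` maps A (Wedge T U V) Z"
    using assms by (auto simp: bij_betw_def)
  then show ?thesis by auto
qed

lemma wedge_map_unique:
  assumes "U \<in> Obj A" "V \<in> Obj A" "m \<in> maps A (Wedge T U V) Z" "m' \<in> maps A (Wedge T U V) Z"
    "m \<bullet> Inc1 T U V = m' \<bullet> Inc1 T U V" "m \<bullet> Inc2 T U V = m' \<bullet> Inc2 T U V"
  shows "m = m'"
proof -
  have "inj_on (\<lambda>m. (m \<bullet> Inc1 T U V, m \<bullet> Inc2 T U V)) (maps A (Wedge T U V) Z)"
    using wedge_iso[of U V Z] assms maps_Obj by (auto simp: is_cat_iso_def bij_betw_def)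
  then show ?thesis using assms by (auto dest!: inj_onD)
qed

text \<open>Surjectivity on tracks provides one with the given components; injectivity on maps then
  forces its source and target to be \<open>m\<close> and \<open>m'\<close>.\<close>

lemma wedge_track_ex:
  assumes UV: "U \<in> Obj A" "V \<in> Obj A" and m: "m \<in> maps A (Wedge T U V) Z" "m' \<in> maps A (Wedge T U V) Z"
    and \<alpha>: "\<alpha> \<in> tracks A (m \<bullet> Inc1 T U V) (m' \<bullet> Inc1 T U V)"
    and \<beta>: "\<beta> \<in> tracks A (m \<bullet> Inc2 T U V) (m' \<bullet> Inc2 T U V)"
  shows "\<exists>\<eta> \<in> tracks A m m'. \<eta> \<triangleleft> Inc1 T U V = \<alpha> \<and> \<eta> \<triangleleft> Inc2 T U V = \<beta>"
proof -
  have "bij_betw (\<lambda>\<eta>. (\<eta> \<triangleleft> Inc1 T U V, \<eta> \<triangleleft> Inc2 T U V)) (Arr (hom_groupoid A (Wedge T U V) Z))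
      (Arr (hom_groupoid A U Z) \<times> Arr (hom_groupoid A V Z))"
    using wedge_iso[of U V Z] UV maps_Obj[OF m(1)] by (auto simp: is_cat_iso_def)
  moreover have "(\<alpha>, \<beta>) \<in> Arr (hom_groupoid A U Z) \<times> Arr (hom_groupoid A V Z)"
    using \<alpha> \<beta> Comp_in[OF Inc1_in[OF UV] m(1)] Comp_in[OF Inc2_in[OF UV] m(1)] by (auto simp: tracks_def)
  ultimately have "(\<alpha>, \<beta>) \<in> (\<lambda>\<eta>. (\<eta> \<triangleleft> Inc1 T U V, \<eta> \<triangleleft> Inc2 T U V)) ` Arr (hom_groupoid A (Wedge T U V) Z)"
    by (simp add: bij_betw_def)
  then obtain \<eta> where \<eta>: "\<eta> \<in> Arr (hom_groupoid A (Wedge T U V) Z)" "\<eta> \<triangleleft> Inc1 T U V = \<alpha>" "\<eta> \<triangleleft> Inc2 T U V = \<beta>"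
    by auto
  define s t where "s = TSrc A \<eta>" and "t = TTgt A \<eta>"
  have \<eta>': "\<eta> \<in> tracks A s t" and s: "s \<in> maps A (Wedge T U V) Z"
    using \<eta>(1) by (auto simp: tracks_def s_def t_def)
  have t: "t \<in> maps A (Wedge T U V) Z" by (rule tracks_maps[OF \<eta>' s])
  have 1: "\<alpha> \<in> tracks A (s \<bullet> Inc1 T U V) (t \<bullet> Inc1 T U V)" using pull_in[OF \<eta>' s Inc1_in[OF UV]] \<eta> by simp
  have 2: "\<beta> \<in> tracks A (s \<bullet> Inc2 T U V) (t \<bullet> Inc2 T U V)" using pull_in[OF \<eta>' s Inc2_in[OF UV]] \<eta> by simp
  have "s = m" using \<alpha> \<beta> 1 2 by (intro wedge_map_unique[OF UV s m(1)]) (auto simp: tracks_def)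
  moreover have "t = m'" using \<alpha> \<beta> 1 2 by (intro wedge_map_unique[OF UV t m(2)]) (auto simp: tracks_def)
  ultimately show ?thesis using \<eta> \<eta>' by blast
qed

lemma wedge_track_unique:
  assumes UV: "U \<in> Obj A" "V \<in> Obj A" and m: "m \<in> maps A (Wedge T U V) Z"
    and "\<eta> \<in> tracks A m m'" "\<eta>' \<in> tracks A m m''"
    "\<eta> \<triangleleft> Inc1 T U V = \<eta>' \<triangleleft> Inc1 T U V" "\<eta> \<triangleleft> Inc2 T U V = \<eta>' \<triangleleft> Inc2 T U V"
  shows "\<eta> = \<eta>'"
proof -
  have "inj_on (\<lambda>\<eta>. (\<eta> \<triangleleft> Inc1 T U V, \<eta> \<triangleleft> Inc2 T U V)) (Arr (hom_groupoid A (Wedge T U V) Z))"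
    using wedge_iso[of U V Z] UV maps_Obj[OF m(1)] by (auto simp: is_cat_iso_def bij_betw_def)
  moreover have "\<eta> \<in> Arr (hom_groupoid A (Wedge T U V) Z)" "\<eta>' \<in> Arr (hom_groupoid A (Wedge T U V) Z)"
    using assms by (auto simp: tracks_def)
  ultimately show ?thesis using assms by (auto dest!: inj_onD)
qed

text \<open>One summand is treated separately so that \<open>pw 1\<close> is \<open>X\<close>
  itself: the wedge of \<open>z\<close> and \<open>X\<close> need only be isomorphic to
  \<open>X\<close>, while a weak cogroup structure on \<open>X\<close> asks for equality.\<close>

primrec pw :: "nat \<Rightarrow> 'o" where
  "pw 0 = z"
| "pw (Suc n) = (if n = 0 then X else Wedge T (pw n) X)"

text \<open>Indices outside \<open>{1..q}\<close> give zero maps, still from \<open>X\<close> to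
  \<open>pw q\<close>. This totality matches the premises of the lemmas on \<open>lin\<close>, which
  range over all indices.\<close>

primrec inc :: "nat \<Rightarrow> nat \<Rightarrow> 'm" where
  "inc 0 i = zm X z"
| "inc (Suc n) i = (if n = 0 then (if i = 1 then Ident A X else zm X X)
     else if i = Suc n then Inc2 T (pw n) X else Inc1 T (pw n) X \<bullet> inc n i)"

lemma pw_1 [simp]: "pw 1 = X" by (simp add: One_nat_def)

lemma pw_in [simp]: "pw q \<in> Obj A"
  by (induction q) (simp_all add: zero_in X_in Wedge_in)

lemma inc_in: "inc q i \<in> maps A X (pw q)"
proof (induction q)
  case 0 then show ?case by (simp add: zm_in X_in zero_in)
next
  case (Suc q)
  then show ?case using Comp_in[OF Suc Inc1_in[OF pw_in X_in, of q]]
    by (auto simp: Ident_in zm_in X_in Inc2_in)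
qed

lemma inc_1 [simp]: "inc 1 1 = Ident A X" by (simp add: One_nat_def)

lemma pw_map_ex:
  assumes "Z \<in> Obj A" "\<And>i. i \<in> {1..q} \<Longrightarrow> h i \<in> maps A X Z"
  shows "\<exists>m \<in> maps A (pw q) Z. \<forall>i \<in> {1..q}. m \<bullet> inc q i = h i"
  using assms(2)
proof (induction q)
  case 0
  then show ?case using from_zero_ex[OF assms(1)] by auto
next
  case (Suc q)
  show ?case
  proof (cases "q = 0")
    case True
    then show ?thesis using Suc.prems[of 1] Comp_Ident[of "h 1" X Z]
      by (intro bexI[of _ "h 1"]) (auto simp: atLeastAtMostSuc_conv One_nat_def)
  next
    case False
    from Suc obtain m where m: "m \<in> maps A (pw q) Z" "\<forall>i \<in> {1..q}. m \<bullet> inc q i = h i" by auto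
    have h: "h (Suc q) \<in> maps A X Z" using Suc.prems by simp
    obtain m' where m': "m' \<in> maps A (Wedge T (pw q) X) Z" "m' \<bullet> Inc1 T (pw q) X = m" "m' \<bullet> Inc2 T (pw q) X = h (Suc q)"
      using wedge_map_ex[OF m(1) h] by blast
    have "m' \<bullet> inc (Suc q) i = h i" if "i \<in> {1..Suc q}" for i
    proof (cases "i = Suc q")
      case True then show ?thesis using m' \<open>q \<noteq> 0\<close> by simp
    next
      case i: False
      then show ?thesis using m' m(2) \<open>q \<noteq> 0\<close> that Comp_assoc[OF inc_in Inc1_in[OF pw_in X_in] m'(1), of i] by simp
    qed
    moreover have "m' \<in> maps A (pw (Suc q)) Z" using m'(1) False by simp
    ultimately show ?thesis by blast
  qed
qed

lemma pw_map_unique: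
  assumes "m \<in> maps A (pw q) Z" "m' \<in> maps A (pw q) Z"
    and "\<And>i. i \<in> {1..q} \<Longrightarrow> m \<bullet> inc q i = m' \<bullet> inc q i"
  shows "m = m'"
  using assms
proof (induction q arbitrary: m m')
  case 0
  then show ?case using from_zero_unique by simp
next
  case (Suc q)
  show ?case
  proof (cases "q = 0")
    case True
    then show ?thesis using Suc.prems(1,2) Suc.prems(3)[of 1]
      by (simp add: Comp_Ident One_nat_def[symmetric])
  next
    case False
    have m: "m \<in> maps A (Wedge T (pw q) X) Z" "m' \<in> maps A (Wedge T (pw q) X) Z" using Suc.prems False by auto
    note I1 = Inc1_in[OF pw_in X_in, of q]
    have "m \<bullet> Inc1 T (pw q) X = m' \<bullet> Inc1 T (pw q) X"
    proof (rule Suc.IH)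
      show "m \<bullet> Inc1 T (pw q) X \<in> maps A (pw q) Z" "m' \<bullet> Inc1 T (pw q) X \<in> maps A (pw q) Z"
        using Comp_in[OF I1] m by auto
      show "(m \<bullet> Inc1 T (pw q) X) \<bullet> inc q i = (m' \<bullet> Inc1 T (pw q) X) \<bullet> inc q i" if "i \<in> {1..q}" for i
        using Suc.prems(3)[of i] that False
        by (simp add: Comp_assoc[OF inc_in I1 m(1)] Comp_assoc[OF inc_in I1 m(2)])
    qed
    moreover have "m \<bullet> Inc2 T (pw q) X = m' \<bullet> Inc2 T (pw q) X"
      using Suc.prems(3)[of "Suc q"] False by simp
    ultimately show ?thesis by (rule wedge_map_unique[OF pw_in X_in m])
  qed
qed

lemma pw_track_ex:
  assumes "m \<in> maps A (pw q) Z" "m' \<in> maps A (pw q) Z"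
    and "\<And>i. i \<in> {1..q} \<Longrightarrow> \<eta> i \<in> tracks A (m \<bullet> inc q i) (m' \<bullet> inc q i)"
  shows "\<exists>\<theta> \<in> tracks A m m'. \<forall>i \<in> {1..q}. \<theta> \<triangleleft> inc q i = \<eta> i"
  using assms
proof (induction q arbitrary: m m')
  case 0
  then have "m = m'" using from_zero_unique by simp
  then show ?case using tid_in[OF 0(1)] by auto
next
  case (Suc q)
  show ?case
  proof (cases "q = 0")
    case True
    then have m: "m \<in> maps A X Z" "m' \<in> maps A X Z" using Suc.prems by auto
    have "\<eta> 1 \<in> tracks A m m'" using Suc.prems(3)[of 1] True m
      by (simp add: Comp_Ident One_nat_def[symmetric])
    then show ?thesis using pull_Ident[of "\<eta> 1" m m' X Z] m True
      by (intro bexI[of _ "\<eta> 1"]) (auto simp: atLeastAtMostSuc_conv One_nat_def)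
  next
    case False
    have m: "m \<in> maps A (Wedge T (pw q) X) Z" "m' \<in> maps A (Wedge T (pw q) X) Z" using Suc.prems False by auto
    note I1 = Inc1_in[OF pw_in X_in, of q]
    have "\<exists>\<theta> \<in> tracks A (m \<bullet> Inc1 T (pw q) X) (m' \<bullet> Inc1 T (pw q) X). \<forall>i \<in> {1..q}. \<theta> \<triangleleft> inc q i = \<eta> i"
    proof (rule Suc.IH)
      show "m \<bullet> Inc1 T (pw q) X \<in> maps A (pw q) Z" "m' \<bullet> Inc1 T (pw q) X \<in> maps A (pw q) Z"
        using Comp_in[OF I1] m by auto
      show "\<eta> i \<in> tracks A ((m \<bullet> Inc1 T (pw q) X) \<bullet> inc q i) ((m' \<bullet> Inc1 T (pw q) X) \<bullet> inc q i)" if "i \<in> {1..q}" for i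
        using Suc.prems(3)[of i] that False
        by (simp add: Comp_assoc[OF inc_in I1 m(1)] Comp_assoc[OF inc_in I1 m(2)])
    qed
    then obtain \<alpha> where \<alpha>: "\<alpha> \<in> tracks A (m \<bullet> Inc1 T (pw q) X) (m' \<bullet> Inc1 T (pw q) X)"
      "\<forall>i \<in> {1..q}. \<alpha> \<triangleleft> inc q i = \<eta> i" by blast
    have \<beta>: "\<eta> (Suc q) \<in> tracks A (m \<bullet> Inc2 T (pw q) X) (m' \<bullet> Inc2 T (pw q) X)"
      using Suc.prems(3)[of "Suc q"] False by simp
    obtain \<theta> where \<theta>: "\<theta> \<in> tracks A m m'" "\<theta> \<triangleleft> Inc1 T (pw q) X = \<alpha>" "\<theta> \<triangleleft> Inc2 T (pw q) X = \<eta> (Suc q)"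
      using wedge_track_ex[OF pw_in X_in m \<alpha>(1) \<beta>] by blast
    have "\<theta> \<triangleleft> inc (Suc q) i = \<eta> i" if "i \<in> {1..Suc q}" for i
    proof (cases "i = Suc q")
      case True then show ?thesis using \<theta> False by simp
    next
      case i: False
      then show ?thesis using \<theta> \<alpha>(2) False that pull_pull[OF \<theta>(1) m(1) I1 inc_in, of i] by simp
    qed
    then show ?thesis using \<theta>(1) by blast
  qed
qed

lemma pw_track_unique:
  assumes "m \<in> maps A (pw q) Z" "\<theta> \<in> tracks A m m'" "\<theta>' \<in> tracks A m m'"
    and "\<And>i. i \<in> {1..q} \<Longrightarrow> \<theta> \<triangleleft> inc q i = \<theta>' \<triangleleft> inc q i"
  shows "\<theta> = \<theta>'"
  using assms
proof (induction q arbitrary: m m' \<theta> \<theta>')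
  case 0
  then show ?case using track_from_zero[of \<theta> m m' Z] track_from_zero[of \<theta>' m m' Z] by simp
next
  case (Suc q)
  show ?case
  proof (cases "q = 0")
    case True
    then have m: "m \<in> maps A X Z" using Suc.prems by auto
    show ?thesis
      using Suc.prems(4)[of 1] True pull_Ident[OF Suc.prems(2) m] pull_Ident[OF Suc.prems(3) m]
      by (simp add: One_nat_def[symmetric])
  next
    case False
    have m: "m \<in> maps A (Wedge T (pw q) X) Z" using Suc.prems False by auto
    note I1 = Inc1_in[OF pw_in X_in, of q]
    have "\<theta> \<triangleleft> Inc1 T (pw q) X = \<theta>' \<triangleleft> Inc1 T (pw q) X"
    proof (rule Suc.IH)
      show "m \<bullet> Inc1 T (pw q) X \<in> maps A (pw q) Z" using Comp_in[OF I1 m] .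
      show "\<theta> \<triangleleft> Inc1 T (pw q) X \<in> tracks A (m \<bullet> Inc1 T (pw q) X) (m' \<bullet> Inc1 T (pw q) X)"
        "\<theta>' \<triangleleft> Inc1 T (pw q) X \<in> tracks A (m \<bullet> Inc1 T (pw q) X) (m' \<bullet> Inc1 T (pw q) X)"
        using pull_in[OF _ m I1] Suc.prems by auto
      show "\<theta> \<triangleleft> Inc1 T (pw q) X \<triangleleft> inc q i = \<theta>' \<triangleleft> Inc1 T (pw q) X \<triangleleft> inc q i" if "i \<in> {1..q}" for i
        using Suc.prems(4)[of i] that False
        by (simp add: pull_pull[OF Suc.prems(2) m I1 inc_in] pull_pull[OF Suc.prems(3) m I1 inc_in])
    qed
    moreover have "\<theta> \<triangleleft> Inc2 T (pw q) X = \<theta>' \<triangleleft> Inc2 T (pw q) X"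
      using Suc.prems(4)[of "Suc q"] False by simp
    ultimately show ?thesis by (rule wedge_track_unique[OF pw_in X_in m Suc.prems(2,3)])
  qed
qed

definition fam :: "nat \<Rightarrow> 'o \<Rightarrow> (nat \<Rightarrow> 'm) \<Rightarrow> 'm" where
  "fam q Z h = (THE m. m \<in> maps A (pw q) Z \<and> (\<forall>i \<in> {1..q}. m \<bullet> inc q i = h i))"

text \<open>The ends \<open>m\<close> and \<open>m'\<close> are arguments because for
  \<open>q = 0\<close> there are no components that could determine them.\<close>

definition tfam :: "nat \<Rightarrow> 'm \<Rightarrow> 'm \<Rightarrow> (nat \<Rightarrow> 't) \<Rightarrow> 't" where
  "tfam q m m' \<eta> = (THE \<theta>. \<theta> \<in> tracks A m m' \<and> (\<forall>i \<in> {1..q}. \<theta> \<triangleleft> inc q i = \<eta> i))"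

lemma fam:
  assumes "Z \<in> Obj A" "\<And>i. i \<in> {1..q} \<Longrightarrow> h i \<in> maps A X Z"
  shows fam_in: "fam q Z h \<in> maps A (pw q) Z"
    and fam_inc: "i \<in> {1..q} \<Longrightarrow> fam q Z h \<bullet> inc q i = h i"
proof -
  have "\<exists>!m. m \<in> maps A (pw q) Z \<and> (\<forall>i \<in> {1..q}. m \<bullet> inc q i = h i)"
  proof (rule ex_ex1I)
    show "\<exists>m. m \<in> maps A (pw q) Z \<and> (\<forall>i \<in> {1..q}. m \<bullet> inc q i = h i)" using pw_map_ex[of Z q h] assms by blast
    fix m m' assume "m \<in> maps A (pw q) Z \<and> (\<forall>i \<in> {1..q}. m \<bullet> inc q i = h i)"
      "m' \<in> maps A (pw q) Z \<and> (\<forall>i \<in> {1..q}. m' \<bullet> inc q i = h i)"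
    then show "m = m'" by (intro pw_map_unique[of m q Z m']) auto
  qed
  from theI'[OF this] show "fam q Z h \<in> maps A (pw q) Z" "i \<in> {1..q} \<Longrightarrow> fam q Z h \<bullet> inc q i = h i"
    unfolding fam_def by blast+
qed

lemma tfam:
  assumes "m \<in> maps A (pw q) Z" "m' \<in> maps A (pw q) Z"
    and "\<And>i. i \<in> {1..q} \<Longrightarrow> \<eta> i \<in> tracks A (m \<bullet> inc q i) (m' \<bullet> inc q i)"
  shows tfam_in: "tfam q m m' \<eta> \<in> tracks A m m'"
    and tfam_inc: "i \<in> {1..q} \<Longrightarrow> tfam q m m' \<eta> \<triangleleft> inc q i = \<eta> i"
proof -
  obtain \<theta> where \<theta>: "\<theta> \<in> tracks A m m'" "\<forall>i \<in> {1..q}. \<theta> \<triangleleft> inc q i = \<eta> i"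
    using pw_track_ex[of m q Z m' \<eta>] assms by blast
  have "\<exists>!\<theta>. \<theta> \<in> tracks A m m' \<and> (\<forall>i \<in> {1..q}. \<theta> \<triangleleft> inc q i = \<eta> i)"
  proof (rule ex1I[of _ \<theta>])
    fix \<theta>' assume "\<theta>' \<in> tracks A m m' \<and> (\<forall>i \<in> {1..q}. \<theta>' \<triangleleft> inc q i = \<eta> i)"
    then show "\<theta>' = \<theta>" using pw_track_unique[OF assms(1), of \<theta>' m' \<theta>] \<theta> by auto
  qed (use \<theta> in blast)
  from theI'[OF this] show "tfam q m m' \<eta> \<in> tracks A m m'" "i \<in> {1..q} \<Longrightarrow> tfam q m m' \<eta> \<triangleleft> inc q i = \<eta> i"
    unfolding tfam_def by blast+
qed

text \<open>Tracks chosen on the individual summands glue, so homotopy classes of maps out of a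
  copower are detected on the summands.\<close>

lemma pw_cls_eq:
  assumes "m \<in> maps A (pw q) Z" "m' \<in> maps A (pw q) Z"
    and "\<And>i. i \<in> {1..q} \<Longrightarrow> cls (m \<bullet> inc q i) = cls (m' \<bullet> inc q i)"
  shows "cls m = cls m'"
proof -
  have "\<exists>\<eta>. \<eta> \<in> tracks A (m \<bullet> inc q i) (m' \<bullet> inc q i)" if "i \<in> {1..q}" for i
    using track_class_eq_iff[OF Comp_in[OF inc_in assms(1)] Comp_in[OF inc_in assms(2)]] assms(3)[OF that] by auto
  then obtain \<eta> where "\<And>i. i \<in> {1..q} \<Longrightarrow> \<eta> i \<in> tracks A (m \<bullet> inc q i) (m' \<bullet> inc q i)" by metis
  then show ?thesis using pw_track_ex[OF assms(1,2)] track_class_eq_iff[OF assms(1,2)] by blast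
qed

text \<open>Representatives of the integral homotopy classes: \<open>num m : X \<rightarrow> X\<close> of class \<open>m\<close>, and \<open>rmap\<close>,
  \<open>cmap\<close>, \<open>mmap\<close> for rows \<open>X\<^sub>q \<rightarrow> X\<close>, columns \<open>X \<rightarrow> X\<^sub>q\<close> and matrices \<open>X\<^sub>q \<rightarrow> X\<^sub>r\<close>. Rows and matrices
  are strictly determined by their restrictions to the summands, columns are not determined by
  their projections.\<close>

definition num :: "int \<Rightarrow> 'm" where
  "num m = (if m = 0 then zm X X else if m = 1 then Ident A X
     else (SOME f. f \<in> maps A X X \<and> cls f = add_pow (PR X X) m (cls (Ident A X))))"

lemma PR_carrier_ex: "\<lbrakk>U \<in> Obj A; V \<in> Obj A; c \<in> carrier (P U V)\<rbrakk> \<Longrightarrow> \<exists>f. f \<in> maps A U V \<and> cls f = c"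
  by (auto simp: PR_carrier)

lemma num: "num m \<in> maps A X X \<and> cls (num m) = add_pow (PR X X) m (cls (Ident A X))"
proof -
  interpret abelian_group "PR X X" by (rule PR_abelian_group[OF X_in X_in])
  have I: "cls (Ident A X) \<in> carrier (PR X X)" using cls_in_P[OF Ident_in[OF X_in]] by simp
  then have "\<exists>f. f \<in> maps A X X \<and> cls f = add_pow (PR X X) m (cls (Ident A X))"
    using PR_carrier_ex[OF X_in X_in] add.int_pow_closed[OF I, of m] by simp
  from someI_ex[OF this] show ?thesis
    using I by (auto simp: num_def zm_in X_in cls_zm Ident_in)
qed

lemma num_in: "num m \<in> maps A X X" and cls_num: "cls (num m) = add_pow (PR X X) m (cls (Ident A X))"
  using num by auto

lemma num_0 [simp]: "num 0 = zm X X" and num_1 [simp]: "num 1 = Ident A X"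
  by (simp_all add: num_def)

definition rmap :: "nat \<Rightarrow> (nat \<Rightarrow> int) \<Rightarrow> 'm" where
  "rmap q a = fam q X (\<lambda>i. num (a i))"

lemma rmap_in: "rmap q a \<in> maps A (pw q) X"
  and rmap_inc: "i \<in> {1..q} \<Longrightarrow> rmap q a \<bullet> inc q i = num (a i)"
  unfolding rmap_def by (rule fam[OF X_in num_in]; assumption)+

abbreviation proj where "proj q k \<equiv> rmap q (axis k)"

text \<open>Zero and unit columns get strict representatives, all others any map of the right class.
  The strict values make zero maps, inclusions and identities come out strictly preserved and make
  \<open>c\<close> normalised.\<close>

definition cmap :: "nat \<Rightarrow> (nat \<Rightarrow> int) \<Rightarrow> 'm" where
  "cmap q x = (if x = (\<lambda>_. 0) then zm X (pw q)
     else if \<exists>i \<in> {1..q}. x = axis i then inc q (SOME i. i \<in> {1..q} \<and> x = axis i)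
     else (SOME f. f \<in> maps A X (pw q) \<and> cls f = lin (PR X (pw q)) q x (\<lambda>i. cls (inc q i))))"

lemma axis_inj: "axis i = axis j \<Longrightarrow> i = j"
  using axis_apply[of i i] axis_apply[of j i] by (auto split: if_splits)

lemma axis_nonzero: "axis i \<noteq> (\<lambda>_. 0)"
  using axis_apply[of i i] by auto

lemma cmap_zero [simp]: "cmap q (\<lambda>_. 0) = zm X (pw q)" by (simp add: cmap_def)

lemma cmap_axis: "i \<in> {1..q} \<Longrightarrow> cmap q (axis i) = inc q i"
proof -
  assume i: "i \<in> {1..q}"
  have "(SOME j. j \<in> {1..q} \<and> axis i = axis j) = i" using i axis_inj by (intro some_equality) auto
  then show ?thesis using i axis_nonzero[of i] by (auto simp: cmap_def)
qed

lemma cls_inc_in: "cls (inc q i) \<in> carrier (P X (pw q))"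
  by (rule cls_in_P[OF inc_in])

lemma cmap: "cmap q x \<in> maps A X (pw q) \<and> cls (cmap q x) = lin (PR X (pw q)) q x (\<lambda>i. cls (inc q i))"
proof -
  interpret abelian_group "PR X (pw q)" by (rule PR_abelian_group[OF X_in pw_in])
  have ex: "\<exists>f. f \<in> maps A X (pw q) \<and> cls f = lin (PR X (pw q)) q x (\<lambda>i. cls (inc q i))"
    using PR_carrier_ex[OF X_in pw_in[of q]] lin_closed[of "\<lambda>i. cls (inc q i)" q x] cls_inc_in by simp
  consider "x = (\<lambda>_. 0)" | i where "i \<in> {1..q}" "x = axis i" | "x \<noteq> (\<lambda>_. 0)" "\<not> (\<exists>i \<in> {1..q}. x = axis i)" by blast
  then show ?thesis
  proof cases
    case 1 then show ?thesis using lin_vzero[of q "\<lambda>i. cls (inc q i)"] by (simp add: zm_in X_in cls_zm)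
  next
    case 2 then show ?thesis
      using lin_axis[of i q "\<lambda>i. cls (inc q i)"] cls_inc_in by (simp add: cmap_axis inc_in)
  next
    case 3 then show ?thesis using someI_ex[OF ex] by (simp add: cmap_def)
  qed
qed

lemma cmap_in: "cmap q x \<in> maps A X (pw q)"
  and cls_cmap: "cls (cmap q x) = lin (PR X (pw q)) q x (\<lambda>i. cls (inc q i))"
  using cmap by auto

definition mmap :: "nat \<Rightarrow> nat \<Rightarrow> (nat \<Rightarrow> nat \<Rightarrow> int) \<Rightarrow> 'm" where
  "mmap q r f = fam q (pw r) (\<lambda>i. cmap r (f i))"

lemma mmap_in: "mmap q r f \<in> maps A (pw q) (pw r)"
  and mmap_inc: "i \<in> {1..q} \<Longrightarrow> mmap q r f \<bullet> inc q i = cmap r (f i)"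
  unfolding mmap_def by (rule fam[OF pw_in cmap_in]; assumption)+

lemma cls_comp_cmap:
  assumes m: "m \<in> maps A (pw q) Y"
  shows "cls (m \<bullet> cmap q x) = lin (PR X Y) q x (\<lambda>i. cls (m \<bullet> inc q i))"
proof -
  have "cls (m \<bullet> cmap q x) = hc (cls m) (lin (PR X (pw q)) q x (\<lambda>i. cls (inc q i)))"
    using ho_Comp[OF cmap_in m] by (simp add: cls_cmap)
  also have "\<dots> = lin (PR X Y) q x (\<lambda>i. cls (m \<bullet> inc q i))"
    using hc_lin_right[OF m X_in cls_inc_in] ho_Comp[OF inc_in m] by simp
  finally show ?thesis .
qed

text \<open>On classes composition is linear, and the numbers are multiples of the identity. This
  guarantees the tracks among which \<open>t\<close> chooses.\<close>

lemma cls_rmap_cmap: "cls (rmap q a \<bullet> cmap q x) = cls (num (dot q a x))"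
proof -
  interpret abelian_group "PR X X" by (rule PR_abelian_group[OF X_in X_in])
  have I: "cls (Ident A X) \<in> carrier (PR X X)" using cls_in_P[OF Ident_in[OF X_in]] by simp
  have "cls (rmap q a \<bullet> cmap q x) = lin (PR X X) q x (\<lambda>i. add_pow (PR X X) (a i) (cls (Ident A X)))"
    unfolding cls_comp_cmap[OF rmap_in]
    by (rule lin_cong) (use add.int_pow_closed[OF I] in \<open>simp_all add: rmap_inc cls_num\<close>)
  then show ?thesis using lin_multiples[OF I] by (simp add: cls_num)
qed

lemma cls_mmap_cmap: "cls (mmap q r f \<bullet> cmap q x) = cls (cmap r (app q f x))"
proof -
  interpret abelian_group "PR X (pw r)" by (rule PR_abelian_group[OF X_in pw_in])
  have I: "cls (inc r k) \<in> carrier (PR X (pw r))" for k using cls_inc_in by simp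
  have "cls (mmap q r f \<bullet> cmap q x) = lin (PR X (pw r)) q x (\<lambda>i. lin (PR X (pw r)) r (f i) (\<lambda>k. cls (inc r k)))"
    unfolding cls_comp_cmap[OF mmap_in]
    by (rule lin_cong) (use lin_closed[OF I] in \<open>simp_all add: mmap_inc cls_cmap\<close>)
  then show ?thesis using lin_app[OF I] by (simp add: cls_cmap)
qed

text \<open>A representative \<open>m\<close> of the combination of projections is compared with the
  row on every summand, where a projection restricts to 0 or 1.\<close>

lemma cls_rmap: "cls (rmap q a) = lin (PR (pw q) X) q a (\<lambda>k. cls (proj q k))"
proof -
  interpret Q: abelian_group "PR (pw q) X" by (rule PR_abelian_group[OF pw_in X_in])
  interpret abelian_group "PR X X" by (rule PR_abelian_group[OF X_in X_in])
  have p: "cls (proj q k) \<in> carrier (P (pw q) X)" for k by (rule cls_in_P[OF rmap_in])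
  have I: "cls (Ident A X) \<in> carrier (PR X X)" using cls_in_P[OF Ident_in[OF X_in]] by simp
  have "lin (PR (pw q) X) q a (\<lambda>k. cls (proj q k)) \<in> carrier (P (pw q) X)"
    using Q.lin_closed[of "\<lambda>k. cls (proj q k)" q a] p by simp
  from PR_carrier_ex[OF pw_in X_in this]
  obtain m where m: "m \<in> maps A (pw q) X" "cls m = lin (PR (pw q) X) q a (\<lambda>k. cls (proj q k))"
    by blast
  have "cls (rmap q a) = cls m"
  proof (rule pw_cls_eq[OF rmap_in m(1)])
    fix i assume i: "i \<in> {1..q}"
    have "cls (m \<bullet> inc q i) = lin (PR X X) q a (\<lambda>k. hc (cls (proj q k)) (cls (inc q i)))"
      using ho_Comp[OF inc_in[of q i] m(1)]
        hc_lin_left[OF inc_in[of q i] X_in, where G = "\<lambda>k. cls (proj q k)" and n = q and a = a] p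
      by (simp add: m(2)[symmetric])
    also have "\<dots> = lin (PR X X) q a (\<lambda>k. add_pow (PR X X) (axis k i) (cls (Ident A X)))"
      using ho_Comp[OF inc_in rmap_in] rmap_inc[OF i] by (simp add: cls_num)
    also have "\<dots> = add_pow (PR X X) (dot q (\<lambda>k. axis k i) a) (cls (Ident A X))"
      by (rule lin_multiples[OF I])
    also have "(\<lambda>k. axis k i) = axis i" by (auto simp: axis_def)
    finally show "cls (rmap q a \<bullet> inc q i) = cls (m \<bullet> inc q i)"
      using i by (simp add: rmap_inc cls_num dot_axis_left)
  qed
  then show ?thesis using m by simp
qed

text \<open>Both sides agree on every summand. It says that the copower is a biproduct in
  \<open>ho A\<close>, and biadditivity transports this to \<open>D\<close>.\<close>

lemma cls_Ident_pw: "cls (Ident A (pw q)) = lin (PR (pw q) (pw q)) q (\<lambda>_. 1) (\<lambda>k. cls (inc q k \<bullet> proj q k))"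
proof -
  interpret Q: abelian_group "PR (pw q) (pw q)" by (rule PR_abelian_group[OF pw_in pw_in])
  interpret abelian_group "PR X (pw q)" by (rule PR_abelian_group[OF X_in pw_in])
  have ip: "inc q k \<bullet> proj q k \<in> maps A (pw q) (pw q)" for k by (rule Comp_in[OF rmap_in inc_in])
  have p: "cls (inc q k \<bullet> proj q k) \<in> carrier (P (pw q) (pw q))" for k by (rule cls_in_P[OF ip])
  have I: "cls (inc q k) \<in> carrier (PR X (pw q))" for k using cls_inc_in by simp
  have "lin (PR (pw q) (pw q)) q (\<lambda>_. 1) (\<lambda>k. cls (inc q k \<bullet> proj q k)) \<in> carrier (P (pw q) (pw q))"
    using Q.lin_closed[of "\<lambda>k. cls (inc q k \<bullet> proj q k)" q "\<lambda>_. 1"] p by simp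
  from PR_carrier_ex[OF pw_in pw_in this]
  obtain m where m: "m \<in> maps A (pw q) (pw q)"
    "cls m = lin (PR (pw q) (pw q)) q (\<lambda>_. 1) (\<lambda>k. cls (inc q k \<bullet> proj q k))"
    by blast
  have "cls (Ident A (pw q)) = cls m"
  proof (rule pw_cls_eq[OF Ident_in[OF pw_in] m(1)])
    fix i assume i: "i \<in> {1..q}"
    have "cls (m \<bullet> inc q i) = lin (PR X (pw q)) q (\<lambda>_. 1) (\<lambda>k. hc (cls (inc q k \<bullet> proj q k)) (cls (inc q i)))"
      using ho_Comp[OF inc_in[of q i] m(1)]
        hc_lin_left[OF inc_in[of q i] pw_in[of q], where G = "\<lambda>k. cls (inc q k \<bullet> proj q k)" and n = q and a = "\<lambda>_. 1"] p
      by (simp add: m(2)[symmetric])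
    also have "\<dots> = lin (PR X (pw q)) q (\<lambda>_. 1) (\<lambda>k. if k = i then cls (inc q k) else \<zero>\<^bsub>PR X (pw q)\<^esub>)"
    proof -
      have "hc (cls (inc q k \<bullet> proj q k)) (cls (inc q i)) = (if k = i then cls (inc q k) else \<zero>\<^bsub>PR X (pw q)\<^esub>)" for k
        using ho_Comp[OF inc_in[of q i] ip[of k]] Comp_assoc[OF inc_in[of q i] rmap_in[of q "axis k"] inc_in[of q k], symmetric] rmap_inc[OF i]
          Comp_Ident[OF inc_in] comp_zm[OF inc_in X_in] cls_zm[OF X_in pw_in]
        by (auto simp: axis_apply)
      then show ?thesis by simp
    qed
    also have "\<dots> = cls (inc q i)" by (rule lin_delta[OF i I])
    finally show "cls (Ident A (pw q) \<bullet> inc q i) = cls (m \<bullet> inc q i)"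
      by (simp add: Ident_Comp[OF inc_in])
  qed
  then show ?thesis using m by simp
qed

section \<open>Coefficients of copowers\<close>

lemma dpull_cmap:
  assumes Y: "Y \<in> Obj A" and d: "d \<in> carrier (D (pw q) Y)"
  shows "dpull (cmap q x) Y d = lin (DR X Y) q x (\<lambda>i. dpull (inc q i) Y d)"
  unfolding dpull_def cls_cmap by (rule Dm_lin_left[OF pw_in X_in Y cls_inc_in d])

lemma dpush_rmap:
  assumes Y: "Y \<in> Obj A" and d: "d \<in> carrier (D Y (pw q))"
  shows "dpush Y (rmap q a) d = lin (DR Y X) q a (\<lambda>k. dpush Y (proj q k) d)"
  unfolding dpush_def cls_rmap[of q a]
  by (rule Dm_lin_right[OF X_in pw_in Y cls_in_P[OF rmap_in] d])

lemma dpush_Ident_pw: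
  assumes Y: "Y \<in> Obj A" and d: "d \<in> carrier (D Y (pw q))"
  shows "d = lin (DR Y (pw q)) q (\<lambda>_. 1) (\<lambda>k. dpush Y (inc q k) (dpush Y (proj q k) d))"
proof -
  have "d = Dm (Ident (ho A) Y) (cls (Ident A (pw q))) d"
    using dpush_Ident[OF Y pw_in d] by (simp add: dpush_def)
  also have "\<dots> = lin (DR Y (pw q)) q (\<lambda>_. 1) (\<lambda>k. dpush Y (inc q k \<bullet> proj q k) d)"
    unfolding cls_Ident_pw dpush_def
    by (rule Dm_lin_right[OF pw_in pw_in Y cls_in_P[OF Comp_in[OF rmap_in inc_in]] d])
  finally show ?thesis by (simp add: dpush_dpush[OF rmap_in inc_in Y d])
qed

text \<open>By \<open>dpush_Ident_pw\<close> an element of \<open>D X (pw q)\<close> is the sum of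
  its projections pushed back along the inclusions.\<close>

lemma dpush_proj_eq:
  assumes d: "d \<in> carrier (D X (pw q))" "d' \<in> carrier (D X (pw q))"
    and eq: "\<And>k. k \<in> {1..q} \<Longrightarrow> dpush X (proj q k) d = dpush X (proj q k) d'"
  shows "d = d'"
proof -
  interpret abelian_group "DR X (pw q)" by (rule DR_abelian_group[OF X_in pw_in])
  have "lin (DR X (pw q)) q (\<lambda>_. 1) (\<lambda>k. dpush X (inc q k) (dpush X (proj q k) d)) =
     lin (DR X (pw q)) q (\<lambda>_. 1) (\<lambda>k. dpush X (inc q k) (dpush X (proj q k) d'))"
    by (rule lin_cong)
       (use eq d in \<open>auto intro!: dpush_in[OF inc_in X_in] dpush_in[OF rmap_in X_in]\<close>)
  then show ?thesis using dpush_Ident_pw[OF X_in d(1)] dpush_Ident_pw[OF X_in d(2)] by simp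
qed

text \<open>The class of a zero map is a combination over no indices, and \<open>D\<close> is
  additive in maps.\<close>

lemma dpush_zm:
  assumes "U \<in> Obj A" "V \<in> Obj A" "Y \<in> Obj A" "d \<in> carrier (D Y U)"
  shows "dpush Y (zm U V) d = \<one>\<^bsub>D Y V\<^esub>"
proof -
  interpret PR: abelian_group "PR U V" by (rule PR_abelian_group[OF assms(1,2)])
  interpret DR: abelian_group "DR Y V" by (rule DR_abelian_group[OF assms(3,2)])
  have one: "\<one>\<^bsub>P U V\<^esub> \<in> carrier (P U V)" using PR.zero_closed by simp
  have "cls (zm U V) = lin (PR U V) 0 (\<lambda>_. 0) (\<lambda>_. \<one>\<^bsub>P U V\<^esub>)"
    by (simp add: cls_zm assms)
  then show ?thesis
    unfolding dpush_def using Dm_lin_right[OF assms(2,1,3) one assms(4), of 0 "\<lambda>_. 0"] by simp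
qed

lemma dpush_proj_ex:
  assumes d: "\<And>k. d k \<in> carrier (D X X)"
  shows "\<exists>e \<in> carrier (D X (pw q)). \<forall>k \<in> {1..q}. dpush X (proj q k) e = d k"
proof -
  interpret abelian_group "DR X (pw q)" by (rule DR_abelian_group[OF X_in pw_in])
  interpret M: abelian_group "DR X X" by (rule DR_abelian_group[OF X_in X_in])
  \<comment> \<open>The sum of the images of the \<open>d k\<close> under the inclusions; a
    projection picks out one term.\<close>
  let ?e = "lin (DR X (pw q)) q (\<lambda>_. 1) (\<lambda>k. dpush X (inc q k) (d k))"
  have i: "dpush X (inc q k) (d k) \<in> carrier (DR X (pw q))" for k using dpush_in[OF inc_in X_in d] by simp
  have "dpush X (proj q k) ?e = d k" if k: "k \<in> {1..q}" for k
  proof -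
    have "dpush X (proj q k) ?e = lin (DR X X) q (\<lambda>_. 1) (\<lambda>j. dpush X (proj q k) (dpush X (inc q j) (d j)))"
      by (rule hom_lin[OF abelian_group_axioms M.abelian_group_axioms])
         (use i dpush_in[OF rmap_in X_in] dpush_add[OF rmap_in X_in] in auto)
    also have "\<dots> = lin (DR X X) q (\<lambda>_. 1) (\<lambda>j. if j = k then d j else \<zero>\<^bsub>DR X X\<^esub>)"
    proof (rule M.lin_cong)
      fix j assume j: "j \<in> {1..q}"
      have "dpush X (proj q k) (dpush X (inc q j) (d j)) = dpush X (num (axis k j)) (d j)"
        using dpush_dpush[OF inc_in rmap_in X_in d] rmap_inc[OF j] by simp
      then show "dpush X (proj q k) (dpush X (inc q j) (d j)) = (if j = k then d j else \<zero>\<^bsub>DR X X\<^esub>)"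
        using dpush_Ident[OF X_in X_in d] dpush_zm[OF X_in X_in X_in d] by (simp add: axis_apply)
    qed (use d M.zero_closed in auto)
    also have "\<dots> = d k" using d by (intro M.lin_delta[OF k]) simp
    finally show ?thesis .
  qed
  then show ?thesis using lin_closed[OF i] by (intro bexI[of _ ?e]) auto
qed

end

section \<open>The cocycle of the integral maps between copowers\<close>

context copowers
begin

text \<open>\<open>X\<^sub>r\<close> is not a strict product, but tracks between maps \<open>X \<rightarrow> X\<^sub>r\<close> of the same class are
  determined by their projections, because \<open>D X X\<^sub>r\<close> is the product of the \<open>D X X\<close>.\<close>

lemma lift_ex1:
  assumes y: "y \<in> maps A X (pw r)" and y': "y' \<in> maps A X (pw r)" and yy': "cls y = cls y'"
    and s: "\<And>k. k \<in> {1..r} \<Longrightarrow> s k \<in> tracks A (proj r k \<bullet> y') (v k)"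
    and u: "\<And>k. k \<in> {1..r} \<Longrightarrow> u k \<in> tracks A (proj r k \<bullet> y) (v k)"
  shows "\<exists>!\<eta>. \<eta> \<in> tracks A y y' \<and> (\<forall>k \<in> {1..r}. s k \<box> (proj r k \<triangleright> \<eta>) = u k)"
proof -
  interpret M: comm_group "D X X" using coeff.comm_group_D X_in by simp
  obtain \<eta> where \<eta>: "\<eta> \<in> tracks A y y'" using track_class_eq_iff[OF y y'] yy' by auto
  have p\<eta>: "proj r k \<triangleright> \<eta> \<in> tracks A (proj r k \<bullet> y) (proj r k \<bullet> y')" for k by (rule push_in[OF \<eta> y rmap_in])
  have s\<eta>: "s k \<box> (proj r k \<triangleright> \<eta>) \<in> tracks A (proj r k \<bullet> y) (v k)" if "k \<in> {1..r}" for k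
    by (rule vcomp_in[OF p\<eta> s[OF that]])
  have py: "proj r k \<bullet> y \<in> maps A X X" for k by (rule Comp_in[OF y rmap_in])
  have key: "s k \<box> (proj r k \<triangleright> act e \<eta>) = act (dpush X (proj r k) e) (s k \<box> (proj r k \<triangleright> \<eta>))"
    if "k \<in> {1..r}" "e \<in> carrier (D X (pw r))" for k e
    using push_act[OF \<eta> y rmap_in that(2)] vcomp_act[OF p\<eta> s[OF that(1)] py dpush_in[OF rmap_in X_in that(2)]] by simp
  have "\<exists>d \<in> carrier (D X X). k \<in> {1..r} \<longrightarrow> u k = act d (s k \<box> (proj r k \<triangleright> \<eta>))" for k
  proof (cases "k \<in> {1..r}")
    case True then show ?thesis using act_ex[OF s\<eta>[OF True] u[OF True] py] by blast
  qed auto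
  then obtain d where d: "\<And>k. d k \<in> carrier (D X X)" "\<And>k. k \<in> {1..r} \<Longrightarrow> u k = act (d k) (s k \<box> (proj r k \<triangleright> \<eta>))"
    by metis
  obtain e where e: "e \<in> carrier (D X (pw r))" "\<forall>k \<in> {1..r}. dpush X (proj r k) e = d k"
    using dpush_proj_ex[of d r] d(1) by blast
  show ?thesis
  proof (rule ex1I[of _ "act e \<eta>"])
    show "act e \<eta> \<in> tracks A y y' \<and> (\<forall>k \<in> {1..r}. s k \<box> (proj r k \<triangleright> act e \<eta>) = u k)"
      using act_in[OF \<eta> y e(1)] key[OF _ e(1)] d(2) e(2) by simp
    fix \<theta> assume \<theta>: "\<theta> \<in> tracks A y y' \<and> (\<forall>k \<in> {1..r}. s k \<box> (proj r k \<triangleright> \<theta>) = u k)"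
    then obtain e' where e': "e' \<in> carrier (D X (pw r))" "\<theta> = act e' \<eta>" using act_ex[OF \<eta> _ y] by blast
    have "e' = e"
    proof (rule dpush_proj_eq[OF e'(1) e(1)])
      fix k assume k: "k \<in> {1..r}"
      have "act (dpush X (proj r k) e') (s k \<box> (proj r k \<triangleright> \<eta>)) = act (dpush X (proj r k) e) (s k \<box> (proj r k \<triangleright> \<eta>))"
        using \<theta> e'(2) key[OF k e'(1)] key[OF k e(1)] k d(2)[OF k] e(2) by auto
      then show "dpush X (proj r k) e' = dpush X (proj r k) e"
        by (rule act_inj[OF s\<eta>[OF k] py dpush_in[OF rmap_in X_in e'(1)] dpush_in[OF rmap_in X_in e(1)]])
    qed
    then show "\<theta> = act e \<eta>" using e'(2) by simp
  qed
qed

text \<open>The projections are prescribed after composition with the reference tracks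
  \<open>s k\<close>, because the projections of a column are integral maps only up to
  homotopy.\<close>

definition lift :: "nat \<Rightarrow> 'm \<Rightarrow> 'm \<Rightarrow> (nat \<Rightarrow> 't) \<Rightarrow> (nat \<Rightarrow> 't) \<Rightarrow> 't" where
  "lift r y y' s u = (THE \<eta>. \<eta> \<in> tracks A y y' \<and> (\<forall>k \<in> {1..r}. s k \<box> (proj r k \<triangleright> \<eta>) = u k))"

lemma lift:
  assumes "y \<in> maps A X (pw r)" "y' \<in> maps A X (pw r)" "cls y = cls y'"
    and "\<And>k. k \<in> {1..r} \<Longrightarrow> s k \<in> tracks A (proj r k \<bullet> y') (v k)"
    and "\<And>k. k \<in> {1..r} \<Longrightarrow> u k \<in> tracks A (proj r k \<bullet> y) (v k)"
  shows lift_in: "lift r y y' s u \<in> tracks A y y'"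
    and lift_proj: "k \<in> {1..r} \<Longrightarrow> s k \<box> (proj r k \<triangleright> lift r y y' s u) = u k"
    and lift_unique: "\<lbrakk>\<eta> \<in> tracks A y y'; \<And>k. k \<in> {1..r} \<Longrightarrow> s k \<box> (proj r k \<triangleright> \<eta>) = u k\<rbrakk> \<Longrightarrow> \<eta> = lift r y y' s u"
proof -
  have ex1: "\<exists>!\<eta>. \<eta> \<in> tracks A y y' \<and> (\<forall>k \<in> {1..r}. s k \<box> (proj r k \<triangleright> \<eta>) = u k)"
    by (rule lift_ex1[OF assms(1,2,3), of s v u]) (use assms(4,5) in auto)
  from theI'[OF this] show 1: "lift r y y' s u \<in> tracks A y y'"
    "k \<in> {1..r} \<Longrightarrow> s k \<box> (proj r k \<triangleright> lift r y y' s u) = u k"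
    unfolding lift_def by blast+
  show "\<lbrakk>\<eta> \<in> tracks A y y'; \<And>k. k \<in> {1..r} \<Longrightarrow> s k \<box> (proj r k \<triangleright> \<eta>) = u k\<rbrakk> \<Longrightarrow> \<eta> = lift r y y' s u"
    using the1_equality[OF ex1, of \<eta>] unfolding lift_def by simp
qed

text \<open>A track from a row times a matrix to the product row, glued from tracks \<tau> for the
  single columns; strict sums leave no further choice.\<close>

definition tm :: "nat \<Rightarrow> nat \<Rightarrow> (nat \<Rightarrow> int) \<Rightarrow> (nat \<Rightarrow> nat \<Rightarrow> int) \<Rightarrow> (nat \<Rightarrow> 't) \<Rightarrow> 't" where
  "tm q r a f \<tau> = tfam q (rmap r a \<bullet> mmap q r f) (rmap q (rowmul q r a f)) \<tau>"

abbreviation rc_tracks where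
  "rc_tracks q a x \<equiv> tracks A (rmap q a \<bullet> cmap q x) (num (dot q a x))"

lemma tm:
  assumes "\<And>i. i \<in> {1..q} \<Longrightarrow> \<tau> i \<in> rc_tracks r a (f i)"
  shows tm_in: "tm q r a f \<tau> \<in> tracks A (rmap r a \<bullet> mmap q r f) (rmap q (rowmul q r a f))"
    and tm_inc: "i \<in> {1..q} \<Longrightarrow> tm q r a f \<tau> \<triangleleft> inc q i = \<tau> i"
proof -
  have \<tau>: "\<tau> i \<in> tracks A ((rmap r a \<bullet> mmap q r f) \<bullet> inc q i) (rmap q (rowmul q r a f) \<bullet> inc q i)"
    if i: "i \<in> {1..q}" for i
    using assms[OF i] Comp_assoc[OF inc_in[of q i] mmap_in[of q r f] rmap_in[of r a]] mmap_inc[OF i] rmap_inc[OF i] i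
    by (simp add: rowmul_def)
  note T = tfam[OF Comp_in[OF mmap_in[of q r f] rmap_in[of r a]] rmap_in[of q "rowmul q r a f"], of \<tau>]
  show "tm q r a f \<tau> \<in> tracks A (rmap r a \<bullet> mmap q r f) (rmap q (rowmul q r a f))"
    unfolding tm_def by (rule T(1)) (use \<tau> in auto)
  show "i \<in> {1..q} \<Longrightarrow> tm q r a f \<tau> \<triangleleft> inc q i = \<tau> i"
    unfolding tm_def by (rule T(2)) (use \<tau> in auto)
qed

lemma tm_cong: "(\<And>i. i \<in> {1..q} \<Longrightarrow> f i = f' i) \<Longrightarrow> (\<And>i. i \<in> {1..q} \<Longrightarrow> \<tau> i = \<tau>' i) \<Longrightarrow> tm q r a f \<tau> = tm q r a f' \<tau>'"
proof -
  assume a: "\<And>i. i \<in> {1..q} \<Longrightarrow> f i = f' i" "\<And>i. i \<in> {1..q} \<Longrightarrow> \<tau> i = \<tau>' i"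
  have "mmap q r f = mmap q r f'" unfolding mmap_def fam_def using a(1) by simp
  moreover have "rowmul q r a f = rowmul q r a f'" using a(1) by (auto simp: rowmul_def)
  ultimately show ?thesis using a(2) by (simp add: tm_def tfam_def)
qed

lemma tm_cmap_in:
  assumes "\<And>i. i \<in> {1..q} \<Longrightarrow> \<tau> i \<in> rc_tracks r a (f i)"
  shows "tm q r a f \<tau> \<triangleleft> cmap q x \<in> tracks A (rmap r a \<bullet> mmap q r f \<bullet> cmap q x) (rmap q (rowmul q r a f) \<bullet> cmap q x)"
proof -
  have "tm q r a f \<tau> \<in> tracks A (rmap r a \<bullet> mmap q r f) (rmap q (rowmul q r a f))"
    by (rule tm_in) (use assms in auto)
  from pull_in[OF this Comp_in[OF mmap_in rmap_in] cmap_in, of x] show ?thesis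
    using Comp_assoc[OF cmap_in mmap_in rmap_in] by simp
qed

text \<open>The analogue for the product of two matrices; it later supplies the compositors of the
  pseudofunctor.\<close>

definition mm :: "nat \<Rightarrow> nat \<Rightarrow> nat \<Rightarrow> (nat \<Rightarrow> nat \<Rightarrow> int) \<Rightarrow> (nat \<Rightarrow> nat \<Rightarrow> int) \<Rightarrow> (nat \<Rightarrow> 't) \<Rightarrow> 't" where
  "mm s q r f g \<psi> = tfam s (mmap q r f \<bullet> mmap s q g) (mmap s r (\<lambda>i. app q f (g i))) \<psi>"

abbreviation mc_tracks where
  "mc_tracks q r f x \<equiv> tracks A (mmap q r f \<bullet> cmap q x) (cmap r (app q f x))"

lemma mm:
  assumes "\<And>i. i \<in> {1..s} \<Longrightarrow> \<psi> i \<in> mc_tracks q r f (g i)"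
  shows mm_in: "mm s q r f g \<psi> \<in> tracks A (mmap q r f \<bullet> mmap s q g) (mmap s r (\<lambda>i. app q f (g i)))"
    and mm_inc: "i \<in> {1..s} \<Longrightarrow> mm s q r f g \<psi> \<triangleleft> inc s i = \<psi> i"
proof -
  have \<psi>: "\<psi> i \<in> tracks A ((mmap q r f \<bullet> mmap s q g) \<bullet> inc s i) (mmap s r (\<lambda>i. app q f (g i)) \<bullet> inc s i)"
    if i: "i \<in> {1..s}" for i
    using assms[OF i] Comp_assoc[OF inc_in[of s i] mmap_in[of s q g] mmap_in[of q r f]] mmap_inc[OF i] by simp
  note T = tfam[OF Comp_in[OF mmap_in[of s q g] mmap_in[of q r f]] mmap_in[of s r "\<lambda>i. app q f (g i)"], of \<psi>]
  show "mm s q r f g \<psi> \<in> tracks A (mmap q r f \<bullet> mmap s q g) (mmap s r (\<lambda>i. app q f (g i)))"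
    unfolding mm_def by (rule T(1)) (use \<psi> in auto)
  show "i \<in> {1..s} \<Longrightarrow> mm s q r f g \<psi> \<triangleleft> inc s i = \<psi> i"
    unfolding mm_def by (rule T(2)) (use \<psi> in auto)
qed

text \<open>\<open>track_cocycle\<close> needs the deviation of the face without the column as one
  element of \<open>D (pw s) X\<close>, but only its restrictions \<open>d i\<close> are given. They
  determine its pullback along \<open>cmap s x\<close> as the combination with coefficients
  \<open>x\<close>; dually, the row \<open>a\<close> turns \<open>e\<close> into a combination of
  projections.\<close>

lemma coherence:
  fixes f g x a and q r s :: nat
  defines "fg \<equiv> (\<lambda>i. app q f (g i))" and "gx \<equiv> app s g x" and "af \<equiv> rowmul q r a f"
  assumes t_fgx: "t_fgx \<in> rc_tracks r a (app q f gx)"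
    and tf: "\<And>i. i \<in> {1..q} \<Longrightarrow> tf i \<in> rc_tracks r a (f i)"
    and t_gx: "t_gx \<in> rc_tracks q af gx"
    and tg: "\<And>i. i \<in> {1..s} \<Longrightarrow> tg i \<in> rc_tracks q af (g i)"
    and t_x: "t_x \<in> rc_tracks s (rowmul s r a fg) x"
    and tfg: "\<And>i. i \<in> {1..s} \<Longrightarrow> tfg i \<in> rc_tracks r a (fg i)"
    and Pgx: "Pgx \<in> mc_tracks s q g x" and Pf_gx: "Pf_gx \<in> mc_tracks q r f gx"
    and Pfg: "\<And>i. i \<in> {1..s} \<Longrightarrow> Pfg i \<in> mc_tracks q r f (g i)" and Pfg_x: "Pfg_x \<in> mc_tracks s r fg x"
    and c: "c1 \<in> carrier (D X X)" "c2 \<in> carrier (D X X)" "c3 \<in> carrier (D X X)"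
    and d: "\<And>i. d i \<in> carrier (D X X)" and e: "e \<in> carrier (D X (pw r))"
    and 1: "t_fgx \<box> (rmap r a \<triangleright> Pf_gx) = act c1 (t_gx \<box> (tm q r a f tf \<triangleleft> cmap q gx))"
    and 2: "t_gx \<box> (rmap q af \<triangleright> Pgx) = act c2 (t_x \<box> (tm s q af g tg \<triangleleft> cmap s x))"
    and 3: "t_fgx \<box> (rmap r a \<triangleright> Pfg_x) = act c3 (t_x \<box> (tm s r a fg tfg \<triangleleft> cmap s x))"
    and 4: "\<And>i. i \<in> {1..s} \<Longrightarrow> tfg i \<box> (rmap r a \<triangleright> Pfg i) = act (d i) (tg i \<box> (tm q r a f tf \<triangleleft> cmap q (g i)))"
    and 5: "Pf_gx \<box> (mmap q r f \<triangleright> Pgx) = act e (Pfg_x \<box> (mm s q r f g Pfg \<triangleleft> cmap s x))"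
  shows "lin (DR X X) r a (\<lambda>k. dpush X (proj r k) e) \<otimes>\<^bsub>D X X\<^esub> c3 \<otimes>\<^bsub>D X X\<^esub> lin (DR X X) s x d = c1 \<otimes>\<^bsub>D X X\<^esub> c2"
proof -
  interpret M: abelian_group "DR X X" by (rule DR_abelian_group[OF X_in X_in])
  have fgx_eq: "app s fg x = app q f gx" unfolding fg_def gx_def by (rule app_app[symmetric])
  have afg_eq: "rowmul s q af g = rowmul s r a fg" unfolding af_def fg_def by (rule rowmul_rowmul)
  have num_eq: "dot q af gx = dot r a (app q f gx)" "dot s (rowmul s r a fg) x = dot r a (app q f gx)"
    by (simp_all add: af_def dot_rowmul fgx_eq)
  have tmf: "tm q r a f tf \<in> tracks A (rmap r a \<bullet> mmap q r f) (rmap q af)" unfolding af_def by (rule tm_in) (rule tf)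
  have tmg: "tm s q af g tg \<in> tracks A (rmap q af \<bullet> mmap s q g) (rmap s (rowmul s r a fg))"
    unfolding afg_eq[symmetric] by (rule tm_in) (rule tg)
  have tmfg: "tm s r a fg tfg \<in> tracks A (rmap r a \<bullet> mmap s r fg) (rmap s (rowmul s r a fg))" by (rule tm_in) (rule tfg)
  have mmfg: "mm s q r f g Pfg \<in> tracks A (mmap q r f \<bullet> mmap s q g) (mmap s r fg)" unfolding fg_def by (rule mm_in) (rule Pfg)
  have R: "rmap r a \<in> maps A (pw r) X" and F: "mmap q r f \<in> maps A (pw q) (pw r)" and G: "mmap s q g \<in> maps A (pw s) (pw q)"
    by (rule rmap_in mmap_in)+
  let ?L = "tm s r a fg tfg \<box> (rmap r a \<triangleright> mm s q r f g Pfg)" and ?R = "tm s q af g tg \<box> (tm q r a f tf \<triangleleft> mmap s q g)"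
  have m: "(rmap r a \<bullet> mmap q r f) \<bullet> mmap s q g \<in> maps A (pw s) X" by (rule Comp_in[OF G Comp_in[OF F R]])
  have aPfg: "rmap r a \<triangleright> mm s q r f g Pfg \<in> tracks A ((rmap r a \<bullet> mmap q r f) \<bullet> mmap s q g) (rmap r a \<bullet> mmap s r fg)"
    using push_in[OF mmfg Comp_in[OF G F] R] Comp_assoc[OF G F R] by simp
  have tmfG: "tm q r a f tf \<triangleleft> mmap s q g \<in> tracks A ((rmap r a \<bullet> mmap q r f) \<bullet> mmap s q g) (rmap q af \<bullet> mmap s q g)"
    by (rule pull_in[OF tmf Comp_in[OF F R] G])
  have L: "?L \<in> tracks A ((rmap r a \<bullet> mmap q r f) \<bullet> mmap s q g) (rmap s (rowmul s r a fg))" by (rule vcomp_in[OF aPfg tmfg])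
  have Rt: "?R \<in> tracks A ((rmap r a \<bullet> mmap q r f) \<bullet> mmap s q g) (rmap s (rowmul s r a fg))" by (rule vcomp_in[OF tmfG tmg])
  \<comment> \<open>The deviation of the two tracks out of \<open>pw s\<close>; its restriction to a
    summand is computed from premise \<open>4\<close>.\<close>
  obtain dd where dd: "dd \<in> carrier (D (pw s) X)" "?L = act dd ?R" using act_ex[OF Rt L m] by blast
  have dd_inc: "dpull (inc s i) X dd = d i" if i: "i \<in> {1..s}" for i
  proof -
    have inci: "inc s i \<in> maps A X (pw s)" by (rule inc_in)
    have "?L \<triangleleft> inc s i = (tm s r a fg tfg \<triangleleft> inc s i) \<box> ((rmap r a \<triangleright> mm s q r f g Pfg) \<triangleleft> inc s i)"
      by (rule pull_vcomp[OF aPfg tmfg m inci])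
    also have "\<dots> = tfg i \<box> (rmap r a \<triangleright> Pfg i)"
      using push_pull[OF mmfg inci Comp_in[OF G F] R] tm_inc[OF tfg i] mm_inc[OF Pfg i] by simp
    finally have l: "?L \<triangleleft> inc s i = act (d i) (tg i \<box> (tm q r a f tf \<triangleleft> cmap q (g i)))" using 4[OF i] by simp
    have "?R \<triangleleft> inc s i = (tm s q af g tg \<triangleleft> inc s i) \<box> (tm q r a f tf \<triangleleft> mmap s q g \<triangleleft> inc s i)"
      by (rule pull_vcomp[OF tmfG tmg m inci])
    also have "\<dots> = tg i \<box> (tm q r a f tf \<triangleleft> cmap q (g i))"
      using pull_pull[OF tmf Comp_in[OF F R] G inci] mmap_inc[OF i] tm_inc[OF tg i] by simp
    finally have r: "?R \<triangleleft> inc s i = tg i \<box> (tm q r a f tf \<triangleleft> cmap q (g i))" .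
    have "act (dpull (inc s i) X dd) (?R \<triangleleft> inc s i) = act (d i) (?R \<triangleleft> inc s i)"
      using pull_act[OF Rt m inci dd(1)] dd(2) l r by simp
    then show ?thesis
      by (rule act_inj[OF pull_in[OF Rt m inci] Comp_in[OF inci m] dpull_in[OF inci X_in dd(1)] d])
  qed
  have Pgx': "Pgx \<in> tracks A (mmap s q g \<bullet> cmap s x) (cmap q gx)" using Pgx unfolding gx_def .
  have Pfg_x': "Pfg_x \<in> tracks A (mmap s r fg \<bullet> cmap s x) (cmap r (app q f gx))" using Pfg_x unfolding fgx_eq .
  have t_gx': "t_gx \<in> tracks A (rmap q af \<bullet> cmap q gx) (num (dot r a (app q f gx)))" using t_gx unfolding num_eq .
  have t_x': "t_x \<in> tracks A (rmap s (rowmul s r a fg) \<bullet> cmap s x) (num (dot r a (app q f gx)))"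
    using t_x unfolding num_eq .
  have "dpush X (rmap r a) e \<otimes>\<^bsub>D X X\<^esub> c3 \<otimes>\<^bsub>D X X\<^esub> dpull (cmap s x) X dd = c1 \<otimes>\<^bsub>D X X\<^esub> c2"
    by (rule track_cocycle[OF cmap_in G F R Pgx' Pf_gx mmfg Pfg_x' t_fgx tmf t_gx' tmg t_x' tmfg c dd(1) e 1 2 3 dd(2) 5])
  moreover have "dpull (cmap s x) X dd = lin (DR X X) s x d"
    unfolding dpull_cmap[OF X_in dd(1)] by (rule M.lin_cong) (use dd_inc d in auto)
  ultimately show ?thesis by (simp only: dpush_rmap[OF X_in e, of a])
qed

text \<open>Taking the identity whenever source and target agree makes the derived cocycle normalised.\<close>

definition t :: "nat \<Rightarrow> (nat \<Rightarrow> int) \<Rightarrow> (nat \<Rightarrow> int) \<Rightarrow> 't" where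
  "t q a x = (if rmap q a \<bullet> cmap q x = num (dot q a x) then tid (num (dot q a x))
     else (SOME \<eta>. \<eta> \<in> rc_tracks q a x))"

lemma t_in: "t q a x \<in> rc_tracks q a x"
proof -
  have "rc_tracks q a x \<noteq> {}"
    using track_class_eq_iff[OF Comp_in[OF cmap_in rmap_in] num_in] cls_rmap_cmap by blast
  then show ?thesis using tid_in[OF num_in] by (auto simp: t_def some_in_eq)
qed

lemma t_tid: "rmap q a \<bullet> cmap q x = num (dot q a x) \<Longrightarrow> t q a x = tid (num (dot q a x))"
  by (simp add: t_def)

lemma t_axis: "i \<in> {1..q} \<Longrightarrow> t q a (axis i) = tid (num (a i))"
  using t_tid[of q a "axis i"] by (simp add: cmap_axis rmap_inc dot_axis_right)

lemma t_zero_right: "t q a (\<lambda>_. 0) = tid (zm X X)"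
  using t_tid[of q a "\<lambda>_. 0"] by (simp add: comp_zm[OF rmap_in X_in])

lemma rmap_zero: "rmap q (\<lambda>_. 0) = zm (pw q) X"
  by (rule pw_map_unique[OF rmap_in zm_in[OF pw_in X_in]]) (simp add: rmap_inc zm_comp[OF inc_in X_in])

lemma t_zero_left: "t q (\<lambda>_. 0) x = tid (zm X X)"
  using t_tid[of q "\<lambda>_. 0" x] by (simp add: rmap_zero zm_comp[OF cmap_in X_in])

abbreviation tt where "tt q r a f \<equiv> tm q r a f (\<lambda>i. t r a (f i))"

lemmas tt_in = tm_in[OF t_in] and tt_inc = tm_inc[OF t_in] and tt_cmap_in = tm_cmap_in[OF t_in]

lemma mc_in: "mmap q r f \<bullet> cmap q x \<in> maps A X (pw r)"
  by (rule Comp_in[OF cmap_in mmap_in])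

text \<open>The choice is forced by asking that unit rows produce no deviation: each projection of
  \<open>psi\<close> has to agree with the tracks \<open>t\<close>. The obstruction is thereby
  pushed into the other rows.\<close>

definition psi :: "nat \<Rightarrow> nat \<Rightarrow> (nat \<Rightarrow> nat \<Rightarrow> int) \<Rightarrow> (nat \<Rightarrow> int) \<Rightarrow> 't" where
  "psi q r f x = lift r (mmap q r f \<bullet> cmap q x) (cmap r (app q f x))
     (\<lambda>k. t r (axis k) (app q f x)) (\<lambda>k. t q (row q f k) x \<box> (tt q r (axis k) f \<triangleleft> cmap q x))"

lemma psi_aux:
  assumes k: "k \<in> {1..r}"
  shows "t r (axis k) (app q f x) \<in> tracks A (proj r k \<bullet> cmap r (app q f x)) (num (app q f x k))"
    and "t q (row q f k) x \<box> (tt q r (axis k) f \<triangleleft> cmap q x) \<in>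
      tracks A (proj r k \<bullet> mmap q r f \<bullet> cmap q x) (num (app q f x k))"
proof -
  show "t r (axis k) (app q f x) \<in> tracks A (proj r k \<bullet> cmap r (app q f x)) (num (app q f x k))"
    using t_in[of r "axis k" "app q f x"] k by (simp add: dot_axis_left)
  have "t q (row q f k) x \<in> tracks A (rmap q (rowmul q r (axis k) f) \<bullet> cmap q x) (num (app q f x k))"
    using t_in[of q "row q f k" x] k by (simp add: dot_row rowmul_axis)
  then show "t q (row q f k) x \<box> (tt q r (axis k) f \<triangleleft> cmap q x) \<in>
      tracks A (proj r k \<bullet> mmap q r f \<bullet> cmap q x) (num (app q f x k))"
    by (rule vcomp_in[OF tt_cmap_in])
qed

lemma psi_in: "psi q r f x \<in> mc_tracks q r f x"
  unfolding psi_def by (rule lift_in[OF mc_in cmap_in cls_mmap_cmap psi_aux])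

lemma psi_proj: "k \<in> {1..r} \<Longrightarrow> t r (axis k) (app q f x) \<box> (proj r k \<triangleright> psi q r f x) =
    t q (row q f k) x \<box> (tt q r (axis k) f \<triangleleft> cmap q x)"
  unfolding psi_def by (rule lift_proj[OF mc_in cmap_in cls_mmap_cmap psi_aux])

lemma psi_unique:
  assumes "\<eta> \<in> mc_tracks q r f x"
    and "\<And>k. k \<in> {1..r} \<Longrightarrow> t r (axis k) (app q f x) \<box> (proj r k \<triangleright> \<eta>) = t q (row q f k) x \<box> (tt q r (axis k) f \<triangleleft> cmap q x)"
  shows "\<eta> = psi q r f x"
  unfolding psi_def by (rule lift_unique[OF mc_in cmap_in cls_mmap_cmap psi_aux]) (use assms in auto)

text \<open>As in the other normal forms of \<open>psi\<close> below, the identity track satisfies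
  the characterising equations. These normal forms make the pseudofunctor strict on identities and
  zero maps.\<close>

lemma psi_axis:
  assumes i: "i \<in> {1..q}" shows "psi q r f (axis i) = tid (cmap r (f i))"
proof (rule psi_unique[symmetric])
  show "tid (cmap r (f i)) \<in> mc_tracks q r f (axis i)"
    using i tid_in[OF cmap_in] by (simp add: cmap_axis mmap_inc app_axis)
  fix k assume k: "k \<in> {1..r}"
  have 1: "t r (axis k) (f i) \<in> tracks A (proj r k \<bullet> cmap r (f i)) (num (f i k))"
    using t_in[of r "axis k" "f i"] k by (simp add: dot_axis_left)
  have "t q (row q f k) (axis i) \<box> (tt q r (axis k) f \<triangleleft> cmap q (axis i)) = t r (axis k) (f i)"
    using tt_inc[OF i] tid_vcomp[OF 1] i by (simp add: t_axis cmap_axis row_def)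
  then show "t r (axis k) (app q f (axis i)) \<box> (proj r k \<triangleright> tid (cmap r (f i))) =
      t q (row q f k) (axis i) \<box> (tt q r (axis k) f \<triangleleft> cmap q (axis i))"
    using push_tid[OF cmap_in rmap_in] vcomp_tid[OF 1] i by (simp add: app_axis)
qed

lemma app_zero: "app q f (\<lambda>_. 0) = (\<lambda>_. 0)" by (simp add: app_def)

lemma tid_zm_vcomp: "\<lbrakk>U \<in> Obj A; V \<in> Obj A\<rbrakk> \<Longrightarrow> tid (zm U V) \<box> tid (zm U V) = tid (zm U V)"
  using tid_vcomp[OF tid_in[OF zm_in]] by blast

lemma psi_zero_right: "psi q r f (\<lambda>_. 0) = tid (zm X (pw r))"
proof (rule psi_unique[symmetric])
  show "tid (zm X (pw r)) \<in> mc_tracks q r f (\<lambda>_. 0)"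
    using tid_in[OF zm_in[OF X_in pw_in]] comp_zm[OF mmap_in X_in] by (simp add: app_zero)
  fix k assume k: "k \<in> {1..r}"
  show "t r (axis k) (app q f (\<lambda>_. 0)) \<box> (proj r k \<triangleright> tid (zm X (pw r))) =
      t q (row q f k) (\<lambda>_. 0) \<box> (tt q r (axis k) f \<triangleleft> cmap q (\<lambda>_. 0))"
    using push_tid[OF zm_in[OF X_in pw_in] rmap_in] comp_zm[OF rmap_in X_in]
      zm_pull[OF tt_in Comp_in[OF mmap_in rmap_in] X_in]
    by (simp add: app_zero t_zero_right)
qed

lemma rowmul_zero: "rowmul q r (\<lambda>_. 0) f = (\<lambda>_. 0)" by (auto simp: rowmul_def)

lemma tt_zero_left: "tt q r (\<lambda>_. 0) f \<triangleleft> cmap q x = tid (zm X X)"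
proof -
  have z: "rmap r (\<lambda>_. 0) \<bullet> mmap q r f = zm (pw q) X" by (simp add: rmap_zero zm_comp[OF mmap_in X_in])
  have 1: "tt q r (\<lambda>_. 0) f \<in> tracks A (zm (pw q) X) (zm (pw q) X)"
    using tt_in[of q r "\<lambda>_. 0" f] unfolding z rowmul_zero unfolding rmap_zero .
  have "tt q r (\<lambda>_. 0) f = tid (zm (pw q) X)"
    by (rule pw_track_unique[OF zm_in[OF pw_in X_in] 1 tid_in[OF zm_in[OF pw_in X_in]]])
       (subst tt_inc, assumption, simp add: t_zero_left pull_tid[OF inc_in zm_in[OF pw_in X_in]] zm_comp[OF inc_in X_in])
  then show ?thesis by (simp add: pull_tid[OF cmap_in zm_in[OF pw_in X_in]] zm_comp[OF cmap_in X_in])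
qed

lemma psi_zero_left:
  assumes f: "\<And>i. i \<in> {1..q} \<Longrightarrow> f i = (\<lambda>_. 0)" shows "psi q r f x = tid (zm X (pw r))"
proof (rule psi_unique[symmetric])
  have app: "app q f x = (\<lambda>_. 0)" using f by (simp add: app_def)
  have m: "mmap q r f = zm (pw q) (pw r)"
    by (rule pw_map_unique[OF mmap_in zm_in[OF pw_in pw_in]])
       (simp add: mmap_inc f zm_comp[OF inc_in pw_in])
  show "tid (zm X (pw r)) \<in> mc_tracks q r f x"
    using tid_in[OF zm_in[OF X_in pw_in]] by (simp add: m app zm_comp[OF cmap_in pw_in])
  fix k assume k: "k \<in> {1..r}"
  have r: "row q f k = (\<lambda>_. 0)" "rowmul q r (axis k) f = (\<lambda>_. 0)" using f by (auto simp: row_def rowmul_def)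
  have z: "proj r k \<bullet> mmap q r f = zm (pw q) X" by (simp add: m comp_zm[OF rmap_in pw_in])
  have 1: "tt q r (axis k) f \<in> tracks A (zm (pw q) X) (zm (pw q) X)"
    using tt_in[of q r "axis k" f] by (simp add: z r rmap_zero)
  have "tt q r (axis k) f = tid (zm (pw q) X)"
    by (rule pw_track_unique[OF zm_in[OF pw_in X_in] 1 tid_in[OF zm_in[OF pw_in X_in]]])
       (simp add: tt_inc f t_zero_right pull_tid[OF inc_in zm_in[OF pw_in X_in]] zm_comp[OF inc_in X_in])
  then show "t r (axis k) (app q f x) \<box> (proj r k \<triangleright> tid (zm X (pw r))) =
      t q (row q f k) x \<box> (tt q r (axis k) f \<triangleleft> cmap q x)"
    using push_tid[OF zm_in[OF X_in pw_in] rmap_in] comp_zm[OF rmap_in X_in]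
    by (simp add: app r t_zero_right t_zero_left pull_tid[OF cmap_in zm_in[OF pw_in X_in]] zm_comp[OF cmap_in X_in])
qed

lemma mmap_axis: "(\<And>i. i \<in> {1..q} \<Longrightarrow> f i = axis i) \<Longrightarrow> mmap q q f = Ident A (pw q)"
  by (rule pw_map_unique[OF mmap_in Ident_in[OF pw_in]])
     (simp add: mmap_inc cmap_axis Ident_Comp[OF inc_in])

lemma app_axes:
  assumes "\<And>i. i \<in> {1..q} \<Longrightarrow> f i = axis i" "x \<in> vec q" shows "app q f x = x"
proof
  fix k
  have "app q f x k = dot q (axis k) x"
    unfolding app_def dot_def by (rule sum.cong) (use assms in \<open>auto simp: axis_apply\<close>)
  also have "\<dots> = x k"
  proof (cases "k \<in> {1..q}")
    case False
    then have "dot q (axis k) x = 0" unfolding dot_def by (intro sum.neutral) (auto simp: axis_apply)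
    then show ?thesis using assms(2) False by (auto simp: vec_def)
  qed (simp add: dot_axis_left)
  finally show "app q f x k = x k" .
qed

lemma row_axes: "(\<And>i. i \<in> {1..q} \<Longrightarrow> f i = axis i) \<Longrightarrow> k \<in> {1..q} \<Longrightarrow> row q f k = axis k"
  by (auto simp: row_def axis_def)

lemma psi_axes:
  assumes f: "\<And>i. i \<in> {1..q} \<Longrightarrow> f i = axis i" and x: "x \<in> vec q"
  shows "psi q q f x = tid (cmap q x)"
proof (rule psi_unique[symmetric])
  have a: "app q f x = x" by (rule app_axes) (use f x in auto)
  have m: "mmap q q f = Ident A (pw q)" by (rule mmap_axis) (use f in auto)
  show "tid (cmap q x) \<in> mc_tracks q q f x"
    using tid_in[OF cmap_in] by (simp add: a m Ident_Comp[OF cmap_in])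
  fix k assume k: "k \<in> {1..q}"
  have r: "row q f k = axis k" "rowmul q q (axis k) f = axis k" using row_axes[of q f k] f k by (auto simp: rowmul_axis)
  have p: "proj q k \<bullet> mmap q q f = proj q k" by (simp add: m Comp_Ident[OF rmap_in])
  have 1: "tt q q (axis k) f \<in> tracks A (proj q k) (proj q k)"
    using tt_in[of q q "axis k" f] by (simp add: p r)
  have "tt q q (axis k) f = tid (proj q k)"
    by (rule pw_track_unique[OF rmap_in 1 tid_in[OF rmap_in]])
       (simp add: tt_inc f t_axis pull_tid[OF inc_in rmap_in] rmap_inc)
  then show "t q (axis k) (app q f x) \<box> (proj q k \<triangleright> tid (cmap q x)) =
      t q (row q f k) x \<box> (tt q q (axis k) f \<triangleleft> cmap q x)"
    by (simp add: a r push_tid[OF cmap_in rmap_in] pull_tid[OF cmap_in rmap_in])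
qed

text \<open>The deviation between reducing \<open>f x\<close> before multiplying by \<open>a\<close>
  and reducing the row \<open>a f\<close> first; it is unique because \<open>D X X\<close> acts
  freely on tracks.\<close>

definition c :: "nat \<Rightarrow> nat \<Rightarrow> (nat \<Rightarrow> int) \<Rightarrow> (nat \<Rightarrow> nat \<Rightarrow> int) \<Rightarrow> (nat \<Rightarrow> int) \<Rightarrow> 'd" where
  "c r q a f x = (THE d. d \<in> carrier (D X X) \<and>
     t r a (app q f x) \<box> (rmap r a \<triangleright> psi q r f x) =
     act d (t q (rowmul q r a f) x \<box> (tt q r a f \<triangleleft> cmap q x)))"

lemma c_tracks:
  shows c_tracks_left: "t r a (app q f x) \<box> (rmap r a \<triangleright> psi q r f x) \<in>
      tracks A (rmap r a \<bullet> mmap q r f \<bullet> cmap q x) (num (dot r a (app q f x)))"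
    and c_tracks_right: "t q (rowmul q r a f) x \<box> (tt q r a f \<triangleleft> cmap q x) \<in>
      tracks A (rmap r a \<bullet> mmap q r f \<bullet> cmap q x) (num (dot r a (app q f x)))"
  using vcomp_in[OF push_in[OF psi_in mc_in rmap_in] t_in] vcomp_in[OF tt_cmap_in t_in]
  by (simp_all add: dot_rowmul)

lemma amc_in: "rmap r a \<bullet> mmap q r f \<bullet> cmap q x \<in> maps A X X"
  by (rule Comp_in[OF mc_in rmap_in])

lemma c_eqI: "\<lbrakk>d \<in> carrier (D X X); t r a (app q f x) \<box> (rmap r a \<triangleright> psi q r f x) =
     act d (t q (rowmul q r a f) x \<box> (tt q r a f \<triangleleft> cmap q x))\<rbrakk> \<Longrightarrow> c r q a f x = d"
  unfolding c_def by (rule the_equality) (use act_inj[OF c_tracks_right amc_in] in auto)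

lemma c_spec: "c r q a f x \<in> carrier (D X X) \<and> t r a (app q f x) \<box> (rmap r a \<triangleright> psi q r f x) =
     act (c r q a f x) (t q (rowmul q r a f) x \<box> (tt q r a f \<triangleleft> cmap q x))"
  using act_ex[OF c_tracks_right[of q r a f x] c_tracks_left[of r a q f x] amc_in[of r a q f x]] c_eqI[of _ r a q f x] by auto

lemma c_in: "c r q a f x \<in> carrier (D X X)"
  and c_eq: "t r a (app q f x) \<box> (rmap r a \<triangleright> psi q r f x) =
     act (c r q a f x) (t q (rowmul q r a f) x \<box> (tt q r a f \<triangleleft> cmap q x))"
  using c_spec by auto

lemma c_axis: "k \<in> {1..r} \<Longrightarrow> c r q (axis k) f x = \<one>\<^bsub>D X X\<^esub>"
proof (rule c_eqI)
  interpret M: comm_group "D X X" using coeff.comm_group_D X_in by simp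
  show "\<one>\<^bsub>D X X\<^esub> \<in> carrier (D X X)" by simp
  assume k: "k \<in> {1..r}"
  show "t r (axis k) (app q f x) \<box> (proj r k \<triangleright> psi q r f x) =
     act \<one>\<^bsub>D X X\<^esub> (t q (rowmul q r (axis k) f) x \<box> (tt q r (axis k) f \<triangleleft> cmap q x))"
    unfolding act_one[OF c_tracks_right amc_in] using psi_proj[OF k] k by (simp add: rowmul_axis)
qed

theorem c_theory_cocycle: "theory_cocycle (DR X X) c"
proof -
  interpret M: abelian_group "DR X X" by (rule DR_abelian_group[OF X_in X_in])
  interpret Mg: comm_group "D X X" using coeff.comm_group_D X_in by simp
  show ?thesis
  proof
    show "c r q a f x \<in> carrier (DR X X)" for r q a f x using c_in by simp
    show "c r q a f x = c r q a f' x" if eq: "\<And>i. i \<in> {1..q} \<Longrightarrow> f i = f' i" for q f f' r a x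
    proof -
      have 1: "mmap q r f = mmap q r f'" unfolding mmap_def fam_def using eq by simp
      have 2: "app q f x = app q f' x" unfolding app_def using eq by simp
      have 3: "rowmul q r a f = rowmul q r a f'" "\<And>k. row q f k = row q f' k" using eq by (auto simp: rowmul_def row_def)
      have 4: "tt q r b f = tt q r b f'" for b by (rule tm_cong) (use eq in auto)
      show ?thesis unfolding c_def psi_def using 1 2 3 4 by simp
    qed
    show "lin (DR X X) r a (\<lambda>k. c q s (row q f k) g x) \<oplus>\<^bsub>DR X X\<^esub> c r s a (\<lambda>i. app q f (g i)) x \<oplus>\<^bsub>DR X X\<^esub>
        lin (DR X X) s x (\<lambda>i. c r q a f (g i)) =
      c q s (rowmul q r a f) g x \<oplus>\<^bsub>DR X X\<^esub> c r q a f (app s g x)"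
      if "a \<in> vec r" "f \<in> mats q r" "g \<in> mats s q" "x \<in> vec s" for a r f q g s x
    proof -
      have "psi q r f (app s g x) \<box> (mmap q r f \<triangleright> psi s q g x) \<in>
          tracks A (mmap q r f \<bullet> mmap s q g \<bullet> cmap s x) (cmap r (app q f (app s g x)))"
        by (rule vcomp_in[OF push_in[OF psi_in mc_in mmap_in] psi_in])
      moreover have "mm s q r f g (\<lambda>i. psi q r f (g i)) \<triangleleft> cmap s x \<in>
          tracks A (mmap q r f \<bullet> mmap s q g \<bullet> cmap s x) (mmap s r (\<lambda>i. app q f (g i)) \<bullet> cmap s x)"
        using pull_in[OF mm_in[OF psi_in] Comp_in[OF mmap_in mmap_in] cmap_in] Comp_assoc[OF cmap_in mmap_in mmap_in] by simp
      then have "psi s r (\<lambda>i. app q f (g i)) x \<box> (mm s q r f g (\<lambda>i. psi q r f (g i)) \<triangleleft> cmap s x) \<in>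
          tracks A (mmap q r f \<bullet> mmap s q g \<bullet> cmap s x) (cmap r (app q f (app s g x)))"
        unfolding app_app by (rule vcomp_in[OF _ psi_in])
      \<comment> \<open>The deviation \<open>e\<close> of \<open>psi\<close> for the product of
        \<open>f\<close> and \<open>g\<close> is a priori unknown, but it lies in
        \<open>D X (pw r)\<close> and can be found from its projections.\<close>
      ultimately obtain e where e: "e \<in> carrier (D X (pw r))" "psi q r f (app s g x) \<box> (mmap q r f \<triangleright> psi s q g x) =
         act e (psi s r (\<lambda>i. app q f (g i)) x \<box> (mm s q r f g (\<lambda>i. psi q r f (g i)) \<triangleleft> cmap s x))"
        using act_ex[OF _ _ Comp_in[OF mc_in mmap_in]] by blast
      have main: "lin (DR X X) r b (\<lambda>k. dpush X (proj r k) e) \<otimes>\<^bsub>D X X\<^esub> c r s b (\<lambda>i. app q f (g i)) x \<otimes>\<^bsub>D X X\<^esub>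
          lin (DR X X) s x (\<lambda>i. c r q b f (g i)) = c r q b f (app s g x) \<otimes>\<^bsub>D X X\<^esub> c q s (rowmul q r b f) g x" for b
        by (rule coherence[OF t_in t_in t_in t_in t_in t_in psi_in psi_in psi_in psi_in c_in c_in c_in c_in e(1)
            c_eq _ _ _ e(2)])
           (use c_eq[of r b s "\<lambda>i. app q f (g i)" x] c_eq[of q "rowmul q r b f" s g x] c_eq[of r b q f]
             in \<open>simp_all add: app_app rowmul_rowmul\<close>)
      \<comment> \<open>At the row \<open>axis k\<close> the values of \<open>c\<close> with this
        row vanish, and \<open>main\<close> identifies the projection of \<open>e\<close> with
        \<open>c q s (row q f k) g x\<close>. Inserted into \<open>main\<close> at \<open>a\<close>,
        this becomes the cocycle identity.\<close>
      have "lin (DR X X) r a (\<lambda>k. dpush X (proj r k) e) = lin (DR X X) r a (\<lambda>k. c q s (row q f k) g x)"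
      proof (rule M.lin_cong)
        fix k assume k: "k \<in> {1..r}"
        have "lin (DR X X) r (axis k) (\<lambda>k. dpush X (proj r k) e) = dpush X (proj r k) e"
          by (rule M.lin_axis[OF k]) (simp add: dpush_in[OF rmap_in X_in e(1)])
        then show "dpush X (proj r k) e = c q s (row q f k) g x"
          using main[of "axis k"] k M.lin_zero[of s x] dpush_in[OF rmap_in X_in e(1)] c_in
          by (simp add: c_axis rowmul_axis)
      qed (use c_in in auto)
      then show ?thesis using main[of a] c_in by (simp add: Mg.m_comm)
    qed
    show "c r q (axis k) f x = \<zero>\<^bsub>DR X X\<^esub>" if "k \<in> {1..r}" "f \<in> mats q r" "x \<in> vec q" for k r f q x
      using c_axis that by simp
    show "c r q (\<lambda>_. 0) f x = \<zero>\<^bsub>DR X X\<^esub>" if "f \<in> mats q r" "x \<in> vec q" for r q f x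
    proof -
      have l: "t r (\<lambda>_. 0) (app q f x) \<box> (rmap r (\<lambda>_. 0) \<triangleright> psi q r f x) = tid (zm X X)"
        using zm_push[OF psi_in mc_in X_in] by (simp add: t_zero_left rmap_zero tid_zm_vcomp X_in)
      have r: "t q (rowmul q r (\<lambda>_. 0) f) x \<box> (tt q r (\<lambda>_. 0) f \<triangleleft> cmap q x) = tid (zm X X)"
        by (simp only: rowmul_zero t_zero_left[of q x] tt_zero_left tid_zm_vcomp X_in)
      have "c r q (\<lambda>_. 0) f x = \<one>\<^bsub>D X X\<^esub>"
        by (rule c_eqI) (simp_all only: Mg.one_closed l r act_one[OF tid_in[OF zm_in[OF X_in X_in]] zm_in[OF X_in X_in]])
      then show ?thesis by simp
    qed
    show "c r q a f (axis i) = \<zero>\<^bsub>DR X X\<^esub>" if "i \<in> {1..q}" "a \<in> vec r" "f \<in> mats q r" for i q a r f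
    proof -
      note 1 = t_in[of r a "f i"]
      have l: "t r a (app q f (axis i)) \<box> (rmap r a \<triangleright> psi q r f (axis i)) = t r a (f i)"
        using that(1) vcomp_tid[OF 1] by (simp add: app_axis psi_axis push_tid[OF cmap_in rmap_in])
      have r: "t q (rowmul q r a f) (axis i) \<box> (tt q r a f \<triangleleft> cmap q (axis i)) = t r a (f i)"
        using that(1) tid_vcomp[OF 1] tt_inc[OF that(1)] by (simp add: t_axis cmap_axis rowmul_def)
      have "c r q a f (axis i) = \<one>\<^bsub>D X X\<^esub>"
        by (rule c_eqI) (simp_all only: Mg.one_closed l r act_one[OF 1 Comp_in[OF cmap_in rmap_in]])
      then show ?thesis by simp
    qed
    show "c r q a f (\<lambda>_. 0) = \<zero>\<^bsub>DR X X\<^esub>" if "a \<in> vec r" "f \<in> mats q r" for a r f q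
    proof -
      have l: "t r a (app q f (\<lambda>_. 0)) \<box> (rmap r a \<triangleright> psi q r f (\<lambda>_. 0)) = tid (zm X X)"
        by (simp add: app_zero psi_zero_right t_zero_right push_tid[OF zm_in[OF X_in pw_in] rmap_in]
            comp_zm[OF rmap_in X_in] tid_zm_vcomp X_in)
      have r: "t q (rowmul q r a f) (\<lambda>_. 0) \<box> (tt q r a f \<triangleleft> cmap q (\<lambda>_. 0)) = tid (zm X X)"
        by (simp add: t_zero_right zm_pull[OF tt_in Comp_in[OF mmap_in rmap_in] X_in] tid_zm_vcomp X_in)
      have "c r q a f (\<lambda>_. 0) = \<one>\<^bsub>D X X\<^esub>"
        by (rule c_eqI) (simp_all only: Mg.one_closed l r act_one[OF tid_in[OF zm_in[OF X_in X_in]] zm_in[OF X_in X_in]])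
      then show ?thesis by simp
    qed
  qed
qed

end

section \<open>Splitting the cocycle over free nilpotent groups\<close>

lemma (in group) lower_central_Suc_trivial:
  assumes "\<And>h k. \<lbrakk>h \<in> carrier G; k \<in> lower_central G n\<rbrakk> \<Longrightarrow> h \<otimes> k \<otimes> inv h \<otimes> inv k = \<one>"
  shows "lower_central G (Suc n) \<subseteq> {\<one>}"
proof -
  have "{h \<otimes> k \<otimes> inv h \<otimes> inv k | h k. h \<in> carrier G \<and> k \<in> lower_central G n} \<subseteq> {\<one>}"
    using assms by auto
  then have "lower_central G (Suc n) \<subseteq> generate G {\<one>}"
    unfolding lower_central.simps commutator_subgroup_def by (rule mono_generate)
  then show ?thesis by (simp add: generate_one)
qed

lemma (in group) lower_central_trivial_mono:
  "\<lbrakk>lower_central G k \<subseteq> {\<one>}; k \<le> n\<rbrakk> \<Longrightarrow> lower_central G n \<subseteq> {\<one>}"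
proof (induction n)
  case (Suc n)
  show ?case
  proof (cases "k = Suc n")
    case False
    then have "lower_central G n \<subseteq> {\<one>}" using Suc by simp
    then show ?thesis by (intro lower_central_Suc_trivial) auto
  qed (use Suc in simp)
qed simp

definition vec_group :: "nat \<Rightarrow> (nat \<Rightarrow> int) monoid" where
  "vec_group q = \<lparr>carrier = vec q, mult = (\<lambda>x y i. x i + y i), one = (\<lambda>_. 0)\<rparr>"

lemma vec_uminus [simp]: "x \<in> vec q \<Longrightarrow> (\<lambda>i. - x i) \<in> vec q" by (simp add: vec_def)

lemma vec_group_group: "group (vec_group q)"
proof (rule groupI)
  show "\<exists>y\<in>carrier (vec_group q). y \<otimes>\<^bsub>vec_group q\<^esub> x = \<one>\<^bsub>vec_group q\<^esub>"
    if "x \<in> carrier (vec_group q)" for x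
    using that by (intro bexI[of _ "\<lambda>i. - x i"]) (auto simp: vec_group_def)
qed (auto simp: vec_group_def)

context theory_cocycle
begin

text \<open>The central extension of \<open>\<int>\<^sup>q\<close> by the coefficients with factor set \<open>- u\<close>.\<close>

definition ext :: "nat \<Rightarrow> (nat \<Rightarrow> int) \<Rightarrow> ((nat \<Rightarrow> int) \<times> 'a) monoid" where
  "ext q a = \<lparr>carrier = vec q \<times> carrier R,
     mult = (\<lambda>(x, m) (y, n). (\<lambda>i. x i + y i, m \<oplus> n \<ominus> u q a x y)),
     one = (\<lambda>_. 0, \<zero>)\<rparr>"

lemma ext_simps [simp]: "carrier (ext q a) = vec q \<times> carrier R" "\<one>\<^bsub>ext q a\<^esub> = (\<lambda>_. 0, \<zero>)"
  "(x, m) \<otimes>\<^bsub>ext q a\<^esub> (y, n) = (\<lambda>i. x i + y i, m \<oplus> n \<ominus> u q a x y)"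
  by (simp_all add: ext_def)

text \<open>Associativity is \<open>u_cocycle\<close>, and \<open>u_zero_left\<close> provides the
  neutral element.\<close>

lemma ext_group: assumes a: "a \<in> vec q" shows "group (ext q a)"
proof (rule groupI)
  fix g h k assume "g \<in> carrier (ext q a)" "h \<in> carrier (ext q a)" "k \<in> carrier (ext q a)"
  then obtain x m y n w p where g: "g = (x, m)" "h = (y, n)" "k = (w, p)" "x \<in> vec q" "y \<in> vec q" "w \<in> vec q"
    and cl: "m \<in> carrier R" "n \<in> carrier R" "p \<in> carrier R" by auto
  have "m \<oplus> n \<ominus> u1 \<oplus> p \<ominus> u2 = m \<oplus> (n \<oplus> p \<ominus> u3) \<ominus> u4"
    if e: "u1 \<oplus> u2 = u3 \<oplus> u4" and ucl: "u1 \<in> carrier R" "u2 \<in> carrier R" "u3 \<in> carrier R" "u4 \<in> carrier R"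
    for u1 u2 u3 u4
  proof -
    have "m \<oplus> n \<ominus> u1 \<oplus> p \<ominus> u2 = m \<oplus> n \<oplus> p \<ominus> (u1 \<oplus> u2)" using cl ucl by algebra
    also have "\<dots> = m \<oplus> (n \<oplus> p \<ominus> u3) \<ominus> u4" unfolding e using cl ucl by algebra
    finally show ?thesis .
  qed
  from this[OF u_cocycle[OF a g(4-6)]]
  show "g \<otimes>\<^bsub>ext q a\<^esub> h \<otimes>\<^bsub>ext q a\<^esub> k = g \<otimes>\<^bsub>ext q a\<^esub> (h \<otimes>\<^bsub>ext q a\<^esub> k)"
    by (simp add: g add.assoc)
next
  fix g assume "g \<in> carrier (ext q a)"
  then obtain x m where g: "g = (x, m)" "x \<in> vec q" "m \<in> carrier R" by auto
  show "\<exists>h\<in>carrier (ext q a). h \<otimes>\<^bsub>ext q a\<^esub> g = \<one>\<^bsub>ext q a\<^esub>"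
  proof
    have "u' \<ominus> m \<oplus> m \<ominus> u' = \<zero>" if "u' \<in> carrier R" for u' using that g by algebra
    then show "(\<lambda>i. - x i, u q a (\<lambda>i. - x i) x \<ominus> m) \<otimes>\<^bsub>ext q a\<^esub> g = \<one>\<^bsub>ext q a\<^esub>" by (simp add: g)
  qed (use g in simp)
qed (auto simp: a u_zero_left minus_eq)

lemma ext_fst_hom: "fst \<in> hom (ext q a) (vec_group q)"
  by (rule homI) (auto simp: vec_group_def)

text \<open>Since \<open>u\<close> vanishes when either column is zero, the kernel of the projection
  to \<int>^q is central.\<close>

lemma ext_central:
  assumes a: "a \<in> vec q" and g: "g \<in> carrier (ext q a)" and k: "k \<in> carrier (ext q a)" "fst k = (\<lambda>_. 0)"
  shows "g \<otimes>\<^bsub>ext q a\<^esub> k = k \<otimes>\<^bsub>ext q a\<^esub> g"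
proof -
  obtain x m n where "g = (x, m)" "k = ((\<lambda>_. 0), n)" "x \<in> vec q" "m \<in> carrier R" "n \<in> carrier R"
    using g k by (cases g; cases k) auto
  then show ?thesis by (simp add: a u_zero_left u_zero_right minus_eq a_comm)
qed

lemma (in group) commutator_eq_one:
  "\<lbrakk>h \<in> carrier G; k \<in> carrier G; h \<otimes> k = k \<otimes> h\<rbrakk> \<Longrightarrow> h \<otimes> k \<otimes> inv h \<otimes> inv k = \<one>"
  by (simp add: m_assoc inv_solve_right)

text \<open>Commutators lie over zero because \<int>^q is abelian, and are therefore central. As
  \<open>lower_central\<close> has the whole group at index 0, triviality at index 2 means class at
  most two; this is the origin of the bound \<open>2 \<le> n\<close>.\<close>

lemma ext_nilpotent: assumes a: "a \<in> vec q" and n: "2 \<le> n" shows "lower_central (ext q a) n \<subseteq> {\<one>\<^bsub>ext q a\<^esub>}"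
proof -
  interpret E: group "ext q a" by (rule ext_group[OF a])
  interpret f: group_hom "ext q a" "vec_group q" fst
    by (simp add: group_hom_def group_hom_axioms_def E.group_axioms vec_group_group ext_fst_hom)
  have "lower_central (vec_group q) (Suc 0) \<subseteq> {\<one>\<^bsub>vec_group q\<^esub>}"
    by (rule f.H.lower_central_Suc_trivial, rule f.H.commutator_eq_one) (auto simp: vec_group_def add.commute)
  then have 1: "fst k = (\<lambda>_. 0)" if "k \<in> lower_central (ext q a) (Suc 0)" for k
    using hom_lower_central[OF f.group_hom_axioms, of "Suc 0"] that by (auto simp: vec_group_def)
  interpret L: normal "lower_central (ext q a) (Suc 0)" "ext q a" by (rule E.lower_central_normal)
  have "lower_central (ext q a) (Suc (Suc 0)) \<subseteq> {\<one>\<^bsub>ext q a\<^esub>}"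
  proof (rule E.lower_central_Suc_trivial, rule E.commutator_eq_one)
    fix h k assume h: "h \<in> carrier (ext q a)" and k: "k \<in> lower_central (ext q a) (Suc 0)"
    show kc: "k \<in> carrier (ext q a)" using k L.subset by blast
    show "h \<otimes>\<^bsub>ext q a\<^esub> k = k \<otimes>\<^bsub>ext q a\<^esub> h" by (rule ext_central[OF a h kc 1[OF k]])
  qed
  then show ?thesis by (rule E.lower_central_trivial_mono) (use n in simp)
qed

text \<open>A symmetric factor set on the abelian group \<int>^q makes the extension
  commutative.\<close>

lemma ext_abelian:
  assumes a: "a \<in> vec q" and sym: "\<And>x y. \<lbrakk>x \<in> vec q; y \<in> vec q\<rbrakk> \<Longrightarrow> u q a x y = u q a y x"
  shows "lower_central (ext q a) 1 \<subseteq> {\<one>\<^bsub>ext q a\<^esub>}"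
proof -
  interpret E: group "ext q a" by (rule ext_group[OF a])
  show ?thesis unfolding One_nat_def
  proof (rule E.lower_central_Suc_trivial, rule E.commutator_eq_one)
    fix h k assume h: "h \<in> carrier (ext q a)" and "k \<in> lower_central (ext q a) 0"
    then show kc: "k \<in> carrier (ext q a)" by simp
    obtain x m y n where "h = (x, m)" "k = (y, n)" "x \<in> vec q" "y \<in> vec q" "m \<in> carrier R" "n \<in> carrier R"
      using h kc by auto
    then show "h \<otimes>\<^bsub>ext q a\<^esub> k = k \<otimes>\<^bsub>ext q a\<^esub> h" by (simp add: sym[of x y] a_comm add.commute)
  qed
qed

end

text \<open>A theory of relatively free groups over which all the central extensions split on the generators;
  the splittings have components \<open>ab\<close>, the exponent sums, and \<open>\<kappa>\<close>, a trivialisation of \<open>u\<close>.\<close>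

locale split_theory = theory_cocycle R c
  for R :: "('d, 'b) ring_scheme" (structure) and c +
  fixes G :: "nat \<Rightarrow> 'g monoid" and e :: "nat \<Rightarrow> nat \<Rightarrow> 'g"
  assumes G_group: "group (G p)"
    and e_in: "i \<in> {1..p} \<Longrightarrow> e p i \<in> carrier (G p)"
    and G_generate: "carrier (G p) = generate (G p) (e p ` {1..p})"
    and G_hom: "(\<And>i. i \<in> {1..p} \<Longrightarrow> s i \<in> carrier (G q)) \<Longrightarrow> \<exists>h \<in> hom (G p) (G q). \<forall>i \<in> {1..p}. h (e p i) = s i"
    and ext_hom: "a \<in> vec q \<Longrightarrow> \<exists>h \<in> hom (G q) (ext q a). \<forall>i \<in> {1..q}. h (e q i) = (axis i, \<zero>)"
begin

lemma hom_unique: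
  assumes "group H" "f \<in> hom (G p) H" "g \<in> hom (G p) H" "\<And>i. i \<in> {1..p} \<Longrightarrow> f (e p i) = g (e p i)"
    and "w \<in> carrier (G p)"
  shows "f w = g w"
  by (rule hom_eq_on_generate[OF G_group assms(1-3), of "e p ` {1..p}"])
     (use assms(4,5) e_in G_generate in auto)

section \<open>Exponent sums and the trivialisation of u\<close>

definition hx :: "nat \<Rightarrow> (nat \<Rightarrow> int) \<Rightarrow> 'g \<Rightarrow> (nat \<Rightarrow> int) \<times> 'd" where
  "hx q a = (SOME h. h \<in> hom (G q) (ext q a) \<and> (\<forall>i \<in> {1..q}. h (e q i) = (axis i, \<zero>)))"

lemma hx: "a \<in> vec q \<Longrightarrow> hx q a \<in> hom (G q) (ext q a) \<and> (\<forall>i \<in> {1..q}. hx q a (e q i) = (axis i, \<zero>))"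
proof -
  assume "a \<in> vec q"
  then have "\<exists>h. h \<in> hom (G q) (ext q a) \<and> (\<forall>i \<in> {1..q}. h (e q i) = (axis i, \<zero>))" using ext_hom by blast
  then show ?thesis unfolding hx_def by (rule someI_ex)
qed

text \<open>Read off from the extension for the zero row; by \<open>fst_hx\<close> every row gives
  the same first component, since generators always go to axes.\<close>

definition ab :: "nat \<Rightarrow> 'g \<Rightarrow> nat \<Rightarrow> int" where
  "ab q w = fst (hx q (\<lambda>_. 0) w)"

text \<open>The value zero outside the domain keeps \<kappa> in the coefficient group for all
  arguments, as the lemmas on \<open>lin\<close> require.\<close>

definition \<kappa> :: "nat \<Rightarrow> (nat \<Rightarrow> int) \<Rightarrow> 'g \<Rightarrow> 'd" where
  "\<kappa> q a w = (if a \<in> vec q \<and> w \<in> carrier (G q) then snd (hx q a w) else \<zero>)"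

lemma fst_hx_hom: "a \<in> vec q \<Longrightarrow> (\<lambda>w. fst (hx q a w)) \<in> hom (G q) (vec_group q)"
  using hom_compose[OF conjunct1[OF hx] ext_fst_hom] by (simp add: comp_def)

lemma fst_hx: assumes "a \<in> vec q" "w \<in> carrier (G q)" shows "fst (hx q a w) = ab q w"
  unfolding ab_def
  by (rule hom_unique[OF vec_group_group fst_hx_hom fst_hx_hom]) (use assms hx[of a q] hx[of "\<lambda>_. 0" q] in auto)

lemma ab_hom: "ab q \<in> hom (G q) (vec_group q)"
  unfolding ab_def[abs_def] by (rule fst_hx_hom) simp

lemma ab_in: "w \<in> carrier (G q) \<Longrightarrow> ab q w \<in> vec q"
  using hom_in_carrier[OF ab_hom] by (simp add: vec_group_def)

lemma ab_mult: "\<lbrakk>w \<in> carrier (G q); w' \<in> carrier (G q)\<rbrakk> \<Longrightarrow> ab q (w \<otimes>\<^bsub>G q\<^esub> w') = (\<lambda>i. ab q w i + ab q w' i)"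
  using hom_mult[OF ab_hom] by (simp add: vec_group_def)

lemma ab_gen: "i \<in> {1..q} \<Longrightarrow> ab q (e q i) = axis i"
  using hx[of "\<lambda>_. 0" q] by (simp add: ab_def)

lemma ab_one: "ab q \<one>\<^bsub>G q\<^esub> = (\<lambda>_. 0)"
  using hom_one[OF ab_hom G_group vec_group_group] by (simp add: vec_group_def)

lemma \<kappa>_in [simp]: "\<kappa> q a w \<in> carrier R"
  using hom_in_carrier[OF conjunct1[OF hx], of a q w] by (auto simp: \<kappa>_def mem_Times_iff)

lemma \<kappa>_gen: "\<lbrakk>i \<in> {1..q}; a \<in> vec q\<rbrakk> \<Longrightarrow> \<kappa> q a (e q i) = \<zero>"
  using hx[of a q] by (simp add: \<kappa>_def)

lemma hx_eq: "\<lbrakk>a \<in> vec q; w \<in> carrier (G q)\<rbrakk> \<Longrightarrow> hx q a w = (ab q w, \<kappa> q a w)"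
  using fst_hx[of a q w] by (simp add: \<kappa>_def prod_eq_iff)

text \<open>Second component of the multiplicativity of \<open>hx\<close>. The minus sign, from the
  factor set \<open>- u\<close>, is what lets \<kappa> balance the terms of
  \<open>u_natural\<close>.\<close>

lemma \<kappa>_mult: "\<lbrakk>a \<in> vec q; w \<in> carrier (G q); w' \<in> carrier (G q)\<rbrakk> \<Longrightarrow>
  \<kappa> q a (w \<otimes>\<^bsub>G q\<^esub> w') = \<kappa> q a w \<oplus> \<kappa> q a w' \<ominus> u q a (ab q w) (ab q w')"
proof -
  assume a: "a \<in> vec q" "w \<in> carrier (G q)" "w' \<in> carrier (G q)"
  interpret group "G q" by (rule G_group)
  have "hx q a (w \<otimes>\<^bsub>G q\<^esub> w') = hx q a w \<otimes>\<^bsub>ext q a\<^esub> hx q a w'"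
    using hom_mult[OF conjunct1[OF hx[OF a(1)]] a(2,3)] .
  then show ?thesis using a by (simp add: hx_eq)
qed

lemma \<kappa>_one: "a \<in> vec q \<Longrightarrow> \<kappa> q a \<one>\<^bsub>G q\<^esub> = \<zero>"
proof -
  assume a: "a \<in> vec q"
  interpret group "G q" by (rule G_group)
  have "hx q a \<one>\<^bsub>G q\<^esub> = \<one>\<^bsub>ext q a\<^esub>" using hom_one[OF conjunct1[OF hx[OF a]] G_group ext_group[OF a]] .
  then show ?thesis using a by (simp add: hx_eq)
qed

lemma hom_to_R_zero:
  assumes K: "\<And>w. w \<in> carrier (G q) \<Longrightarrow> K w \<in> carrier R"
    and mult: "\<And>w w'. \<lbrakk>w \<in> carrier (G q); w' \<in> carrier (G q)\<rbrakk> \<Longrightarrow> K (w \<otimes>\<^bsub>G q\<^esub> w') = K w \<oplus> K w'"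
    and gen: "\<And>i. i \<in> {1..q} \<Longrightarrow> K (e q i) = \<zero>" and w: "w \<in> carrier (G q)"
  shows "K w = \<zero>"
  by (rule hom_unique[of "add_monoid R" K q "\<lambda>_. \<zero>" w]) (use assms a_group in \<open>auto simp: hom_def\<close>)

text \<open>At unit rows \<open>u\<close> vanishes, so \<kappa> is a homomorphism there, and it is
  zero on generators. Hence identity matrices receive no correction.\<close>

lemma \<kappa>_axis: "\<lbrakk>k \<in> {1..q}; w \<in> carrier (G q)\<rbrakk> \<Longrightarrow> \<kappa> q (axis k) w = \<zero>"
  by (rule hom_to_R_zero) (auto simp: \<kappa>_mult u_axis ab_in \<kappa>_gen minus_eq)

lemma \<kappa>_zero: "w \<in> carrier (G q) \<Longrightarrow> \<kappa> q (\<lambda>_. 0) w = \<zero>"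
  by (rule hom_to_R_zero[of q "\<kappa> q (\<lambda>_. 0)"]) (auto simp: \<kappa>_mult u_zero ab_in \<kappa>_gen minus_eq)

text \<open>Both sides are homomorphisms in \<open>w\<close> with equal values on the generators:
  exponent sums turn homomorphisms into matrices.\<close>

lemma ab_comp:
  assumes f: "f \<in> hom (G q) (G r)" and w: "w \<in> carrier (G q)"
  shows "ab r (f w) = app q (\<lambda>i. ab r (f (e q i))) (ab q w)"
proof (rule hom_unique[OF vec_group_group, of "\<lambda>w. ab r (f w)" q r])
  show "(\<lambda>w. ab r (f w)) \<in> hom (G q) (vec_group r)"
    using hom_compose[OF f ab_hom] by (simp add: comp_def)
  have "(\<lambda>i. ab r (f (e q i))) \<in> mats q r"
    using ab_in hom_in_carrier[OF f] e_in by (auto simp: mats_def)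
  then show "(\<lambda>w. app q (\<lambda>i. ab r (f (e q i))) (ab q w)) \<in> hom (G q) (vec_group r)"
    by (auto simp: hom_def vec_group_def ab_mult app_add)
qed (use w in \<open>auto simp: ab_gen app_axis\<close>)

text \<open>Both sides differ by a homomorphism in \<open>w\<close> that vanishes on the generators.\<close>

lemma \<kappa>_main:
  fixes f q r
  defines "F \<equiv> (\<lambda>i. ab r (f (e q i)))"
  assumes f: "f \<in> hom (G q) (G r)" and a: "a \<in> vec r" and w: "w \<in> carrier (G q)"
  shows "\<kappa> r a (f w) \<oplus> lin R r a (\<lambda>k. \<kappa> q (row q F k) w) \<oplus> c r q a F (ab q w) =
    \<kappa> q (rowmul q r a F) w \<oplus> lin R q (ab q w) (\<lambda>i. \<kappa> r a (f (e q i)))"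
proof -
  have F: "F \<in> mats q r"
    using ab_in hom_in_carrier[OF f] e_in by (auto simp: mats_def F_def)
  note fin = hom_in_carrier[OF f]
  let ?K = "\<lambda>w. \<kappa> r a (f w) \<oplus> lin R r a (\<lambda>k. \<kappa> q (row q F k) w) \<oplus> c r q a F (ab q w) \<ominus>
    (\<kappa> q (rowmul q r a F) w \<oplus> lin R q (ab q w) (\<lambda>i. \<kappa> r a (f (e q i))))"
  have "?K w = \<zero>"
  proof (rule hom_to_R_zero[of q ?K, OF _ _ _ w])
    fix i assume i: "i \<in> {1..q}"
    then show "?K (e q i) = \<zero>"
      using lin_axis[OF i, of "\<lambda>i. \<kappa> r a (f (e q i))"]
      by (simp add: \<kappa>_gen ab_gen c_axis_right a F minus_eq r_neg)
  next
    fix w w' assume w: "w \<in> carrier (G q)" "w' \<in> carrier (G q)"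
    let ?x = "ab q w" and ?y = "ab q w'"
    have x: "?x \<in> vec q" "?y \<in> vec q" using ab_in w by auto
    have 1: "\<kappa> r a (f (w \<otimes>\<^bsub>G q\<^esub> w')) = \<kappa> r a (f w) \<oplus> \<kappa> r a (f w') \<ominus> u r a (app q F ?x) (app q F ?y)"
      using hom_mult[OF f w] \<kappa>_mult[OF a fin fin] w ab_comp[OF f] by (simp add: F_def)
    have 2: "lin R r a (\<lambda>k. \<kappa> q (row q F k) (w \<otimes>\<^bsub>G q\<^esub> w')) =
      lin R r a (\<lambda>k. \<kappa> q (row q F k) w) \<oplus> lin R r a (\<lambda>k. \<kappa> q (row q F k) w') \<ominus> lin R r a (\<lambda>k. u q (row q F k) ?x ?y)"
      by (simp add: \<kappa>_mult w lin_minus lin_add)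
    have 3: "\<kappa> q (rowmul q r a F) (w \<otimes>\<^bsub>G q\<^esub> w') =
      \<kappa> q (rowmul q r a F) w \<oplus> \<kappa> q (rowmul q r a F) w' \<ominus> u q (rowmul q r a F) ?x ?y"
      by (simp add: \<kappa>_mult w)
    have 4: "lin R q (ab q (w \<otimes>\<^bsub>G q\<^esub> w')) (\<lambda>i. \<kappa> r a (f (e q i))) =
      lin R q ?x (\<lambda>i. \<kappa> r a (f (e q i))) \<oplus> lin R q ?y (\<lambda>i. \<kappa> r a (f (e q i)))"
      by (simp add: ab_mult w lin_vadd)
    have solve: "(k1 \<oplus> k2 \<ominus> u1) \<oplus> (l1 \<oplus> l2 \<ominus> u2) \<oplus> c3 \<ominus> ((m1 \<oplus> m2 \<ominus> u3) \<oplus> (n1 \<oplus> n2)) =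
        (k1 \<oplus> l1 \<oplus> c1 \<ominus> (m1 \<oplus> n1)) \<oplus> (k2 \<oplus> l2 \<oplus> c2 \<ominus> (m2 \<oplus> n2))"
      if e: "u2 \<oplus> u1 \<oplus> (c1 \<oplus> c2) = u3 \<oplus> c3"
        and cl: "k1 \<in> carrier R" "k2 \<in> carrier R" "u1 \<in> carrier R" "l1 \<in> carrier R" "l2 \<in> carrier R" "u2 \<in> carrier R"
          "c3 \<in> carrier R" "m1 \<in> carrier R" "m2 \<in> carrier R" "u3 \<in> carrier R" "n1 \<in> carrier R" "n2 \<in> carrier R"
          "c1 \<in> carrier R" "c2 \<in> carrier R"
      for k1 k2 u1 l1 l2 u2 c3 m1 m2 u3 n1 n2 c1 c2
    proof -
      have A: "(k1 \<oplus> k2 \<ominus> u1) \<oplus> (l1 \<oplus> l2 \<ominus> u2) = (k1 \<oplus> l1) \<oplus> (k2 \<oplus> l2) \<ominus> (u2 \<oplus> u1)"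
        using cl by algebra
      have B: "(m1 \<oplus> m2 \<ominus> u3) \<oplus> (n1 \<oplus> n2) = (m1 \<oplus> n1) \<oplus> (m2 \<oplus> n2) \<ominus> u3"
        using cl by algebra
      have C: "p1 \<oplus> p2 \<ominus> U \<oplus> c3 \<ominus> (q1 \<oplus> q2 \<ominus> u3) = (p1 \<oplus> c1 \<ominus> q1) \<oplus> (p2 \<oplus> c2 \<ominus> q2)"
        if e': "U \<oplus> (c1 \<oplus> c2) = u3 \<oplus> c3"
          and "p1 \<in> carrier R" "p2 \<in> carrier R" "U \<in> carrier R" "q1 \<in> carrier R" "q2 \<in> carrier R"
        for p1 p2 U q1 q2
      proof -
        have "p1 \<oplus> p2 \<ominus> U \<oplus> c3 \<ominus> (q1 \<oplus> q2 \<ominus> u3) = p1 \<oplus> p2 \<ominus> U \<oplus> (u3 \<oplus> c3) \<ominus> (q1 \<oplus> q2)"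
          using that(2-) cl(7,10) by algebra
        also have "\<dots> = (p1 \<oplus> c1 \<ominus> q1) \<oplus> (p2 \<oplus> c2 \<ominus> q2)"
          unfolding e'[symmetric] using that(2-) cl(13,14) by algebra
        finally show ?thesis .
      qed
      show ?thesis unfolding A B by (rule C[OF e]) (use cl in simp_all)
    qed
    \<comment> \<open>Additivity of the error: the three kinds of values of \<open>u\<close>
      contributed by \<kappa> balance, by \<open>u_natural\<close>, the failure of \<open>c\<close>
      to be additive in the column.\<close>
    show "?K (w \<otimes>\<^bsub>G q\<^esub> w') = ?K w \<oplus> ?K w'"
      unfolding 1 2 3 4 unfolding ab_mult[OF w]
      by (rule solve[OF u_natural[OF a F x]]) simp_all
  qed simp
  moreover have "x = y" if "x \<ominus> y = \<zero>" "x \<in> carrier R" "y \<in> carrier R" for x y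
  proof -
    have "x = (x \<ominus> y) \<oplus> y" using that(2,3) by algebra
    then show ?thesis using that by simp
  qed
  ultimately show ?thesis by simp
qed

end

section \<open>Weak cogroups\<close>

context split_theory
begin

abbreviation N where "N \<equiv> group_theory G"
abbreviation S where "S \<equiv> standard_sums G e"

lemma N_maps: "m \<in> maps N p q \<longleftrightarrow> (\<exists>f. m = (p, q, f) \<and> f \<in> hom (G p) (G q) \<and> f \<in> extensional (carrier (G p)))"
  by (auto simp: maps_def group_theory_def)

lemma N_mapsE:
  assumes "m \<in> maps N p q"
  obtains f where "m = (p, q, f)" "f \<in> hom (G p) (G q)" "f \<in> extensional (carrier (G p))"
  using assms N_maps by blast

lemma N_Comp: "Comp N (q', r, g) (p, q, f) = (p, r, compose (carrier (G p)) g f)"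
  by (simp add: group_theory_def)

lemma N_Ident: "Ident N p = (p, p, \<lambda>x \<in> carrier (G p). x)"
  by (simp add: group_theory_def)

lemma N_eqI:
  assumes "f \<in> hom (G p) (G q)" "f \<in> extensional (carrier (G p))" "g \<in> hom (G p) (G q)" "g \<in> extensional (carrier (G p))"
    and "\<And>i. i \<in> {1..p} \<Longrightarrow> f (e p i) = g (e p i)"
  shows "f = g"
  by (rule extensionalityI[OF assms(2,4)]) (rule hom_unique[OF G_group assms(1,3,5)])

lemma N_ex:
  assumes "\<And>i. i \<in> {1..p} \<Longrightarrow> s i \<in> carrier (G q)"
  obtains f where "f \<in> hom (G p) (G q)" "f \<in> extensional (carrier (G p))" "\<And>i. i \<in> {1..p} \<Longrightarrow> f (e p i) = s i"
proof -
  obtain h where h: "h \<in> hom (G p) (G q)" "\<forall>i \<in> {1..p}. h (e p i) = s i" using G_hom[of p s q] assms by blast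
  interpret group "G p" by (rule G_group)
  have "restrict h (carrier (G p)) \<in> hom (G p) (G q)" using h(1) by (auto simp: hom_def)
  with h(2) show ?thesis using that[of "restrict h (carrier (G p))"] e_in by simp
qed

lemma compose_hom: "\<lbrakk>f \<in> hom (G p) (G q); g \<in> hom (G q) (G r)\<rbrakk> \<Longrightarrow> compose (carrier (G p)) g f \<in> hom (G p) (G r)"
  using group.is_monoid[OF G_group[of p]] by (auto simp: hom_def compose_def monoid.m_closed Pi_iff)

lemma generator_map_eq:
  assumes "\<And>i. i \<in> {1..p} \<Longrightarrow> s i \<in> {1..q}"
  obtains f where "generator_map G e p q s = (p, q, f)" "f \<in> hom (G p) (G q)" "f \<in> extensional (carrier (G p))"
    "\<And>i. i \<in> {1..p} \<Longrightarrow> f (e p i) = e q (s i)"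
proof -
  obtain f where f: "f \<in> hom (G p) (G q)" "f \<in> extensional (carrier (G p))" "\<And>i. i \<in> {1..p} \<Longrightarrow> f (e p i) = e q (s i)"
    using N_ex[of p "\<lambda>i. e q (s i)" q] e_in assms by blast
  have "generator_map G e p q s = (p, q, f)"
    unfolding generator_map_def
  proof (rule the_equality)
    show "(p, q, f) \<in> maps N p q \<and> (\<forall>i \<in> {1..p}. snd (snd (p, q, f)) (e p i) = e q (s i))"
      using f by (simp add: N_maps)
    fix m assume "m \<in> maps N p q \<and> (\<forall>i \<in> {1..p}. snd (snd m) (e p i) = e q (s i))"
    then obtain g where g: "m = (p, q, g)" "g \<in> hom (G p) (G q)" "g \<in> extensional (carrier (G p))"
      "\<And>i. i \<in> {1..p} \<Longrightarrow> g (e p i) = e q (s i)" by (auto simp: N_maps)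
    have "g = f" by (rule N_eqI[OF g(2,3) f(1,2)]) (simp only: g(4) f(3))
    then show "m = (p, q, f)" using g by simp
  qed
  then show ?thesis using that f by blast
qed

text \<open>\<open>G 0\<close> is generated by the empty set and so trivial; both definite
  descriptions then denote constant homomorphisms.\<close>

lemma N_zero_map: "zero_map N 0 p q = (p, q, \<lambda>w \<in> carrier (G p). \<one>\<^bsub>G q\<^esub>)"
proof -
  have G0: "carrier (G 0) = {\<one>\<^bsub>G 0\<^esub>}" using G_generate[of 0] group.generate_empty[OF G_group] by simp
  interpret g0: group "G 0" by (rule G_group)
  interpret gp: group "G p" by (rule G_group)
  interpret gq: group "G q" by (rule G_group)
  let ?f = "\<lambda>w \<in> carrier (G p). \<one>\<^bsub>G 0\<^esub>" and ?g = "\<lambda>w \<in> carrier (G 0). \<one>\<^bsub>G q\<^esub>"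
  have "(THE g. g \<in> maps N 0 q) = (0, q, ?g)"
  proof (rule the_equality)
    show "(0, q, ?g) \<in> maps N 0 q" by (auto simp: N_maps hom_def)
    fix m assume "m \<in> maps N 0 q"
    then show "m = (0, q, ?g)"
      by (elim N_mapsE) (auto intro!: N_eqI simp: hom_def)
  qed
  moreover have "(THE f. f \<in> maps N p 0) = (p, 0, ?f)"
  proof (rule the_equality)
    show "(p, 0, ?f) \<in> maps N p 0" by (auto simp: N_maps hom_def)
    fix m assume "m \<in> maps N p 0"
    then obtain f where f: "m = (p, 0, f)" "f \<in> hom (G p) (G 0)" "f \<in> extensional (carrier (G p))" by (rule N_mapsE)
    have "f = ?f" by (rule extensionalityI[OF f(3)]) (use hom_in_carrier[OF f(2)] G0 in auto)
    then show "m = (p, 0, ?f)" using f by simp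
  qed
  ultimately show ?thesis by (auto simp: zero_map_def N_Comp compose_def)
qed

lemma N_copair:
  assumes h: "h \<in> hom (G p) (G r)" "h \<in> extensional (carrier (G p))"
    and k: "k \<in> hom (G q) (G r)" "k \<in> extensional (carrier (G q))"
  shows "\<exists>m. copair N S (p, r, h) (q, r, k) = (p + q, r, m) \<and> m \<in> hom (G (p + q)) (G r) \<and>
    (\<forall>i \<in> {1..p}. m (e (p + q) i) = h (e p i)) \<and> (\<forall>j \<in> {1..q}. m (e (p + q) (p + j)) = k (e q j))"
proof -
  obtain i1 where i1: "generator_map G e p (p + q) (\<lambda>i. i) = (p, p + q, i1)" "i1 \<in> hom (G p) (G (p + q))"
    "\<And>i. i \<in> {1..p} \<Longrightarrow> i1 (e p i) = e (p + q) i"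
    using generator_map_eq[of p "\<lambda>i. i" "p + q"] by auto
  obtain i2 where i2: "generator_map G e q (p + q) (\<lambda>j. p + j) = (q, p + q, i2)" "i2 \<in> hom (G q) (G (p + q))"
    "\<And>j. j \<in> {1..q} \<Longrightarrow> i2 (e q j) = e (p + q) (p + j)"
    using generator_map_eq[of q "\<lambda>j. p + j" "p + q"] by auto
  \<comment> \<open>Generators up to \<open>p\<close> come from the first summand, the later ones
    from the second, shifted by \<open>p\<close>.\<close>
  obtain m where m: "m \<in> hom (G (p + q)) (G r)" "m \<in> extensional (carrier (G (p + q)))"
    "\<And>i. i \<in> {1..p + q} \<Longrightarrow> m (e (p + q) i) = (if i \<le> p then h (e p i) else k (e q (i - p)))"
  proof (rule N_ex[of "p + q" "\<lambda>i. if i \<le> p then h (e p i) else k (e q (i - p))" r])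
    show "(if i \<le> p then h (e p i) else k (e q (i - p))) \<in> carrier (G r)" if "i \<in> {1..p + q}" for i
    proof (cases "i \<le> p")
      case False
      then have "i - p \<in> {1..q}" using that by auto
      then show ?thesis using hom_in_carrier[OF k(1) e_in] False by simp
    qed (use hom_in_carrier[OF h(1) e_in] that in simp)
  qed blast
  have mi: "m (e (p + q) i) = h (e p i)" if "i \<in> {1..p}" for i using m(3)[of i] that by simp
  have mj: "m (e (p + q) (p + j)) = k (e q j)" if "j \<in> {1..q}" for j using m(3)[of "p + j"] that by simp
  have c1: "compose (carrier (G p)) f i1 = h \<longleftrightarrow> (\<forall>i \<in> {1..p}. f (e (p + q) i) = h (e p i))"
    if "f \<in> hom (G (p + q)) (G r)" for f
    using N_eqI[OF compose_hom[OF i1(2) that] _ h] i1(3) e_in by (auto simp: compose_def)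
  have c2: "compose (carrier (G q)) f i2 = k \<longleftrightarrow> (\<forall>j \<in> {1..q}. f (e (p + q) (p + j)) = k (e q j))"
    if "f \<in> hom (G (p + q)) (G r)" for f
    using N_eqI[OF compose_hom[OF i2(2) that] _ k] i2(3) e_in by (auto simp: compose_def)
  have "copair N S (p, r, h) (q, r, k) = (p + q, r, m)"
  proof -
    have st: "Src N (a, b, f) = a" "Tgt N (a, b, f) = b" for a b f by (simp_all add: group_theory_def)
    show ?thesis
      unfolding copair_def Let_def st
    proof (rule the_equality)
      show "(p + q, r, m) \<in> maps N (Wedge S p q) r \<and> Comp N (p + q, r, m) (Inc1 S p q) = (p, r, h) \<and>
          Comp N (p + q, r, m) (Inc2 S p q) = (q, r, k)"
        using m c1 c2 mi mj by (simp add: standard_sums_def N_maps i1(1) i2(1) N_Comp)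
      fix m' assume m': "m' \<in> maps N (Wedge S p q) r \<and> Comp N m' (Inc1 S p q) = (p, r, h) \<and>
          Comp N m' (Inc2 S p q) = (q, r, k)"
      then obtain f where f: "m' = (p + q, r, f)" "f \<in> hom (G (p + q)) (G r)" "f \<in> extensional (carrier (G (p + q)))"
        by (auto simp: standard_sums_def elim: N_mapsE)
      have fi: "\<forall>i \<in> {1..p}. f (e (p + q) i) = h (e p i)" "\<forall>j \<in> {1..q}. f (e (p + q) (p + j)) = k (e q j)"
        using m' f c1[OF f(2)] c2[OF f(2)] by (auto simp: standard_sums_def i1(1) i2(1) N_Comp)
      have "f = m"
      proof (rule N_eqI[OF f(2,3) m(1,2)])
        fix i assume i: "i \<in> {1..p + q}"
        show "f (e (p + q) i) = m (e (p + q) i)"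
        proof (cases "i \<le> p")
          case False
          then have "i - p \<in> {1..q}" using i by auto
          then show ?thesis using fi(2)[rule_format, of "i - p"] mj[of "i - p"] False by simp
        qed (use fi(1) mi i in auto)
      qed
      then show "m' = (p + q, r, m)" using f by simp
    qed
  qed
  then show ?thesis using m(1) mi mj by blast
qed

end

section \<open>Changing matrices off their columns, and tracks by coefficients\<close>

context copowers
begin

lemma mmap_cong: "(\<And>i. i \<in> {1..q} \<Longrightarrow> f i = f' i) \<Longrightarrow> mmap q r f = mmap q r f'"
  by (simp add: mmap_def fam_def)

lemma row_cong: "(\<And>i. i \<in> {1..q} \<Longrightarrow> f i = f' i) \<Longrightarrow> row q f k = row q f' k"
  and rowmul_cong: "(\<And>i. i \<in> {1..q} \<Longrightarrow> f i = f' i) \<Longrightarrow> rowmul q r a f = rowmul q r a f'"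
  and app_cong: "(\<And>i. i \<in> {1..q} \<Longrightarrow> f i = f' i) \<Longrightarrow> app q f x = app q f' x"
  by (auto simp: row_def rowmul_def app_def)

lemma psi_cong: "(\<And>i. i \<in> {1..q} \<Longrightarrow> f i = f' i) \<Longrightarrow> psi q r f x = psi q r f' x"
proof -
  assume eq: "\<And>i. i \<in> {1..q} \<Longrightarrow> f i = f' i"
  have "tt q r b f = tt q r b f'" for b by (rule tm_cong) (use eq in auto)
  then show ?thesis
    using mmap_cong[of q f f' r] app_cong[of q f f' x] row_cong[of q f f'] eq by (simp add: psi_def)
qed

text \<open>The deviation of the two glued tracks is known on every summand, and
  \<open>dpull_cmap\<close> extends it linearly to the column \<open>x\<close>.\<close>

lemma tm_act_cmap:
  assumes \<tau>: "\<And>i. i \<in> {1..q} \<Longrightarrow> \<tau> i \<in> rc_tracks r a (f i)" and d: "\<And>i. d i \<in> carrier (D X X)"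
  shows "tm q r a f (\<lambda>i. act (d i) (\<tau> i)) \<triangleleft> cmap q x = act (lin (DR X X) q x d) (tm q r a f \<tau> \<triangleleft> cmap q x)"
proof -
  interpret M: abelian_group "DR X X" by (rule DR_abelian_group[OF X_in X_in])
  have \<tau>': "act (d i) (\<tau> i) \<in> rc_tracks r a (f i)" if "i \<in> {1..q}" for i
    by (rule act_in[OF \<tau>[OF that] Comp_in[OF cmap_in rmap_in] d])
  note m = Comp_in[OF mmap_in[of q r f] rmap_in[of r a]]
  have 1: "tm q r a f \<tau> \<in> tracks A (rmap r a \<bullet> mmap q r f) (rmap q (rowmul q r a f))" by (rule tm_in[OF \<tau>])
  have 2: "tm q r a f (\<lambda>i. act (d i) (\<tau> i)) \<in> tracks A (rmap r a \<bullet> mmap q r f) (rmap q (rowmul q r a f))"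
    by (rule tm_in[OF \<tau>'])
  obtain dd where dd: "dd \<in> carrier (D (pw q) X)" "tm q r a f (\<lambda>i. act (d i) (\<tau> i)) = act dd (tm q r a f \<tau>)"
    using act_ex[OF 1 2 m] by blast
  have "dpull (inc q i) X dd = d i" if i: "i \<in> {1..q}" for i
  proof (rule act_inj[OF \<tau>[OF i] Comp_in[OF cmap_in rmap_in] dpull_in[OF inc_in X_in dd(1)] d])
    have "act (dpull (inc q i) X dd) (tm q r a f \<tau> \<triangleleft> inc q i) = act dd (tm q r a f \<tau>) \<triangleleft> inc q i"
      by (rule pull_act[OF 1 m inc_in dd(1), symmetric])
    also have "\<dots> = act (d i) (\<tau> i)" unfolding dd(2)[symmetric] by (rule tm_inc[OF \<tau>' i])
    also have "tm q r a f \<tau> \<triangleleft> inc q i = \<tau> i" by (rule tm_inc[OF \<tau> i])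
    finally show "act (dpull (inc q i) X dd) (\<tau> i) = act (d i) (\<tau> i)" .
  qed
  then have "dpull (cmap q x) X dd = lin (DR X X) q x d"
    unfolding dpull_cmap[OF X_in dd(1)] by (intro M.lin_cong) (use d in auto)
  then show ?thesis unfolding dd(2) using pull_act[OF 1 m cmap_in dd(1)] by simp
qed

text \<open>An element of \<open>D X (pw r)\<close> with prescribed projections, unique by
  \<open>dpush_proj_eq\<close>.\<close>

definition lam :: "nat \<Rightarrow> (nat \<Rightarrow> 'd) \<Rightarrow> 'd" where
  "lam r d = (SOME e. e \<in> carrier (D X (pw r)) \<and> (\<forall>k \<in> {1..r}. dpush X (proj r k) e = d k))"

lemma lam:
  assumes "\<And>k. d k \<in> carrier (D X X)"
  shows "lam r d \<in> carrier (D X (pw r)) \<and> (\<forall>k \<in> {1..r}. dpush X (proj r k) (lam r d) = d k)"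
proof -
  have "\<exists>e. e \<in> carrier (D X (pw r)) \<and> (\<forall>k \<in> {1..r}. dpush X (proj r k) e = d k)"
    using dpush_proj_ex[of d r] assms by blast
  then show ?thesis unfolding lam_def by (rule someI_ex)
qed

lemma dpush_one: "\<lbrakk>g \<in> maps A Y Y'; U \<in> Obj A\<rbrakk> \<Longrightarrow> dpush U g \<one>\<^bsub>D U Y\<^esub> = \<one>\<^bsub>D U Y'\<^esub>"
  using hom_one[OF dpush_hom] coeff.comm_group_D[of U Y] coeff.comm_group_D[of U Y'] maps_Obj
  by (auto simp: comm_group_def)

lemma DX_group: "V \<in> Obj A \<Longrightarrow> comm_group (D X V)"
  using coeff.comm_group_D X_in by simp

lemma dpush_proj_one:
  assumes "d \<in> carrier (D X (pw r))" "\<And>k. k \<in> {1..r} \<Longrightarrow> dpush X (proj r k) d = \<one>\<^bsub>D X X\<^esub>"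
  shows "d = \<one>\<^bsub>D X (pw r)\<^esub>"
proof -
  interpret comm_group "D X (pw r)" by (rule DX_group[OF pw_in])
  show ?thesis
    by (rule dpush_proj_eq[OF assms(1)]) (use assms(2) dpush_one[OF rmap_in X_in] in auto)
qed

lemma lam_one: assumes "\<And>k. k \<in> {1..r} \<Longrightarrow> d k = \<one>\<^bsub>D X X\<^esub>" "\<And>k. d k \<in> carrier (D X X)"
  shows "lam r d = \<one>\<^bsub>D X (pw r)\<^esub>"
  by (rule dpush_proj_one) (use lam[of d r] assms in auto)

end

locale split_copowers = copowers A P D Dm z \<sigma> T X
  for A :: "('o, 'm, 't, 'z) track_cat_scheme"
    and P :: "'o \<Rightarrow> 'o \<Rightarrow> 'm set monoid"
    and D :: "'o \<Rightarrow> 'o \<Rightarrow> 'd monoid"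
    and Dm :: "'m set \<Rightarrow> 'm set \<Rightarrow> 'd \<Rightarrow> 'd"
    and z :: 'o
    and \<sigma> :: "'m \<Rightarrow> 'd \<Rightarrow> 't"
    and T :: "('o, 'm) sum_choice" and X :: 'o +
  fixes G :: "nat \<Rightarrow> 'g monoid" and e :: "nat \<Rightarrow> nat \<Rightarrow> 'g"
  assumes split_theory: "split_theory (ring_of (D X X)) c G e"
begin

sublocale sp: split_theory "DR X X" c G e by (rule split_theory)

abbreviation N where "N \<equiv> group_theory G"
abbreviation S where "S \<equiv> standard_sums G e"
abbreviation ab where "ab \<equiv> sp.ab"
abbreviation \<kappa> where "\<kappa> \<equiv> sp.\<kappa>"

lemma \<kappa>_in: "\<kappa> q a w \<in> carrier (D X X)"
  using sp.\<kappa>_in[of q a w] by simp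

definition mat :: "nat \<Rightarrow> nat \<Rightarrow> ('g \<Rightarrow> 'g) \<Rightarrow> nat \<Rightarrow> nat \<Rightarrow> int" where
  "mat q r f = (\<lambda>i. ab r (f (e q i)))"

text \<open>Unlike \<open>t\<close>, it depends on the word \<open>w\<close> and not only on
  \<open>ab q w\<close>: here the theory \<open>G\<close> enters the tracks.\<close>

definition t' :: "nat \<Rightarrow> (nat \<Rightarrow> int) \<Rightarrow> 'g \<Rightarrow> 't" where
  "t' q a w = act (\<kappa> q a w) (t q a (ab q w))"

text \<open>Each projection is corrected by \<kappa> at the corresponding row of the matrix, so that
  pushing along a row \<open>a\<close> yields exactly the combination that occurs in
  \<open>\<kappa>_main\<close>.\<close>

definition psi' :: "nat \<Rightarrow> nat \<Rightarrow> (nat \<Rightarrow> nat \<Rightarrow> int) \<Rightarrow> 'g \<Rightarrow> 't" where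
  "psi' q r F w = act (lam r (\<lambda>k. \<kappa> q (row q F k) w)) (psi q r F (ab q w))"

lemma t'_in: "t' q a w \<in> rc_tracks q a (ab q w)"
  unfolding t'_def by (rule act_in[OF t_in Comp_in[OF cmap_in rmap_in] \<kappa>_in])

lemma lam_\<kappa>: "lam r (\<lambda>k. \<kappa> q (row q F k) w) \<in> carrier (D X (pw r))"
  "k \<in> {1..r} \<Longrightarrow> dpush X (proj r k) (lam r (\<lambda>k. \<kappa> q (row q F k) w)) = \<kappa> q (row q F k) w"
  using lam[of "\<lambda>k. \<kappa> q (row q F k) w" r] \<kappa>_in by auto

lemma psi'_in: "psi' q r F w \<in> mc_tracks q r F (ab q w)"
  unfolding psi'_def by (rule act_in[OF psi_in mc_in lam_\<kappa>(1)])

lemma psi'_cong: "(\<And>i. i \<in> {1..q} \<Longrightarrow> F i = F' i) \<Longrightarrow> psi' q r F w = psi' q r F' w"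
  using psi_cong[of q F F' r "ab q w"] row_cong[of q F F'] by (simp add: psi'_def)

lemma psi'_eq_psi: "(\<And>k. k \<in> {1..r} \<Longrightarrow> \<kappa> q (row q F k) w = \<one>\<^bsub>D X X\<^esub>) \<Longrightarrow> psi' q r F w = psi q r F (ab q w)"
  unfolding psi'_def using lam_one[of r "\<lambda>k. \<kappa> q (row q F k) w"] \<kappa>_in act_one[OF psi_in mc_in] by simp

lemma psi'_gen: "i \<in> {1..q} \<Longrightarrow> psi' q r F (e q i) = tid (cmap r (F i))"
  using psi'_eq_psi[of r q F "e q i"] sp.\<kappa>_gen[of i q] sp.ab_gen[of i q] by (simp add: psi_axis)

lemma psi'_one: "psi' q r F \<one>\<^bsub>G q\<^esub> = tid (zm X (pw r))"
  using psi'_eq_psi[of r q F "\<one>\<^bsub>G q\<^esub>"] sp.\<kappa>_one[of _ q] by (simp add: sp.ab_one psi_zero_right)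

lemma psi'_zero:
  assumes "\<And>i. i \<in> {1..q} \<Longrightarrow> F i = (\<lambda>_. 0)" "w \<in> carrier (G q)"
  shows "psi' q r F w = tid (zm X (pw r))"
proof -
  have "row q F k = (\<lambda>_. 0)" for k using assms(1) by (auto simp: row_def)
  then show ?thesis
    using psi'_eq_psi[of r q F w] sp.\<kappa>_zero[of w q] psi_zero_left[of q F r "ab q w"] assms by simp
qed

lemma psi'_axes:
  assumes F: "\<And>i. i \<in> {1..q} \<Longrightarrow> F i = axis i" and w: "w \<in> carrier (G q)"
  shows "psi' q q F w = tid (cmap q (ab q w))"
  using psi'_eq_psi[of q q F w] sp.\<kappa>_axis[of _ q w] row_axes[of q F] psi_axes[of q F "ab q w"] sp.ab_in[of w q] assms
  by simp

lemma ab_app: "\<lbrakk>f \<in> hom (G q) (G r); w \<in> carrier (G q)\<rbrakk> \<Longrightarrow> ab r (f w) = app q (mat q r f) (ab q w)"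
  unfolding mat_def by (rule sp.ab_comp)

text \<open>The vanishing of the obstruction: the corrections on the left and the value of
  \<open>c\<close> add up, by \<open>\<kappa>_main\<close>, to the corrections on the right.\<close>

lemma t'_psi':
  assumes f: "f \<in> hom (G q) (G r)" and a: "a \<in> vec r" and w: "w \<in> carrier (G q)"
  shows "t' r a (f w) \<box> (rmap r a \<triangleright> psi' q r (mat q r f) w) =
    t' q (rowmul q r a (mat q r f)) w \<box> (tm q r a (mat q r f) (\<lambda>i. t' r a (f (e q i))) \<triangleleft> cmap q (ab q w))"
proof -
  let ?F = "mat q r f" and ?x = "ab q w"
  let ?l = "lam r (\<lambda>k. \<kappa> q (row q ?F k) w)"
  let ?L = "lin (DR X X) r a (\<lambda>k. \<kappa> q (row q ?F k) w)" and ?L' = "lin (DR X X) q ?x (\<lambda>i. \<kappa> r a (f (e q i)))"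
  let ?b = "rowmul q r a ?F"
  interpret M: comm_group "D X X" by (rule DX_group[OF X_in])
  have ab: "ab r (f w) = app q ?F ?x" by (rule ab_app[OF f w])
  have L: "?L \<in> carrier (D X X)" "?L' \<in> carrier (D X X)"
    using sp.lin_closed[of "\<lambda>k. \<kappa> q (row q ?F k) w" r a] sp.lin_closed[of "\<lambda>i. \<kappa> r a (f (e q i))" q ?x] \<kappa>_in by auto
  have l: "dpush X (rmap r a) ?l = ?L"
    unfolding dpush_rmap[OF X_in lam_\<kappa>(1), of r a] by (rule sp.lin_cong) (use lam_\<kappa>(2) \<kappa>_in in auto)
  have p: "rmap r a \<triangleright> psi q r ?F ?x \<in> tracks A (rmap r a \<bullet> mmap q r ?F \<bullet> cmap q ?x) (rmap r a \<bullet> cmap r (app q ?F ?x))"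
    by (rule push_in[OF psi_in mc_in rmap_in])
  note amc = amc_in[of r a q ?F ?x]
  note T1 = t_in[of r a "app q ?F ?x"]
  have tq: "t q ?b ?x \<in> tracks A (rmap q ?b \<bullet> cmap q ?x) (num (dot r a (app q ?F ?x)))"
    using t_in[of q ?b ?x] by (simp add: dot_rowmul)
  have T2: "tt q r a ?F \<triangleleft> cmap q ?x \<in> tracks A (rmap r a \<bullet> mmap q r ?F \<bullet> cmap q ?x) (rmap q ?b \<bullet> cmap q ?x)"
    by (rule tt_cmap_in)
  note R = c_tracks_right[of q r a ?F ?x]
  have "t' r a (f w) \<box> (rmap r a \<triangleright> psi' q r ?F w) =
      act (\<kappa> r a (f w)) (t r a (app q ?F ?x)) \<box> act ?L (rmap r a \<triangleright> psi q r ?F ?x)"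
    unfolding t'_def psi'_def ab using push_act[OF psi_in[of q r ?F ?x] mc_in[of q r ?F ?x] rmap_in[of r a] lam_\<kappa>(1)[of r q ?F w]] l by simp
  also have "\<dots> = act (\<kappa> r a (f w)) (act ?L (t r a (app q ?F ?x) \<box> (rmap r a \<triangleright> psi q r ?F ?x)))"
    unfolding act_vcomp[OF act_in[OF p amc L(1)] T1 amc \<kappa>_in] vcomp_act[OF p T1 amc L(1)] ..
  also have "\<dots> = act (\<kappa> r a (f w) \<otimes>\<^bsub>D X X\<^esub> ?L \<otimes>\<^bsub>D X X\<^esub> c r q a ?F ?x) (t q ?b ?x \<box> (tt q r a ?F \<triangleleft> cmap q ?x))"
    unfolding c_eq
    using act_act[OF R amc L(1) c_in[of r q a ?F ?x]] act_act[OF R amc \<kappa>_in M.m_closed[OF L(1) c_in[of r q a ?F ?x]]]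
    by (simp add: M.m_assoc \<kappa>_in L c_in)
  also have "\<kappa> r a (f w) \<otimes>\<^bsub>D X X\<^esub> ?L \<otimes>\<^bsub>D X X\<^esub> c r q a ?F ?x = \<kappa> q ?b w \<otimes>\<^bsub>D X X\<^esub> ?L'"
    using sp.\<kappa>_main[OF f a w] by (simp add: mat_def)
  finally have 1: "t' r a (f w) \<box> (rmap r a \<triangleright> psi' q r ?F w) =
      act (\<kappa> q ?b w \<otimes>\<^bsub>D X X\<^esub> ?L') (t q ?b ?x \<box> (tt q r a ?F \<triangleleft> cmap q ?x))" .
  have "tm q r a ?F (\<lambda>i. t' r a (f (e q i))) \<triangleleft> cmap q ?x = act ?L' (tt q r a ?F \<triangleleft> cmap q ?x)"
    unfolding t'_def mat_def by (rule tm_act_cmap[OF t_in \<kappa>_in])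
  then have "t' q ?b w \<box> (tm q r a ?F (\<lambda>i. t' r a (f (e q i))) \<triangleleft> cmap q ?x) =
      act (\<kappa> q ?b w) (t q ?b ?x) \<box> act ?L' (tt q r a ?F \<triangleleft> cmap q ?x)"
    by (simp add: t'_def)
  also have "\<dots> = act (\<kappa> q ?b w) (act ?L' (t q ?b ?x \<box> (tt q r a ?F \<triangleleft> cmap q ?x)))"
    unfolding act_vcomp[OF act_in[OF T2 amc L(2)] tq amc \<kappa>_in] vcomp_act[OF T2 tq amc L(2)] ..
  also have "\<dots> = act (\<kappa> q ?b w \<otimes>\<^bsub>D X X\<^esub> ?L') (t q ?b ?x \<box> (tt q r a ?F \<triangleleft> cmap q ?x))"
    by (rule act_act[OF R amc \<kappa>_in L(2)])
  finally show ?thesis using 1 by simp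
qed

text \<open>For a unit row the other four faces of the diagram commute by \<open>t'_psi'\<close>, so
  \<open>coherence\<close> forces the projection of the remaining deviation \<open>d\<close> to be
  trivial. Projections detect elements of \<open>D X (pw r)\<close>.\<close>

lemma psi'_coherence:
  assumes f: "f \<in> hom (G q) (G r)" and g: "g \<in> hom (G s) (G q)" and w: "w \<in> carrier (G s)"
  shows "psi' q r (mat q r f) (g w) \<box> (mmap q r (mat q r f) \<triangleright> psi' s q (mat s q g) w) =
    psi' s r (mat s r (\<lambda>w. f (g w))) w \<box>
      (mm s q r (mat q r f) (mat s q g) (\<lambda>i. psi' q r (mat q r f) (g (e s i))) \<triangleleft> cmap s (ab s w))"
proof -
  let ?F = "mat q r f" and ?G = "mat s q g" and ?x = "ab s w"
  let ?H = "\<lambda>i. app q ?F (?G i)"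
  have gw: "g w \<in> carrier (G q)" and ge: "\<And>i. i \<in> {1..s} \<Longrightarrow> g (e s i) \<in> carrier (G q)"
    using hom_in_carrier[OF g] w sp.e_in by auto
  have fg: "(\<lambda>w. f (g w)) \<in> hom (G s) (G r)" using hom_compose[OF g f] by (simp add: comp_def)
  have H: "mat s r (\<lambda>w. f (g w)) i = ?H i" if "i \<in> {1..s}" for i
    using ab_app[OF f ge[OF that]] by (simp add: mat_def)
  have ab1: "ab q (g w) = app s ?G ?x" by (rule ab_app[OF g w])
  have ab2: "ab r (f (g w)) = app q ?F (app s ?G ?x)" unfolding ab_app[OF f gw] ab1 ..
  have ab3: "ab q (g (e s i)) = ?G i" for i by (simp add: mat_def)
  have ab4: "ab r (f (g (e s i))) = ?H i" if "i \<in> {1..s}" for i using H[OF that] by (simp add: mat_def)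
  have ab5: "ab r (f (e q i)) = ?F i" for i by (simp add: mat_def)
  have pH: "psi' s r (mat s r (\<lambda>w. f (g w))) w = psi' s r ?H w" by (rule psi'_cong) (rule H)
  have P1: "psi' s q ?G w \<in> mc_tracks s q ?G ?x" by (rule psi'_in)
  have P2: "psi' q r ?F (g w) \<in> mc_tracks q r ?F (app s ?G ?x)" using psi'_in[of q r ?F "g w"] unfolding ab1 .
  have P3: "psi' q r ?F (g (e s i)) \<in> mc_tracks q r ?F (?G i)" for i using psi'_in[of q r ?F "g (e s i)"] unfolding ab3 .
  have P4: "psi' s r ?H w \<in> mc_tracks s r ?H ?x" by (rule psi'_in)
  have L: "psi' q r ?F (g w) \<box> (mmap q r ?F \<triangleright> psi' s q ?G w) \<in>
      tracks A (mmap q r ?F \<bullet> mmap s q ?G \<bullet> cmap s ?x) (cmap r (app q ?F (app s ?G ?x)))"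
    by (rule vcomp_in[OF push_in[OF P1 mc_in mmap_in] P2])
  have "mm s q r ?F ?G (\<lambda>i. psi' q r ?F (g (e s i))) \<triangleleft> cmap s ?x \<in>
      tracks A (mmap q r ?F \<bullet> mmap s q ?G \<bullet> cmap s ?x) (mmap s r ?H \<bullet> cmap s ?x)"
    using pull_in[OF mm_in[OF P3] Comp_in[OF mmap_in mmap_in] cmap_in] Comp_assoc[OF cmap_in mmap_in mmap_in] by simp
  then have Rt: "psi' s r ?H w \<box> (mm s q r ?F ?G (\<lambda>i. psi' q r ?F (g (e s i))) \<triangleleft> cmap s ?x) \<in>
      tracks A (mmap q r ?F \<bullet> mmap s q ?G \<bullet> cmap s ?x) (cmap r (app q ?F (app s ?G ?x)))"
    using P4 unfolding app_app by (rule vcomp_in)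
  obtain d where d: "d \<in> carrier (D X (pw r))" "psi' q r ?F (g w) \<box> (mmap q r ?F \<triangleright> psi' s q ?G w) =
      act d (psi' s r ?H w \<box> (mm s q r ?F ?G (\<lambda>i. psi' q r ?F (g (e s i))) \<triangleleft> cmap s ?x))"
    using act_ex[OF Rt L Comp_in[OF mc_in mmap_in]] by blast
  interpret M: comm_group "D X X" by (rule DX_group[OF X_in])
  have "dpush X (proj r k) d = \<one>\<^bsub>D X X\<^esub>" if k: "k \<in> {1..r}" for k
  proof -
    let ?a = "axis k" and ?b = "rowmul q r (axis k) ?F"
    have a: "?a \<in> vec r" using k by simp
    have t1: "t' r ?a (f (g w)) \<in> rc_tracks r ?a (app q ?F (app s ?G ?x))" using t'_in[of r ?a "f (g w)"] unfolding ab2 .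
    have t2: "t' r ?a (f (e q i)) \<in> rc_tracks r ?a (?F i)" for i using t'_in[of r ?a "f (e q i)"] unfolding ab5 .
    have t3: "t' q ?b (g w) \<in> rc_tracks q ?b (app s ?G ?x)" using t'_in[of q ?b "g w"] unfolding ab1 .
    have t4: "t' q ?b (g (e s i)) \<in> rc_tracks q ?b (?G i)" for i using t'_in[of q ?b "g (e s i)"] unfolding ab3 .
    have t6: "t' r ?a (f (g (e s i))) \<in> rc_tracks r ?a (?H i)" if "i \<in> {1..s}" for i
      using t'_in[of r ?a "f (g (e s i))"] unfolding ab4[OF that] .
    have rH: "rowmul s r ?a (mat s r (\<lambda>w. f (g w))) = rowmul s r ?a ?H" by (rule rowmul_cong) (rule H)
    have t5: "t' s (rowmul s r ?a ?H) w \<in> rc_tracks s (rowmul s r ?a ?H) ?x" by (rule t'_in)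
    have tmH: "tm s r ?a (mat s r (\<lambda>w. f (g w))) (\<lambda>i. t' r ?a (f (g (e s i)))) = tm s r ?a ?H (\<lambda>i. t' r ?a (f (g (e s i))))"
      by (rule tm_cong) (use H in auto)
    have one: "act \<one>\<^bsub>D X X\<^esub> \<eta> = \<eta>" if "\<eta> \<in> tracks A m m'" "m \<in> maps A X X" for \<eta> m m'
      by (rule act_one[OF that])
    \<comment> \<open>In \<open>e1\<close> to \<open>e4\<close> commutativity is phrased as
      translation by the neutral element, the form that \<open>coherence\<close> expects.\<close>
    have e1: "t' r ?a (f (g w)) \<box> (proj r k \<triangleright> psi' q r ?F (g w)) =
        act \<one>\<^bsub>D X X\<^esub> (t' q ?b (g w) \<box> (tm q r ?a ?F (\<lambda>i. t' r ?a (f (e q i))) \<triangleleft> cmap q (app s ?G ?x)))"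
      using t'_psi'[OF f a gw] act_one[OF vcomp_in[OF push_in[OF P2 mc_in rmap_in[of r ?a]] t1] Comp_in[OF mc_in rmap_in]]
      unfolding ab1 by simp
    have e2: "t' q ?b (g w) \<box> (rmap q ?b \<triangleright> psi' s q ?G w) =
        act \<one>\<^bsub>D X X\<^esub> (t' s (rowmul s r ?a ?H) w \<box> (tm s q ?b ?G (\<lambda>i. t' q ?b (g (e s i))) \<triangleleft> cmap s ?x))"
      using t'_psi'[OF g vec_rowmul[of q r ?a ?F] w] act_one[OF vcomp_in[OF push_in[OF P1 mc_in rmap_in[of q ?b]] t3] Comp_in[OF mc_in rmap_in]]
      unfolding rowmul_rowmul by simp
    have t1': "t' r ?a (f (g w)) \<in> tracks A (rmap r ?a \<bullet> cmap r (app s ?H ?x)) (num (dot r ?a (app q ?F (app s ?G ?x))))"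
      using t1 unfolding app_app .
    have e3: "t' r ?a (f (g w)) \<box> (proj r k \<triangleright> psi' s r ?H w) =
        act \<one>\<^bsub>D X X\<^esub> (t' s (rowmul s r ?a ?H) w \<box> (tm s r ?a ?H (\<lambda>i. t' r ?a (f (g (e s i)))) \<triangleleft> cmap s ?x))"
      using t'_psi'[OF fg a w] act_one[OF vcomp_in[OF push_in[OF P4 mc_in rmap_in[of r ?a]] t1'] Comp_in[OF mc_in rmap_in]]
      unfolding rH tmH pH by simp
    have e4: "t' r ?a (f (g (e s i))) \<box> (proj r k \<triangleright> psi' q r ?F (g (e s i))) =
        act \<one>\<^bsub>D X X\<^esub> (t' q ?b (g (e s i)) \<box> (tm q r ?a ?F (\<lambda>i. t' r ?a (f (e q i))) \<triangleleft> cmap q (?G i)))"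
      if i: "i \<in> {1..s}" for i
      using t'_psi'[OF f a ge[OF i]] act_one[OF vcomp_in[OF push_in[OF P3 mc_in rmap_in[of r ?a]] t6[OF i]] Comp_in[OF mc_in rmap_in]]
      unfolding ab3 by simp
    have "lin (DR X X) r ?a (\<lambda>k. dpush X (proj r k) d) \<otimes>\<^bsub>D X X\<^esub> \<one>\<^bsub>D X X\<^esub> \<otimes>\<^bsub>D X X\<^esub> lin (DR X X) s ?x (\<lambda>i. \<one>\<^bsub>D X X\<^esub>) =
        \<one>\<^bsub>D X X\<^esub> \<otimes>\<^bsub>D X X\<^esub> \<one>\<^bsub>D X X\<^esub>"
      by (rule coherence[OF t1 t2 t3 t4 t5 t6 P1 P2 P3 P4 _ _ _ _ d(1) e1 e2 e3 e4 d(2)]) simp_all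
    moreover have "lin (DR X X) r ?a (\<lambda>k. dpush X (proj r k) d) = dpush X (proj r k) d"
      by (rule sp.lin_axis[OF k]) (simp add: dpush_in[OF rmap_in X_in d(1)])
    moreover have "lin (DR X X) s ?x (\<lambda>i. \<one>\<^bsub>D X X\<^esub>) = \<one>\<^bsub>D X X\<^esub>" using sp.lin_zero[of s ?x] by simp
    ultimately show ?thesis using dpush_in[OF rmap_in X_in d(1)] by simp
  qed
  then have "d = \<one>\<^bsub>D X (pw r)\<^esub>" by (intro dpush_proj_one[OF d(1)])
  then show ?thesis using d(2) act_one[OF Rt Comp_in[OF mc_in mmap_in]] unfolding pH by simp
qed

end

section \<open>Maps and tracks with given components on a wedge\<close>

context copowers
begin

lemma copair:
  assumes a: "a \<in> maps A U Z" and b: "b \<in> maps A V Z"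
  shows copair_in: "copair A T a b \<in> maps A (Wedge T U V) Z"
    and copair_Inc1: "copair A T a b \<bullet> Inc1 T U V = a"
    and copair_Inc2: "copair A T a b \<bullet> Inc2 T U V = b"
proof -
  have UV: "U \<in> Obj A" "V \<in> Obj A" using a b maps_Obj by blast+
  have "\<exists>!m. m \<in> maps A (Wedge T U V) Z \<and> m \<bullet> Inc1 T U V = a \<and> m \<bullet> Inc2 T U V = b"
  proof (rule ex_ex1I)
    show "\<exists>m. m \<in> maps A (Wedge T U V) Z \<and> m \<bullet> Inc1 T U V = a \<and> m \<bullet> Inc2 T U V = b"
      using wedge_map_ex[OF a b] by blast
    show "m = m'" if "m \<in> maps A (Wedge T U V) Z \<and> m \<bullet> Inc1 T U V = a \<and> m \<bullet> Inc2 T U V = b"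
      "m' \<in> maps A (Wedge T U V) Z \<and> m' \<bullet> Inc1 T U V = a \<and> m' \<bullet> Inc2 T U V = b" for m m'
      using wedge_map_unique[OF UV, of m Z m'] that by simp
  qed
  from theI'[OF this] show "copair A T a b \<in> maps A (Wedge T U V) Z"
    "copair A T a b \<bullet> Inc1 T U V = a" "copair A T a b \<bullet> Inc2 T U V = b"
    by (simp_all add: copair_def maps_Src[OF a] maps_Src[OF b] maps_Tgt[OF a])
qed

lemma tcopair_eqI:
  assumes UV: "U \<in> Obj A" "V \<in> Obj A" and m: "m \<in> maps A (Wedge T U V) Z" and \<eta>: "\<eta> \<in> tracks A m m'"
    and "\<eta> \<triangleleft> Inc1 T U V = \<alpha>" "\<eta> \<triangleleft> Inc2 T U V = \<beta>"
  shows "tcopair A T \<alpha> \<beta> = \<eta>"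
proof -
  have \<alpha>: "TSrc A \<alpha> = m \<bullet> Inc1 T U V" and \<beta>: "TSrc A \<beta> = m \<bullet> Inc2 T U V"
    using pull_in[OF \<eta> m Inc1_in[OF UV]] pull_in[OF \<eta> m Inc2_in[OF UV]] assms by (auto simp: tracks_def)
  note s = maps_Src[OF Comp_in[OF Inc1_in[OF UV] m]] maps_Src[OF Comp_in[OF Inc2_in[OF UV] m]]
    maps_Tgt[OF Comp_in[OF Inc1_in[OF UV] m]]
  show ?thesis
    unfolding tcopair_def Let_def \<alpha> \<beta> s
  proof (rule the_equality)
    show "\<eta> \<in> Arr (hom_groupoid A (Wedge T U V) Z) \<and> \<eta> \<triangleleft> Inc1 T U V = \<alpha> \<and> \<eta> \<triangleleft> Inc2 T U V = \<beta>"
      using assms by (auto simp: tracks_def)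
    fix \<theta> assume \<theta>: "\<theta> \<in> Arr (hom_groupoid A (Wedge T U V) Z) \<and> \<theta> \<triangleleft> Inc1 T U V = \<alpha> \<and> \<theta> \<triangleleft> Inc2 T U V = \<beta>"
    have "inj_on (\<lambda>\<eta>. (\<eta> \<triangleleft> Inc1 T U V, \<eta> \<triangleleft> Inc2 T U V)) (Arr (hom_groupoid A (Wedge T U V) Z))"
      using wedge_iso[of U V Z] UV maps_Obj[OF m(1)] by (auto simp: is_cat_iso_def bij_betw_def)
    moreover have "\<eta> \<in> Arr (hom_groupoid A (Wedge T U V) Z)" using m \<eta> by (auto simp: tracks_def)
    ultimately show "\<theta> = \<eta>" using \<theta> assms(5,6) by (auto dest!: inj_onD)
  qed
qed

end

section \<open>The pseudofunctor of a split theory\<close>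

context split_copowers
begin

text \<open>On maps only exponent sums are used, so homomorphisms with equal matrices have equal
  images. The compositor uses the words \<open>g (e s i)\<close>, one for each summand.\<close>

definition \<phi> :: "(nat, nat \<times> nat \<times> ('g \<Rightarrow> 'g), 'o, 'm, 't) pseudo" where
  "\<phi> = \<lparr>
     PObj = pw,
     PMap = (\<lambda>(q, r, f). mmap q r (mat q r f)),
     PComp = (\<lambda>(q, r, f) (s, _, g). mm s q r (mat q r f) (mat s q g) (\<lambda>i. psi' q r (mat q r f) (g (e s i)))),
     PUnit = (\<lambda>q. tid (Ident A (pw q)))\<rparr>"

lemma \<phi>_simps [simp]: "PObj \<phi> q = pw q" "PMap \<phi> (q, r, f) = mmap q r (mat q r f)"
  "PUnit \<phi> q = tid (Ident A (pw q))"
  "PComp \<phi> (q, r, f) (s, q', g) = mm s q r (mat q r f) (mat s q g) (\<lambda>i. psi' q r (mat q r f) (g (e s i)))"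
  by (simp_all add: \<phi>_def)

lemma e_in: "i \<in> {1..p} \<Longrightarrow> e p i \<in> carrier (G p)" by (rule sp.e_in)

lemma mat_compose:
  assumes "f \<in> hom (G q) (G r)" "g \<in> hom (G s) (G q)" "i \<in> {1..s}"
  shows "mat s r (compose (carrier (G s)) f g) i = app q (mat q r f) (mat s q g i)"
  using ab_app[OF assms(1) hom_in_carrier[OF assms(2) e_in[OF assms(3)]]] assms e_in
  by (simp add: mat_def compose_def)

lemma mat_id: "i \<in> {1..p} \<Longrightarrow> mat p p (\<lambda>x \<in> carrier (G p). x) i = axis i"
  using e_in by (simp add: mat_def sp.ab_gen)

lemma mmap_id: "mmap p p (mat p p (\<lambda>x \<in> carrier (G p). x)) = Ident A (pw p)"
  by (rule mmap_axis) (rule mat_id)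

lemma psi'_word: "psi' q r F (g (e s i)) \<in> mc_tracks q r F (mat s q g i)"
  using psi'_in[of q r F "g (e s i)"] by (simp add: mat_def)

lemma \<phi>_comp_in:
  assumes f: "f \<in> hom (G q) (G r)" and g: "g \<in> hom (G s) (G q)"
  shows "PComp \<phi> (q, r, f) (s, q, g) \<in>
    tracks A (mmap q r (mat q r f) \<bullet> mmap s q (mat s q g)) (mmap s r (mat s r (compose (carrier (G s)) f g)))"
proof -
  have eq: "mmap s r (mat s r (compose (carrier (G s)) f g)) = mmap s r (\<lambda>i. app q (mat q r f) (mat s q g i))"
    by (rule mmap_cong) (rule mat_compose[OF f g])
  show ?thesis unfolding eq \<phi>_simps by (rule mm_in[OF psi'_word])
qed

lemma \<phi>_comp_inc: "i \<in> {1..s} \<Longrightarrow> PComp \<phi> (q, r, f) (s, q, g) \<triangleleft> inc s i = psi' q r (mat q r f) (g (e s i))"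
  unfolding \<phi>_simps by (rule mm_inc[OF psi'_word])

lemma mm_maps: "mmap q r F \<bullet> mmap s q F' \<in> maps A (pw s) (pw r)"
  by (rule Comp_in[OF mmap_in mmap_in])

lemma \<phi>_pseudofunctor: "pseudofunctor N A \<phi>"
proof
  show "PObj \<phi> p \<in> Obj A" for p by simp
  show "PMap \<phi> m \<in> maps A (PObj \<phi> p) (PObj \<phi> q)" if "m \<in> maps N p q" for m p q
    using that by (elim sp.N_mapsE) (simp add: mmap_in)
  show "PComp \<phi> f g \<in> tracks A (PMap \<phi> f \<bullet> PMap \<phi> g) (PMap \<phi> (Comp N f g))"
    if "g \<in> maps N s q" "f \<in> maps N q r" for f g s q r
    using that \<phi>_comp_in by (elim sp.N_mapsE) (simp add: sp.N_Comp del: \<phi>_simps(4))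
  show "PUnit \<phi> p \<in> tracks A (PMap \<phi> (Ident N p)) (Ident A (PObj \<phi> p))" for p
    using tid_in[OF Ident_in[OF pw_in]] by (simp add: sp.N_Ident mmap_id)
next
  fix h p s g q f r assume "h \<in> maps N p s" "g \<in> maps N s q" "f \<in> maps N q r"
  then obtain h' g' f' where h: "h = (p, s, h')" "h' \<in> hom (G p) (G s)" and g: "g = (s, q, g')" "g' \<in> hom (G s) (G q)"
    and f: "f = (q, r, f')" "f' \<in> hom (G q) (G r)" by (auto simp: sp.N_maps)
  let ?H = "mat p s h'" and ?G = "mat s q g'" and ?F = "mat q r f'"
  let ?gh = "compose (carrier (G p)) g' h'" and ?fg = "compose (carrier (G s)) f' g'"
  have gh: "?gh \<in> hom (G p) (G q)" and fg: "?fg \<in> hom (G s) (G r)" using sp.compose_hom f g h by auto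
  have fgh: "compose (carrier (G p)) f' ?gh = compose (carrier (G p)) ?fg h'"
    using hom_in_carrier[OF h(2)] by (auto simp: compose_def)
  note m = Comp_in[OF mm_maps[of s q ?G p ?H] mmap_in[of q r ?F]]
  note as = Comp_assoc[OF mmap_in[of p s ?H] mmap_in[of s q ?G] mmap_in[of q r ?F]]
  have 1: "mmap q r ?F \<triangleright> PComp \<phi> g h \<in> tracks A (mmap q r ?F \<bullet> mmap s q ?G \<bullet> mmap p s ?H) (mmap q r ?F \<bullet> mmap p q (mat p q ?gh))"
    unfolding g h by (rule push_in[OF \<phi>_comp_in[OF g(2) h(2)] mm_maps mmap_in])
  have 2: "PComp \<phi> f g \<triangleleft> mmap p s ?H \<in> tracks A (mmap q r ?F \<bullet> mmap s q ?G \<bullet> mmap p s ?H) (mmap s r (mat s r ?fg) \<bullet> mmap p s ?H)"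
    using pull_in[OF \<phi>_comp_in[OF f(2) g(2)] mm_maps mmap_in] unfolding f g as .
  note 3 = \<phi>_comp_in[OF f(2) gh] and 4 = \<phi>_comp_in[OF fg h(2)]
  \<comment> \<open>Tracks out of \<open>pw p\<close> are compared on the summands; on summand
    \<open>j\<close> the identity is \<open>psi'_coherence\<close> for the word
    \<open>h' (e p j)\<close>.\<close>
  have "PComp \<phi> (q, r, f') (p, q, ?gh) \<box> (mmap q r ?F \<triangleright> PComp \<phi> g h) =
      PComp \<phi> (s, r, ?fg) (p, s, h') \<box> (PComp \<phi> f g \<triangleleft> mmap p s ?H)"
  proof (rule pw_track_unique[OF m vcomp_in[OF 1 3]])
    show "PComp \<phi> (s, r, ?fg) (p, s, h') \<box> (PComp \<phi> f g \<triangleleft> mmap p s ?H) \<in>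
        tracks A (mmap q r ?F \<bullet> mmap s q ?G \<bullet> mmap p s ?H) (mmap p r (mat p r (compose (carrier (G p)) f' ?gh)))"
      unfolding fgh by (rule vcomp_in[OF 2 4])
    fix j assume j: "j \<in> {1..p}"
    let ?w = "h' (e p j)"
    have w: "?w \<in> carrier (G s)" using hom_in_carrier[OF h(2) e_in[OF j]] .
    have gw: "?gh (e p j) = g' ?w" using e_in[OF j] by (simp add: compose_def)
    have Hj: "?H j = ab s ?w" by (simp add: mat_def)
    have "(PComp \<phi> (q, r, f') (p, q, ?gh) \<box> (mmap q r ?F \<triangleright> PComp \<phi> g h)) \<triangleleft> inc p j =
        psi' q r ?F (g' ?w) \<box> (mmap q r ?F \<triangleright> psi' s q ?G ?w)"
      using pull_vcomp[OF 1 3 m inc_in, of j]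
        push_pull[OF \<phi>_comp_in[OF g(2) h(2)] inc_in mm_maps mmap_in[of q r ?F], of j]
        \<phi>_comp_inc[OF j, of q r f' ?gh] \<phi>_comp_inc[OF j, of s q g' h'] gw
      by (simp add: g(1) h(1) del: \<phi>_simps(4))
    also have "\<dots> = psi' s r (mat s r (\<lambda>w. f' (g' w))) ?w \<box>
        (mm s q r ?F ?G (\<lambda>i. psi' q r ?F (g' (e s i))) \<triangleleft> cmap s (ab s ?w))"
      by (rule psi'_coherence[OF f(2) g(2) w])
    also have "psi' s r (mat s r (\<lambda>w. f' (g' w))) ?w = psi' s r (mat s r ?fg) ?w"
      by (rule psi'_cong) (use e_in in \<open>simp add: mat_def compose_def\<close>)
    also have "psi' s r (mat s r ?fg) ?w \<box> (mm s q r ?F ?G (\<lambda>i. psi' q r ?F (g' (e s i))) \<triangleleft> cmap s (ab s ?w)) =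
        (PComp \<phi> (s, r, ?fg) (p, s, h') \<box> (PComp \<phi> f g \<triangleleft> mmap p s ?H)) \<triangleleft> inc p j"
      using pull_vcomp[OF 2 4 m inc_in, of j]
        pull_pull[OF \<phi>_comp_in[OF f(2) g(2)] mm_maps mmap_in[of p s ?H] inc_in, of j]
        \<phi>_comp_inc[OF j, of s r ?fg h'] mmap_inc[OF j, of s ?H]
      by (simp add: f(1) g(1) Hj del: \<phi>_simps(4)) (simp add: g(1))
    finally show "(PComp \<phi> (q, r, f') (p, q, ?gh) \<box> (mmap q r ?F \<triangleright> PComp \<phi> g h)) \<triangleleft> inc p j =
        (PComp \<phi> (s, r, ?fg) (p, s, h') \<box> (PComp \<phi> f g \<triangleleft> mmap p s ?H)) \<triangleleft> inc p j" .
  qed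
  then show "PComp \<phi> f (Comp N g h) \<box> (PMap \<phi> f \<triangleright> PComp \<phi> g h) =
      PComp \<phi> (Comp N f g) h \<box> (PComp \<phi> f g \<triangleleft> PMap \<phi> h)"
    by (simp add: f(1) g(1) h(1) sp.N_Comp del: \<phi>_simps(4))
next
  fix f q r assume "f \<in> maps N q r"
  then obtain f' where f: "f = (q, r, f')" "f' \<in> hom (G q) (G r)" "f' \<in> extensional (carrier (G q))" by (rule sp.N_mapsE)
  let ?F = "mat q r f'" and ?I = "\<lambda>x \<in> carrier (G q). x" and ?J = "\<lambda>x \<in> carrier (G r). x"
  have I: "(\<lambda>x \<in> carrier (G p). x) \<in> hom (G p) (G p)" for p
  proof -
    interpret group "G p" by (rule sp.G_group)
    show ?thesis by (auto simp: hom_def)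
  qed
  have fI: "compose (carrier (G q)) f' ?I = f'" using f(3) by (auto simp: compose_def extensional_def)
  have If: "compose (carrier (G q)) ?J f' = f'"
    using f(3) hom_in_carrier[OF f(2)] by (auto simp: compose_def extensional_def)
  have "PComp \<phi> f (q, q, ?I) = tid (mmap q r ?F)"
  proof (rule pw_track_unique[OF mmap_in _ tid_in[OF mmap_in]])
    show "PComp \<phi> f (q, q, ?I) \<in> tracks A (mmap q r ?F) (mmap q r ?F)"
      using \<phi>_comp_in[OF f(2) I] unfolding f(1) fI mmap_id Comp_Ident[OF mmap_in] .
    fix j assume j: "j \<in> {1..q}"
    show "PComp \<phi> f (q, q, ?I) \<triangleleft> inc q j = tid (mmap q r ?F) \<triangleleft> inc q j"
      unfolding f(1) \<phi>_comp_inc[OF j] pull_tid[OF inc_in mmap_in] mmap_inc[OF j]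
      using e_in[OF j] psi'_gen[OF j] by simp
  qed
  then show "PComp \<phi> f (Ident N q) = PMap \<phi> f \<triangleright> PUnit \<phi> q"
    using push_tid[OF Ident_in[OF pw_in] mmap_in] Comp_Ident[OF mmap_in] by (simp add: f(1) sp.N_Ident del: \<phi>_simps(4))
  have "PComp \<phi> (r, r, ?J) f = tid (mmap q r ?F)"
  proof (rule pw_track_unique[OF mmap_in _ tid_in[OF mmap_in]])
    show "PComp \<phi> (r, r, ?J) f \<in> tracks A (mmap q r ?F) (mmap q r ?F)"
      using \<phi>_comp_in[OF I f(2)] unfolding f(1) If mmap_id Ident_Comp[OF mmap_in] .
    fix j assume j: "j \<in> {1..q}"
    have "psi' r r (mat r r ?J) (f' (e q j)) = tid (cmap r (?F j))"
      using psi'_axes[of r "mat r r ?J" "f' (e q j)"] mat_id hom_in_carrier[OF f(2) e_in[OF j]] by (simp add: mat_def)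
    then show "PComp \<phi> (r, r, ?J) f \<triangleleft> inc q j = tid (mmap q r ?F) \<triangleleft> inc q j"
      unfolding f(1) \<phi>_comp_inc[OF j] pull_tid[OF inc_in mmap_in] mmap_inc[OF j] .
  qed
  then show "PComp \<phi> (Ident N r) f = PUnit \<phi> r \<triangleleft> PMap \<phi> f"
    using pull_tid[OF mmap_in Ident_in[OF pw_in]] Ident_Comp[OF mmap_in] by (simp add: f(1) sp.N_Ident del: \<phi>_simps(4))
qed

section \<open>Preservation of zero maps and sums\<close>

lemma mmap_zero: "(\<And>i. i \<in> {1..q} \<Longrightarrow> F i = (\<lambda>_. 0)) \<Longrightarrow> mmap q r F = zm (pw q) (pw r)"
  by (rule pw_map_unique[OF mmap_in zm_in[OF pw_in pw_in]]) (simp add: mmap_inc zm_comp[OF inc_in pw_in])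

lemma mat_zero: "i \<in> {1..p} \<Longrightarrow> mat p q (\<lambda>w \<in> carrier (G p). \<one>\<^bsub>G q\<^esub>) i = (\<lambda>_. 0)"
  using e_in by (simp add: mat_def sp.ab_one)

lemma mmap_mat_zero: "mmap p q (mat p q (\<lambda>w \<in> carrier (G p). \<one>\<^bsub>G q\<^esub>)) = zm (pw p) (pw q)"
  by (rule mmap_zero) (rule mat_zero)

text \<open>The standard inclusions send generators to generators, so their matrices consist of unit
  columns, which are represented strictly by \<open>inc\<close>.\<close>

lemma comparison_parts:
  "PMap \<phi> (Inc1 S p q) \<in> maps A (pw p) (pw (p + q))" "PMap \<phi> (Inc2 S p q) \<in> maps A (pw q) (pw (p + q))"
  "i \<in> {1..p} \<Longrightarrow> PMap \<phi> (Inc1 S p q) \<bullet> inc p i = inc (p + q) i"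
  "j \<in> {1..q} \<Longrightarrow> PMap \<phi> (Inc2 S p q) \<bullet> inc q j = inc (p + q) (p + j)"
proof -
  obtain i1 where i1: "generator_map G e p (p + q) (\<lambda>i. i) = (p, p + q, i1)" "\<And>i. i \<in> {1..p} \<Longrightarrow> i1 (e p i) = e (p + q) i"
    using sp.generator_map_eq[of p "\<lambda>i. i" "p + q"] by auto
  obtain i2 where i2: "generator_map G e q (p + q) (\<lambda>j. p + j) = (q, p + q, i2)" "\<And>j. j \<in> {1..q} \<Longrightarrow> i2 (e q j) = e (p + q) (p + j)"
    using sp.generator_map_eq[of q "\<lambda>j. p + j" "p + q"] by auto
  have 1: "PMap \<phi> (Inc1 S p q) = mmap p (p + q) (mat p (p + q) i1)" by (simp add: standard_sums_def i1(1))
  have 2: "PMap \<phi> (Inc2 S p q) = mmap q (p + q) (mat q (p + q) i2)" by (simp add: standard_sums_def i2(1))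
  show "PMap \<phi> (Inc1 S p q) \<in> maps A (pw p) (pw (p + q))" "PMap \<phi> (Inc2 S p q) \<in> maps A (pw q) (pw (p + q))"
    unfolding 1 2 by (rule mmap_in)+
  show "PMap \<phi> (Inc1 S p q) \<bullet> inc p i = inc (p + q) i" if i: "i \<in> {1..p}"
    unfolding 1 mmap_inc[OF i] using i by (simp add: mat_def i1(2) sp.ab_gen cmap_axis)
  show "PMap \<phi> (Inc2 S p q) \<bullet> inc q j = inc (p + q) (p + j)" if j: "j \<in> {1..q}"
    unfolding 2 mmap_inc[OF j] using j by (simp add: mat_def i2(2) sp.ab_gen cmap_axis)
qed

lemma comparison:
  "sum_comparison S A T \<phi> p q \<in> maps A (Wedge T (pw p) (pw q)) (pw (p + q))"
  "sum_comparison S A T \<phi> p q \<bullet> Inc1 T (pw p) (pw q) = PMap \<phi> (Inc1 S p q)"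
  "sum_comparison S A T \<phi> p q \<bullet> Inc2 T (pw p) (pw q) = PMap \<phi> (Inc2 S p q)"
  unfolding sum_comparison_def by (rule copair[OF comparison_parts(1,2)])+

text \<open>\<open>pw (p + q)\<close> is nested differently from the wedge of \<open>pw p\<close>
  and \<open>pw q\<close>, but both have the same summands. The inverse is given on these by
  \<open>?h\<close>, and strict uniqueness on both sides shows the composites to be
  identities.\<close>

lemma comparison_iso: "isomorphism A (sum_comparison S A T \<phi> p q)"
proof -
  let ?\<iota> = "sum_comparison S A T \<phi> p q" and ?W = "Wedge T (pw p) (pw q)"
  let ?h = "\<lambda>i. if i \<le> p then Inc1 T (pw p) (pw q) \<bullet> inc p i else Inc2 T (pw p) (pw q) \<bullet> inc q (i - p)"
  note I1 = Inc1_in[OF pw_in pw_in, of p q] and I2 = Inc2_in[OF pw_in pw_in, of p q]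
  have W: "?W \<in> Obj A" by (rule Wedge_in[OF pw_in pw_in])
  have h: "?h i \<in> maps A X ?W" for i using Comp_in[OF inc_in I1] Comp_in[OF inc_in I2] by simp
  let ?k = "fam (p + q) ?W ?h"
  have k: "?k \<in> maps A (pw (p + q)) ?W" by (rule fam_in) (use W h in auto)
  have k_inc: "?k \<bullet> inc (p + q) i = ?h i" if "i \<in> {1..p + q}" for i
    by (rule fam_inc) (use W h that in auto)
  have 1: "?\<iota> \<bullet> ?k = Ident A (pw (p + q))"
  proof (rule pw_map_unique[OF Comp_in[OF k comparison(1)] Ident_in[OF pw_in]])
    fix i assume i: "i \<in> {1..p + q}"
    have "(?\<iota> \<bullet> ?k) \<bullet> inc (p + q) i = ?\<iota> \<bullet> ?h i"
      using Comp_assoc[OF inc_in k comparison(1), of i] k_inc[OF i] by simp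
    also have "\<dots> = inc (p + q) i"
    proof (cases "i \<le> p")
      case True
      then show ?thesis
        using Comp_assoc[OF inc_in I1 comparison(1), of i] comparison(2) comparison_parts(3)[of i p q] i by simp
    next
      case False
      then have "i - p \<in> {1..q}" using i by auto
      then show ?thesis
        using Comp_assoc[OF inc_in I2 comparison(1), of "i - p"] comparison(3) comparison_parts(4)[of "i - p" q p] False by simp
    qed
    finally show "(?\<iota> \<bullet> ?k) \<bullet> inc (p + q) i = Ident A (pw (p + q)) \<bullet> inc (p + q) i"
      by (simp add: Ident_Comp[OF inc_in])
  qed
  have 2: "?k \<bullet> ?\<iota> = Ident A ?W"
  proof (rule wedge_map_unique[OF pw_in pw_in Comp_in[OF comparison(1) k] Ident_in[OF W]])
    have "?k \<bullet> PMap \<phi> (Inc1 S p q) = Inc1 T (pw p) (pw q)"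
    proof (rule pw_map_unique[OF Comp_in[OF comparison_parts(1) k] I1])
      fix i assume i: "i \<in> {1..p}"
      then show "(?k \<bullet> PMap \<phi> (Inc1 S p q)) \<bullet> inc p i = Inc1 T (pw p) (pw q) \<bullet> inc p i"
        using Comp_assoc[OF inc_in comparison_parts(1) k, of i] comparison_parts(3)[OF i] k_inc[of i] by simp
    qed
    then show "(?k \<bullet> ?\<iota>) \<bullet> Inc1 T (pw p) (pw q) = Ident A ?W \<bullet> Inc1 T (pw p) (pw q)"
      using Comp_assoc[OF I1 comparison(1) k] comparison(2) Ident_Comp[OF I1] by simp
    have "?k \<bullet> PMap \<phi> (Inc2 S p q) = Inc2 T (pw p) (pw q)"
    proof (rule pw_map_unique[OF Comp_in[OF comparison_parts(2) k] I2])
      fix j assume j: "j \<in> {1..q}"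
      then show "(?k \<bullet> PMap \<phi> (Inc2 S p q)) \<bullet> inc q j = Inc2 T (pw p) (pw q) \<bullet> inc q j"
        using Comp_assoc[OF inc_in comparison_parts(2) k, of j] comparison_parts(4)[OF j] k_inc[of "p + j"] by simp
    qed
    then show "(?k \<bullet> ?\<iota>) \<bullet> Inc2 T (pw p) (pw q) = Ident A ?W \<bullet> Inc2 T (pw p) (pw q)"
      using Comp_assoc[OF I2 comparison(1) k] comparison(3) Ident_Comp[OF I2] by simp
  qed
  show ?thesis
    using 1 2 k comparison(1) by (auto simp: isomorphism_def maps_def)
qed

text \<open>A compositor is determined by words at the generators of its source, so restriction
  along a map that takes summand \<open>j\<close> to summand \<open>l j\<close> only reindexes these
  words. It is applied to both inclusions into a sum.\<close>

lemma \<phi>_comp_generators: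
  assumes g: "g \<in> hom (G r) (G s)" and m: "m \<in> hom (G a) (G r)" and h: "h \<in> hom (G p) (G r)"
    and \<iota>: "\<iota> \<in> maps A (pw p) (pw a)" and \<iota>_inc: "\<And>j. j \<in> {1..p} \<Longrightarrow> \<iota> \<bullet> inc p j = inc a (l j)"
    and l: "\<And>j. j \<in> {1..p} \<Longrightarrow> l j \<in> {1..a}" and mh: "\<And>j. j \<in> {1..p} \<Longrightarrow> m (e a (l j)) = h (e p j)"
  shows "PComp \<phi> (r, s, g) (a, r, m) \<triangleleft> \<iota> = PComp \<phi> (r, s, g) (p, r, h)"
proof -
  let ?gm = "mmap r s (mat r s g) \<bullet> mmap a r (mat a r m)" and ?gh = "mmap r s (mat r s g) \<bullet> mmap p r (mat p r h)"
  note \<eta> = \<phi>_comp_in[OF g m] and gm = mm_maps[of r s "mat r s g" a "mat a r m"]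
  have pull: "mmap a q (mat a q m') \<bullet> \<iota> = mmap p q (mat p q h')"
    if "\<And>j. j \<in> {1..p} \<Longrightarrow> m' (e a (l j)) = h' (e p j)" for q m' h'
  proof (rule pw_map_unique[OF Comp_in[OF \<iota> mmap_in] mmap_in])
    fix j assume j: "j \<in> {1..p}"
    show "(mmap a q (mat a q m') \<bullet> \<iota>) \<bullet> inc p j = mmap p q (mat p q h') \<bullet> inc p j"
      unfolding Comp_assoc[OF inc_in \<iota> mmap_in, symmetric] \<iota>_inc[OF j] mmap_inc[OF j] mmap_inc[OF l[OF j]]
      by (simp add: mat_def that[OF j])
  qed
  have s: "?gm \<bullet> \<iota> = ?gh"
    unfolding Comp_assoc[OF \<iota> mmap_in mmap_in, symmetric] using pull[of m h] mh by simp
  have t: "mmap a s (mat a s (compose (carrier (G a)) g m)) \<bullet> \<iota> = mmap p s (mat p s (compose (carrier (G p)) g h))"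
    by (rule pull) (use e_in l mh in \<open>simp add: compose_def\<close>)
  show ?thesis
  proof (rule pw_track_unique[OF mm_maps _ \<phi>_comp_in[OF g h]])
    show "PComp \<phi> (r, s, g) (a, r, m) \<triangleleft> \<iota> \<in> tracks A ?gh (mmap p s (mat p s (compose (carrier (G p)) g h)))"
      using pull_in[OF \<eta> gm \<iota>] unfolding s t .
    fix j assume j: "j \<in> {1..p}"
    show "PComp \<phi> (r, s, g) (a, r, m) \<triangleleft> \<iota> \<triangleleft> inc p j = PComp \<phi> (r, s, g) (p, r, h) \<triangleleft> inc p j"
      unfolding pull_pull[OF \<eta> gm \<iota> inc_in] \<iota>_inc[OF j] \<phi>_comp_inc[OF j] \<phi>_comp_inc[OF l[OF j]] mh[OF j] ..
  qed
qed

lemma \<phi>_copair: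
  assumes "h \<in> maps N p r" "k \<in> maps N q r" "g \<in> maps N r s"
  shows "pull A (sum_comparison S A T \<phi> p q) (PComp \<phi> g (copair N S h k)) = tcopair A T (PComp \<phi> g h) (PComp \<phi> g k)"
proof -
  from assms obtain h' k' g' where h: "h = (p, r, h')" "h' \<in> hom (G p) (G r)" "h' \<in> extensional (carrier (G p))"
    and k: "k = (q, r, k')" "k' \<in> hom (G q) (G r)" "k' \<in> extensional (carrier (G q))"
    and g: "g = (r, s, g')" "g' \<in> hom (G r) (G s)" by (auto simp: sp.N_maps)
  obtain m where m: "copair N S (p, r, h') (q, r, k') = (p + q, r, m)" "m \<in> hom (G (p + q)) (G r)"
    "\<And>i. i \<in> {1..p} \<Longrightarrow> m (e (p + q) i) = h' (e p i)" "\<And>j. j \<in> {1..q} \<Longrightarrow> m (e (p + q) (p + j)) = k' (e q j)"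
    using sp.N_copair[OF h(2,3) k(2,3)] by auto
  let ?\<iota> = "sum_comparison S A T \<phi> p q" and ?\<eta> = "PComp \<phi> g (p + q, r, m)"
  let ?i1 = "PMap \<phi> (Inc1 S p q)" and ?i2 = "PMap \<phi> (Inc2 S p q)"
  let ?gm = "mmap r s (mat r s g') \<bullet> mmap (p + q) r (mat (p + q) r m)"
  note \<eta> = \<phi>_comp_in[OF g(2) m(2), folded g(1)]
  note gm = mm_maps[of r s "mat r s g'" "p + q" "mat (p + q) r m"]
  note I1 = Inc1_in[OF pw_in pw_in, of p q] and I2 = Inc2_in[OF pw_in pw_in, of p q]
  have \<eta>1: "?\<eta> \<triangleleft> ?i1 = PComp \<phi> g h" unfolding g(1) h(1)
    by (rule \<phi>_comp_generators[OF g(2) m(2) h(2) comparison_parts(1) comparison_parts(3)]) (use m(3) in auto)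
  have \<eta>2: "?\<eta> \<triangleleft> ?i2 = PComp \<phi> g k" unfolding g(1) k(1)
    by (rule \<phi>_comp_generators[OF g(2) m(2) k(2) comparison_parts(2) comparison_parts(4)]) (use m(4) in auto)
  have "tcopair A T (PComp \<phi> g h) (PComp \<phi> g k) = ?\<eta> \<triangleleft> ?\<iota>"
  proof (rule tcopair_eqI[OF pw_in pw_in Comp_in[OF comparison(1) gm] pull_in[OF \<eta> gm comparison(1)]])
    show "?\<eta> \<triangleleft> ?\<iota> \<triangleleft> Inc1 T (pw p) (pw q) = PComp \<phi> g h"
      unfolding pull_pull[OF \<eta> gm comparison(1) I1] comparison(2) by (rule \<eta>1)
    show "?\<eta> \<triangleleft> ?\<iota> \<triangleleft> Inc2 T (pw p) (pw q) = PComp \<phi> g k"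
      unfolding pull_pull[OF \<eta> gm comparison(1) I2] comparison(3) by (rule \<eta>2)
  qed
  then show ?thesis by (simp add: h(1) k(1) m(1) del: \<phi>_simps(4))
qed

lemma \<phi>_coproduct_preserving: "coproduct_preserving N A \<phi> 0 S z T"
proof -
  interpret pseudofunctor N A \<phi> by (rule \<phi>_pseudofunctor)
  have zero: "(\<lambda>w \<in> carrier (G p). \<one>\<^bsub>G q\<^esub>) \<in> hom (G p) (G q)" for p q
  proof -
    interpret p: group "G p" by (rule sp.G_group)
    interpret q: group "G q" by (rule sp.G_group)
    show ?thesis by (auto simp: hom_def)
  qed
  show ?thesis
  proof
    show "PMap \<phi> (Ident N p) = Ident A (PObj \<phi> p)" for p by (simp add: sp.N_Ident mmap_id)
    show "PUnit \<phi> p = tid (Ident A (PObj \<phi> p))" for p by simp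
    show "PObj \<phi> 0 = z" by simp
    show "PMap \<phi> (zero_map N 0 p q) = zm (PObj \<phi> p) (PObj \<phi> q)" for p q
      using mmap_mat_zero by (simp add: sp.N_zero_map)
    show "PComp \<phi> f (zero_map N 0 p q) = tid (zm (PObj \<phi> p) (PObj \<phi> r))" if f: "f \<in> maps N q r" for p f q r
    proof -
      obtain f' where f: "f = (q, r, f')" "f' \<in> hom (G q) (G r)" using f by (rule sp.N_mapsE)
      have s: "mmap q r (mat q r f') \<bullet> mmap p q (mat p q (\<lambda>w \<in> carrier (G p). \<one>\<^bsub>G q\<^esub>)) = zm (pw p) (pw r)"
        unfolding mmap_mat_zero by (rule comp_zm[OF mmap_in pw_in])
      have "mmap p r (mat p r (compose (carrier (G p)) f' (\<lambda>w \<in> carrier (G p). \<one>\<^bsub>G q\<^esub>))) = zm (pw p) (pw r)"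
        using hom_one[OF f(2) sp.G_group sp.G_group] e_in by (intro mmap_zero) (simp add: mat_def compose_def sp.ab_one)
      then have 1: "PComp \<phi> f (p, q, \<lambda>w \<in> carrier (G p). \<one>\<^bsub>G q\<^esub>) \<in> tracks A (zm (pw p) (pw r)) (zm (pw p) (pw r))"
        using \<phi>_comp_in[OF f(2) zero[where p = p and q = q]] unfolding f(1) s by simp
      have "PComp \<phi> f (p, q, \<lambda>w \<in> carrier (G p). \<one>\<^bsub>G q\<^esub>) = tid (zm (pw p) (pw r))"
      proof (rule pw_track_unique[OF zm_in[OF pw_in pw_in] 1 tid_in[OF zm_in[OF pw_in pw_in]]])
        fix j assume j: "j \<in> {1..p}"
        show "PComp \<phi> f (p, q, \<lambda>w \<in> carrier (G p). \<one>\<^bsub>G q\<^esub>) \<triangleleft> inc p j = tid (zm (pw p) (pw r)) \<triangleleft> inc p j"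
          unfolding f(1) \<phi>_comp_inc[OF j] pull_tid[OF inc_in zm_in[OF pw_in pw_in]] zm_comp[OF inc_in pw_in]
          using e_in[OF j] by (simp add: psi'_one)
      qed
      then show ?thesis by (simp add: sp.N_zero_map del: \<phi>_simps(4))
    qed
    show "PComp \<phi> (zero_map N 0 q r) f = tid (zm (PObj \<phi> p) (PObj \<phi> r))" if f: "f \<in> maps N p q" for f p q r
    proof -
      obtain f' where f: "f = (p, q, f')" "f' \<in> hom (G p) (G q)" using f by (rule sp.N_mapsE)
      let ?z = "\<lambda>w \<in> carrier (G q). \<one>\<^bsub>G r\<^esub>"
      have s: "mmap q r (mat q r ?z) \<bullet> mmap p q (mat p q f') = zm (pw p) (pw r)"
        unfolding mmap_mat_zero by (rule zm_comp[OF mmap_in pw_in])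
      have "mmap p r (mat p r (compose (carrier (G p)) ?z f')) = zm (pw p) (pw r)"
        using hom_in_carrier[OF f(2)] e_in by (intro mmap_zero) (simp add: mat_def compose_def sp.ab_one)
      then have 1: "PComp \<phi> (q, r, ?z) f \<in> tracks A (zm (pw p) (pw r)) (zm (pw p) (pw r))"
        using \<phi>_comp_in[OF zero[where p = q and q = r] f(2)] unfolding f(1) s by simp
      have "PComp \<phi> (q, r, ?z) f = tid (zm (pw p) (pw r))"
      proof (rule pw_track_unique[OF zm_in[OF pw_in pw_in] 1 tid_in[OF zm_in[OF pw_in pw_in]]])
        fix j assume j: "j \<in> {1..p}"
        show "PComp \<phi> (q, r, ?z) f \<triangleleft> inc p j = tid (zm (pw p) (pw r)) \<triangleleft> inc p j"
          unfolding f(1) \<phi>_comp_inc[OF j] pull_tid[OF inc_in zm_in[OF pw_in pw_in]] zm_comp[OF inc_in pw_in]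
          by (rule psi'_zero[OF _ hom_in_carrier[OF f(2) e_in[OF j]]]) (rule mat_zero)
      qed
      then show ?thesis by (simp add: sp.N_zero_map f(1) del: \<phi>_simps(4))
    qed
    show "isomorphism A (sum_comparison S A T \<phi> p q)" for p q by (rule comparison_iso)
    show "pull A (sum_comparison S A T \<phi> p q) (PComp \<phi> g (copair N S h k)) = tcopair A T (PComp \<phi> g h) (PComp \<phi> g k)"
      if "h \<in> maps N p r" "k \<in> maps N q r" "g \<in> maps N r s" for h k g p q r s
      by (rule \<phi>_copair[OF that])
    show "pull A (sum_comparison S A T \<phi> p p) (PUnit \<phi> (Wedge S p p)) =
      push A (sum_comparison S A T \<phi> p p)
        (tcopair A T (push A (Inc1 T (PObj \<phi> p) (PObj \<phi> p)) (PUnit \<phi> p))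
                     (push A (Inc2 T (PObj \<phi> p) (PObj \<phi> p)) (PUnit \<phi> p)))" for p
    proof -
      note I1 = Inc1_in[OF pw_in pw_in, of p p] and I2 = Inc2_in[OF pw_in pw_in, of p p]
      have W: "Wedge T (pw p) (pw p) \<in> Obj A" by (rule Wedge_in[OF pw_in pw_in])
      have "tcopair A T (push A (Inc1 T (pw p) (pw p)) (tid (Ident A (pw p)))) (push A (Inc2 T (pw p) (pw p)) (tid (Ident A (pw p)))) =
          tid (Ident A (Wedge T (pw p) (pw p)))"
        by (rule tcopair_eqI[OF pw_in pw_in Ident_in[OF W] tid_in[OF Ident_in[OF W]]])
           (simp_all add: pull_tid[OF I1 Ident_in[OF W]] pull_tid[OF I2 Ident_in[OF W]] push_tid[OF Ident_in[OF pw_in] I1]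
             push_tid[OF Ident_in[OF pw_in] I2] Comp_Ident[OF I1] Comp_Ident[OF I2] Ident_Comp[OF I1] Ident_Comp[OF I2])
      then show ?thesis
        using pull_tid[OF comparison(1)[of p p] Ident_in[OF pw_in]] push_tid[OF Ident_in[OF W] comparison(1)[of p p]]
          Comp_Ident[OF comparison(1)[of p p]] Ident_Comp[OF comparison(1)[of p p]]
        by (simp add: standard_sums_def[of G e])
    qed
  qed
qed

lemma \<phi>_weak_cogroup: "weak_cogroup G e A z T X \<phi>"
  using \<phi>_coproduct_preserving by (simp add: weak_cogroup_def)

end

section \<open>Weak cogroup structures from splittings\<close>

context copowers
begin

lemma weak_cogroup_ex:
  assumes "split_theory (DR X X) c G e"
  shows "\<exists>\<phi>. weak_cogroup G e A z T X \<phi>"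
proof -
  interpret split_copowers A P D Dm z \<sigma> T X G e
    by (simp add: split_copowers_def split_copowers_axioms_def copowers_axioms assms)
  show ?thesis using \<phi>_weak_cogroup by blast
qed

text \<open>Free nilpotent groups are universal for groups with trivial \<Gamma>_n. The extensions
  are such groups by assumption, the objects of the theory by
  \<open>lower_central_F_nil\<close>.\<close>

lemma split_F_nil:
  assumes "\<And>q a. a \<in> vec q \<Longrightarrow> lower_central (theory_cocycle.ext (DR X X) c q a) n \<subseteq> {\<one>\<^bsub>theory_cocycle.ext (DR X X) c q a\<^esub>}"
  shows "split_theory (DR X X) c (F_nil n) (F_nil_gen n)"
proof -
  interpret theory_cocycle "DR X X" c by (rule c_theory_cocycle)
  show ?thesis
  proof (intro split_theory.intro split_theory_axioms.intro c_theory_cocycle)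
    show "\<exists>h \<in> hom (F_nil n p) (F_nil n q). \<forall>i \<in> {1..p}. h (F_nil_gen n p i) = s i"
      if "\<And>i. i \<in> {1..p} \<Longrightarrow> s i \<in> carrier (F_nil n q)" for p q s
      using F_nil_hom[OF F_nil_group lower_central_F_nil, of p s] that by blast
    show "\<exists>h \<in> hom (F_nil n q) (ext q a). \<forall>i \<in> {1..q}. h (F_nil_gen n q i) = (axis i, \<zero>\<^bsub>DR X X\<^esub>)" if "a \<in> vec q" for a q
      using F_nil_hom[OF ext_group[OF that] assms[OF that], of q "\<lambda>i. (axis i, \<zero>\<^bsub>DR X X\<^esub>)"] zero_closed by simp
  qed (rule F_nil_group F_nil_gen F_nil_generate; assumption)+
qed

lemma split_F_grp: "split_theory (DR X X) c F_grp F_gen"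
proof -
  interpret theory_cocycle "DR X X" c by (rule c_theory_cocycle)
  show ?thesis
  proof (intro split_theory.intro split_theory_axioms.intro c_theory_cocycle)
    show "\<exists>h \<in> hom (F_grp p) (F_grp q). \<forall>i \<in> {1..p}. h (F_gen p i) = s i"
      if "\<And>i. i \<in> {1..p} \<Longrightarrow> s i \<in> carrier (F_grp q)" for p q s
      using F_grp_hom[OF F_grp_group, of p s] that by blast
    show "\<exists>h \<in> hom (F_grp q) (ext q a). \<forall>i \<in> {1..q}. h (F_gen q i) = (axis i, \<zero>\<^bsub>DR X X\<^esub>)" if "a \<in> vec q" for a q
      using F_grp_hom[OF ext_group[OF that], of q "\<lambda>i. (axis i, \<zero>\<^bsub>DR X X\<^esub>)"] zero_closed by simp
  qed (rule F_grp_group F_grp_gen F_grp_generate; assumption)+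
qed

lemma admits_weak_nil_cogroup_ge_2: assumes "2 \<le> n" shows "admits_weak_nil_cogroup n A z T X"
proof (cases n)
  case (enat k)
  interpret theory_cocycle "DR X X" c by (rule c_theory_cocycle)
  have "2 \<le> k" using assms enat by (simp add: numeral_eq_enat)
  then have "split_theory (DR X X) c (F_nil k) (F_nil_gen k)" by (intro split_F_nil ext_nilpotent)
  then show ?thesis using weak_cogroup_ex enat by (simp add: admits_weak_nil_cogroup_def)
next
  case infinity
  then show ?thesis using weak_cogroup_ex[OF split_F_grp] by (simp add: admits_weak_nil_cogroup_def)
qed

lemma admits_weak_nil_cogroup_1: assumes "no_2_torsion (Obj A) D" shows "admits_weak_nil_cogroup 1 A z T X"
proof -
  interpret theory_cocycle "DR X X" c by (rule c_theory_cocycle)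
  have "d = \<zero>\<^bsub>DR X X\<^esub>" if "d \<in> carrier (DR X X)" "d \<oplus>\<^bsub>DR X X\<^esub> d = \<zero>\<^bsub>DR X X\<^esub>" for d
    using assms X_in that by (auto simp: no_2_torsion_def)
  then have "split_theory (DR X X) c (F_nil 1) (F_nil_gen 1)"
    by (intro split_F_nil ext_abelian u_symmetric) auto
  then show ?thesis using weak_cogroup_ex by (simp add: admits_weak_nil_cogroup_def one_enat_def)
qed

end

theorem theorem2p9:
  fixes A :: "('o, 'm, 't) track_cat"
    and P :: "'o \<Rightarrow> 'o \<Rightarrow> 'm set monoid"
    and D :: "'o \<Rightarrow> 'o \<Rightarrow> 'd monoid"
    and Dm :: "'m set \<Rightarrow> 'm set \<Rightarrow> 'd \<Rightarrow> 'd"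
    and z :: 'o
    and \<sigma> :: "'m \<Rightarrow> 'd \<Rightarrow> 't"
    and T :: "('o, 'm) sum_choice"
  assumes "additive_track_category A P D Dm z \<sigma>"
    and "strict_coproducts A T"
  shows "(\<forall>n::enat. 2 \<le> n \<longrightarrow> (\<forall>X \<in> Obj A. admits_weak_nil_cogroup n A z T X)) \<and>
    (no_2_torsion (Obj A) D \<longrightarrow> (\<forall>X \<in> Obj A. admits_weak_nil_cogroup 1 A z T X))"
proof -
  have c: "copowers A P D Dm z \<sigma> T X" if "X \<in> Obj A" for X
    using assms that by (simp add: copowers_def copowers_axioms_def)
  show ?thesis
    using copowers.admits_weak_nil_cogroup_ge_2[OF c] copowers.admits_weak_nil_cogroup_1[OF c] by simp
qed

end
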